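(* Let $\mathcal V$ be an extensive, cartesian closed category with pullbacks, $\mathcal C$ a $\mathcal V$-category, and $F\colon\mathcal C^{\mathrm{op}}\to\mathcal V$ a $\mathcal V$-functor. Given a pair $(C,x)$ of an object $C\in\mathcal C$ and an element $x\colon\ast\to FC$ in $\mathcal V$, the following are equivalent: (i) the $\mathcal V$-functor $F$ is $\mathcal V$-representable by $(C,x)$; (ii) the pair $(C,x)$ is an internal terminal object in the internal category of elements $\int_{\mathcal C}F$.
   Context: Extensive: $\mathcal V$ has all small coproducts and for every set $I$ and family $\{X_i\}_{i\in I}$ the functor $\bigsqcup_{i\in I}\colon\prod_{i\in I}\mathcal V_{/X_i}\to\mathcal V_{/\bigsqcup_i X_i}$ is an equivalence. $\ast$ is the terminal object, $\emptyset$ the initial object, $[X,Y]$ the internal hom of $\mathcal V$, $\iota$ denotes coproduct inclusions. $\mathcal V$-categories are enriched over the cartesian monoidal structure, have a set of objects, composition $c_{A,B,C}\colon\mathcal C(A,B)\times\mathcal C(B,C)\to\mathcal C(A,C)$ and identities $i_A\colon\ast\to\mathcal C(A,A)$. For $F\colon\mathcal C^{\mathrm{op}}\to\mathcal V$, $\mathrm{ev}^F_{A,B}\colon\mathcal C(A,B)\times FB\to FA$ is the transpose of $\mathcal C(A,B)\to[FB,FA]$. $F$ is $\mathcal V$-representable by $(C,x)$ if the $\mathcal V$-natural transformation $\alpha_x\colon\mathcal C(-,C)\Rightarrow F$ corresponding to $x$ under the enriched Yoneda lemma is an isomorphism. An internal category $\mathbb A$ to $\mathcal V$ consists of objects $\mathbb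 A_0,\mathbb A_1$ with maps $s,t\colon\mathbb A_1\to\mathbb A_0$, $i\colon\mathbb A_0\to\mathbb A_1$, $c\colon\mathbb A_1\times_{\mathbb A_0}\mathbb A_1\to\mathbb A_1$ satisfying the usual axioms; with internal functors these form $\mathrm{Cat}(\mathcal V)$, cartesian closed with internal hom $\llbracket-,-\rrbracket$. The terminal internal category is also written $\ast$; an element of $\mathbb A$ is an internal functor $\ast\to\mathbb A$, equivalently a map $\ast\to\mathbb A_0$. $\int_{\mathcal C}F$ has $(\int_{\mathcal C}F)_0=\bigsqcup_{A}FA$, $(\int_{\mathcal C}F)_1=\bigsqcup_{A,B}\mathcal C(A,B)\times FB$; on the $(A,B)$ summand, $s$ is $\mathrm{ev}^F_{A,B}$ into $FA$ and $t$ is the projection onto $FB$; identity is induced by $i_A\times\mathrm{id}_{FA}$ and composition by $c_{A,B,C}\times\mathrm{id}_{FC}$. The pair $(C,x)$ is the element $\ast\xrightarrow{x}FC\xrightarrow{\iota_C}\bigsqcup_AFA$. Let $\mathbb 2$ be the internal category $\mathrm{Int}\,\mathbb 2$ associated to the $\mathcal V$-category with objects $0,1$ and hom-objects $\ast,\ast,\ast,\emptyset$ for $(0,0),(0,1),(1,1),(1,0)$ (so $\mathbb 2_0=\ast\sqcup\ast$, $\mathbb 2_1=\ast\sqcup\ast\sqcup\ast$), with inclusion $\langle0,1\rangle\colon\ast\sqcup\ast\to\mathbb 2$. For an element $T\colon\ast\to\mathbb A$, the slice internal category $\mathbb A_{/T}$ is the pullback in $\mathrm{Cat}(\mathcal V)$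 of $\langle0,1\rangle^*\colon\llbracket\mathbb 2,\mathbb A\rrbracket\to\mathbb A\times\mathbb A$ along $\mathrm{id}_{\mathbb A}\times T\colon\mathbb A\to\mathbb A\times\mathbb A$. $T$ is an internal terminal object in $\mathbb A$ if the projection $\mathbb A_{/T}\to\mathbb A$ is an isomorphism. *)

theory Defs
  imports Main "HOL-Library.FuncSet"
begin

section \<open>Categories, functors, equivalences\<close>

record ('o, 'm) category =
  Ob :: "'o set"
  Ar :: "'m set"
  Dom :: "'m \<Rightarrow> 'o"
  Cod :: "'m \<Rightarrow> 'o"
  Id :: "'o \<Rightarrow> 'm"
  Cmp :: "'m \<Rightarrow> 'm \<Rightarrow> 'm"  (infixl "\<cdot>\<index>" 70)

definition Hom :: "('o, 'm) category \<Rightarrow> 'o \<Rightarrow> 'o \<Rightarrow> 'm set" where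
  "Hom K a b = {f \<in> Ar K. Dom K f = a \<and> Cod K f = b}"

text \<open>Composition \<open>g \<cdot>\<^bsub>K\<^esub> f\<close> is in applicative order (first \<open>f\<close>, then \<open>g\<close>); its value on
  non-composable pairs is irrelevant.\<close>

definition is_category :: "('o, 'm) category \<Rightarrow> bool" where
  "is_category K \<longleftrightarrow>
     (\<forall>f\<in>Ar K. Dom K f \<in> Ob K \<and> Cod K f \<in> Ob K) \<and>
     (\<forall>a\<in>Ob K. Id K a \<in> Hom K a a) \<and>
     (\<forall>f\<in>Ar K. \<forall>g\<in>Ar K. Cod K f = Dom K g \<longrightarrow> g \<cdot>\<^bsub>K\<^esub> f \<in> Hom K (Dom K f) (Cod K g)) \<and>
     (\<forall>f\<in>Ar K. f \<cdot>\<^bsub>K\<^esub> Id K (Dom K f) = f \<and> Id K (Cod K f) \<cdot>\<^bsub>K\<^esub> f = f) \<and>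
     (\<forall>f\<in>Ar K. \<forall>g\<in>Ar K. \<forall>h\<in>Ar K. Cod K f = Dom K g \<longrightarrow> Cod K g = Dom K h \<longrightarrow>
        h \<cdot>\<^bsub>K\<^esub> (g \<cdot>\<^bsub>K\<^esub> f) = (h \<cdot>\<^bsub>K\<^esub> g) \<cdot>\<^bsub>K\<^esub> f)"

definition is_inverse :: "('o, 'm) category \<Rightarrow> 'm \<Rightarrow> 'm \<Rightarrow> bool" where
  "is_inverse K f g \<longleftrightarrow> f \<in> Ar K \<and> g \<in> Hom K (Cod K f) (Dom K f) \<and>
     g \<cdot>\<^bsub>K\<^esub> f = Id K (Dom K f) \<and> f \<cdot>\<^bsub>K\<^esub> g = Id K (Cod K f)"

definition is_iso :: "('o, 'm) category \<Rightarrow> 'm \<Rightarrow> bool" where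
  "is_iso K f \<longleftrightarrow> (\<exists>g. is_inverse K f g)"

definition inv_arr :: "('o, 'm) category \<Rightarrow> 'm \<Rightarrow> 'm" where
  "inv_arr K f = (THE g. is_inverse K f g)"

definition is_functor ::
  "('o, 'm) category \<Rightarrow> ('p, 'n) category \<Rightarrow> ('o \<Rightarrow> 'p) \<Rightarrow> ('m \<Rightarrow> 'n) \<Rightarrow> bool" where
  "is_functor K L Fo Fa \<longleftrightarrow>
     (\<forall>a\<in>Ob K. Fo a \<in> Ob L) \<and>
     (\<forall>f\<in>Ar K. Fa f \<in> Hom L (Fo (Dom K f)) (Fo (Cod K f))) \<and>
     (\<forall>a\<in>Ob K. Fa (Id K a) = Id L (Fo a)) \<and>
     (\<forall>f\<in>Ar K. \<forall>g\<in>Ar K. Cod K f = Dom K g \<longrightarrow> Fa (g \<cdot>\<^bsub>K\<^esub> f) = Fa g \<cdot>\<^bsub>L\<^esub> Fa f)"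

definition is_nat_iso ::
  "('o, 'm) category \<Rightarrow> ('p, 'n) category \<Rightarrow> ('o \<Rightarrow> 'p) \<Rightarrow> ('m \<Rightarrow> 'n) \<Rightarrow>
   ('o \<Rightarrow> 'p) \<Rightarrow> ('m \<Rightarrow> 'n) \<Rightarrow> ('o \<Rightarrow> 'n) \<Rightarrow> bool" where
  "is_nat_iso K L Fo Fa Go Ga \<eta> \<longleftrightarrow>
     (\<forall>a\<in>Ob K. \<eta> a \<in> Hom L (Fo a) (Go a) \<and> is_iso L (\<eta> a)) \<and>
     (\<forall>f\<in>Ar K. \<eta> (Cod K f) \<cdot>\<^bsub>L\<^esub> Fa f = Ga f \<cdot>\<^bsub>L\<^esub> \<eta> (Dom K f))"

definition is_equivalence ::
  "('o, 'm) category \<Rightarrow> ('p, 'n) category \<Rightarrow> ('o \<Rightarrow> 'p) \<Rightarrow> ('m \<Rightarrow> 'n) \<Rightarrow> bool" where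
  "is_equivalence K L Fo Fa \<longleftrightarrow> is_functor K L Fo Fa \<and>
     (\<exists>Go Ga \<eta> \<epsilon>. is_functor L K Go Ga \<and>
        is_nat_iso K K id id (Go \<circ> Fo) (Ga \<circ> Fa) \<eta> \<and>
        is_nat_iso L L (Fo \<circ> Go) (Fa \<circ> Ga) id id \<epsilon>)"

text \<open>An arrow of the slice category from \<open>f\<close> to \<open>g\<close> is a triple \<open>(f, h, g)\<close> with \<open>g \<cdot> h = f\<close>.\<close>

definition slice_cat :: "('o, 'm) category \<Rightarrow> 'o \<Rightarrow> ('m, 'm \<times> 'm \<times> 'm) category" where
  "slice_cat K x =
    \<lparr>Ob = {f \<in> Ar K. Cod K f = x},
     Ar = {(f, h, g). f \<in> Ar K \<and> g \<in> Ar K \<and> Cod K f = x \<and> Cod K g = x \<and>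
                      h \<in> Hom K (Dom K f) (Dom K g) \<and> g \<cdot>\<^bsub>K\<^esub> h = f},
     Dom = (\<lambda>(f, h, g). f),
     Cod = (\<lambda>(f, h, g). g),
     Id = (\<lambda>f. (f, Id K (Dom K f), f)),
     Cmp = (\<lambda>(f', h', g') (f, h, g). (f, h' \<cdot>\<^bsub>K\<^esub> h, g'))\<rparr>"

definition Prod_cat :: "'i set \<Rightarrow> ('i \<Rightarrow> ('o, 'm) category) \<Rightarrow> ('i \<Rightarrow> 'o, 'i \<Rightarrow> 'm) category" where
  "Prod_cat I K =
    \<lparr>Ob = (\<Pi>\<^sub>E i\<in>I. Ob (K i)),
     Ar = (\<Pi>\<^sub>E i\<in>I. Ar (K i)),
     Dom = (\<lambda>f. \<lambda>i\<in>I. Dom (K i) (f i)),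
     Cod = (\<lambda>f. \<lambda>i\<in>I. Cod (K i) (f i)),
     Id = (\<lambda>a. \<lambda>i\<in>I. Id (K i) (a i)),
     Cmp = (\<lambda>g f. \<lambda>i\<in>I. Cmp (K i) (g i) (f i))\<rparr>"


section \<open>Limits, colimits and exponentials\<close>

text \<open>Universal objects are introduced by their universal property; whenever one exists, a choice
  of it is fixed by \<open>SOME\<close>. All notions are used both for the base category and for the
  category of its internal categories.\<close>

definition is_terminal :: "('o, 'm) category \<Rightarrow> 'o \<Rightarrow> bool" where
  "is_terminal K t \<longleftrightarrow> t \<in> Ob K \<and> (\<forall>x\<in>Ob K. \<exists>!f. f \<in> Hom K x t)"

definition terminal :: "('o, 'm) category \<Rightarrow> 'o" where
  "terminal K = (SOME t. is_terminal K t)"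

definition bang :: "('o, 'm) category \<Rightarrow> 'o \<Rightarrow> 'm" where
  "bang K x = (THE f. f \<in> Hom K x (terminal K))"

definition is_initial :: "('o, 'm) category \<Rightarrow> 'o \<Rightarrow> bool" where
  "is_initial K z \<longleftrightarrow> z \<in> Ob K \<and> (\<forall>x\<in>Ob K. \<exists>!f. f \<in> Hom K z x)"

definition initial :: "('o, 'm) category \<Rightarrow> 'o" where
  "initial K = (SOME z. is_initial K z)"

definition is_product :: "('o, 'm) category \<Rightarrow> 'o \<Rightarrow> 'o \<Rightarrow> 'o \<times> 'm \<times> 'm \<Rightarrow> bool" where
  "is_product K a b = (\<lambda>(p, p1, p2).
     p \<in> Ob K \<and> p1 \<in> Hom K p a \<and> p2 \<in> Hom K p b \<and>
     (\<forall>x\<in>Ob K. \<forall>f\<in>Hom K x a. \<forall>g\<in>Hom K x b.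
        \<exists>!h. h \<in> Hom K x p \<and> p1 \<cdot>\<^bsub>K\<^esub> h = f \<and> p2 \<cdot>\<^bsub>K\<^esub> h = g))"

definition product :: "('o, 'm) category \<Rightarrow> 'o \<Rightarrow> 'o \<Rightarrow> 'o \<times> 'm \<times> 'm" where
  "product K a b = (SOME p. is_product K a b p)"

definition prd :: "('o, 'm) category \<Rightarrow> 'o \<Rightarrow> 'o \<Rightarrow> 'o" where
  "prd K a b = fst (product K a b)"

definition pr1 :: "('o, 'm) category \<Rightarrow> 'o \<Rightarrow> 'o \<Rightarrow> 'm" where
  "pr1 K a b = fst (snd (product K a b))"

definition pr2 :: "('o, 'm) category \<Rightarrow> 'o \<Rightarrow> 'o \<Rightarrow> 'm" where
  "pr2 K a b = snd (snd (product K a b))"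

definition pair :: "('o, 'm) category \<Rightarrow> 'm \<Rightarrow> 'm \<Rightarrow> 'm" where
  "pair K f g = (THE h. h \<in> Hom K (Dom K f) (prd K (Cod K f) (Cod K g)) \<and>
     pr1 K (Cod K f) (Cod K g) \<cdot>\<^bsub>K\<^esub> h = f \<and> pr2 K (Cod K f) (Cod K g) \<cdot>\<^bsub>K\<^esub> h = g)"

definition prd_map :: "('o, 'm) category \<Rightarrow> 'm \<Rightarrow> 'm \<Rightarrow> 'm" where
  "prd_map K f g = pair K (f \<cdot>\<^bsub>K\<^esub> pr1 K (Dom K f) (Dom K g)) (g \<cdot>\<^bsub>K\<^esub> pr2 K (Dom K f) (Dom K g))"

definition prd_swap :: "('o, 'm) category \<Rightarrow> 'o \<Rightarrow> 'o \<Rightarrow> 'm" where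
  "prd_swap K a b = pair K (pr2 K a b) (pr1 K a b)"

text \<open>\<open>(a \<times> b) \<times> c \<rightarrow> a\<close>, \<open>(a \<times> b) \<times> c \<rightarrow> b \<times> c\<close> and the associator
  \<open>(a \<times> b) \<times> c \<rightarrow> a \<times> (b \<times> c)\<close>:\<close>

definition pr_first :: "('o, 'm) category \<Rightarrow> 'o \<Rightarrow> 'o \<Rightarrow> 'o \<Rightarrow> 'm" where
  "pr_first K a b c = pr1 K a b \<cdot>\<^bsub>K\<^esub> pr1 K (prd K a b) c"

definition pr_rest :: "('o, 'm) category \<Rightarrow> 'o \<Rightarrow> 'o \<Rightarrow> 'o \<Rightarrow> 'm" where
  "pr_rest K a b c = pair K (pr2 K a b \<cdot>\<^bsub>K\<^esub> pr1 K (prd K a b) c) (pr2 K (prd K a b) c)"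

definition prd_assoc :: "('o, 'm) category \<Rightarrow> 'o \<Rightarrow> 'o \<Rightarrow> 'o \<Rightarrow> 'm" where
  "prd_assoc K a b c = pair K (pr_first K a b c) (pr_rest K a b c)"

definition is_pullback :: "('o, 'm) category \<Rightarrow> 'm \<Rightarrow> 'm \<Rightarrow> 'o \<times> 'm \<times> 'm \<Rightarrow> bool" where
  "is_pullback K f g = (\<lambda>(p, p1, p2).
     p \<in> Ob K \<and> p1 \<in> Hom K p (Dom K f) \<and> p2 \<in> Hom K p (Dom K g) \<and> f \<cdot>\<^bsub>K\<^esub> p1 = g \<cdot>\<^bsub>K\<^esub> p2 \<and>
     (\<forall>x\<in>Ob K. \<forall>h\<in>Hom K x (Dom K f). \<forall>k\<in>Hom K x (Dom K g). f \<cdot>\<^bsub>K\<^esub> h = g \<cdot>\<^bsub>K\<^esub> k \<longrightarrow>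
        (\<exists>!u. u \<in> Hom K x p \<and> p1 \<cdot>\<^bsub>K\<^esub> u = h \<and> p2 \<cdot>\<^bsub>K\<^esub> u = k)))"

definition has_pullbacks :: "('o, 'm) category \<Rightarrow> bool" where
  "has_pullbacks K \<longleftrightarrow>
     (\<forall>f\<in>Ar K. \<forall>g\<in>Ar K. Cod K f = Cod K g \<longrightarrow> (\<exists>p. is_pullback K f g p))"

definition pullback :: "('o, 'm) category \<Rightarrow> 'm \<Rightarrow> 'm \<Rightarrow> 'o \<times> 'm \<times> 'm" where
  "pullback K f g = (SOME p. is_pullback K f g p)"

definition pb :: "('o, 'm) category \<Rightarrow> 'm \<Rightarrow> 'm \<Rightarrow> 'o" where
  "pb K f g = fst (pullback K f g)"

definition pb1 :: "('o, 'm) category \<Rightarrow> 'm \<Rightarrow> 'm \<Rightarrow> 'm" where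
  "pb1 K f g = fst (snd (pullback K f g))"

definition pb2 :: "('o, 'm) category \<Rightarrow> 'm \<Rightarrow> 'm \<Rightarrow> 'm" where
  "pb2 K f g = snd (snd (pullback K f g))"

definition pb_pair :: "('o, 'm) category \<Rightarrow> 'm \<Rightarrow> 'm \<Rightarrow> 'm \<Rightarrow> 'm \<Rightarrow> 'm" where
  "pb_pair K f g h k = (THE u. u \<in> Hom K (Dom K h) (pb K f g) \<and>
     pb1 K f g \<cdot>\<^bsub>K\<^esub> u = h \<and> pb2 K f g \<cdot>\<^bsub>K\<^esub> u = k)"

definition is_exponential :: "('o, 'm) category \<Rightarrow> 'o \<Rightarrow> 'o \<Rightarrow> 'o \<times> 'm \<Rightarrow> bool" where
  "is_exponential K a b = (\<lambda>(e, ev).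
     e \<in> Ob K \<and> ev \<in> Hom K (prd K e a) b \<and>
     (\<forall>x\<in>Ob K. \<forall>f\<in>Hom K (prd K x a) b.
        \<exists>!g. g \<in> Hom K x e \<and> ev \<cdot>\<^bsub>K\<^esub> prd_map K g (Id K a) = f))"

definition exponential :: "('o, 'm) category \<Rightarrow> 'o \<Rightarrow> 'o \<Rightarrow> 'o \<times> 'm" where
  "exponential K a b = (SOME e. is_exponential K a b e)"

definition exp_ob :: "('o, 'm) category \<Rightarrow> 'o \<Rightarrow> 'o \<Rightarrow> 'o" where
  "exp_ob K a b = fst (exponential K a b)"

definition exp_ev :: "('o, 'm) category \<Rightarrow> 'o \<Rightarrow> 'o \<Rightarrow> 'm" where
  "exp_ev K a b = snd (exponential K a b)"

text \<open>Transposition between \<open>f : x \<times> a \<rightarrow> b\<close> and \<open>g : x \<rightarrow> [a, b]\<close>:\<close>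

definition curry_arr :: "('o, 'm) category \<Rightarrow> 'o \<Rightarrow> 'o \<Rightarrow> 'o \<Rightarrow> 'm \<Rightarrow> 'm" where
  "curry_arr K x a b f = (THE g. g \<in> Hom K x (exp_ob K a b) \<and>
     exp_ev K a b \<cdot>\<^bsub>K\<^esub> prd_map K g (Id K a) = f)"

definition uncurry_arr :: "('o, 'm) category \<Rightarrow> 'o \<Rightarrow> 'o \<Rightarrow> 'm \<Rightarrow> 'm" where
  "uncurry_arr K a b g = exp_ev K a b \<cdot>\<^bsub>K\<^esub> prd_map K g (Id K a)"

text \<open>\<open>[a, h] : [a, Dom h] \<rightarrow> [a, Cod h]\<close> and \<open>[h, b] : [Cod h, b] \<rightarrow> [Dom h, b]\<close>:\<close>

definition exp_post :: "('o, 'm) category \<Rightarrow> 'o \<Rightarrow> 'm \<Rightarrow> 'm" where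
  "exp_post K a h = curry_arr K (exp_ob K a (Dom K h)) a (Cod K h) (h \<cdot>\<^bsub>K\<^esub> exp_ev K a (Dom K h))"

definition exp_pre :: "('o, 'm) category \<Rightarrow> 'm \<Rightarrow> 'o \<Rightarrow> 'm" where
  "exp_pre K h b = curry_arr K (exp_ob K (Cod K h) b) (Dom K h) b
     (exp_ev K (Cod K h) b \<cdot>\<^bsub>K\<^esub> prd_map K (Id K (exp_ob K (Cod K h) b)) h)"

definition cartesian_closed :: "('o, 'm) category \<Rightarrow> bool" where
  "cartesian_closed K \<longleftrightarrow>
     (\<exists>t. is_terminal K t) \<and>
     (\<forall>a\<in>Ob K. \<forall>b\<in>Ob K. \<exists>p. is_product K a b p) \<and>
     (\<forall>a\<in>Ob K. \<forall>b\<in>Ob K. \<exists>e. is_exponential K a b e)"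

definition is_coproduct ::
  "('o, 'm) category \<Rightarrow> 'i set \<Rightarrow> ('i \<Rightarrow> 'o) \<Rightarrow> 'o \<times> ('i \<Rightarrow> 'm) \<Rightarrow> bool" where
  "is_coproduct K I X = (\<lambda>(s, \<iota>).
     s \<in> Ob K \<and> (\<forall>i\<in>I. \<iota> i \<in> Hom K (X i) s) \<and>
     (\<forall>y\<in>Ob K. \<forall>f. (\<forall>i\<in>I. f i \<in> Hom K (X i) y) \<longrightarrow>
        (\<exists>!h. h \<in> Hom K s y \<and> (\<forall>i\<in>I. h \<cdot>\<^bsub>K\<^esub> \<iota> i = f i))))"

definition coproduct ::
  "('o, 'm) category \<Rightarrow> 'i set \<Rightarrow> ('i \<Rightarrow> 'o) \<Rightarrow> 'o \<times> ('i \<Rightarrow> 'm)" where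
  "coproduct K I X = (SOME s. is_coproduct K I X s)"

definition coprd :: "('o, 'm) category \<Rightarrow> 'i set \<Rightarrow> ('i \<Rightarrow> 'o) \<Rightarrow> 'o" where
  "coprd K I X = fst (coproduct K I X)"

definition coprd_in :: "('o, 'm) category \<Rightarrow> 'i set \<Rightarrow> ('i \<Rightarrow> 'o) \<Rightarrow> 'i \<Rightarrow> 'm" where
  "coprd_in K I X = snd (coproduct K I X)"

definition cotuple ::
  "('o, 'm) category \<Rightarrow> 'i set \<Rightarrow> ('i \<Rightarrow> 'o) \<Rightarrow> 'o \<Rightarrow> ('i \<Rightarrow> 'm) \<Rightarrow> 'm" where
  "cotuple K I X y f =
     (THE h. h \<in> Hom K (coprd K I X) y \<and> (\<forall>i\<in>I. h \<cdot>\<^bsub>K\<^esub> coprd_in K I X i = f i))"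


section \<open>Extensive categories\<close>

text \<open>The functor \<open>\<Prod>\<^sub>i K\<^bsub>/X i\<^esub> \<rightarrow> K\<^bsub>/\<Squnion>X\<^esub>\<close> forming coproducts:\<close>

definition coprd_slice_ob ::
  "('o, 'm) category \<Rightarrow> 'i set \<Rightarrow> ('i \<Rightarrow> 'o) \<Rightarrow> ('i \<Rightarrow> 'm) \<Rightarrow> 'm" where
  "coprd_slice_ob K I X f =
     cotuple K I (\<lambda>i. Dom K (f i)) (coprd K I X) (\<lambda>i. coprd_in K I X i \<cdot>\<^bsub>K\<^esub> f i)"

definition coprd_slice_ar ::
  "('o, 'm) category \<Rightarrow> 'i set \<Rightarrow> ('i \<Rightarrow> 'o) \<Rightarrow> ('i \<Rightarrow> 'm \<times> 'm \<times> 'm) \<Rightarrow> 'm \<times> 'm \<times> 'm" where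
  "coprd_slice_ar K I X u =
     (let f = (\<lambda>i. fst (u i)); h = (\<lambda>i. fst (snd (u i))); g = (\<lambda>i. snd (snd (u i)))
      in (coprd_slice_ob K I X f,
          cotuple K I (\<lambda>i. Dom K (f i)) (coprd K I (\<lambda>i. Dom K (g i)))
            (\<lambda>i. coprd_in K I (\<lambda>i. Dom K (g i)) i \<cdot>\<^bsub>K\<^esub> h i),
          coprd_slice_ob K I X g))"

text \<open>The type \<open>'i\<close> plays the role of the universe: a small set is a subset of \<open>'i\<close>. For infinite
  \<open>'i\<close> this covers, up to reindexing, all sets of at most the cardinality of \<open>'i\<close>, in particular
  families indexed by pairs and triples of elements of \<open>'i\<close>.\<close>

definition extensive :: "'i itself \<Rightarrow> ('o, 'm) category \<Rightarrow> bool" where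
  "extensive _ K \<longleftrightarrow>
     (\<forall>(I :: 'i set) X. (\<forall>i\<in>I. X i \<in> Ob K) \<longrightarrow>
        (\<exists>s. is_coproduct K I X s) \<and>
        is_equivalence (Prod_cat I (\<lambda>i. slice_cat K (X i))) (slice_cat K (coprd K I X))
          (coprd_slice_ob K I X) (coprd_slice_ar K I X))"


section \<open>Enriched categories\<close>

text \<open>Enrichment is over the cartesian monoidal structure of \<open>V\<close>. Composition is in diagrammatic
  order: \<open>ECmp C a b c : C(a, b) \<times> C(b, c) \<rightarrow> C(a, c)\<close>.\<close>

record ('a, 'o, 'm) enriched_category =
  EOb :: "'a set"
  EHom :: "'a \<Rightarrow> 'a \<Rightarrow> 'o"
  EId :: "'a \<Rightarrow> 'm"
  ECmp :: "'a \<Rightarrow> 'a \<Rightarrow> 'a \<Rightarrow> 'm"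

definition is_enriched_category ::
  "('o, 'm) category \<Rightarrow> ('a, 'o, 'm) enriched_category \<Rightarrow> bool" where
  "is_enriched_category V C \<longleftrightarrow>
     (\<forall>a\<in>EOb C. \<forall>b\<in>EOb C. EHom C a b \<in> Ob V) \<and>
     (\<forall>a\<in>EOb C. EId C a \<in> Hom V (terminal V) (EHom C a a)) \<and>
     (\<forall>a\<in>EOb C. \<forall>b\<in>EOb C. \<forall>c\<in>EOb C.
        ECmp C a b c \<in> Hom V (prd V (EHom C a b) (EHom C b c)) (EHom C a c)) \<and>
     (\<forall>a\<in>EOb C. \<forall>b\<in>EOb C.
        ECmp C a a b \<cdot>\<^bsub>V\<^esub> prd_map V (EId C a) (Id V (EHom C a b)) = pr2 V (terminal V) (EHom C a b) \<and>
        ECmp C a b b \<cdot>\<^bsub>V\<^esub> prd_map V (Id V (EHom C a b)) (EId C b) = pr1 V (EHom C a b) (terminal V)) \<and>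
     (\<forall>a\<in>EOb C. \<forall>b\<in>EOb C. \<forall>c\<in>EOb C. \<forall>d\<in>EOb C.
        ECmp C a c d \<cdot>\<^bsub>V\<^esub> prd_map V (ECmp C a b c) (Id V (EHom C c d)) =
        ECmp C a b d \<cdot>\<^bsub>V\<^esub> prd_map V (Id V (EHom C a b)) (ECmp C b c d)
          \<cdot>\<^bsub>V\<^esub> prd_assoc V (EHom C a b) (EHom C b c) (EHom C c d))"

definition enriched_op ::
  "('o, 'm) category \<Rightarrow> ('a, 'o, 'm) enriched_category \<Rightarrow> ('a, 'o, 'm) enriched_category" where
  "enriched_op V C =
    \<lparr>EOb = EOb C,
     EHom = (\<lambda>a b. EHom C b a),
     EId = EId C,
     ECmp = (\<lambda>a b c. ECmp C c b a \<cdot>\<^bsub>V\<^esub> prd_swap V (EHom C b a) (EHom C c b))\<rparr>"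

text \<open>\<open>V\<close> as a category enriched over itself; composition \<open>[a, b] \<times> [b, c] \<rightarrow> [a, c]\<close> is the transpose
  of \<open>([a, b] \<times> [b, c]) \<times> a \<rightarrow> c, ((f, g), x) \<mapsto> g (f x)\<close>.\<close>

definition self_enriched :: "('o, 'm) category \<Rightarrow> ('o, 'o, 'm) enriched_category" where
  "self_enriched V =
    \<lparr>EOb = Ob V,
     EHom = exp_ob V,
     EId = (\<lambda>a. curry_arr V (terminal V) a a (pr2 V (terminal V) a)),
     ECmp = (\<lambda>a b c.
       let E = exp_ob V a b; E' = exp_ob V b c in
       curry_arr V (prd V E E') a c
         (exp_ev V b c \<cdot>\<^bsub>V\<^esub> pair V
            (pr2 V E E' \<cdot>\<^bsub>V\<^esub> pr1 V (prd V E E') a)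
            (exp_ev V a b \<cdot>\<^bsub>V\<^esub> pair V (pr_first V E E' a) (pr2 V (prd V E E') a))))\<rparr>"

record ('a, 'b, 'm) enriched_functor =
  FOb :: "'a \<Rightarrow> 'b"
  FHom :: "'a \<Rightarrow> 'a \<Rightarrow> 'm"

definition is_enriched_functor ::
  "('o, 'm) category \<Rightarrow> ('a, 'o, 'm) enriched_category \<Rightarrow> ('b, 'o, 'm) enriched_category \<Rightarrow>
   ('a, 'b, 'm) enriched_functor \<Rightarrow> bool" where
  "is_enriched_functor V D E F \<longleftrightarrow>
     (\<forall>a\<in>EOb D. FOb F a \<in> EOb E) \<and>
     (\<forall>a\<in>EOb D. \<forall>b\<in>EOb D. FHom F a b \<in> Hom V (EHom D a b) (EHom E (FOb F a) (FOb F b))) \<and>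
     (\<forall>a\<in>EOb D. FHom F a a \<cdot>\<^bsub>V\<^esub> EId D a = EId E (FOb F a)) \<and>
     (\<forall>a\<in>EOb D. \<forall>b\<in>EOb D. \<forall>c\<in>EOb D.
        FHom F a c \<cdot>\<^bsub>V\<^esub> ECmp D a b c =
        ECmp E (FOb F a) (FOb F b) (FOb F c) \<cdot>\<^bsub>V\<^esub> prd_map V (FHom F a b) (FHom F b c))"

text \<open>Enriched natural transformations between \<open>V\<close>-functors \<open>F, G : D \<rightarrow> V\<close>, with components
  \<open>F a \<rightarrow> G a\<close> in \<open>V\<close> (equivalently \<open>\<ast> \<rightarrow> [F a, G a]\<close>). Naturality is the equality of the two maps
  \<open>D(a, b) \<rightarrow> [F a, G b]\<close>.\<close>

definition is_enriched_nat ::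
  "('o, 'm) category \<Rightarrow> ('a, 'o, 'm) enriched_category \<Rightarrow> ('a, 'o, 'm) enriched_functor \<Rightarrow>
   ('a, 'o, 'm) enriched_functor \<Rightarrow> ('a \<Rightarrow> 'm) \<Rightarrow> bool" where
  "is_enriched_nat V D F G \<alpha> \<longleftrightarrow>
     \<alpha> \<in> (\<Pi>\<^sub>E a\<in>EOb D. Hom V (FOb F a) (FOb G a)) \<and>
     (\<forall>a\<in>EOb D. \<forall>b\<in>EOb D.
        exp_post V (FOb F a) (\<alpha> b) \<cdot>\<^bsub>V\<^esub> FHom F a b = exp_pre V (\<alpha> a) (FOb G b) \<cdot>\<^bsub>V\<^esub> FHom G a b)"

definition is_enriched_nat_iso ::
  "('o, 'm) category \<Rightarrow> ('a, 'o, 'm) enriched_category \<Rightarrow> ('a, 'o, 'm) enriched_functor \<Rightarrow>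
   ('a, 'o, 'm) enriched_functor \<Rightarrow> ('a \<Rightarrow> 'm) \<Rightarrow> bool" where
  "is_enriched_nat_iso V D F G \<alpha> \<longleftrightarrow> is_enriched_nat V D F G \<alpha> \<and>
     (\<exists>\<beta>. is_enriched_nat V D G F \<beta> \<and>
        (\<forall>a\<in>EOb D. \<beta> a \<cdot>\<^bsub>V\<^esub> \<alpha> a = Id V (FOb F a) \<and> \<alpha> a \<cdot>\<^bsub>V\<^esub> \<beta> a = Id V (FOb G a)))"

text \<open>The functor \<open>C(-, c) : C\<^sup>o\<^sup>p \<rightarrow> V\<close>; its action \<open>C\<^sup>o\<^sup>p(b, a) = C(a, b) \<rightarrow> [C(b, c), C(a, c)]\<close> is the
  transpose of composition.\<close>

definition representable ::
  "('o, 'm) category \<Rightarrow> ('a, 'o, 'm) enriched_category \<Rightarrow> 'a \<Rightarrow> ('a, 'o, 'm) enriched_functor" where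
  "representable V C c =
    \<lparr>FOb = (\<lambda>a. EHom C a c),
     FHom = (\<lambda>b a. curry_arr V (EHom C a b) (EHom C b c) (EHom C a c) (ECmp C a b c))\<rparr>"

text \<open>The transformation \<open>C(-, c) \<Rightarrow> F\<close> corresponding to \<open>x : \<ast> \<rightarrow> F c\<close> under the Yoneda bijection
  \<open>\<alpha> \<mapsto> \<alpha>\<^sub>c \<cdot> id\<^sub>c\<close>:\<close>

definition yoneda_nat ::
  "('o, 'm) category \<Rightarrow> ('a, 'o, 'm) enriched_category \<Rightarrow> ('a, 'o, 'm) enriched_functor \<Rightarrow>
   'a \<Rightarrow> 'm \<Rightarrow> 'a \<Rightarrow> 'm" where
  "yoneda_nat V C F c x =
     (THE \<alpha>. is_enriched_nat V (enriched_op V C) (representable V C c) F \<alpha> \<and>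
             \<alpha> c \<cdot>\<^bsub>V\<^esub> EId C c = x)"

definition representable_by ::
  "('o, 'm) category \<Rightarrow> ('a, 'o, 'm) enriched_category \<Rightarrow> ('a, 'o, 'm) enriched_functor \<Rightarrow>
   'a \<Rightarrow> 'm \<Rightarrow> bool" where
  "representable_by V C F c x \<longleftrightarrow>
     is_enriched_nat_iso V (enriched_op V C) (representable V C c) F (yoneda_nat V C F c x)"


section \<open>Internal categories\<close>

record ('o, 'm) internal_category =
  Ob0 :: 'o
  Ob1 :: 'o
  Src :: 'm
  Tgt :: 'm
  Idn :: 'm
  Cmpn :: 'm

text \<open>Composition is defined on the pullback of \<open>(Tgt, Src)\<close>, i.e. it is in diagrammatic order. In the
  associativity law, \<open>Q\<close> is the object \<open>(A\<^sub>1 \<times> A\<^sub>1) \<times> A\<^sub>1\<close> of composable triples (products over \<open>A\<^sub>0\<close>).\<close>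

definition is_internal_category ::
  "('o, 'm) category \<Rightarrow> ('o, 'm) internal_category \<Rightarrow> bool" where
  "is_internal_category V A \<longleftrightarrow>
    (let s = Src A; t = Tgt A; i = Idn A; c = Cmpn A;
         p1 = pb1 V t s; p2 = pb2 V t s;
         Q = pb V (t \<cdot>\<^bsub>V\<^esub> p2) s; q1 = pb1 V (t \<cdot>\<^bsub>V\<^esub> p2) s; q2 = pb2 V (t \<cdot>\<^bsub>V\<^esub> p2) s
     in Ob0 A \<in> Ob V \<and> Ob1 A \<in> Ob V \<and>
        s \<in> Hom V (Ob1 A) (Ob0 A) \<and> t \<in> Hom V (Ob1 A) (Ob0 A) \<and>
        i \<in> Hom V (Ob0 A) (Ob1 A) \<and> c \<in> Hom V (pb V t s) (Ob1 A) \<and>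
        s \<cdot>\<^bsub>V\<^esub> i = Id V (Ob0 A) \<and> t \<cdot>\<^bsub>V\<^esub> i = Id V (Ob0 A) \<and>
        s \<cdot>\<^bsub>V\<^esub> c = s \<cdot>\<^bsub>V\<^esub> p1 \<and> t \<cdot>\<^bsub>V\<^esub> c = t \<cdot>\<^bsub>V\<^esub> p2 \<and>
        c \<cdot>\<^bsub>V\<^esub> pb_pair V t s (i \<cdot>\<^bsub>V\<^esub> s) (Id V (Ob1 A)) = Id V (Ob1 A) \<and>
        c \<cdot>\<^bsub>V\<^esub> pb_pair V t s (Id V (Ob1 A)) (i \<cdot>\<^bsub>V\<^esub> t) = Id V (Ob1 A) \<and>
        c \<cdot>\<^bsub>V\<^esub> pb_pair V t s (c \<cdot>\<^bsub>V\<^esub> q1) q2 =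
        c \<cdot>\<^bsub>V\<^esub> pb_pair V t s (p1 \<cdot>\<^bsub>V\<^esub> q1) (c \<cdot>\<^bsub>V\<^esub> pb_pair V t s (p2 \<cdot>\<^bsub>V\<^esub> q1) q2))"

record ('o, 'm) internal_functor =
  IDom :: "('o, 'm) internal_category"
  ICod :: "('o, 'm) internal_category"
  Fun0 :: 'm
  Fun1 :: 'm

definition is_internal_functor ::
  "('o, 'm) category \<Rightarrow> ('o, 'm) internal_functor \<Rightarrow> bool" where
  "is_internal_functor V F \<longleftrightarrow>
    (let A = IDom F; B = ICod F;
         p1 = pb1 V (Tgt A) (Src A); p2 = pb2 V (Tgt A) (Src A)
     in is_internal_category V A \<and> is_internal_category V B \<and>
        Fun0 F \<in> Hom V (Ob0 A) (Ob0 B) \<and> Fun1 F \<in> Hom V (Ob1 A) (Ob1 B) \<and>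
        Src B \<cdot>\<^bsub>V\<^esub> Fun1 F = Fun0 F \<cdot>\<^bsub>V\<^esub> Src A \<and>
        Tgt B \<cdot>\<^bsub>V\<^esub> Fun1 F = Fun0 F \<cdot>\<^bsub>V\<^esub> Tgt A \<and>
        Fun1 F \<cdot>\<^bsub>V\<^esub> Idn A = Idn B \<cdot>\<^bsub>V\<^esub> Fun0 F \<and>
        Fun1 F \<cdot>\<^bsub>V\<^esub> Cmpn A =
        Cmpn B \<cdot>\<^bsub>V\<^esub> pb_pair V (Tgt B) (Src B) (Fun1 F \<cdot>\<^bsub>V\<^esub> p1) (Fun1 F \<cdot>\<^bsub>V\<^esub> p2))"

definition Cat ::
  "('o, 'm) category \<Rightarrow> (('o, 'm) internal_category, ('o, 'm) internal_functor) category" where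
  "Cat V =
    \<lparr>Ob = {A. is_internal_category V A},
     Ar = {F. is_internal_functor V F},
     Dom = IDom,
     Cod = ICod,
     Id = (\<lambda>A. \<lparr>IDom = A, ICod = A, Fun0 = Id V (Ob0 A), Fun1 = Id V (Ob1 A)\<rparr>),
     Cmp = (\<lambda>G F. \<lparr>IDom = IDom F, ICod = ICod G,
                   Fun0 = Fun0 G \<cdot>\<^bsub>V\<^esub> Fun0 F, Fun1 = Fun1 G \<cdot>\<^bsub>V\<^esub> Fun1 F\<rparr>)\<rparr>"

text \<open>The terminal internal category, and the element \<open>\<ast> \<rightarrow> A\<close> given by a map \<open>x : \<ast> \<rightarrow> A\<^sub>0\<close>:\<close>

definition int_one :: "('o, 'm) category \<Rightarrow> ('o, 'm) internal_category" where
  "int_one V =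
    (let e = Id V (terminal V) in
     \<lparr>Ob0 = terminal V, Ob1 = terminal V, Src = e, Tgt = e, Idn = e, Cmpn = bang V (pb V e e)\<rparr>)"

definition int_element ::
  "('o, 'm) category \<Rightarrow> ('o, 'm) internal_category \<Rightarrow> 'm \<Rightarrow> ('o, 'm) internal_functor" where
  "int_element V A x = \<lparr>IDom = int_one V, ICod = A, Fun0 = x, Fun1 = Idn A \<cdot>\<^bsub>V\<^esub> x\<rparr>"

text \<open>The composite \<open>A \<rightarrow> \<ast> \<rightarrow> B\<close> for an element \<open>T : \<ast> \<rightarrow> B\<close>:\<close>

definition int_const ::
  "('o, 'm) category \<Rightarrow> ('o, 'm) internal_category \<Rightarrow> ('o, 'm) internal_functor \<Rightarrow>
   ('o, 'm) internal_functor" where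
  "int_const V A T = T \<cdot>\<^bsub>Cat V\<^esub> (THE u. u \<in> Hom (Cat V) A (int_one V))"


subsection \<open>Internal categories from enriched ones\<close>

text \<open>In both constructions below, the object of composable pairs is identified with a coproduct over
  triples of objects by means of the canonical comparison map, which is an isomorphism by
  extensivity.\<close>

definition Int_cat ::
  "('o, 'm) category \<Rightarrow> ('a, 'o, 'm) enriched_category \<Rightarrow> ('o, 'm) internal_category" where
  "Int_cat V C =
    (let I0 = EOb C; X0 = (\<lambda>a. terminal V);
         I1 = EOb C \<times> EOb C; X1 = (\<lambda>(a, b). EHom C a b);
         I2 = EOb C \<times> EOb C \<times> EOb C; X2 = (\<lambda>(a, b, d). prd V (EHom C a b) (EHom C b d));
         A0 = coprd V I0 X0; A1 = coprd V I1 X1;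
         s = cotuple V I1 X1 A0 (\<lambda>(a, b). coprd_in V I0 X0 a \<cdot>\<^bsub>V\<^esub> bang V (EHom C a b));
         t = cotuple V I1 X1 A0 (\<lambda>(a, b). coprd_in V I0 X0 b \<cdot>\<^bsub>V\<^esub> bang V (EHom C a b));
         comparison = cotuple V I2 X2 (pb V t s) (\<lambda>(a, b, d).
           pb_pair V t s
             (coprd_in V I1 X1 (a, b) \<cdot>\<^bsub>V\<^esub> pr1 V (EHom C a b) (EHom C b d))
             (coprd_in V I1 X1 (b, d) \<cdot>\<^bsub>V\<^esub> pr2 V (EHom C a b) (EHom C b d)))
     in \<lparr>Ob0 = A0, Ob1 = A1, Src = s, Tgt = t,
         Idn = cotuple V I0 X0 A1 (\<lambda>a. coprd_in V I1 X1 (a, a) \<cdot>\<^bsub>V\<^esub> EId C a),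
         Cmpn = cotuple V I2 X2 A1 (\<lambda>(a, b, d). coprd_in V I1 X1 (a, d) \<cdot>\<^bsub>V\<^esub> ECmp C a b d)
                  \<cdot>\<^bsub>V\<^esub> inv_arr V comparison\<rparr>)"

text \<open>For \<open>F : C\<^sup>o\<^sup>p \<rightarrow> V\<close>, the map \<open>C(a, b) \<times> F b \<rightarrow> F a\<close>:\<close>

definition ev_fun ::
  "('o, 'm) category \<Rightarrow> ('a, 'o, 'm) enriched_functor \<Rightarrow> 'a \<Rightarrow> 'a \<Rightarrow> 'm" where
  "ev_fun V F a b = uncurry_arr V (FOb F b) (FOb F a) (FHom F b a)"

text \<open>In the category of elements, the composable pair with index \<open>(a, b, d)\<close> given by \<open>((f, g), z)\<close> in
  \<open>(C(a, b) \<times> C(b, d)) \<times> F d\<close> consists of the arrows \<open>(f, ev (g, z))\<close> and \<open>(g, z)\<close>.\<close>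

definition elements ::
  "('o, 'm) category \<Rightarrow> ('a, 'o, 'm) enriched_category \<Rightarrow> ('a, 'o, 'm) enriched_functor \<Rightarrow>
   ('o, 'm) internal_category" where
  "elements V C F =
    (let I0 = EOb C; X0 = FOb F;
         I1 = EOb C \<times> EOb C; X1 = (\<lambda>(a, b). prd V (EHom C a b) (FOb F b));
         I2 = EOb C \<times> EOb C \<times> EOb C;
         X2 = (\<lambda>(a, b, d). prd V (prd V (EHom C a b) (EHom C b d)) (FOb F d));
         A0 = coprd V I0 X0; A1 = coprd V I1 X1;
         s = cotuple V I1 X1 A0 (\<lambda>(a, b). coprd_in V I0 X0 a \<cdot>\<^bsub>V\<^esub> ev_fun V F a b);
         t = cotuple V I1 X1 A0 (\<lambda>(a, b). coprd_in V I0 X0 b \<cdot>\<^bsub>V\<^esub> pr2 V (EHom C a b) (FOb F b));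
         comparison = cotuple V I2 X2 (pb V t s) (\<lambda>(a, b, d).
           pb_pair V t s
             (coprd_in V I1 X1 (a, b) \<cdot>\<^bsub>V\<^esub>
                pair V (pr_first V (EHom C a b) (EHom C b d) (FOb F d))
                       (ev_fun V F b d \<cdot>\<^bsub>V\<^esub> pr_rest V (EHom C a b) (EHom C b d) (FOb F d)))
             (coprd_in V I1 X1 (b, d) \<cdot>\<^bsub>V\<^esub> pr_rest V (EHom C a b) (EHom C b d) (FOb F d)))
     in \<lparr>Ob0 = A0, Ob1 = A1, Src = s, Tgt = t,
         Idn = cotuple V I0 X0 A1 (\<lambda>a. coprd_in V I1 X1 (a, a) \<cdot>\<^bsub>V\<^esub>
           prd_map V (EId C a) (Id V (FOb F a)) \<cdot>\<^bsub>V\<^esub> pair V (bang V (FOb F a)) (Id V (FOb F a))),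
         Cmpn = cotuple V I2 X2 A1 (\<lambda>(a, b, d). coprd_in V I1 X1 (a, d) \<cdot>\<^bsub>V\<^esub>
             prd_map V (ECmp C a b d) (Id V (FOb F d)))
           \<cdot>\<^bsub>V\<^esub> inv_arr V comparison\<rparr>)"

definition elements_pair ::
  "('o, 'm) category \<Rightarrow> ('a, 'o, 'm) enriched_category \<Rightarrow> ('a, 'o, 'm) enriched_functor \<Rightarrow>
   'a \<Rightarrow> 'm \<Rightarrow> ('o, 'm) internal_functor" where
  "elements_pair V C F c x = int_element V (elements V C F) (coprd_in V (EOb C) (FOb F) c \<cdot>\<^bsub>V\<^esub> x)"


subsection \<open>Internal slices and internal terminal objects\<close>

text \<open>The enriched category with objects \<open>0 = False\<close> and \<open>1 = True\<close>. Its identities and compositions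
  are the only maps between the respective objects.\<close>

definition enriched_two :: "('o, 'm) category \<Rightarrow> (bool, 'o, 'm) enriched_category" where
  "enriched_two V =
    (let H = (\<lambda>a b. if a \<and> \<not> b then initial V else terminal V) in
     \<lparr>EOb = UNIV, EHom = H,
      EId = (\<lambda>a. THE f. f \<in> Hom V (terminal V) (H a a)),
      ECmp = (\<lambda>a b c. THE f. f \<in> Hom V (prd V (H a b) (H b c)) (H a c))\<rparr>)"

definition int_two :: "('o, 'm) category \<Rightarrow> ('o, 'm) internal_category" where
  "int_two V = Int_cat V (enriched_two V)"

definition int_two_element :: "('o, 'm) category \<Rightarrow> bool \<Rightarrow> ('o, 'm) internal_functor" where
  "int_two_element V k = int_element V (int_two V) (coprd_in V UNIV (\<lambda>_. terminal V) k)"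

text \<open>Restriction \<open>\<lbrakk>B, A\<rbrakk> \<rightarrow> \<lbrakk>\<ast>, A\<rbrakk> \<cong> A\<close> along an element \<open>b\<close> of \<open>B\<close>, that is evaluation at \<open>b\<close>:\<close>

definition int_eval_at ::
  "('o, 'm) category \<Rightarrow> ('o, 'm) internal_category \<Rightarrow> ('o, 'm) internal_functor \<Rightarrow>
   ('o, 'm) internal_functor" where
  "int_eval_at V A b =
    (let B = ICod b; E = exp_ob (Cat V) B A
     in exp_ev (Cat V) B A \<cdot>\<^bsub>Cat V\<^esub> pair (Cat V) (Id (Cat V) E) (int_const V E b))"

text \<open>\<open>\<langle>0, 1\<rangle>\<^sup>* : \<lbrakk>2, A\<rbrakk> \<rightarrow> \<lbrakk>\<ast> \<squnion> \<ast>, A\<rbrakk> \<cong> A \<times> A\<close>:\<close>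

definition int_endpoints ::
  "('o, 'm) category \<Rightarrow> ('o, 'm) internal_category \<Rightarrow> ('o, 'm) internal_functor" where
  "int_endpoints V A =
     pair (Cat V) (int_eval_at V A (int_two_element V False))
                  (int_eval_at V A (int_two_element V True))"

text \<open>\<open>id \<times> T : A \<cong> A \<times> \<ast> \<rightarrow> A \<times> A\<close> for an element \<open>T\<close> of \<open>A\<close>:\<close>

definition int_id_times ::
  "('o, 'm) category \<Rightarrow> ('o, 'm) internal_category \<Rightarrow> ('o, 'm) internal_functor \<Rightarrow>
   ('o, 'm) internal_functor" where
  "int_id_times V A T = pair (Cat V) (Id (Cat V) A) (int_const V A T)"

definition int_slice ::
  "('o, 'm) category \<Rightarrow> ('o, 'm) internal_category \<Rightarrow> ('o, 'm) internal_functor \<Rightarrow>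
   ('o, 'm) internal_category" where
  "int_slice V A T = pb (Cat V) (int_endpoints V A) (int_id_times V A T)"

definition int_slice_proj ::
  "('o, 'm) category \<Rightarrow> ('o, 'm) internal_category \<Rightarrow> ('o, 'm) internal_functor \<Rightarrow>
   ('o, 'm) internal_functor" where
  "int_slice_proj V A T = pb2 (Cat V) (int_endpoints V A) (int_id_times V A T)"

definition is_internal_terminal ::
  "('o, 'm) category \<Rightarrow> ('o, 'm) internal_category \<Rightarrow> ('o, 'm) internal_functor \<Rightarrow> bool" where
  "is_internal_terminal V A T \<longleftrightarrow>
     T \<in> Hom (Cat V) (int_one V) A \<and> is_iso (Cat V) (int_slice_proj V A T)"

end

theory Submission
  imports Defs
begin

text \<open>
  Everything is computed with generalised elements. The arrows \<open>U \<rightarrow> A\<^sub>1\<close> of the base category are the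
  arrows of an ordinary category with objects \<open>U \<rightarrow> A\<^sub>0\<close>, naturally in the stage \<open>U\<close>, and being a
  terminal object has a plain meaning in these terms: an element \<open>x\<^sub>0\<close> of \<open>A\<close> is an internal terminal object iff
  for every stage \<open>U\<close> and every \<open>a : U \<rightarrow> A\<^sub>0\<close> there is exactly one \<open>f : U \<rightarrow> A\<^sub>1\<close> from \<open>a\<close> to the
  constant element \<open>x\<^sub>0\<close> (theorem \<open>is_internal_terminal_iff\<close>). Likewise, by the enriched Yoneda lemma,
  \<open>F\<close> is represented by \<open>(c, x)\<close> iff for all \<open>a\<close>, \<open>U\<close> and \<open>y : U \<rightarrow> F a\<close> there is exactly one
  \<open>f : U \<rightarrow> C(a, c)\<close> that acts on \<open>x\<close> with value \<open>y\<close> (\<open>representable_by_iff\<close>).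

  An object of the category of elements at a stage \<open>U\<close> is an arrow \<open>U \<rightarrow> \<Squnion>\<^sub>a F a\<close>, and extensivity says
  that it is, locally on \<open>U\<close>, an element \<open>y\<close> of a single \<open>F a\<close>: the stage is a coproduct of pieces on
  which this is so. An arrow from \<open>y\<close> to \<open>(c, x)\<close> is then, locally, an \<open>f\<close> that acts on \<open>x\<close> with
  value \<open>y\<close>; all other summands \<open>C(a, b) \<times> F b\<close> only contribute over initial stages, on which every
  equation holds. Unique existence on the pieces is the same as unique existence on \<open>U\<close>, so the two
  descriptions agree (\<open>representable_iff_terminal\<close>).

  The work lies in reaching this description from the definition of the slice as a pullback of
  the exponential by the interval \<open>2\<close>. Pullbacks and products of internal categories are formed on
  objects and on arrows. The local argument also shows that functors \<open>X \<times> 2 \<rightarrow> A\<close> correspond to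
  natural transformations between functors \<open>X \<rightarrow> A\<close> (\<open>functor_of_transf\<close>), and these in turn to
  functors from \<open>X\<close> to the internal category of arrows and commutative squares of \<open>A\<close>
  (\<open>functor_into_AA\<close>), which is therefore the exponential. Hence the slice over an element classifies
  transformations to the constant functor (\<open>is_internal_terminal_iff_transf\<close>). Both \<open>2\<close> and the
  category of elements are coproducts of a family of objects and a matrix of objects; one lemma,
  \<open>IC_glued\<close>, shows that such data form an internal category.
\<close>

section \<open>Categories with chosen finite limits\<close>

text \<open>The rewriting rules below express types by equations for \<open>Dom\<close> and \<open>Cod\<close> instead of membership in
  a hom-set, so that all premises of a rule are determined by its left-hand side.\<close>

locale cat =
  fixes V :: "('o, 'm) category" (structure)
  assumes cat: "is_category V"
begin

lemma in_hom: "f \<in> Hom V a b \<longleftrightarrow> f \<in> Ar V \<and> Dom V f = a \<and> Cod V f = b"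
  by (auto simp: Hom_def)

lemma Dom_Ob [simp]: "f \<in> Ar V \<Longrightarrow> Dom V f \<in> Ob V"
  and Cod_Ob [simp]: "f \<in> Ar V \<Longrightarrow> Cod V f \<in> Ob V"
  using cat by (auto simp: is_category_def)

lemma hom_Ob: "f \<in> Hom V a b \<Longrightarrow> a \<in> Ob V" "f \<in> Hom V a b \<Longrightarrow> b \<in> Ob V"
  using Dom_Ob Cod_Ob by (auto simp: in_hom)

lemma Id_Ar [simp]: "a \<in> Ob V \<Longrightarrow> Id V a \<in> Ar V"
  and Dom_Id [simp]: "a \<in> Ob V \<Longrightarrow> Dom V (Id V a) = a"
  and Cod_Id [simp]: "a \<in> Ob V \<Longrightarrow> Cod V (Id V a) = a"
  using cat by (auto simp: is_category_def in_hom)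

lemma comp_Ar [simp]: "f \<in> Ar V \<Longrightarrow> g \<in> Ar V \<Longrightarrow> Cod V f = Dom V g \<Longrightarrow> g \<cdot> f \<in> Ar V"
  and Dom_comp [simp]: "f \<in> Ar V \<Longrightarrow> g \<in> Ar V \<Longrightarrow> Cod V f = Dom V g \<Longrightarrow> Dom V (g \<cdot> f) = Dom V f"
  and Cod_comp [simp]: "f \<in> Ar V \<Longrightarrow> g \<in> Ar V \<Longrightarrow> Cod V f = Dom V g \<Longrightarrow> Cod V (g \<cdot> f) = Cod V g"
  using cat by (auto simp: is_category_def in_hom)

lemma comp_Id [simp]: "f \<in> Ar V \<Longrightarrow> Dom V f = a \<Longrightarrow> f \<cdot> Id V a = f"
  and Id_comp [simp]: "f \<in> Ar V \<Longrightarrow> Cod V f = a \<Longrightarrow> Id V a \<cdot> f = f"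
  using cat by (auto simp: is_category_def)

lemma assoc [simp]:
  "f \<in> Ar V \<Longrightarrow> g \<in> Ar V \<Longrightarrow> h \<in> Ar V \<Longrightarrow> Cod V f = Dom V g \<Longrightarrow> Cod V g = Dom V h \<Longrightarrow>
   (h \<cdot> g) \<cdot> f = h \<cdot> (g \<cdot> f)"
  using cat by (auto simp: is_category_def)

lemma comp_hom: "f \<in> Hom V a b \<Longrightarrow> g \<in> Hom V b d \<Longrightarrow> g \<cdot> f \<in> Hom V a d"
  by (simp add: in_hom)

text \<open>The rewriting rules for composites nest them to the right, which hides the left half of a
  known equation \<open>g \<cdot> f = k\<close> inside \<open>g \<cdot> (f \<cdot> u)\<close>; this is that equation at the element \<open>u\<close>.\<close>

lemma comp_eq_at:
  "g \<cdot> f = k \<Longrightarrow> f \<in> Ar V \<Longrightarrow> g \<in> Ar V \<Longrightarrow> Cod V f = Dom V g \<Longrightarrow> u \<in> Ar V \<Longrightarrow> Cod V u = Dom V f \<Longrightarrow>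
   g \<cdot> (f \<cdot> u) = k \<cdot> u"
  by (metis assoc)

lemma is_isoI:
  "f \<in> Hom V a b \<Longrightarrow> g \<in> Hom V b a \<Longrightarrow> g \<cdot> f = Id V a \<Longrightarrow> f \<cdot> g = Id V b \<Longrightarrow> is_iso V f"
  by (auto simp: is_iso_def is_inverse_def in_hom)

lemma inv_arr:
  assumes "is_iso V f" "f \<in> Hom V a b"
  shows "inv_arr V f \<in> Hom V b a" "inv_arr V f \<cdot> f = Id V a" "f \<cdot> inv_arr V f = Id V b"
proof -
  have "\<exists>!g. is_inverse V f g"
  proof -
    obtain g where g: "is_inverse V f g" using assms by (auto simp: is_iso_def)
    moreover have "g' = g" if "is_inverse V f g'" for g'
    proof -
      have "g' = g' \<cdot> (f \<cdot> g)" using g that assms by (simp add: is_inverse_def in_hom)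
      also have "\<dots> = (g' \<cdot> f) \<cdot> g" using g that assms by (intro assoc[symmetric]) (auto simp: is_inverse_def in_hom)
      also have "\<dots> = g" using g that assms by (simp add: is_inverse_def in_hom)
      finally show ?thesis .
    qed
    ultimately show ?thesis by blast
  qed
  then have "is_inverse V f (inv_arr V f)"
    unfolding inv_arr_def by (rule theI')
  then show "inv_arr V f \<in> Hom V b a" "inv_arr V f \<cdot> f = Id V a" "f \<cdot> inv_arr V f = Id V b"
    using assms by (auto simp: is_inverse_def in_hom)
qed

text \<open>The Yoneda lemma in the form in which isomorphisms are recognised throughout: \<open>f\<close> is invertible
  iff it is a bijection on generalised elements.\<close>

lemma is_iso_iff_bij_elements:
  assumes f: "f \<in> Hom V a b"
  shows "is_iso V f \<longleftrightarrow> (\<forall>U\<in>Ob V. \<forall>v\<in>Hom V U b. \<exists>!u. u \<in> Hom V U a \<and> f \<cdot> u = v)"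
proof (intro iffI ballI)
  fix U v assume "is_iso V f" and U: "U \<in> Ob V" and v: "v \<in> Hom V U b"
  note i = inv_arr[OF this(1) f]
  have i3: "inv_arr V f \<cdot> (f \<cdot> u) = u" if "u \<in> Hom V U a" for u
    using comp_eq_at[OF i(2), of u] that f i(1) by (simp add: in_hom)
  have "f \<cdot> (inv_arr V f \<cdot> v) = v"
    using comp_eq_at[OF i(3), of v] f i(1) v by (simp add: in_hom)
  moreover have "inv_arr V f \<cdot> v \<in> Hom V U a" using i(1) v by (simp add: in_hom)
  ultimately show "\<exists>!u. u \<in> Hom V U a \<and> f \<cdot> u = v"
    using i3 by metis
next
  assume bij: "\<forall>U\<in>Ob V. \<forall>v\<in>Hom V U b. \<exists>!u. u \<in> Hom V U a \<and> f \<cdot> u = v"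
  have ab: "a \<in> Ob V" "b \<in> Ob V" using f hom_Ob by auto
  then obtain g where g: "g \<in> Hom V b a" "f \<cdot> g = Id V b"
    using bij by (metis Cod_Id Dom_Id Id_Ar in_hom)
  have "g \<cdot> f \<in> Hom V a a" "f \<cdot> (g \<cdot> f) = f"
    using f g comp_eq_at[OF g(2), of f] by (auto simp: in_hom)
  moreover have "Id V a \<in> Hom V a a" "f \<cdot> Id V a = f"
    using f ab by (auto simp: in_hom)
  ultimately have "g \<cdot> f = Id V a" using bij ab f by metis
  then show "is_iso V f" using is_isoI f g by blast
qed

lemma is_iso_cancel:
  assumes "is_iso V f" "f \<in> Hom V a b" "u \<in> Hom V U a" "u' \<in> Hom V U a" "f \<cdot> u = f \<cdot> u'"
  shows "u = u'"
  using is_iso_iff_bij_elements[OF assms(2)] assms comp_hom hom_Ob by metis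

subsection \<open>Universal constructions\<close>

lemma is_terminal_unique:
  "is_terminal V t \<Longrightarrow> f \<in> Hom V x t \<Longrightarrow> g \<in> Hom V x t \<Longrightarrow> f = g"
  using hom_Ob by (metis is_terminal_def)

lemma is_initial_unique:
  "is_initial V z \<Longrightarrow> f \<in> Hom V z y \<Longrightarrow> g \<in> Hom V z y \<Longrightarrow> f = g"
  using hom_Ob by (metis is_initial_def)

lemma is_initial_ex: "is_initial V z \<Longrightarrow> y \<in> Ob V \<Longrightarrow> \<exists>f. f \<in> Hom V z y"
  by (metis is_initial_def)

lemma is_productD:
  assumes "is_product V a b (p, p1, p2)"
  shows "p \<in> Ob V" "p1 \<in> Hom V p a" "p2 \<in> Hom V p b"
    and "f \<in> Hom V x a \<Longrightarrow> g \<in> Hom V x b \<Longrightarrow> \<exists>h. h \<in> Hom V x p \<and> p1 \<cdot> h = f \<and> p2 \<cdot> h = g"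
    and "h \<in> Hom V x p \<Longrightarrow> k \<in> Hom V x p \<Longrightarrow> p1 \<cdot> h = p1 \<cdot> k \<Longrightarrow> p2 \<cdot> h = p2 \<cdot> k \<Longrightarrow> h = k"
proof -
  show *: "p \<in> Ob V" "p1 \<in> Hom V p a" "p2 \<in> Hom V p b"
    using assms by (auto simp: is_product_def)
  have U: "\<exists>!h. h \<in> Hom V x p \<and> p1 \<cdot> h = f \<and> p2 \<cdot> h = g" if "f \<in> Hom V x a" "g \<in> Hom V x b" for f g x
    using assms that hom_Ob by (simp add: is_product_def)
  show "\<exists>h. h \<in> Hom V x p \<and> p1 \<cdot> h = f \<and> p2 \<cdot> h = g" if "f \<in> Hom V x a" "g \<in> Hom V x b"
    using U[OF that] by blast
  show "h = k" if h: "h \<in> Hom V x p" "k \<in> Hom V x p" "p1 \<cdot> h = p1 \<cdot> k" "p2 \<cdot> h = p2 \<cdot> k"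
    using U[OF comp_hom[OF h(1) *(2)] comp_hom[OF h(1) *(3)]] h by auto
qed

lemma is_pullbackD:
  assumes "is_pullback V f g (p, p1, p2)"
  shows "p \<in> Ob V" "p1 \<in> Hom V p (Dom V f)" "p2 \<in> Hom V p (Dom V g)" "f \<cdot> p1 = g \<cdot> p2"
    and "h \<in> Hom V x (Dom V f) \<Longrightarrow> k \<in> Hom V x (Dom V g) \<Longrightarrow> f \<cdot> h = g \<cdot> k \<Longrightarrow>
      \<exists>u. u \<in> Hom V x p \<and> p1 \<cdot> u = h \<and> p2 \<cdot> u = k"
    and "f \<in> Ar V \<Longrightarrow> g \<in> Ar V \<Longrightarrow> u \<in> Hom V x p \<Longrightarrow> v \<in> Hom V x p \<Longrightarrow>
      p1 \<cdot> u = p1 \<cdot> v \<Longrightarrow> p2 \<cdot> u = p2 \<cdot> v \<Longrightarrow> u = v"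
proof -
  show *: "p \<in> Ob V" "p1 \<in> Hom V p (Dom V f)" "p2 \<in> Hom V p (Dom V g)" "f \<cdot> p1 = g \<cdot> p2"
    using assms by (auto simp: is_pullback_def)
  have U: "\<exists>!u. u \<in> Hom V x p \<and> p1 \<cdot> u = h \<and> p2 \<cdot> u = k"
    if "h \<in> Hom V x (Dom V f)" "k \<in> Hom V x (Dom V g)" "f \<cdot> h = g \<cdot> k" for h k x
    using assms that hom_Ob by (simp add: is_pullback_def)
  show "\<exists>u. u \<in> Hom V x p \<and> p1 \<cdot> u = h \<and> p2 \<cdot> u = k"
    if "h \<in> Hom V x (Dom V f)" "k \<in> Hom V x (Dom V g)" "f \<cdot> h = g \<cdot> k"
    using U[OF that] by blast
  show "u = v" if fg: "f \<in> Ar V" "g \<in> Ar V" and h: "u \<in> Hom V x p" "v \<in> Hom V x p" "p1 \<cdot> u = p1 \<cdot> v" "p2 \<cdot> u = p2 \<cdot> v"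
  proof -
    have "f \<cdot> (p1 \<cdot> u) = g \<cdot> (p2 \<cdot> u)"
      using comp_eq_at[OF *(4), of u] fg h * by (simp add: in_hom)
    from U[OF comp_hom[OF h(1) *(2)] comp_hom[OF h(1) *(3)] this] show ?thesis using h by auto
  qed
qed

lemma is_coproductD:
  assumes "is_coproduct V I X (s, \<iota>)"
  shows "s \<in> Ob V" "i \<in> I \<Longrightarrow> \<iota> i \<in> Hom V (X i) s"
    and "y \<in> Ob V \<Longrightarrow> (\<And>i. i \<in> I \<Longrightarrow> f i \<in> Hom V (X i) y) \<Longrightarrow>
      \<exists>h. h \<in> Hom V s y \<and> (\<forall>i\<in>I. h \<cdot> \<iota> i = f i)"
    and "h \<in> Hom V s y \<Longrightarrow> k \<in> Hom V s y \<Longrightarrow> (\<And>i. i \<in> I \<Longrightarrow> h \<cdot> \<iota> i = k \<cdot> \<iota> i) \<Longrightarrow> h = k"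
proof -
  show *: "s \<in> Ob V" and **: "\<And>i. i \<in> I \<Longrightarrow> \<iota> i \<in> Hom V (X i) s"
    using assms by (auto simp: is_coproduct_def)
  have U: "\<exists>!h. h \<in> Hom V s y \<and> (\<forall>i\<in>I. h \<cdot> \<iota> i = f i)"
    if "y \<in> Ob V" "\<And>i. i \<in> I \<Longrightarrow> f i \<in> Hom V (X i) y" for y f
    using assms that by (simp add: is_coproduct_def)
  show "\<exists>h. h \<in> Hom V s y \<and> (\<forall>i\<in>I. h \<cdot> \<iota> i = f i)"
    if "y \<in> Ob V" "\<And>i. i \<in> I \<Longrightarrow> f i \<in> Hom V (X i) y"
    using U[OF that] by blast
  show "h = k" if h: "h \<in> Hom V s y" "k \<in> Hom V s y" "\<And>i. i \<in> I \<Longrightarrow> h \<cdot> \<iota> i = k \<cdot> \<iota> i"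
  proof -
    have "y \<in> Ob V" "\<And>i. i \<in> I \<Longrightarrow> h \<cdot> \<iota> i \<in> Hom V (X i) y"
      using h ** comp_hom hom_Ob by blast+
    from U[OF this] h show ?thesis by metis
  qed
qed

lemma is_coproduct_initial: "is_coproduct V {} X (s, \<iota>) \<Longrightarrow> is_initial V s"
  by (simp add: is_coproduct_def is_initial_def)

lemma is_coproduct_iso_unique:
  assumes "is_coproduct V I X (s, \<iota>)" "is_coproduct V I X (s', \<iota>')"
  obtains e where "e \<in> Hom V s s'" "is_iso V e" "\<And>i. i \<in> I \<Longrightarrow> e \<cdot> \<iota> i = \<iota>' i"
proof -
  note c = is_coproductD[OF assms(1)] and c' = is_coproductD[OF assms(2)]
  obtain e where e: "e \<in> Hom V s s'" "\<And>i. i \<in> I \<Longrightarrow> e \<cdot> \<iota> i = \<iota>' i"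
    using c(3)[OF c'(1), of \<iota>'] c'(2) by blast
  obtain d where d: "d \<in> Hom V s' s" "\<And>i. i \<in> I \<Longrightarrow> d \<cdot> \<iota>' i = \<iota> i"
    using c'(3)[OF c(1), of \<iota>] c(2) by blast
  have "d \<cdot> e = Id V s"
    by (rule c(4)[of _ s]) (use e d c in \<open>auto simp: in_hom\<close>)
  moreover have "e \<cdot> d = Id V s'"
    by (rule c'(4)[of _ s']) (use e d c' in \<open>auto simp: in_hom\<close>)
  ultimately show ?thesis using that is_isoI e d by blast
qed

lemma is_coproduct_transport:
  assumes "is_coproduct V I X (s, \<iota>)" "e \<in> Hom V s s'" "is_iso V e"
  shows "is_coproduct V I X (s', \<lambda>i. e \<cdot> \<iota> i)"
proof -
  note c = is_coproductD[OF assms(1)]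
  note inv = inv_arr[OF assms(3,2)]
  have inv3: "inv_arr V e \<cdot> (e \<cdot> u) = u" if "u \<in> Ar V" "Cod V u = s" for u
    using comp_eq_at[OF inv(2), of u] that assms(2) inv(1) by (simp add: in_hom)
  have inv4: "e \<cdot> (inv_arr V e \<cdot> u) = u" if "u \<in> Ar V" "Cod V u = s'" for u
    using comp_eq_at[OF inv(3), of u] that assms(2) inv(1) by (simp add: in_hom)
  show ?thesis
    unfolding is_coproduct_def prod.case
  proof (intro conjI ballI allI impI)
    show "s' \<in> Ob V" using assms hom_Ob by blast
    show "e \<cdot> \<iota> i \<in> Hom V (X i) s'" if "i \<in> I" for i
      using c(2)[OF that] assms(2) comp_hom by blast
    fix y f assume y: "y \<in> Ob V" and f: "\<forall>i\<in>I. f i \<in> Hom V (X i) y"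
    obtain h where h: "h \<in> Hom V s y" "\<And>i. i \<in> I \<Longrightarrow> h \<cdot> \<iota> i = f i"
      using c(3)[OF y, of f] f by blast
    show "\<exists>!h. h \<in> Hom V s' y \<and> (\<forall>i\<in>I. h \<cdot> (e \<cdot> \<iota> i) = f i)"
    proof (rule ex1I[of _ "h \<cdot> inv_arr V e"])
      show "h \<cdot> inv_arr V e \<in> Hom V s' y \<and> (\<forall>i\<in>I. (h \<cdot> inv_arr V e) \<cdot> (e \<cdot> \<iota> i) = f i)"
      proof (intro conjI ballI)
        show "h \<cdot> inv_arr V e \<in> Hom V s' y" using h inv comp_hom by blast
        fix i assume i: "i \<in> I"
        show "(h \<cdot> inv_arr V e) \<cdot> (e \<cdot> \<iota> i) = f i"
          using h(1) h(2)[OF i] inv(1) assms(2) c(2)[OF i] by (simp add: in_hom inv3)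
      qed
      fix k assume k: "k \<in> Hom V s' y \<and> (\<forall>i\<in>I. k \<cdot> (e \<cdot> \<iota> i) = f i)"
      have "k \<cdot> e = h"
      proof (rule c(4)[of _ y])
        show "k \<cdot> e \<in> Hom V s y" "h \<in> Hom V s y" using k h assms(2) comp_hom by blast+
        fix i assume i: "i \<in> I"
        show "(k \<cdot> e) \<cdot> \<iota> i = h \<cdot> \<iota> i"
          using k h(2)[OF i] i assms(2) c(2)[OF i] by (auto simp: in_hom)
      qed
      then show "k = h \<cdot> inv_arr V e"
        using k inv assms(2) by (auto simp: in_hom)
    qed
  qed
qed

text \<open>Coproducts are given for index sets inside the fixed universe, whereas the internal category of
  elements uses families indexed by pairs and triples; these are reached along an injection.\<close>

lemma is_coproduct_reindex:
  assumes "inj_on e I"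
  shows "is_coproduct V (e ` I) X (s, \<iota>) \<longleftrightarrow> is_coproduct V I (X \<circ> e) (s, \<iota> \<circ> e)"
proof -
  have "(\<forall>f. (\<forall>i\<in>e ` I. f i \<in> Hom V (X i) y) \<longrightarrow> (\<exists>!h. h \<in> Hom V s y \<and> (\<forall>i\<in>e ` I. h \<cdot> \<iota> i = f i))) \<longleftrightarrow>
    (\<forall>f. (\<forall>i\<in>I. f i \<in> Hom V (X (e i)) y) \<longrightarrow> (\<exists>!h. h \<in> Hom V s y \<and> (\<forall>i\<in>I. h \<cdot> \<iota> (e i) = f i)))"
    (is "?L \<longleftrightarrow> ?R") for y
  proof
    assume L: ?L
    show ?R
    proof (intro allI impI)
      fix f assume "\<forall>i\<in>I. f i \<in> Hom V (X (e i)) y"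
      then have "\<forall>i\<in>e ` I. (f \<circ> inv_into I e) i \<in> Hom V (X i) y" using assms by simp
      with L have "\<exists>!h. h \<in> Hom V s y \<and> (\<forall>i\<in>e ` I. h \<cdot> \<iota> i = (f \<circ> inv_into I e) i)" by blast
      then show "\<exists>!h. h \<in> Hom V s y \<and> (\<forall>i\<in>I. h \<cdot> \<iota> (e i) = f i)" using assms by simp
    qed
  next
    assume R: ?R
    show ?L
    proof (intro allI impI)
      fix f assume "\<forall>i\<in>e ` I. f i \<in> Hom V (X i) y"
      then show "\<exists>!h. h \<in> Hom V s y \<and> (\<forall>i\<in>e ` I. h \<cdot> \<iota> i = f i)"
        using R[rule_format, of "f \<circ> e"] by simp
    qed
  qed
  then show ?thesis by (simp add: is_coproduct_def)
qed

lemma is_coproduct_cong: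
  assumes "\<And>i. i \<in> I \<Longrightarrow> X i = X' i" "\<And>i. i \<in> I \<Longrightarrow> \<iota> i = \<iota>' i"
  shows "is_coproduct V I X (s, \<iota>) \<longleftrightarrow> is_coproduct V I X' (s, \<iota>')"
  using assms by (simp add: is_coproduct_def)

lemma is_coproduct_chosen:
  "is_coproduct V I X d \<Longrightarrow> is_coproduct V I X (coprd V I X, coprd_in V I X)"
  unfolding coprd_def coprd_in_def coproduct_def by (auto intro: someI2)

lemma cotuple:
  assumes "is_coproduct V I X (coprd V I X, coprd_in V I X)" "y \<in> Ob V"
    and "\<And>i. i \<in> I \<Longrightarrow> f i \<in> Hom V (X i) y"
  shows "cotuple V I X y f \<in> Hom V (coprd V I X) y"
    and "i \<in> I \<Longrightarrow> cotuple V I X y f \<cdot> coprd_in V I X i = f i"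
proof -
  have "\<exists>!h. h \<in> Hom V (coprd V I X) y \<and> (\<forall>i\<in>I. h \<cdot> coprd_in V I X i = f i)"
    using is_coproductD(3)[OF assms] is_coproductD(4)[OF assms(1)] by metis
  then have "cotuple V I X y f \<in> Hom V (coprd V I X) y \<and> (\<forall>i\<in>I. cotuple V I X y f \<cdot> coprd_in V I X i = f i)"
    unfolding cotuple_def by (rule theI')
  then show "cotuple V I X y f \<in> Hom V (coprd V I X) y" "i \<in> I \<Longrightarrow> cotuple V I X y f \<cdot> coprd_in V I X i = f i"
    by auto
qed

lemma is_pullback_iso_unique:
  assumes "is_pullback V f g (p, p1, p2)" "is_pullback V f g (q, q1, q2)" "f \<in> Ar V" "g \<in> Ar V"
  obtains e where "e \<in> Hom V p q" "is_iso V e" "q1 \<cdot> e = p1" "q2 \<cdot> e = p2"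
proof -
  note p = is_pullbackD[OF assms(1)] and q = is_pullbackD[OF assms(2)]
  obtain e where e: "e \<in> Hom V p q" "q1 \<cdot> e = p1" "q2 \<cdot> e = p2"
    using q(5)[OF p(2,3,4)] by blast
  obtain d where d: "d \<in> Hom V q p" "p1 \<cdot> d = q1" "p2 \<cdot> d = q2"
    using p(5)[OF q(2,3,4)] by blast
  have "d \<cdot> e = Id V p"
    by (rule p(6)[of _ p])
      (use assms(3,4) e d p q comp_eq_at[OF d(2), of e] comp_eq_at[OF d(3), of e] in \<open>auto simp: in_hom\<close>)
  moreover have "e \<cdot> d = Id V q"
    by (rule q(6)[of _ q])
      (use assms(3,4) e d p q comp_eq_at[OF e(2), of d] comp_eq_at[OF e(3), of d] in \<open>auto simp: in_hom\<close>)
  ultimately show ?thesis using that is_isoI e d by blast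
qed

end

locale lex = cat V for V :: "('o, 'm) category" (structure) +
  assumes ex_terminal: "\<exists>t. is_terminal V t"
    and ex_product: "\<And>a b. a \<in> Ob V \<Longrightarrow> b \<in> Ob V \<Longrightarrow> \<exists>p. is_product V a b p"
    and ex_pullback: "has_pullbacks V"
begin

lemma terminal: "is_terminal V (terminal V)"
  unfolding terminal_def using ex_terminal by (rule someI_ex)

lemma terminal_Ob [simp]: "terminal V \<in> Ob V"
  using terminal by (simp add: is_terminal_def)

lemma bang: "x \<in> Ob V \<Longrightarrow> bang V x \<in> Hom V x (terminal V)"
  unfolding bang_def
  by (rule theI'[where P = "\<lambda>f. f \<in> Hom V x (terminal V)"]) (use terminal in \<open>simp add: is_terminal_def\<close>)

lemma bang_simps [simp]:
  "x \<in> Ob V \<Longrightarrow> bang V x \<in> Ar V" "x \<in> Ob V \<Longrightarrow> Dom V (bang V x) = x"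
  "x \<in> Ob V \<Longrightarrow> Cod V (bang V x) = terminal V"
  using bang by (auto simp: in_hom)

lemma to_terminal: "f \<in> Ar V \<Longrightarrow> Cod V f = terminal V \<Longrightarrow> f = bang V (Dom V f)"
  by (rule is_terminal_unique[OF terminal]) (auto simp: in_hom)

lemma bang_comp [simp]: "u \<in> Ar V \<Longrightarrow> Cod V u = x \<Longrightarrow> bang V x \<cdot> u = bang V (Dom V u)"
  using to_terminal[of "bang V x \<cdot> u"] Cod_Ob[of u] by simp

lemma product_chosen:
  "a \<in> Ob V \<Longrightarrow> b \<in> Ob V \<Longrightarrow> is_product V a b (prd V a b, pr1 V a b, pr2 V a b)"
  using ex_product[of a b] unfolding prd_def pr1_def pr2_def product_def by (auto intro: someI2)

lemma product_simps [simp]: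
  assumes "a \<in> Ob V" "b \<in> Ob V"
  shows "prd V a b \<in> Ob V" "pr1 V a b \<in> Ar V" "pr2 V a b \<in> Ar V"
    "Dom V (pr1 V a b) = prd V a b" "Dom V (pr2 V a b) = prd V a b"
    "Cod V (pr1 V a b) = a" "Cod V (pr2 V a b) = b"
  using is_productD(1-3)[OF product_chosen[OF assms]] by (auto simp: in_hom)

lemma pair:
  assumes "f \<in> Hom V x a" "g \<in> Hom V x b"
  shows "pair V f g \<in> Hom V x (prd V a b)" "pr1 V a b \<cdot> pair V f g = f" "pr2 V a b \<cdot> pair V f g = g"
proof -
  note p = is_productD[OF product_chosen[OF hom_Ob(2)[OF assms(1)] hom_Ob(2)[OF assms(2)]]]
  have "\<exists>!h. h \<in> Hom V (Dom V f) (prd V (Cod V f) (Cod V g)) \<and>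
     pr1 V (Cod V f) (Cod V g) \<cdot> h = f \<and> pr2 V (Cod V f) (Cod V g) \<cdot> h = g"
    using p(4)[OF assms] p(5) assms in_hom by metis
  then have "pair V f g \<in> Hom V (Dom V f) (prd V (Cod V f) (Cod V g)) \<and>
     pr1 V (Cod V f) (Cod V g) \<cdot> pair V f g = f \<and> pr2 V (Cod V f) (Cod V g) \<cdot> pair V f g = g"
    unfolding pair_def by (rule theI')
  then show "pair V f g \<in> Hom V x (prd V a b)" "pr1 V a b \<cdot> pair V f g = f" "pr2 V a b \<cdot> pair V f g = g"
    using assms by (auto simp: in_hom)
qed

lemma pair_simps [simp]:
  assumes "f \<in> Ar V" "g \<in> Ar V" "Dom V f = Dom V g"
  shows "pair V f g \<in> Ar V" "Dom V (pair V f g) = Dom V g" "Cod V (pair V f g) = prd V (Cod V f) (Cod V g)"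
    and "Cod V f = a \<Longrightarrow> Cod V g = b \<Longrightarrow> pr1 V a b \<cdot> pair V f g = f"
    and "Cod V f = a \<Longrightarrow> Cod V g = b \<Longrightarrow> pr2 V a b \<cdot> pair V f g = g"
  using pair[of f "Dom V f" "Cod V f" g "Cod V g"] assms by (auto simp: in_hom)

lemma pair_unique:
  "a \<in> Ob V \<Longrightarrow> b \<in> Ob V \<Longrightarrow> h \<in> Hom V x (prd V a b) \<Longrightarrow> k \<in> Hom V x (prd V a b) \<Longrightarrow>
   pr1 V a b \<cdot> h = pr1 V a b \<cdot> k \<Longrightarrow> pr2 V a b \<cdot> h = pr2 V a b \<cdot> k \<Longrightarrow> h = k"
  using is_productD(5)[OF product_chosen] by blast

lemma pair_comp [simp]:
  assumes "f \<in> Ar V" "g \<in> Ar V" "Dom V f = Dom V g" "u \<in> Ar V" "Cod V u = Dom V g"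
  shows "pair V f g \<cdot> u = pair V (f \<cdot> u) (g \<cdot> u)"
proof (rule pair_unique[of "Cod V f" "Cod V g" _ "Dom V u"])
  have *: "p \<cdot> (pair V f g \<cdot> u) = (p \<cdot> pair V f g) \<cdot> u"
    if "p \<in> Ar V" "Dom V p = prd V (Cod V f) (Cod V g)" for p
    using assms that by simp
  show "pr1 V (Cod V f) (Cod V g) \<cdot> (pair V f g \<cdot> u) = pr1 V (Cod V f) (Cod V g) \<cdot> pair V (f \<cdot> u) (g \<cdot> u)"
    "pr2 V (Cod V f) (Cod V g) \<cdot> (pair V f g \<cdot> u) = pr2 V (Cod V f) (Cod V g) \<cdot> pair V (f \<cdot> u) (g \<cdot> u)"
    using assms by (simp_all add: * del: assoc)
qed (use assms in \<open>simp_all add: in_hom\<close>)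

lemma pair_eta [simp]:
  "a \<in> Ob V \<Longrightarrow> b \<in> Ob V \<Longrightarrow> h \<in> Ar V \<Longrightarrow> Cod V h = prd V a b \<Longrightarrow> pair V (pr1 V a b \<cdot> h) (pr2 V a b \<cdot> h) = h"
  by (rule pair_unique[of a b _ "Dom V h"]) (simp_all add: in_hom)

lemma pair_Id [simp]:
  "a \<in> Ob V \<Longrightarrow> b \<in> Ob V \<Longrightarrow> pair V (pr1 V a b) (pr2 V a b) = Id V (prd V a b)"
  using pair_eta[of a b "Id V (prd V a b)"] by simp

lemma pair_eq_iff:
  assumes "f \<in> Ar V" "g \<in> Ar V" "Dom V f = Dom V g" "f' \<in> Ar V" "g' \<in> Ar V" "Dom V f' = Dom V g'"
    "Cod V f = Cod V f'" "Cod V g = Cod V g'"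
  shows "pair V f g = pair V f' g' \<longleftrightarrow> f = f' \<and> g = g'"
  using pair_simps(4,5)[of f g] pair_simps(4,5)[of f' g'] assms by metis

lemma pullback_chosen:
  "f \<in> Ar V \<Longrightarrow> g \<in> Ar V \<Longrightarrow> Cod V f = Cod V g \<Longrightarrow> is_pullback V f g (pb V f g, pb1 V f g, pb2 V f g)"
  using ex_pullback unfolding has_pullbacks_def pb_def pb1_def pb2_def pullback_def
  by (auto intro: someI2)

lemma pb_simps [simp]:
  assumes "f \<in> Ar V" "g \<in> Ar V" "Cod V f = Cod V g"
  shows "pb V f g \<in> Ob V" "pb1 V f g \<in> Ar V" "pb2 V f g \<in> Ar V"
    "Dom V (pb1 V f g) = pb V f g" "Dom V (pb2 V f g) = pb V f g"
    "Cod V (pb1 V f g) = Dom V f" "Cod V (pb2 V f g) = Dom V g"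
  using is_pullbackD(1-3)[OF pullback_chosen[OF assms]] by (auto simp: in_hom)

lemma pb_square: "f \<in> Ar V \<Longrightarrow> g \<in> Ar V \<Longrightarrow> Cod V f = Cod V g \<Longrightarrow> f \<cdot> pb1 V f g = g \<cdot> pb2 V f g"
  using is_pullbackD(4)[OF pullback_chosen] .

lemma pb_square_at:
  "f \<in> Ar V \<Longrightarrow> g \<in> Ar V \<Longrightarrow> Cod V f = Cod V g \<Longrightarrow> u \<in> Ar V \<Longrightarrow> Cod V u = pb V f g \<Longrightarrow>
   f \<cdot> (pb1 V f g \<cdot> u) = g \<cdot> (pb2 V f g \<cdot> u)"
  using comp_eq_at[OF pb_square, of f g u] by simp

lemma pb_unique:
  "f \<in> Ar V \<Longrightarrow> g \<in> Ar V \<Longrightarrow> Cod V f = Cod V g \<Longrightarrow> u \<in> Hom V x (pb V f g) \<Longrightarrow> v \<in> Hom V x (pb V f g) \<Longrightarrow>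
   pb1 V f g \<cdot> u = pb1 V f g \<cdot> v \<Longrightarrow> pb2 V f g \<cdot> u = pb2 V f g \<cdot> v \<Longrightarrow> u = v"
  using is_pullbackD(6)[OF pullback_chosen] by blast

lemma pb_pair:
  assumes "f \<in> Ar V" "g \<in> Ar V" "Cod V f = Cod V g"
    "h \<in> Ar V" "k \<in> Ar V" "Dom V h = Dom V k" "Cod V h = Dom V f" "Cod V k = Dom V g" "f \<cdot> h = g \<cdot> k"
  shows "pb_pair V f g h k \<in> Hom V (Dom V k) (pb V f g)"
    "pb1 V f g \<cdot> pb_pair V f g h k = h" "pb2 V f g \<cdot> pb_pair V f g h k = k"
proof -
  have "\<exists>!u. u \<in> Hom V (Dom V h) (pb V f g) \<and> pb1 V f g \<cdot> u = h \<and> pb2 V f g \<cdot> u = k"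
    using is_pullbackD(5)[OF pullback_chosen, of f g h "Dom V h" k] pb_unique[of f g] assms
    by (metis in_hom)
  then have "pb_pair V f g h k \<in> Hom V (Dom V h) (pb V f g) \<and>
      pb1 V f g \<cdot> pb_pair V f g h k = h \<and> pb2 V f g \<cdot> pb_pair V f g h k = k"
    unfolding pb_pair_def by (rule theI')
  then show "pb_pair V f g h k \<in> Hom V (Dom V k) (pb V f g)"
    "pb1 V f g \<cdot> pb_pair V f g h k = h" "pb2 V f g \<cdot> pb_pair V f g h k = k"
    using assms by auto
qed

lemma pb_pair_simps [simp]:
  assumes "f \<in> Ar V" "g \<in> Ar V" "Cod V f = Cod V g"
    "h \<in> Ar V" "k \<in> Ar V" "Dom V h = Dom V k" "Cod V h = Dom V f" "Cod V k = Dom V g" "f \<cdot> h = g \<cdot> k"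
  shows "pb_pair V f g h k \<in> Ar V" "Dom V (pb_pair V f g h k) = Dom V k" "Cod V (pb_pair V f g h k) = pb V f g"
    "pb1 V f g \<cdot> pb_pair V f g h k = h" "pb2 V f g \<cdot> pb_pair V f g h k = k"
  using pb_pair[OF assms] by (auto simp: in_hom)

lemma pb_pair_comp:
  assumes "f \<in> Ar V" "g \<in> Ar V" "Cod V f = Cod V g"
    "h \<in> Ar V" "k \<in> Ar V" "Dom V h = Dom V k" "Cod V h = Dom V f" "Cod V k = Dom V g" "f \<cdot> h = g \<cdot> k"
    "u \<in> Ar V" "Cod V u = Dom V k"
  shows "pb_pair V f g h k \<cdot> u = pb_pair V f g (h \<cdot> u) (k \<cdot> u)"
proof -
  have e: "f \<cdot> (h \<cdot> u) = g \<cdot> (k \<cdot> u)"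
    using comp_eq_at[OF assms(9), of u] assms by simp
  show ?thesis
    by (rule pb_unique[of f g _ "Dom V u"])
      (use assms e in \<open>simp_all add: in_hom comp_eq_at[OF pb_pair_simps(4)] comp_eq_at[OF pb_pair_simps(5)]\<close>)
qed

lemma pb_pair_eta:
  assumes "f \<in> Ar V" "g \<in> Ar V" "Cod V f = Cod V g" "u \<in> Ar V" "Cod V u = pb V f g"
  shows "pb_pair V f g (pb1 V f g \<cdot> u) (pb2 V f g \<cdot> u) = u"
  by (rule pb_unique[of f g _ "Dom V u"]) (use assms pb_square_at[OF assms] in \<open>simp_all add: in_hom\<close>)

end

section \<open>Consequences of extensivity\<close>

subsection \<open>Equivalences are full\<close>

lemma is_equivalenceE:
  assumes "is_equivalence K L Fo Fa"
  obtains Go Ga \<eta> \<epsilon> where "is_functor K L Fo Fa" "is_functor L K Go Ga"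
    "\<And>a. a \<in> Ob K \<Longrightarrow> \<eta> a \<in> Hom K a (Go (Fo a)) \<and> is_iso K (\<eta> a)"
    "\<And>f a b. f \<in> Hom K a b \<Longrightarrow> \<eta> b \<cdot>\<^bsub>K\<^esub> f = Ga (Fa f) \<cdot>\<^bsub>K\<^esub> \<eta> a"
    "\<And>a. a \<in> Ob L \<Longrightarrow> \<epsilon> a \<in> Hom L (Fo (Go a)) a \<and> is_iso L (\<epsilon> a)"
    "\<And>f a b. f \<in> Hom L a b \<Longrightarrow> \<epsilon> b \<cdot>\<^bsub>L\<^esub> Fa (Ga f) = f \<cdot>\<^bsub>L\<^esub> \<epsilon> a"
proof -
  obtain Go Ga \<eta> \<epsilon> where *: "is_functor K L Fo Fa" "is_functor L K Go Ga"
    "is_nat_iso K K id id (Go \<circ> Fo) (Ga \<circ> Fa) \<eta>" "is_nat_iso L L (Fo \<circ> Go) (Fa \<circ> Ga) id id \<epsilon>"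
    using assms unfolding is_equivalence_def by blast
  show ?thesis
    by (rule that[OF *(1,2), of \<eta> \<epsilon>]) (use *(3,4) in \<open>auto simp: is_nat_iso_def Hom_def\<close>)
qed

lemma is_functor_hom:
  "is_functor K L Fo Fa \<Longrightarrow> f \<in> Hom K a b \<Longrightarrow> Fa f \<in> Hom L (Fo a) (Fo b)"
  by (auto simp: is_functor_def Hom_def)

lemma (in cat) is_iso_cancel_right:
  assumes "is_iso V f" "f \<in> Hom V a b" "u \<in> Hom V b y" "u' \<in> Hom V b y" "u \<cdot> f = u' \<cdot> f"
  shows "u = u'"
proof -
  note i = inv_arr[OF assms(1,2)]
  have *: "w = (w \<cdot> f) \<cdot> inv_arr V f" if "w \<in> Hom V b y" for w
    using that i assms(2) by (simp add: in_hom)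
  show ?thesis using *[OF assms(3)] *[OF assms(4)] assms(5) by metis
qed

text \<open>Naturality of the unit leaves only one candidate \<open>h\<close> for a preimage of \<open>g\<close>, and shows that \<open>h\<close> and
  \<open>g\<close> have the same image under the inverse functor; the counit makes that functor faithful.\<close>

lemma equivalence_full:
  assumes K: "is_category K" and L: "is_category L" and E: "is_equivalence K L Fo Fa"
    and ab: "a \<in> Ob K" "b \<in> Ob K" and g: "g \<in> Hom L (Fo a) (Fo b)"
  shows "\<exists>h. h \<in> Hom K a b \<and> Fa h = g"
proof -
  interpret K: cat K using K by unfold_locales
  interpret L: cat L using L by unfold_locales
  from E obtain Go Ga \<eta> \<epsilon> where F: "is_functor K L Fo Fa" and G: "is_functor L K Go Ga"
    and \<eta>: "\<And>a. a \<in> Ob K \<Longrightarrow> \<eta> a \<in> Hom K a (Go (Fo a)) \<and> is_iso K (\<eta> a)"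
    and \<eta>n: "\<And>f a b. f \<in> Hom K a b \<Longrightarrow> \<eta> b \<cdot>\<^bsub>K\<^esub> f = Ga (Fa f) \<cdot>\<^bsub>K\<^esub> \<eta> a"
    and \<epsilon>: "\<And>a. a \<in> Ob L \<Longrightarrow> \<epsilon> a \<in> Hom L (Fo (Go a)) a \<and> is_iso L (\<epsilon> a)"
    and \<epsilon>n: "\<And>f a b. f \<in> Hom L a b \<Longrightarrow> \<epsilon> b \<cdot>\<^bsub>L\<^esub> Fa (Ga f) = f \<cdot>\<^bsub>L\<^esub> \<epsilon> a"
    by (rule is_equivalenceE) blast
  define h where "h = inv_arr K (\<eta> b) \<cdot>\<^bsub>K\<^esub> (Ga g \<cdot>\<^bsub>K\<^esub> \<eta> a)"
  have Gg: "Ga g \<in> Hom K (Go (Fo a)) (Go (Fo b))"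
    using is_functor_hom[OF G g] .
  note i = K.inv_arr[of "\<eta> b" b "Go (Fo b)"]
  have m: "Ga g \<cdot>\<^bsub>K\<^esub> \<eta> a \<in> Hom K a (Go (Fo b))" using Gg \<eta> ab K.comp_hom by blast
  have h: "h \<in> Hom K a b" unfolding h_def using m i \<eta> ab K.comp_hom by blast
  have "\<eta> b \<cdot>\<^bsub>K\<^esub> h = Ga g \<cdot>\<^bsub>K\<^esub> \<eta> a"
    unfolding h_def using K.comp_eq_at[OF i(3), of "Ga g \<cdot>\<^bsub>K\<^esub> \<eta> a"] m i(1) \<eta>[OF ab(2)]
    by (simp add: K.in_hom)
  then have *: "Ga (Fa h) \<cdot>\<^bsub>K\<^esub> \<eta> a = Ga g \<cdot>\<^bsub>K\<^esub> \<eta> a" using \<eta>n[OF h] by simp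
  have Fh: "Fa h \<in> Hom L (Fo a) (Fo b)" using is_functor_hom[OF F h] .
  have "Ga (Fa h) = Ga g"
    using K.is_iso_cancel_right[OF _ _ is_functor_hom[OF G Fh] Gg *] \<eta>[OF ab(1)] by blast
  then have **: "Fa h \<cdot>\<^bsub>L\<^esub> \<epsilon> (Fo a) = g \<cdot>\<^bsub>L\<^esub> \<epsilon> (Fo a)" using \<epsilon>n[OF Fh] \<epsilon>n[OF g] by simp
  have "Fo a \<in> Ob L" using g L.hom_Ob by blast
  then have "Fa h = g" using L.is_iso_cancel_right[OF _ _ Fh g **] \<epsilon> by blast
  with h show ?thesis by blast
qed

subsection \<open>Slice and product categories\<close>

lemma slice_cat_simps [simp]:
  "Ob (slice_cat K x) = {f \<in> Ar K. Cod K f = x}"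
  "(f, h, g) \<in> Ar (slice_cat K x) \<longleftrightarrow> f \<in> Ar K \<and> g \<in> Ar K \<and> Cod K f = x \<and> Cod K g = x \<and>
     h \<in> Hom K (Dom K f) (Dom K g) \<and> g \<cdot>\<^bsub>K\<^esub> h = f"
  "Dom (slice_cat K x) (f, h, g) = f" "Cod (slice_cat K x) (f, h, g) = g"
  "Id (slice_cat K x) f = (f, Id K (Dom K f), f)"
  "(f', h', g') \<cdot>\<^bsub>slice_cat K x\<^esub> (f, h, g) = (f, h' \<cdot>\<^bsub>K\<^esub> h, g')"
  by (auto simp: slice_cat_def)

lemma is_categoryI:
  assumes "\<And>f. f \<in> Ar K \<Longrightarrow> Dom K f \<in> Ob K \<and> Cod K f \<in> Ob K"
    "\<And>a. a \<in> Ob K \<Longrightarrow> Id K a \<in> Hom K a a"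
    "\<And>f g. f \<in> Ar K \<Longrightarrow> g \<in> Ar K \<Longrightarrow> Cod K f = Dom K g \<Longrightarrow> g \<cdot>\<^bsub>K\<^esub> f \<in> Hom K (Dom K f) (Cod K g)"
    "\<And>f. f \<in> Ar K \<Longrightarrow> f \<cdot>\<^bsub>K\<^esub> Id K (Dom K f) = f"
    "\<And>f. f \<in> Ar K \<Longrightarrow> Id K (Cod K f) \<cdot>\<^bsub>K\<^esub> f = f"
    "\<And>f g h. f \<in> Ar K \<Longrightarrow> g \<in> Ar K \<Longrightarrow> h \<in> Ar K \<Longrightarrow> Cod K f = Dom K g \<Longrightarrow> Cod K g = Dom K h \<Longrightarrow>
      h \<cdot>\<^bsub>K\<^esub> (g \<cdot>\<^bsub>K\<^esub> f) = (h \<cdot>\<^bsub>K\<^esub> g) \<cdot>\<^bsub>K\<^esub> f"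
  shows "is_category K"
  using assms by (simp add: is_category_def)

lemma (in cat) slice_cat_is_category: "is_category (slice_cat V x)"
proof (rule is_categoryI)
  fix f g assume "f \<in> Ar (slice_cat V x)" "g \<in> Ar (slice_cat V x)"
    "Cod (slice_cat V x) f = Dom (slice_cat V x) g"
  then show "g \<cdot>\<^bsub>slice_cat V x\<^esub> f \<in> Hom (slice_cat V x) (Dom (slice_cat V x) f) (Cod (slice_cat V x) g)"
    by (cases f; cases g) (auto simp: Hom_def comp_eq_at)
next
  fix f g h assume "f \<in> Ar (slice_cat V x)" "g \<in> Ar (slice_cat V x)" "h \<in> Ar (slice_cat V x)"
    "Cod (slice_cat V x) f = Dom (slice_cat V x) g" "Cod (slice_cat V x) g = Dom (slice_cat V x) h"
  then show "h \<cdot>\<^bsub>slice_cat V x\<^esub> (g \<cdot>\<^bsub>slice_cat V x\<^esub> f) = (h \<cdot>\<^bsub>slice_cat V x\<^esub> g) \<cdot>\<^bsub>slice_cat V x\<^esub> f"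
    by (cases f; cases g; cases h) (auto simp: Hom_def)
next
  fix f assume "f \<in> Ar (slice_cat V x)"
  then show "Dom (slice_cat V x) f \<in> Ob (slice_cat V x) \<and> Cod (slice_cat V x) f \<in> Ob (slice_cat V x)"
    "f \<cdot>\<^bsub>slice_cat V x\<^esub> Id (slice_cat V x) (Dom (slice_cat V x) f) = f"
    "Id (slice_cat V x) (Cod (slice_cat V x) f) \<cdot>\<^bsub>slice_cat V x\<^esub> f = f"
    by (cases f; auto simp: Hom_def)+
qed (auto simp: Hom_def)

lemma Prod_cat_is_category:
  assumes "\<And>i. i \<in> I \<Longrightarrow> is_category (K i)"
  shows "is_category (Prod_cat I K)"
proof -
  have c: "cat (K i)" if "i \<in> I" for i using assms[OF that] by unfold_locales
  note Ks = cat.Dom_Ob[OF c] cat.Cod_Ob[OF c] cat.Id_Ar[OF c] cat.Dom_Id[OF c] cat.Cod_Id[OF c]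
    cat.comp_Ar[OF c] cat.Dom_comp[OF c] cat.Cod_comp[OF c] cat.comp_Id[OF c] cat.Id_comp[OF c]
    cat.assoc[OF c]
  have e: "(\<lambda>i\<in>I. f i) = (\<lambda>i\<in>I. g i) \<longleftrightarrow> (\<forall>i\<in>I. f i = g i)" for f g :: "'a \<Rightarrow> 'b"
    by (auto simp: restrict_def fun_eq_iff)
  show ?thesis
    by (rule is_categoryI) (auto simp: Ks PiE_iff Prod_cat_def Hom_def e intro!: extensionalityI[of _ I])
qed

subsection \<open>Universal and disjoint coproducts\<close>

text \<open>The inverse of the inclusion is the identity on the \<open>i\<close>-th summand; on the initial ones there is
  nothing to choose and nothing to check.\<close>

lemma (in cat) coproduct_concentrated:
  assumes c: "is_coproduct V I Y (s, \<iota>)" and i: "i \<in> I"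
    and Y: "\<And>j. j \<in> I \<Longrightarrow> j \<noteq> i \<Longrightarrow> is_initial V (Y j)"
  shows "is_iso V (\<iota> i)"
proof -
  have ii: "\<iota> i \<in> Hom V (Y i) s" using is_coproductD(2)[OF c i] .
  have UO: "Y i \<in> Ob V" using ii hom_Ob by blast
  define k where "k = (\<lambda>j. if j = i then Id V (Y i) else (SOME f. f \<in> Hom V (Y j) (Y i)))"
  have k: "k j \<in> Hom V (Y j) (Y i)" if "j \<in> I" for j
    using someI_ex[OF is_initial_ex[OF Y[OF that] UO]] UO by (auto simp: k_def in_hom)
  obtain r where r: "r \<in> Hom V s (Y i)" "\<forall>j\<in>I. r \<cdot> \<iota> j = k j"
    using is_coproductD(3)[OF c UO, of k] k by blast
  have ri: "r \<cdot> \<iota> i = Id V (Y i)" using r i by (simp add: k_def)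
  have "\<iota> i \<cdot> r = Id V s"
  proof (rule is_coproductD(4)[OF c, of _ s])
    show "\<iota> i \<cdot> r \<in> Hom V s s" using r ii comp_hom by blast
    show "Id V s \<in> Hom V s s" using is_coproductD(1)[OF c] by (simp add: in_hom)
    fix j assume j: "j \<in> I"
    have ij: "\<iota> j \<in> Hom V (Y j) s" using is_coproductD(2)[OF c j] .
    show "(\<iota> i \<cdot> r) \<cdot> \<iota> j = Id V s \<cdot> \<iota> j"
    proof (cases "j = i")
      case True
      then show ?thesis using r ii ri by (simp add: in_hom)
    next
      case False
      have "(\<iota> i \<cdot> r) \<cdot> \<iota> j \<in> Hom V (Y j) s" "Id V s \<cdot> \<iota> j \<in> Hom V (Y j) s"
        using r(1) ii ij is_coproductD(1)[OF c] by (auto simp: in_hom)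
      then show ?thesis using is_initial_unique[OF Y[OF j False]] by blast
    qed
  qed
  then show ?thesis using is_isoI ii r ri by blast
qed


lemma inj_pairs:
  assumes "infinite (UNIV :: 'i set)"
  shows "\<exists>e :: 'i \<times> 'i \<Rightarrow> 'i. inj e"
  using card_of_Times_same_infinite[OF assms] unfolding card_of_ordIso[symmetric]
  by (auto simp: bij_betw_def)

lemma inj_triples:
  assumes "infinite (UNIV :: 'i set)"
  shows "\<exists>e :: 'i \<times> 'i \<times> 'i \<Rightarrow> 'i. inj e"
proof -
  obtain e :: "'i \<times> 'i \<Rightarrow> 'i" where e: "inj e" using inj_pairs[OF assms] by blast
  have "inj (\<lambda>(a, b, c). e (a, e (b, c)))"
    using injD[OF e] by (intro injI) (auto dest!: injD[OF e])
  then show ?thesis by blast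
qed

lemma inj_of_finite:
  assumes "infinite (UNIV :: 'i set)" "finite (UNIV :: 'a set)"
  shows "\<exists>e :: 'a \<Rightarrow> 'i. inj e"
proof -
  obtain B :: "'i set" where "finite B" "card B = card (UNIV :: 'a set)"
    using infinite_arbitrarily_large[OF assms(1)] by blast
  then have "\<exists>e. inj_on e (UNIV :: 'a set) \<and> e ` UNIV \<subseteq> B"
    using assms(2) by (metis card_le_inj order_refl)
  then show ?thesis by blast
qed

context cat
begin

text \<open>Extensivity in terms of generalised elements. Along a coproduct diagram \<open>(s, \<iota>)\<close>, every
  element \<open>u\<close> of \<open>s\<close> at a stage \<open>U\<close> lies, locally on \<open>U\<close>, in one of the summands; and an element
  of two summands only exists at an initial stage, unless the summands and the elements coincide.
  The second clause says that the inclusions are monic and disjoint.\<close>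

definition extensive_at :: "'k set \<Rightarrow> bool" where
  "extensive_at I \<longleftrightarrow>
    (\<forall>X. (\<forall>i\<in>I. X i \<in> Ob V) \<longrightarrow> (\<exists>d. is_coproduct V I X d)) \<and>
    (\<forall>X s \<iota>. is_coproduct V I X (s, \<iota>) \<longrightarrow>
      (\<forall>U. \<forall>u\<in>Hom V U s. \<exists>Y j v. is_coproduct V I Y (U, j) \<and>
         (\<forall>i\<in>I. v i \<in> Hom V (Y i) (X i) \<and> u \<cdot> j i = \<iota> i \<cdot> v i)) \<and>
      (\<forall>i\<in>I. \<forall>k\<in>I. \<forall>U. \<forall>u\<in>Hom V U (X i). \<forall>v\<in>Hom V U (X k). \<iota> i \<cdot> u = \<iota> k \<cdot> v \<longrightarrow>
         (if i = k then u = v else is_initial V U)))"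

lemma extensive_at_reindex:
  assumes E: "extensive_at (e ` I)" and e: "inj_on e I"
  shows "extensive_at I"
proof -
  define d where "d = inv_into I e"
  have d: "d (e i) = i" if "i \<in> I" for i using that e by (simp add: d_def)
  have re: "is_coproduct V I X (s, \<iota>) \<longleftrightarrow> is_coproduct V (e ` I) (X \<circ> d) (s, \<iota> \<circ> d)" for X s \<iota>
    unfolding is_coproduct_reindex[OF e] by (rule is_coproduct_cong) (auto simp: d)
  show ?thesis
    unfolding extensive_at_def
  proof (intro conjI allI impI ballI)
    fix X assume X: "\<forall>i\<in>I. X i \<in> Ob V"
    then have "\<forall>i\<in>e ` I. (X \<circ> d) i \<in> Ob V" by (auto simp: d)
    then obtain s \<iota> where "is_coproduct V (e ` I) (X \<circ> d) (s, \<iota>)"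
      using E unfolding extensive_at_def by (metis surj_pair)
    then have "is_coproduct V I (X \<circ> d \<circ> e) (s, \<iota> \<circ> e)"
      unfolding is_coproduct_reindex[OF e] .
    then have "is_coproduct V I X (s, \<iota> \<circ> e)"
      by (subst is_coproduct_cong) (auto simp: d)
    then show "\<exists>d. is_coproduct V I X d" by blast
  next
    fix X s \<iota> U u assume c: "is_coproduct V I X (s, \<iota>)" and u: "u \<in> Hom V U s"
    obtain Y j v where Y: "is_coproduct V (e ` I) Y (U, j)"
      "\<forall>i\<in>e ` I. v i \<in> Hom V (Y i) ((X \<circ> d) i) \<and> u \<cdot> j i = (\<iota> \<circ> d) i \<cdot> v i"
      using E c[unfolded re] u unfolding extensive_at_def by metis
    have "is_coproduct V I (Y \<circ> e) (U, j \<circ> e)" using Y(1) is_coproduct_reindex[OF e] by blast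
    moreover have "\<forall>i\<in>I. (v \<circ> e) i \<in> Hom V ((Y \<circ> e) i) (X i) \<and> u \<cdot> (j \<circ> e) i = \<iota> i \<cdot> (v \<circ> e) i"
      using Y(2) by (auto simp: d)
    ultimately show "\<exists>Y j v. is_coproduct V I Y (U, j) \<and>
         (\<forall>i\<in>I. v i \<in> Hom V (Y i) (X i) \<and> u \<cdot> j i = \<iota> i \<cdot> v i)" by blast
  next
    fix X s \<iota> i k U u v
    assume c: "is_coproduct V I X (s, \<iota>)" and ik: "i \<in> I" "k \<in> I"
      and uv: "u \<in> Hom V U (X i)" "v \<in> Hom V U (X k)" "\<iota> i \<cdot> u = \<iota> k \<cdot> v"
    have E': "\<forall>i\<in>e ` I. \<forall>k\<in>e ` I. \<forall>U. \<forall>u\<in>Hom V U ((X \<circ> d) i). \<forall>v\<in>Hom V U ((X \<circ> d) k).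
        (\<iota> \<circ> d) i \<cdot> u = (\<iota> \<circ> d) k \<cdot> v \<longrightarrow> (if i = k then u = v else is_initial V U)"
      using E c[unfolded re] unfolding extensive_at_def by blast
    have "if e i = e k then u = v else is_initial V U"
      by (rule E'[rule_format]) (use ik uv in \<open>auto simp: d\<close>)
    then show "if i = k then u = v else is_initial V U"
      using inj_on_eq_iff[OF e ik] by simp
  qed
qed

end

locale extensive_cat = lex V for V :: "('o, 'm) category" (structure) +
  fixes universe :: "'i itself"
  assumes infinite_universe: "infinite (UNIV :: 'i set)"
    and extensive: "extensive TYPE('i) V"
begin

lemma coproduct_chosen:
  fixes I :: "'i set"
  shows "\<forall>i\<in>I. X i \<in> Ob V \<Longrightarrow> is_coproduct V I X (coprd V I X, coprd_in V I X)"
  using extensive is_coproduct_chosen unfolding extensive_def by blast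

lemma slice_equivalence:
  fixes I :: "'i set"
  shows "\<forall>i\<in>I. X i \<in> Ob V \<Longrightarrow>
   is_equivalence (Prod_cat I (\<lambda>i. slice_cat V (X i))) (slice_cat V (coprd V I X))
          (coprd_slice_ob V I X) (coprd_slice_ar V I X)"
  using extensive unfolding extensive_def by blast

lemma Prod_slice_is_category: "is_category (Prod_cat I (\<lambda>i. slice_cat V (X i)))"
  by (rule Prod_cat_is_category) (rule slice_cat_is_category)

lemma coprd_slice_ob:
  fixes I :: "'i set"
  assumes "\<forall>i\<in>I. f i \<in> Hom V (Y i) (X i)"
  shows "coprd_slice_ob V I X f \<in> Hom V (coprd V I (\<lambda>i. Dom V (f i))) (coprd V I X)"
    "i \<in> I \<Longrightarrow> coprd_slice_ob V I X f \<cdot> coprd_in V I (\<lambda>i. Dom V (f i)) i = coprd_in V I X i \<cdot> f i"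
    "is_coproduct V I Y (coprd V I (\<lambda>i. Dom V (f i)), coprd_in V I (\<lambda>i. Dom V (f i)))"
proof -
  have X: "\<forall>i\<in>I. X i \<in> Ob V" using assms hom_Ob by blast
  note cX = is_coproductD[OF coproduct_chosen[OF X]]
  have Y: "Dom V (f i) = Y i" "Y i \<in> Ob V" if "i \<in> I" for i
    using that assms hom_Ob(1)[of "f i"] by (auto simp: in_hom)
  have c: "is_coproduct V I (\<lambda>i. Dom V (f i)) (coprd V I (\<lambda>i. Dom V (f i)), coprd_in V I (\<lambda>i. Dom V (f i)))"
    by (rule coproduct_chosen) (simp add: Y)
  have t: "coprd_in V I X i \<cdot> f i \<in> Hom V (Dom V (f i)) (coprd V I X)" if "i \<in> I" for i
    using cX(2)[OF that] assms that by (auto simp: in_hom)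
  show "coprd_slice_ob V I X f \<in> Hom V (coprd V I (\<lambda>i. Dom V (f i))) (coprd V I X)"
    "i \<in> I \<Longrightarrow> coprd_slice_ob V I X f \<cdot> coprd_in V I (\<lambda>i. Dom V (f i)) i = coprd_in V I X i \<cdot> f i"
    unfolding coprd_slice_ob_def using cotuple[OF c cX(1), where f = "\<lambda>i. coprd_in V I X i \<cdot> f i"] t by auto
  show "is_coproduct V I Y (coprd V I (\<lambda>i. Dom V (f i)), coprd_in V I (\<lambda>i. Dom V (f i)))"
    using c by (subst is_coproduct_cong[of _ _ "\<lambda>i. Dom V (f i)"]) (auto simp: Y)
qed

text \<open>Essential surjectivity: an object of the slice over a coproduct is a coproduct.\<close>

lemma decompose:
  fixes I :: "'i set"
  assumes X: "\<forall>i\<in>I. X i \<in> Ob V" and u: "u \<in> Hom V U (coprd V I X)"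
  obtains Y j v where "is_coproduct V I Y (U, j)"
    "\<And>i. i \<in> I \<Longrightarrow> v i \<in> Hom V (Y i) (X i)" "\<And>i. i \<in> I \<Longrightarrow> u \<cdot> j i = coprd_in V I X i \<cdot> v i"
proof -
  let ?S = "coprd V I X" and ?K = "Prod_cat I (\<lambda>i. slice_cat V (X i))"
  obtain Go Ga \<epsilon> where G: "is_functor (slice_cat V ?S) ?K Go Ga"
    and \<epsilon>: "\<And>a. a \<in> Ob (slice_cat V ?S) \<Longrightarrow>
      \<epsilon> a \<in> Hom (slice_cat V ?S) (coprd_slice_ob V I X (Go a)) a \<and> is_iso (slice_cat V ?S) (\<epsilon> a)"
    by (rule is_equivalenceE[OF slice_equivalence[OF X]]) blast+
  have uO: "u \<in> Ob (slice_cat V ?S)" using u by (simp add: in_hom)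
  define f where "f = Go u"
  have "f \<in> Ob ?K" using G uO by (simp add: is_functor_def f_def)
  then have f: "\<forall>i\<in>I. f i \<in> Hom V (Dom V (f i)) (X i)"
    by (auto simp: Prod_cat_def PiE_iff in_hom)
  note c = coprd_slice_ob[OF f]
  obtain e where e: "\<epsilon> u = (coprd_slice_ob V I X f, e, u)"
    using \<epsilon>[OF uO] by (cases "\<epsilon> u") (auto simp: Hom_def f_def)
  have eh: "e \<in> Hom V (coprd V I (\<lambda>i. Dom V (f i))) U" "u \<cdot> e = coprd_slice_ob V I X f"
    using \<epsilon>[OF uO] e c(1) u unfolding in_hom by (auto simp: Hom_def)
  obtain g where "is_inverse (slice_cat V ?S) (\<epsilon> u) g" using \<epsilon>[OF uO] by (auto simp: is_iso_def)
  then have "is_inverse V e (fst (snd g))"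
    using e eh u c(1) by (cases g) (auto simp: is_inverse_def Hom_def)
  then have ei: "is_iso V e" by (auto simp: is_iso_def)
  show ?thesis
  proof (rule that[OF is_coproduct_transport[OF c(3) eh(1) ei]])
    show "f i \<in> Hom V (Dom V (f i)) (X i)" if "i \<in> I" for i using f that by blast
    fix i assume i: "i \<in> I"
    have "coprd_in V I (\<lambda>i. Dom V (f i)) i \<in> Hom V (Dom V (f i)) (coprd V I (\<lambda>i. Dom V (f i)))"
      using is_coproductD(2)[OF c(3) i] .
    then show "u \<cdot> (e \<cdot> coprd_in V I (\<lambda>i. Dom V (f i)) i) = coprd_in V I X i \<cdot> f i"
      using comp_eq_at[OF eh(2)] eh(1) u c(2)[OF i] by (simp add: in_hom)
  qed
qed

lemma initial: "is_initial V (initial V)"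
proof -
  have "is_initial V (coprd V ({} :: 'i set) undefined)"
    using is_coproduct_initial[OF coproduct_chosen[of "{} :: 'i set"]] by simp
  then show ?thesis unfolding initial_def by (rule someI)
qed

lemma initial_Ob [simp]: "initial V \<in> Ob V"
  using initial by (simp add: is_initial_def)

text \<open>Decomposition along the empty coproduct shows that initial objects are strict.\<close>

lemma strict_initial:
  assumes "is_initial V z" "f \<in> Hom V U z"
  shows "is_initial V U"
proof -
  let ?z = "coprd V ({} :: 'i set) (\<lambda>_. U)"
  have "?z \<in> Ob V" using is_coproductD(1)[OF coproduct_chosen[of "{} :: 'i set"]] by simp
  then obtain g where g: "g \<in> Hom V z ?z" using is_initial_ex assms by blast
  obtain Y j where "is_coproduct V ({} :: 'i set) Y (U, j)"
    by (rule decompose[of "{} :: 'i set" "\<lambda>_. U" "g \<cdot> f" U]) (use g assms comp_hom in auto)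
  then show ?thesis by (rule is_coproduct_initial)
qed

text \<open>The object of \<open>\<Prod>\<^sub>i V\<^bsub>/X i\<^esub>\<close> that is \<open>u\<close> in degree \<open>i\<close> and initial in all other degrees. Its
  coproduct is \<open>\<iota>\<^sub>i \<cdot> u\<close>, so fullness on such objects tells what the elements of \<open>\<Squnion>X\<close> that factor
  through a summand have in common.\<close>

definition concentrated :: "'i set \<Rightarrow> ('i \<Rightarrow> 'o) \<Rightarrow> 'i \<Rightarrow> 'm \<Rightarrow> 'i \<Rightarrow> 'm" where
  "concentrated I X i u = (\<lambda>j\<in>I. if j = i then u else (SOME f. f \<in> Hom V (initial V) (X j)))"

lemma concentrated:
  fixes I :: "'i set" and X and u
  assumes X: "\<forall>i\<in>I. X i \<in> Ob V" and i: "i \<in> I" and u: "u \<in> Hom V U (X i)"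
  defines "P \<equiv> concentrated I X i u"
  shows "P \<in> Ob (Prod_cat I (\<lambda>i. slice_cat V (X i)))" "P i = u"
    "\<And>j. j \<in> I \<Longrightarrow> j \<noteq> i \<Longrightarrow> P j \<in> Hom V (initial V) (X j)"
    "\<And>j. j \<in> I \<Longrightarrow> P j \<in> Hom V (if j = i then U else initial V) (X j)"
    "coprd_in V I (\<lambda>j. Dom V (P j)) i \<in> Hom V U (coprd V I (\<lambda>j. Dom V (P j)))"
    "is_iso V (coprd_in V I (\<lambda>j. Dom V (P j)) i)"
    "coprd_slice_ob V I X P \<in> Hom V (coprd V I (\<lambda>j. Dom V (P j))) (coprd V I X)"
    "coprd_slice_ob V I X P \<cdot> coprd_in V I (\<lambda>j. Dom V (P j)) i = coprd_in V I X i \<cdot> u"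
proof -
  show Pi: "P i = u" using i by (simp add: P_def concentrated_def)
  show Pj: "P j \<in> Hom V (initial V) (X j)" if "j \<in> I" "j \<noteq> i" for j
    using that someI_ex[OF is_initial_ex[OF initial X[rule_format, OF that(1)]]] by (simp add: P_def concentrated_def)
  show Ph: "P j \<in> Hom V (if j = i then U else initial V) (X j)" if "j \<in> I" for j
    using Pi Pj[OF that] u by auto
  have "P \<in> extensional I" by (simp add: P_def concentrated_def)
  then show "P \<in> Ob (Prod_cat I (\<lambda>i. slice_cat V (X i)))"
    using Ph by (auto simp: Prod_cat_def PiE_iff in_hom)
  define Y where "Y = (\<lambda>j. if j = i then U else initial V)"
  have "\<forall>j\<in>I. P j \<in> Hom V (Y j) (X j)" using Ph by (simp add: Y_def)
  note c = coprd_slice_ob[OF this]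
  let ?S = "coprd V I (\<lambda>j. Dom V (P j))" and ?in = "coprd_in V I (\<lambda>j. Dom V (P j))"
  show ii: "?in i \<in> Hom V U ?S"
    using is_coproductD(2)[OF c(3) i] by (simp add: Y_def)
  show "coprd_slice_ob V I X P \<in> Hom V ?S (coprd V I X)" by (rule c(1))
  show "coprd_slice_ob V I X P \<cdot> ?in i = coprd_in V I X i \<cdot> u" using c(2)[OF i] Pi by simp
  show "is_iso V (?in i)"
    by (rule coproduct_concentrated[OF c(3) i]) (use initial in \<open>simp add: Y_def\<close>)
qed

text \<open>Fullness on concentrated objects: if \<open>\<iota>\<^sub>i \<cdot> u = \<iota>\<^sub>k \<cdot> v\<close>, the two concentrated objects at \<open>u\<close> and
  \<open>v\<close> have isomorphic images, hence there is an arrow between them, whose \<open>i\<close>-th component ends in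
  the initial object if \<open>i \<noteq> k\<close>.\<close>

lemma disjoint:
  fixes I :: "'i set"
  assumes X: "\<forall>i\<in>I. X i \<in> Ob V" and ik: "i \<in> I" "k \<in> I" "i \<noteq> k"
    and uv: "u \<in> Hom V U (X i)" "v \<in> Hom V U (X k)" "coprd_in V I X i \<cdot> u = coprd_in V I X k \<cdot> v"
  shows "is_initial V U"
proof -
  define P where "P = concentrated I X i u"
  define Q where "Q = concentrated I X k v"
  let ?K = "Prod_cat I (\<lambda>i. slice_cat V (X i))" and ?L = "slice_cat V (coprd V I X)"
  note p = concentrated[where i = i and u = u, OF X ik(1) uv(1), folded P_def]
  note q = concentrated[where i = k and u = v, OF X ik(2) uv(2), folded Q_def]
  let ?a = "coprd_in V I (\<lambda>j. Dom V (P j)) i" and ?b = "coprd_in V I (\<lambda>j. Dom V (Q j)) k"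
  note ai = inv_arr[OF p(6,5)]
  let ?g = "(coprd_slice_ob V I X P, ?b \<cdot> inv_arr V ?a, coprd_slice_ob V I X Q)"
  have "coprd_slice_ob V I X Q \<cdot> (?b \<cdot> inv_arr V ?a) = (coprd_in V I X k \<cdot> v) \<cdot> inv_arr V ?a"
    using comp_eq_at[OF q(8), of "inv_arr V ?a"] ai q(5,7) by (simp add: in_hom)
  also have "\<dots> = coprd_slice_ob V I X P \<cdot> (?a \<cdot> inv_arr V ?a)"
    using comp_eq_at[OF p(8), of "inv_arr V ?a"] ai p(5,7) uv(3) by (simp add: in_hom)
  also have "\<dots> = coprd_slice_ob V I X P" using ai(3) p(7) by (simp add: in_hom)
  finally have g: "?g \<in> Hom ?L (coprd_slice_ob V I X P) (coprd_slice_ob V I X Q)"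
    using p(5,7) q(5,7) ai(1) by (simp add: Hom_def)
  then obtain h where h: "h \<in> Hom ?K P Q"
    using equivalence_full[where Fo = "coprd_slice_ob V I X" and a = P and b = Q,
      OF Prod_slice_is_category slice_cat_is_category slice_equivalence[OF X] p(1) q(1) g]
    by blast
  obtain a w b where hi: "h i = (a, w, b)" by (cases "h i")
  have "h i \<in> Ar (slice_cat V (X i))" "Dom (slice_cat V (X i)) (h i) = P i" "Cod (slice_cat V (X i)) (h i) = Q i"
    using h ik(1) by (auto simp: Hom_def Prod_cat_def PiE_iff dest: fun_cong[of _ _ i])
  then have "w \<in> Hom V U (initial V)"
    using p(2) q(3)[OF ik(1)] ik(3) uv(1) hi by (auto simp: in_hom)
  then show ?thesis using strict_initial[OF initial] by blast
qed

text \<open>If \<open>\<iota>\<^sub>i \<cdot> u = \<iota>\<^sub>i \<cdot> v\<close>, the two concentrated objects have equal images. By fullness the identity of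
  that image comes from an arrow \<open>w\<close> with \<open>v \<cdot> w\<^sub>i = u\<close>, and \<open>w\<^sub>i\<close> is the identity because it is one
  after the invertible inclusion of the only summand that is not initial.\<close>

lemma coprd_in_mono:
  fixes I :: "'i set"
  assumes X: "\<forall>i\<in>I. X i \<in> Ob V" and i: "i \<in> I"
    and uv: "u \<in> Hom V U (X i)" "v \<in> Hom V U (X i)" "coprd_in V I X i \<cdot> u = coprd_in V I X i \<cdot> v"
  shows "u = v"
proof -
  define P where "P = concentrated I X i u"
  define Q where "Q = concentrated I X i v"
  let ?K = "Prod_cat I (\<lambda>i. slice_cat V (X i))" and ?L = "slice_cat V (coprd V I X)"
  note p = concentrated[where i = i and u = u, OF X i uv(1), folded P_def]
  note q = concentrated[where i = i and u = v, OF X i uv(2), folded Q_def]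
  have D: "Dom V (P j) = Dom V (Q j)" for j
    using uv by (simp add: P_def Q_def concentrated_def in_hom)
  have "coprd_in V I X j \<cdot> P j = coprd_in V I X j \<cdot> Q j" for j
    using uv(3) i by (simp add: P_def Q_def concentrated_def)
  then have same: "coprd_slice_ob V I X P = coprd_slice_ob V I X Q"
    by (simp add: coprd_slice_ob_def D)
  let ?\<phi> = "coprd_slice_ob V I X P" and ?S = "coprd V I (\<lambda>j. Dom V (P j))"
  have g: "(?\<phi>, Id V ?S, ?\<phi>) \<in> Hom ?L ?\<phi> (coprd_slice_ob V I X Q)"
    using p(7) same hom_Ob(1)[OF p(7)] by (simp add: Hom_def)
  then obtain h where h: "h \<in> Hom ?K P Q" "coprd_slice_ar V I X h = (?\<phi>, Id V ?S, ?\<phi>)"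
    using equivalence_full[where Fo = "coprd_slice_ob V I X" and a = P and b = Q,
      OF Prod_slice_is_category slice_cat_is_category slice_equivalence[OF X] p(1) q(1) g]
    by blast
  have hj: "h j \<in> Ar (slice_cat V (X j)) \<and> fst (h j) = P j \<and> snd (snd (h j)) = Q j" if "j \<in> I" for j
  proof -
    have "h j \<in> Ar (slice_cat V (X j))" "Dom (slice_cat V (X j)) (h j) = P j" "Cod (slice_cat V (X j)) (h j) = Q j"
      using h that by (auto simp: Hom_def Prod_cat_def PiE_iff dest: fun_cong[of _ _ j])
    then show ?thesis by (cases "h j") auto
  qed
  define w where "w = (\<lambda>j. fst (snd (h j)))"
  have w: "w j \<in> Hom V (Dom V (P j)) (Dom V (Q j)) \<and> Q j \<cdot> w j = P j" if "j \<in> I" for j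
    using hj[OF that] by (cases "h j") (auto simp: w_def)
  \<comment> \<open>Outside \<open>I\<close> the families of domains occurring in the image of an arrow take some default
    value, so the coproducts there need not be those of \<open>P\<close> and \<open>Q\<close>. The default value does not depend
    on the arrow, and comparing with the image of the identity of \<open>P\<close> removes the difference.\<close>
  have id: "Id ?K P \<in> Hom ?K P P" "coprd_slice_ar V I X (Id ?K P) = (?\<phi>, Id V ?S, ?\<phi>)"
  proof -
    interpret K: cat ?K using Prod_slice_is_category by unfold_locales
    show "Id ?K P \<in> Hom ?K P P" using p(1) by (simp add: K.in_hom)
    show "coprd_slice_ar V I X (Id ?K P) = (?\<phi>, Id V ?S, ?\<phi>)"
      using slice_equivalence[OF X] p(1,7) by (auto simp: is_equivalence_def is_functor_def in_hom)
  qed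
  define Y1 where "Y1 = (\<lambda>j. Dom V (fst (h j)))"
  define Y2 where "Y2 = (\<lambda>j. Dom V (snd (snd (h j))))"
  have out: "h j = Id ?K P j" if "j \<notin> I" for j
    using h(1) that by (auto simp: Hom_def Prod_cat_def PiE_iff extensional_def)
  have idj: "Id ?K P j = (P j, Id V (Dom V (P j)), P j)" if "j \<in> I" for j
    using that by (simp add: Prod_cat_def)
  have Y: "Y1 j = Dom V (P j)" "Y2 j = Dom V (P j)" if "j \<in> I" for j
    using hj[OF that] by (simp_all add: Y1_def Y2_def D)
  have "Dom V (fst (Id ?K P j)) = Y1 j \<and> Dom V (snd (snd (Id ?K P j))) = Y2 j" for j
  proof (cases "j \<in> I")
    case True
    then show ?thesis using Y idj by simp
  next
    case False
    then show ?thesis using out[OF False] by (simp only: Y1_def Y2_def)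
  qed
  then have Yid: "(\<lambda>j. Dom V (fst (Id ?K P j))) = Y1" "(\<lambda>j. Dom V (snd (snd (Id ?K P j)))) = Y2"
    by blast+
  have YO: "\<forall>j\<in>I. Y1 j \<in> Ob V" "\<forall>j\<in>I. Y2 j \<in> Ob V"
    using p(4) Y hom_Ob(1)[OF uv(1)] by (auto simp: in_hom)
  note c1 = coproduct_chosen[OF YO(1)] and c2 = coproduct_chosen[OF YO(2)]
  have ct: "cotuple V I Y1 (coprd V I Y2) f \<cdot> coprd_in V I Y1 i = f i"
    if "\<And>j. j \<in> I \<Longrightarrow> f j \<in> Hom V (Y1 j) (coprd V I Y2)" for f
    by (rule cotuple(2)[OF c1 is_coproductD(1)[OF c2]]) (use that i in auto)
  have in2: "coprd_in V I Y2 j \<in> Hom V (Y2 j) (coprd V I Y2)" if "j \<in> I" for j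
    using is_coproductD(2)[OF c2 that] .
  have "cotuple V I Y1 (coprd V I Y2) (\<lambda>j. coprd_in V I Y2 j \<cdot> w j) = Id V ?S"
    using h(2) unfolding coprd_slice_ar_def Let_def w_def Y1_def Y2_def by simp
  moreover have "cotuple V I Y1 (coprd V I Y2) (\<lambda>j. coprd_in V I Y2 j \<cdot> fst (snd (Id ?K P j))) = Id V ?S"
    using id(2) unfolding coprd_slice_ar_def Let_def Yid by simp
  ultimately have "coprd_in V I Y2 i \<cdot> w i = coprd_in V I Y2 i \<cdot> fst (snd (Id ?K P i))"
    using ct[of "\<lambda>j. coprd_in V I Y2 j \<cdot> w j"] ct[of "\<lambda>j. coprd_in V I Y2 j \<cdot> fst (snd (Id ?K P j))"]
      w in2 Y D YO p(4) idj by (auto simp: in_hom)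
  then have "coprd_in V I Y2 i \<cdot> w i = coprd_in V I Y2 i \<cdot> Id V (Dom V (P i))" by (simp add: idj i)
  moreover have "is_iso V (coprd_in V I Y2 i)"
  proof (rule coproduct_concentrated[OF c2 i])
    fix j assume "j \<in> I" "j \<noteq> i"
    then have "Y2 j = initial V" using p(3) Y by (auto simp: in_hom)
    then show "is_initial V (Y2 j)" using initial by simp
  qed
  ultimately have "w i = Id V (Dom V (P i))"
    using is_iso_cancel[OF _ in2[OF i], of "w i" "Dom V (P i)" "Id V (Dom V (P i))"] w[OF i] Y(2)[OF i] D
      hom_Ob(1)[of "w i"] by (auto simp: in_hom)
  then show "u = v"
    using w[OF i] p(2) q(2) uv(1,2) by (auto simp: in_hom)
qed

theorem extensive_at_universe: "extensive_at (I :: 'i set)"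
  unfolding extensive_at_def
proof (intro conjI allI impI ballI)
  show "\<exists>d. is_coproduct V I X d" if "\<forall>i\<in>I. X i \<in> Ob V" for X
    using coproduct_chosen[of I X] that by blast
next
  fix X s \<iota> U u assume c: "is_coproduct V I X (s, \<iota>)" and u: "u \<in> Hom V U s"
  have X: "\<forall>i\<in>I. X i \<in> Ob V" using is_coproductD(2)[OF c] hom_Ob by blast
  note c' = coproduct_chosen[OF X]
  obtain e where e: "e \<in> Hom V s (coprd V I X)" "is_iso V e" "\<And>i. i \<in> I \<Longrightarrow> e \<cdot> \<iota> i = coprd_in V I X i"
    using is_coproduct_iso_unique[OF c c'] by blast
  obtain Y j v where d: "is_coproduct V I Y (U, j)"
    "\<And>i. i \<in> I \<Longrightarrow> v i \<in> Hom V (Y i) (X i)" "\<And>i. i \<in> I \<Longrightarrow> (e \<cdot> u) \<cdot> j i = coprd_in V I X i \<cdot> v i"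
    using decompose[OF X comp_hom[OF u e(1)]] by blast
  have "u \<cdot> j i = \<iota> i \<cdot> v i" if i: "i \<in> I" for i
  proof (rule is_iso_cancel[OF e(2,1)])
    note h = is_coproductD(2)[OF d(1) i] d(2)[OF i] is_coproductD(2)[OF c i]
    show "u \<cdot> j i \<in> Hom V (Y i) s" "\<iota> i \<cdot> v i \<in> Hom V (Y i) s" using h u comp_hom by blast+
    show "e \<cdot> (u \<cdot> j i) = e \<cdot> (\<iota> i \<cdot> v i)"
      using d(3)[OF i] comp_eq_at[OF e(3)[OF i], of "v i"] h u e(1) by (simp add: in_hom)
  qed
  then show "\<exists>Y j v. is_coproduct V I Y (U, j) \<and>
         (\<forall>i\<in>I. v i \<in> Hom V (Y i) (X i) \<and> u \<cdot> j i = \<iota> i \<cdot> v i)"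
    using d by blast
next
  fix X s \<iota> i k U u v
  assume c: "is_coproduct V I X (s, \<iota>)" and ik: "i \<in> I" "k \<in> I"
    and uv: "u \<in> Hom V U (X i)" "v \<in> Hom V U (X k)" "\<iota> i \<cdot> u = \<iota> k \<cdot> v"
  have X: "\<forall>i\<in>I. X i \<in> Ob V" using is_coproductD(2)[OF c] hom_Ob by blast
  note c' = coproduct_chosen[OF X]
  obtain e where e: "e \<in> Hom V s (coprd V I X)" "is_iso V e" "\<And>i. i \<in> I \<Longrightarrow> e \<cdot> \<iota> i = coprd_in V I X i"
    using is_coproduct_iso_unique[OF c c'] by blast
  have "coprd_in V I X i \<cdot> u = coprd_in V I X k \<cdot> v"
    using comp_eq_at[OF e(3)[OF ik(1)], of u] comp_eq_at[OF e(3)[OF ik(2)], of v] e(1) uv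
      is_coproductD(2)[OF c] ik by (simp add: in_hom)
  then show "if i = k then u = v else is_initial V U"
    using coprd_in_mono[where i = i, OF X ik(1) uv(1)] disjoint[where i = i, OF X ik _ uv(1,2)] uv(2) by auto
qed

corollary extensive_at_small:
  "inj_on (e :: 'k \<Rightarrow> 'i) I \<Longrightarrow> extensive_at I"
  using extensive_at_reindex extensive_at_universe by blast


end

subsection \<open>Local reasoning\<close>

context cat
begin

lemma locally:
  assumes E: "extensive_at I" and c: "is_coproduct V I X (s, \<iota>)" and u: "u \<in> Hom V U s"
  obtains Y j v where "is_coproduct V I Y (U, j)" "\<And>i. i \<in> I \<Longrightarrow> j i \<in> Hom V (Y i) U"
    "\<And>i. i \<in> I \<Longrightarrow> v i \<in> Hom V (Y i) (X i)" "\<And>i. i \<in> I \<Longrightarrow> u \<cdot> j i = \<iota> i \<cdot> v i"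
proof -
  obtain Y j v where "is_coproduct V I Y (U, j)"
    "\<forall>i\<in>I. v i \<in> Hom V (Y i) (X i) \<and> u \<cdot> j i = \<iota> i \<cdot> v i"
    using E c u unfolding extensive_at_def by metis
  then show ?thesis using that is_coproductD(2) by metis
qed

lemma summand_eq:
  assumes E: "extensive_at I" and c: "is_coproduct V I X (s, \<iota>)" and i: "i \<in> I"
    and uv: "u \<in> Hom V U (X i)" "v \<in> Hom V U (X i)" "\<iota> i \<cdot> u = \<iota> i \<cdot> v"
  shows "u = v"
  using E c i uv unfolding extensive_at_def by metis

lemma summand_disjoint:
  assumes E: "extensive_at I" and c: "is_coproduct V I X (s, \<iota>)" and i: "i \<in> I" "k \<in> I" "i \<noteq> k"
    and uv: "u \<in> Hom V U (X i)" "v \<in> Hom V U (X k)" "\<iota> i \<cdot> u = \<iota> k \<cdot> v"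
  shows "is_initial V U"
  using E c i uv unfolding extensive_at_def by metis

text \<open>To compare two arrows out of \<open>U\<close>, or to lift an arrow out of \<open>U\<close> through given equations, one
  may assume that a given element of a coproduct lies in one of the summands. The pieces of a
  decomposition form a coproduct, so any choice of lifts over them glues.\<close>

lemma local_eq:
  assumes E: "extensive_at I" and c: "is_coproduct V I X (s, \<iota>)" and u: "u \<in> Hom V U s"
    and hk: "h \<in> Hom V U Y" "k \<in> Hom V U Y"
    and step: "\<And>W w i v. i \<in> I \<Longrightarrow> w \<in> Hom V W U \<Longrightarrow> v \<in> Hom V W (X i) \<Longrightarrow> u \<cdot> w = \<iota> i \<cdot> v \<Longrightarrow> h \<cdot> w = k \<cdot> w"
  shows "h = k"
proof -
  obtain Z j v where l: "is_coproduct V I Z (U, j)" "\<And>i. i \<in> I \<Longrightarrow> j i \<in> Hom V (Z i) U"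
    "\<And>i. i \<in> I \<Longrightarrow> v i \<in> Hom V (Z i) (X i)" "\<And>i. i \<in> I \<Longrightarrow> u \<cdot> j i = \<iota> i \<cdot> v i"
    using locally[OF E c u] by blast
  show ?thesis
    by (rule is_coproductD(4)[OF l(1) hk]) (rule step[OF _ l(2,3,4)])
qed

lemma local_lift:
  assumes E: "extensive_at I" and c: "is_coproduct V I X (s, \<iota>)" and u: "u \<in> Hom V U s"
    and fg: "f \<in> Hom V Y Z" "g \<in> Hom V U Z" "f' \<in> Hom V Y Z'" "g' \<in> Hom V U Z'"
    and step: "\<And>W w i v. i \<in> I \<Longrightarrow> w \<in> Hom V W U \<Longrightarrow> v \<in> Hom V W (X i) \<Longrightarrow> u \<cdot> w = \<iota> i \<cdot> v \<Longrightarrow>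
      \<exists>a. a \<in> Hom V W Y \<and> f \<cdot> a = g \<cdot> w \<and> f' \<cdot> a = g' \<cdot> w"
  shows "\<exists>h. h \<in> Hom V U Y \<and> f \<cdot> h = g \<and> f' \<cdot> h = g'"
proof -
  obtain T j v where l: "is_coproduct V I T (U, j)" "\<And>i. i \<in> I \<Longrightarrow> j i \<in> Hom V (T i) U"
    "\<And>i. i \<in> I \<Longrightarrow> v i \<in> Hom V (T i) (X i)" "\<And>i. i \<in> I \<Longrightarrow> u \<cdot> j i = \<iota> i \<cdot> v i"
    using locally[OF E c u] by blast
  have "\<forall>i\<in>I. \<exists>a. a \<in> Hom V (T i) Y \<and> f \<cdot> a = g \<cdot> j i \<and> f' \<cdot> a = g' \<cdot> j i"
    using step l by blast
  then obtain a where a: "\<And>i. i \<in> I \<Longrightarrow> a i \<in> Hom V (T i) Y \<and> f \<cdot> a i = g \<cdot> j i \<and> f' \<cdot> a i = g' \<cdot> j i"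
    by metis
  have "Y \<in> Ob V" using fg hom_Ob by blast
  then obtain h where h: "h \<in> Hom V U Y" "\<forall>i\<in>I. h \<cdot> j i = a i"
    using is_coproductD(3)[OF l(1), of Y a] a by blast
  have *: "(p \<cdot> h) \<cdot> j i = p \<cdot> a i" if "i \<in> I" "p \<in> Hom V Y B" for p B i
    using h that l(2)[OF that(1)] by (auto simp: in_hom)
  have "f \<cdot> h = g"
    by (rule is_coproductD(4)[OF l(1)]) (use h fg * a comp_hom in auto)
  moreover have "f' \<cdot> h = g'"
    by (rule is_coproductD(4)[OF l(1)]) (use h fg * a comp_hom in auto)
  ultimately show ?thesis using h by blast
qed

text \<open>Definition by cases: an arrow out of \<open>P\<close> may be given, naturally in the stage, on those elements
  whose image under some \<open>e : P \<rightarrow> s\<close> lies in a summand. The values on the pieces of one decomposition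
  of \<open>P\<close> glue; naturality and disjointness give the prescribed value on every other such element.\<close>

lemma define_by_cases:
  assumes E: "extensive_at I" and c: "is_coproduct V I X (s, \<iota>)" and e: "e \<in> Hom V P s"
    and Y: "Y \<in> Ob V"
    and typed: "\<And>i U u v. i \<in> I \<Longrightarrow> u \<in> Hom V U P \<Longrightarrow> v \<in> Hom V U (X i) \<Longrightarrow> e \<cdot> u = \<iota> i \<cdot> v \<Longrightarrow>
      \<phi> i u v \<in> Hom V U Y"
    and nat: "\<And>i U u v W w. i \<in> I \<Longrightarrow> u \<in> Hom V U P \<Longrightarrow> v \<in> Hom V U (X i) \<Longrightarrow> e \<cdot> u = \<iota> i \<cdot> v \<Longrightarrow>
      w \<in> Hom V W U \<Longrightarrow> \<phi> i u v \<cdot> w = \<phi> i (u \<cdot> w) (v \<cdot> w)"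
  obtains k where "k \<in> Hom V P Y"
    "\<And>i U u v. i \<in> I \<Longrightarrow> u \<in> Hom V U P \<Longrightarrow> v \<in> Hom V U (X i) \<Longrightarrow> e \<cdot> u = \<iota> i \<cdot> v \<Longrightarrow> k \<cdot> u = \<phi> i u v"
proof -
  obtain T j v where l: "is_coproduct V I T (P, j)" "\<And>i. i \<in> I \<Longrightarrow> j i \<in> Hom V (T i) P"
    "\<And>i. i \<in> I \<Longrightarrow> v i \<in> Hom V (T i) (X i)" "\<And>i. i \<in> I \<Longrightarrow> e \<cdot> j i = \<iota> i \<cdot> v i"
    using locally[OF E c e] by blast
  have "\<And>i. i \<in> I \<Longrightarrow> \<phi> i (j i) (v i) \<in> Hom V (T i) Y" using typed l by blast
  then obtain k where k: "k \<in> Hom V P Y" "\<forall>i\<in>I. k \<cdot> j i = \<phi> i (j i) (v i)"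
    using is_coproductD(3)[OF l(1) Y, of "\<lambda>i. \<phi> i (j i) (v i)"] by blast
  have "k \<cdot> u = \<phi> i u v'"
    if i: "i \<in> I" and u: "u \<in> Hom V U P" and v': "v' \<in> Hom V U (X i)" "e \<cdot> u = \<iota> i \<cdot> v'" for i U u v'
  proof (rule local_eq[OF E l(1) u])
    show "k \<cdot> u \<in> Hom V U Y" using k u comp_hom by blast
    show f: "\<phi> i u v' \<in> Hom V U Y" using typed i u v' by blast
    fix W w n t assume n: "n \<in> I" and w: "w \<in> Hom V W U" and t: "t \<in> Hom V W (T n)" and eq: "u \<cdot> w = j n \<cdot> t"
    note cn = is_coproductD(2)[OF c n] and ci = is_coproductD(2)[OF c i]
    have vn: "v n \<cdot> t \<in> Hom V W (X n)" and vi: "v' \<cdot> w \<in> Hom V W (X i)" using t w l n v' comp_hom by blast+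
    have "\<iota> n \<cdot> (v n \<cdot> t) = e \<cdot> (j n \<cdot> t)"
      using comp_eq_at[OF l(4)[OF n], of t] l(2,3)[OF n] e cn t by (simp add: in_hom)
    also have "\<dots> = \<iota> i \<cdot> (v' \<cdot> w)"
      using comp_eq_at[OF v'(2), of w] v' e ci w u eq by (simp add: in_hom)
    finally have eq': "\<iota> n \<cdot> (v n \<cdot> t) = \<iota> i \<cdot> (v' \<cdot> w)" .
    show "(k \<cdot> u) \<cdot> w = \<phi> i u v' \<cdot> w"
    proof (cases "n = i")
      case True
      then have vv: "v n \<cdot> t = v' \<cdot> w" using summand_eq[OF E c i _ vi] vn eq' by blast
      have "(k \<cdot> u) \<cdot> w = (k \<cdot> j n) \<cdot> t" using k(1) l(2)[OF n] u w t eq by (simp add: in_hom)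
      also have "\<dots> = \<phi> n (j n) (v n) \<cdot> t" using k n by simp
      also have "\<dots> = \<phi> n (j n \<cdot> t) (v n \<cdot> t)" using nat[OF n l(2)[OF n] l(3)[OF n] l(4)[OF n] t] .
      also have "\<dots> = \<phi> i u v' \<cdot> w"
        using nat[OF i u v' w] True vv eq by simp
      finally show ?thesis .
    next
      case False
      then have "is_initial V W" using summand_disjoint[OF E c n i _ vn vi eq'] by blast
      moreover have "(k \<cdot> u) \<cdot> w \<in> Hom V W Y" "\<phi> i u v' \<cdot> w \<in> Hom V W Y"
        using k u w f comp_hom by blast+
      ultimately show ?thesis by (rule is_initial_unique)
    qed
  qed
  then show ?thesis using that k by blast
qed

end

section \<open>Internal categories through their generalised elements\<close>

context lex
begin

text \<open>The arrows \<open>U \<rightarrow> A\<^sub>1\<close> are the arrows of a category with objects \<open>U \<rightarrow> A\<^sub>0\<close>, naturally in \<open>U\<close>;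
  \<open>icomp\<close> is its composition.\<close>

definition icomp :: "('o, 'm) internal_category \<Rightarrow> 'm \<Rightarrow> 'm \<Rightarrow> 'm" where
  "icomp A f g = Cmpn A \<cdot> pb_pair V (Tgt A) (Src A) f g"

text \<open>Only the types of the structure maps; this is what makes \<open>icomp\<close> meaningful and natural in the
  stage before the axioms have been established.\<close>

definition internal_graph :: "('o, 'm) internal_category \<Rightarrow> bool" where
  "internal_graph A \<longleftrightarrow> Ob0 A \<in> Ob V \<and> Ob1 A \<in> Ob V \<and>
     Src A \<in> Hom V (Ob1 A) (Ob0 A) \<and> Tgt A \<in> Hom V (Ob1 A) (Ob0 A) \<and>
     Idn A \<in> Hom V (Ob0 A) (Ob1 A) \<and> Cmpn A \<in> Hom V (pb V (Tgt A) (Src A)) (Ob1 A)"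

lemma graph_simps:
  assumes "internal_graph A"
  shows "Ob0 A \<in> Ob V" "Ob1 A \<in> Ob V" "Src A \<in> Ar V" "Dom V (Src A) = Ob1 A" "Cod V (Src A) = Ob0 A"
    "Tgt A \<in> Ar V" "Dom V (Tgt A) = Ob1 A" "Cod V (Tgt A) = Ob0 A"
    "Idn A \<in> Ar V" "Dom V (Idn A) = Ob0 A" "Cod V (Idn A) = Ob1 A"
    "Cmpn A \<in> Ar V" "Dom V (Cmpn A) = pb V (Tgt A) (Src A)" "Cod V (Cmpn A) = Ob1 A"
  using assms by (auto simp: internal_graph_def in_hom)

lemma icomp_graph:
  assumes "internal_graph A" "f \<in> Ar V" "g \<in> Ar V" "Dom V f = Dom V g" "Cod V f = Ob1 A" "Cod V g = Ob1 A"
    "Tgt A \<cdot> f = Src A \<cdot> g"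
  shows "icomp A f g \<in> Ar V" "Dom V (icomp A f g) = Dom V g" "Cod V (icomp A f g) = Ob1 A"
    "u \<in> Ar V \<Longrightarrow> Cod V u = Dom V g \<Longrightarrow> icomp A f g \<cdot> u = icomp A (f \<cdot> u) (g \<cdot> u)"
  using assms by (simp_all add: icomp_def pb_pair_comp graph_simps)

abbreviation IC :: "('o, 'm) internal_category \<Rightarrow> bool" where
  "IC \<equiv> is_internal_category V"

lemma IC_simps [simp]:
  assumes "IC A"
  shows "Ob0 A \<in> Ob V" "Ob1 A \<in> Ob V" "Src A \<in> Ar V" "Dom V (Src A) = Ob1 A" "Cod V (Src A) = Ob0 A"
    "Tgt A \<in> Ar V" "Dom V (Tgt A) = Ob1 A" "Cod V (Tgt A) = Ob0 A"
    "Idn A \<in> Ar V" "Dom V (Idn A) = Ob0 A" "Cod V (Idn A) = Ob1 A"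
    "Cmpn A \<in> Ar V" "Dom V (Cmpn A) = pb V (Tgt A) (Src A)" "Cod V (Cmpn A) = Ob1 A"
    "Src A \<cdot> Idn A = Id V (Ob0 A)" "Tgt A \<cdot> Idn A = Id V (Ob0 A)"
  using assms by (auto simp: is_internal_category_def Let_def in_hom)

lemma IC_Idn [simp]:
  assumes "IC A" "u \<in> Ar V" "Cod V u = Ob0 A"
  shows "Src A \<cdot> (Idn A \<cdot> u) = u" "Tgt A \<cdot> (Idn A \<cdot> u) = u"
  using comp_eq_at[OF IC_simps(15), of A u] comp_eq_at[OF IC_simps(16), of A u] assms by simp_all

lemma icomp_simps [simp]:
  assumes "IC A" "f \<in> Ar V" "g \<in> Ar V" "Dom V f = Dom V g" "Cod V f = Ob1 A" "Cod V g = Ob1 A"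
    "Tgt A \<cdot> f = Src A \<cdot> g"
  shows "icomp A f g \<in> Ar V" "Dom V (icomp A f g) = Dom V g" "Cod V (icomp A f g) = Ob1 A"
    "Src A \<cdot> icomp A f g = Src A \<cdot> f" "Tgt A \<cdot> icomp A f g = Tgt A \<cdot> g"
    "u \<in> Ar V \<Longrightarrow> Cod V u = Dom V g \<Longrightarrow> icomp A f g \<cdot> u = icomp A (f \<cdot> u) (g \<cdot> u)"
proof -
  have c: "Src A \<cdot> Cmpn A = Src A \<cdot> pb1 V (Tgt A) (Src A)" "Tgt A \<cdot> Cmpn A = Tgt A \<cdot> pb2 V (Tgt A) (Src A)"
    using assms(1) unfolding is_internal_category_def Let_def by blast+
  have g: "internal_graph A"
    using assms(1) unfolding is_internal_category_def Let_def internal_graph_def by blast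
  note i = icomp_graph[OF g assms(2-)]
  show "icomp A f g \<in> Ar V" "Dom V (icomp A f g) = Dom V g" "Cod V (icomp A f g) = Ob1 A"
    by (fact i)+
  show "icomp A f g \<cdot> u = icomp A (f \<cdot> u) (g \<cdot> u)" if "u \<in> Ar V" "Cod V u = Dom V g"
    using i(4) that .
  let ?w = "pb_pair V (Tgt A) (Src A) f g"
  have w: "?w \<in> Ar V" "Cod V ?w = pb V (Tgt A) (Src A)" "pb1 V (Tgt A) (Src A) \<cdot> ?w = f"
    "pb2 V (Tgt A) (Src A) \<cdot> ?w = g"
    using assms by simp_all
  show "Src A \<cdot> icomp A f g = Src A \<cdot> f"
    using comp_eq_at[OF c(1), of ?w] w assms(1) by (simp add: icomp_def)
  show "Tgt A \<cdot> icomp A f g = Tgt A \<cdot> g"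
    using comp_eq_at[OF c(2), of ?w] w assms(1) by (simp add: icomp_def)
qed

lemma icomp_Idn [simp]:
  assumes "IC A" "f \<in> Ar V" "Cod V f = Ob1 A"
  shows "Src A \<cdot> f = x \<Longrightarrow> icomp A (Idn A \<cdot> x) f = f" "Tgt A \<cdot> f = x \<Longrightarrow> icomp A f (Idn A \<cdot> x) = f"
proof -
  let ?I = "Id V (Ob1 A)"
  have "icomp A (Idn A \<cdot> Src A) ?I = ?I" "icomp A ?I (Idn A \<cdot> Tgt A) = ?I"
    using assms(1) unfolding is_internal_category_def Let_def icomp_def by blast+
  moreover have "icomp A (Idn A \<cdot> Src A) ?I \<cdot> f = icomp A (Idn A \<cdot> (Src A \<cdot> f)) f"
    "icomp A ?I (Idn A \<cdot> Tgt A) \<cdot> f = icomp A f (Idn A \<cdot> (Tgt A \<cdot> f))"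
    using assms by (simp_all add: comp_eq_at[OF IC_simps(16)] comp_eq_at[OF IC_simps(15)])
  ultimately show "Src A \<cdot> f = x \<Longrightarrow> icomp A (Idn A \<cdot> x) f = f" "Tgt A \<cdot> f = x \<Longrightarrow> icomp A f (Idn A \<cdot> x) = f"
    using assms by auto
qed

text \<open>The axiom is the case of the universal composable triple, through which every other one factors.\<close>

lemma icomp_assoc:
  assumes "IC A" "f \<in> Ar V" "g \<in> Ar V" "h \<in> Ar V" "Dom V f = Dom V h" "Dom V g = Dom V h"
    "Cod V f = Ob1 A" "Cod V g = Ob1 A" "Cod V h = Ob1 A"
    "Tgt A \<cdot> f = Src A \<cdot> g" "Tgt A \<cdot> g = Src A \<cdot> h"
  shows "icomp A (icomp A f g) h = icomp A f (icomp A g h)"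
proof -
  define s where "s = Src A"
  define t where "t = Tgt A"
  define p1 where "p1 = pb1 V t s"
  define p2 where "p2 = pb2 V t s"
  define q1 where "q1 = pb1 V (t \<cdot> p2) s"
  define q2 where "q2 = pb2 V (t \<cdot> p2) s"
  note ds = s_def t_def p1_def p2_def q1_def q2_def
  have law: "icomp A (Cmpn A \<cdot> q1) q2 = icomp A (p1 \<cdot> q1) (icomp A (p2 \<cdot> q1) q2)"
    using assms(1) unfolding is_internal_category_def Let_def icomp_def ds by blast
  have tp: "s \<in> Ar V" "t \<in> Ar V" "Dom V s = Ob1 A" "Dom V t = Ob1 A" "Cod V s = Ob0 A" "Cod V t = Ob0 A"
    "p1 \<in> Ar V" "p2 \<in> Ar V" "Dom V p1 = pb V t s" "Dom V p2 = pb V t s" "Cod V p1 = Ob1 A" "Cod V p2 = Ob1 A"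
    using assms(1) by (simp_all add: ds)
  have tq: "q1 \<in> Ar V" "q2 \<in> Ar V" "Dom V q1 = pb V (t \<cdot> p2) s" "Dom V q2 = pb V (t \<cdot> p2) s"
    "Cod V q1 = pb V t s" "Cod V q2 = Ob1 A"
    using tp by (simp_all add: q1_def q2_def)
  have sq: "t \<cdot> p1 = s \<cdot> p2" using tp pb_square[of t s] by (simp add: p1_def p2_def)
  have sq': "t \<cdot> (p2 \<cdot> q1) = s \<cdot> q2" using tp pb_square[of "t \<cdot> p2" s] by (simp add: q1_def q2_def)
  have cm: "Tgt A \<cdot> (Cmpn A \<cdot> v) = t \<cdot> (p2 \<cdot> v)" if "v \<in> Ar V" "Cod V v = pb V t s" for v
  proof -
    have "Tgt A \<cdot> Cmpn A = Tgt A \<cdot> p2"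
      using assms(1) unfolding is_internal_category_def Let_def ds by blast
    then show ?thesis using comp_eq_at[of "Tgt A" "Cmpn A" _ v] that assms(1) tp by (simp add: t_def s_def)
  qed
  define a where "a = pb_pair V t s f g"
  have a: "a \<in> Ar V" "Dom V a = Dom V h" "Cod V a = pb V t s" "p1 \<cdot> a = f" "p2 \<cdot> a = g"
    using assms tp by (simp_all add: a_def ds)
  define w where "w = pb_pair V (t \<cdot> p2) s a h"
  have w: "w \<in> Ar V" "Dom V w = Dom V h" "Cod V w = pb V (t \<cdot> p2) s" "q1 \<cdot> w = a" "q2 \<cdot> w = h"
    using assms tp a by (simp_all add: w_def q1_def q2_def) (simp_all add: s_def t_def)
  have sqw: "t \<cdot> (p1 \<cdot> q1) = s \<cdot> (p2 \<cdot> q1)" using comp_eq_at[OF sq, of q1] tp tq by simp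
  have "icomp A (Cmpn A \<cdot> q1) q2 \<cdot> w = icomp A ((Cmpn A \<cdot> q1) \<cdot> w) (q2 \<cdot> w)"
    using assms(1) tp tq w sq' by (intro icomp_simps(6)) (auto simp: cm s_def t_def)
  also have "\<dots> = icomp A (icomp A f g) h"
    using assms(1) tp tq w by (simp add: icomp_def a_def s_def t_def)
  finally have l: "icomp A (Cmpn A \<cdot> q1) q2 \<cdot> w = icomp A (icomp A f g) h" .
  have "icomp A (p1 \<cdot> q1) (icomp A (p2 \<cdot> q1) q2) \<cdot> w = icomp A ((p1 \<cdot> q1) \<cdot> w) (icomp A ((p2 \<cdot> q1) \<cdot> w) (q2 \<cdot> w))"
    using assms(1) tp tq w sq' sqw unfolding s_def t_def by simp
  also have "\<dots> = icomp A f (icomp A g h)"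
    using assms(1) tp tq w a by simp
  finally show ?thesis using l law by simp
qed

text \<open>Conversely, the axioms are the laws of \<open>icomp\<close> at the universal composable pair and triple.\<close>

lemma is_internal_categoryI:
  assumes g: "internal_graph A"
    and Idn: "Src A \<cdot> Idn A = Id V (Ob0 A)" "Tgt A \<cdot> Idn A = Id V (Ob0 A)"
    and st: "\<And>U f g. f \<in> Hom V U (Ob1 A) \<Longrightarrow> g \<in> Hom V U (Ob1 A) \<Longrightarrow> Tgt A \<cdot> f = Src A \<cdot> g \<Longrightarrow>
       Src A \<cdot> icomp A f g = Src A \<cdot> f \<and> Tgt A \<cdot> icomp A f g = Tgt A \<cdot> g"
    and unit: "\<And>U f. f \<in> Hom V U (Ob1 A) \<Longrightarrow> icomp A (Idn A \<cdot> (Src A \<cdot> f)) f = f"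
      "\<And>U f. f \<in> Hom V U (Ob1 A) \<Longrightarrow> icomp A f (Idn A \<cdot> (Tgt A \<cdot> f)) = f"
    and assoc: "\<And>U f g h. f \<in> Hom V U (Ob1 A) \<Longrightarrow> g \<in> Hom V U (Ob1 A) \<Longrightarrow> h \<in> Hom V U (Ob1 A) \<Longrightarrow>
       Tgt A \<cdot> f = Src A \<cdot> g \<Longrightarrow> Tgt A \<cdot> g = Src A \<cdot> h \<Longrightarrow>
       icomp A (icomp A f g) h = icomp A f (icomp A g h)"
  shows "IC A"
proof -
  define s where "s = Src A"
  define t where "t = Tgt A"
  define p1 where "p1 = pb1 V t s"
  define p2 where "p2 = pb2 V t s"
  define q1 where "q1 = pb1 V (t \<cdot> p2) s"
  define q2 where "q2 = pb2 V (t \<cdot> p2) s"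
  have tp: "s \<in> Ar V" "t \<in> Ar V" "Dom V s = Ob1 A" "Dom V t = Ob1 A" "Cod V s = Ob0 A" "Cod V t = Ob0 A"
    using g by (simp_all add: s_def t_def graph_simps)
  then have tp': "p1 \<in> Ar V" "p2 \<in> Ar V" "Dom V p1 = pb V t s" "Dom V p2 = pb V t s" "Cod V p1 = Ob1 A" "Cod V p2 = Ob1 A"
    by (simp_all add: p1_def p2_def)
  have tq: "q1 \<in> Ar V" "q2 \<in> Ar V" "Dom V q1 = pb V (t \<cdot> p2) s" "Dom V q2 = pb V (t \<cdot> p2) s"
    "Cod V q1 = pb V t s" "Cod V q2 = Ob1 A"
    using tp tp' by (simp_all add: q1_def q2_def)
  have ty: "Idn A \<in> Ar V" "Dom V (Idn A) = Ob0 A" "Cod V (Idn A) = Ob1 A"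
    "Cmpn A \<in> Ar V" "Dom V (Cmpn A) = pb V t s" "Cod V (Cmpn A) = Ob1 A"
    using g by (simp_all add: s_def t_def graph_simps)
  have sq: "t \<cdot> p1 = s \<cdot> p2" using tp pb_square[of t s] by (simp add: p1_def p2_def)
  have sq': "t \<cdot> (p2 \<cdot> q1) = s \<cdot> q2" using tp tp' pb_square[of "t \<cdot> p2" s] by (simp add: q1_def q2_def)
  have sqw: "t \<cdot> (p1 \<cdot> q1) = s \<cdot> (p2 \<cdot> q1)" using comp_eq_at[OF sq, of q1] tp tp' tq by simp
  have C: "icomp A p1 p2 = Cmpn A" "icomp A (p1 \<cdot> q1) (p2 \<cdot> q1) = Cmpn A \<cdot> q1"
    using pb_pair_eta[of t s "Id V (pb V t s)"] pb_pair_eta[of t s q1] tp tp' ty tq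
    by (simp_all add: icomp_def p1_def p2_def flip: s_def t_def)
  have "s \<cdot> Cmpn A = s \<cdot> p1" "t \<cdot> Cmpn A = t \<cdot> p2"
    using st[of p1 "pb V t s" p2] tp' sq C by (simp_all add: s_def t_def in_hom)
  moreover have "icomp A (Idn A \<cdot> s) (Id V (Ob1 A)) = Id V (Ob1 A)" "icomp A (Id V (Ob1 A)) (Idn A \<cdot> t) = Id V (Ob1 A)"
    using unit[of "Id V (Ob1 A)" "Ob1 A"] graph_simps(2)[OF g] tp by (simp_all add: s_def t_def in_hom)
  moreover have "icomp A (Cmpn A \<cdot> q1) q2 = icomp A (p1 \<cdot> q1) (icomp A (p2 \<cdot> q1) q2)"
    using assoc[of "p1 \<cdot> q1" "pb V (t \<cdot> p2) s" "p2 \<cdot> q1" q2] C tp' tq sq' sqw by (simp add: in_hom s_def t_def)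
  ultimately show ?thesis
    using g Idn unfolding internal_graph_def is_internal_category_def Let_def icomp_def p1_def p2_def q1_def q2_def s_def t_def
    by blast
qed

text \<open>An internal category may be given by a natural composition of generalised elements: by the
  Yoneda lemma it comes from its value at the universal composable pair.\<close>

lemma icomp_natural:
  assumes "Src A \<in> Hom V a1 a0" "Tgt A \<in> Hom V a1 a0"
    and typed: "\<And>U f g. f \<in> Hom V U a1 \<Longrightarrow> g \<in> Hom V U a1 \<Longrightarrow> Tgt A \<cdot> f = Src A \<cdot> g \<Longrightarrow> m f g \<in> Hom V U a1"
    and nat: "\<And>U W f g u. f \<in> Hom V U a1 \<Longrightarrow> g \<in> Hom V U a1 \<Longrightarrow> Tgt A \<cdot> f = Src A \<cdot> g \<Longrightarrow>
       u \<in> Hom V W U \<Longrightarrow> m f g \<cdot> u = m (f \<cdot> u) (g \<cdot> u)"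
    and C: "Cmpn A = m (pb1 V (Tgt A) (Src A)) (pb2 V (Tgt A) (Src A))"
  shows "Cmpn A \<in> Hom V (pb V (Tgt A) (Src A)) a1"
    "f \<in> Hom V U a1 \<Longrightarrow> g \<in> Hom V U a1 \<Longrightarrow> Tgt A \<cdot> f = Src A \<cdot> g \<Longrightarrow> icomp A f g = m f g"
proof -
  let ?p = "pb1 V (Tgt A) (Src A)" and ?q = "pb2 V (Tgt A) (Src A)" and ?P = "pb V (Tgt A) (Src A)"
  have p: "?p \<in> Hom V ?P a1" "?q \<in> Hom V ?P a1" "Tgt A \<cdot> ?p = Src A \<cdot> ?q"
    using assms(1,2) pb_square[of "Tgt A" "Src A"] by (simp_all add: in_hom)
  show "Cmpn A \<in> Hom V ?P a1" using typed[OF p] C by simp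
  show "icomp A f g = m f g" if "f \<in> Hom V U a1" "g \<in> Hom V U a1" "Tgt A \<cdot> f = Src A \<cdot> g"
    using nat[OF p, of "pb_pair V (Tgt A) (Src A) f g" U] that assms(1,2)
    by (simp add: icomp_def C in_hom)
qed

subsection \<open>Internal functors\<close>

abbreviation IF :: "('o, 'm) internal_functor \<Rightarrow> bool" where
  "IF \<equiv> is_internal_functor V"

lemma IF_simps [simp]:
  assumes "IF F"
  shows "IC (IDom F)" "IC (ICod F)"
    "Fun0 F \<in> Ar V" "Dom V (Fun0 F) = Ob0 (IDom F)" "Cod V (Fun0 F) = Ob0 (ICod F)"
    "Fun1 F \<in> Ar V" "Dom V (Fun1 F) = Ob1 (IDom F)" "Cod V (Fun1 F) = Ob1 (ICod F)"
  using assms by (auto simp: is_internal_functor_def Let_def in_hom)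

lemma IF_at:
  assumes "IF F" "IDom F = A" "ICod F = B"
  shows "u \<in> Ar V \<Longrightarrow> Cod V u = Ob1 A \<Longrightarrow> Src B \<cdot> (Fun1 F \<cdot> u) = Fun0 F \<cdot> (Src A \<cdot> u)"
    "u \<in> Ar V \<Longrightarrow> Cod V u = Ob1 A \<Longrightarrow> Tgt B \<cdot> (Fun1 F \<cdot> u) = Fun0 F \<cdot> (Tgt A \<cdot> u)"
    "u \<in> Ar V \<Longrightarrow> Cod V u = Ob0 A \<Longrightarrow> Fun1 F \<cdot> (Idn A \<cdot> u) = Idn B \<cdot> (Fun0 F \<cdot> u)"
    "f \<in> Ar V \<Longrightarrow> g \<in> Ar V \<Longrightarrow> Dom V f = Dom V g \<Longrightarrow> Cod V f = Ob1 A \<Longrightarrow> Cod V g = Ob1 A \<Longrightarrow>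
     Tgt A \<cdot> f = Src A \<cdot> g \<Longrightarrow> Fun1 F \<cdot> icomp A f g = icomp B (Fun1 F \<cdot> f) (Fun1 F \<cdot> g)"
proof -
  note ty = IF_simps[OF assms(1), unfolded assms(2,3)]
  let ?p1 = "pb1 V (Tgt A) (Src A)" and ?p2 = "pb2 V (Tgt A) (Src A)"
  have e: "Src B \<cdot> Fun1 F = Fun0 F \<cdot> Src A" "Tgt B \<cdot> Fun1 F = Fun0 F \<cdot> Tgt A"
    "Fun1 F \<cdot> Idn A = Idn B \<cdot> Fun0 F" "Fun1 F \<cdot> Cmpn A = icomp B (Fun1 F \<cdot> ?p1) (Fun1 F \<cdot> ?p2)"
    using assms unfolding is_internal_functor_def Let_def icomp_def by blast+
  show s: "Src B \<cdot> (Fun1 F \<cdot> u) = Fun0 F \<cdot> (Src A \<cdot> u)" if "u \<in> Ar V" "Cod V u = Ob1 A" for u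
    using comp_eq_at[OF e(1), of u] that ty by simp
  show t: "Tgt B \<cdot> (Fun1 F \<cdot> u) = Fun0 F \<cdot> (Tgt A \<cdot> u)" if "u \<in> Ar V" "Cod V u = Ob1 A" for u
    using comp_eq_at[OF e(2), of u] that ty by simp
  show "Fun1 F \<cdot> (Idn A \<cdot> u) = Idn B \<cdot> (Fun0 F \<cdot> u)" if "u \<in> Ar V" "Cod V u = Ob0 A"
    using comp_eq_at[OF e(3), of u] that ty by simp
  show "Fun1 F \<cdot> icomp A f g = icomp B (Fun1 F \<cdot> f) (Fun1 F \<cdot> g)"
    if h: "f \<in> Ar V" "g \<in> Ar V" "Dom V f = Dom V g" "Cod V f = Ob1 A" "Cod V g = Ob1 A" "Tgt A \<cdot> f = Src A \<cdot> g"
  proof -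
    let ?w = "pb_pair V (Tgt A) (Src A) f g"
    have "Fun1 F \<cdot> icomp A f g = icomp B (Fun1 F \<cdot> ?p1) (Fun1 F \<cdot> ?p2) \<cdot> ?w"
      unfolding icomp_def[of A] by (rule comp_eq_at[OF e(4)]) (use h ty in simp_all)
    also have "\<dots> = icomp B ((Fun1 F \<cdot> ?p1) \<cdot> ?w) ((Fun1 F \<cdot> ?p2) \<cdot> ?w)"
      using h ty by (intro icomp_simps(6)) (auto simp: s t pb_square)
    finally show ?thesis using h ty by simp
  qed
qed

lemma is_internal_functorI:
  assumes "IC A" "IC B" "IDom F = A" "ICod F = B"
    and F0: "Fun0 F \<in> Hom V (Ob0 A) (Ob0 B)" and F1: "Fun1 F \<in> Hom V (Ob1 A) (Ob1 B)"
    and "Src B \<cdot> Fun1 F = Fun0 F \<cdot> Src A" "Tgt B \<cdot> Fun1 F = Fun0 F \<cdot> Tgt A"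
    and "Fun1 F \<cdot> Idn A = Idn B \<cdot> Fun0 F"
    and icomp: "\<And>U f g. f \<in> Hom V U (Ob1 A) \<Longrightarrow> g \<in> Hom V U (Ob1 A) \<Longrightarrow> Tgt A \<cdot> f = Src A \<cdot> g \<Longrightarrow>
      Fun1 F \<cdot> icomp A f g = icomp B (Fun1 F \<cdot> f) (Fun1 F \<cdot> g)"
  shows "IF F"
proof -
  let ?p1 = "pb1 V (Tgt A) (Src A)" and ?p2 = "pb2 V (Tgt A) (Src A)" and ?P = "pb V (Tgt A) (Src A)"
  have "icomp A ?p1 ?p2 = Cmpn A"
    using pb_pair_eta[of "Tgt A" "Src A" "Id V ?P"] assms(1) by (simp add: icomp_def)
  then have "Fun1 F \<cdot> Cmpn A = icomp B (Fun1 F \<cdot> ?p1) (Fun1 F \<cdot> ?p2)"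
    using icomp[of ?p1 ?P ?p2] assms(1) by (simp add: in_hom pb_square)
  then show ?thesis
    unfolding is_internal_functor_def Let_def icomp_def assms(3,4) using assms by blast
qed

lemma internal_functor_eqI:
  "IDom F = IDom G \<Longrightarrow> ICod F = ICod G \<Longrightarrow> Fun0 F = Fun0 G \<Longrightarrow> Fun1 F = Fun1 G \<Longrightarrow> F = (G :: ('o, 'm) internal_functor)"
  by simp

end

section \<open>Finite limits of internal categories\<close>

context cat
begin

lemma is_pullback_transport:
  assumes p: "is_pullback V f g (p, p1, p2)" and fg: "f \<in> Ar V" "g \<in> Ar V"
    and e: "e \<in> Hom V q p" "is_iso V e"
  shows "is_pullback V f g (q, p1 \<cdot> e, p2 \<cdot> e)"
proof -
  note P = is_pullbackD[OF p] and i = inv_arr[OF e(2,1)]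
  have inv: "e \<cdot> (inv_arr V e \<cdot> u) = u" if "u \<in> Ar V" "Cod V u = p" for u
    using comp_eq_at[OF i(3), of u] that e i(1) by (simp add: in_hom)
  show ?thesis
    unfolding is_pullback_def prod.case
  proof (intro conjI ballI impI)
    show "q \<in> Ob V" using e hom_Ob by blast
    show "p1 \<cdot> e \<in> Hom V q (Dom V f)" "p2 \<cdot> e \<in> Hom V q (Dom V g)" using P e comp_hom by blast+
    show "f \<cdot> (p1 \<cdot> e) = g \<cdot> (p2 \<cdot> e)"
      using comp_eq_at[OF P(4), of e] P(2,3) e fg by (simp add: in_hom)
    fix x h k assume h: "h \<in> Hom V x (Dom V f)" "k \<in> Hom V x (Dom V g)" "f \<cdot> h = g \<cdot> k"
    obtain u where u: "u \<in> Hom V x p" "p1 \<cdot> u = h" "p2 \<cdot> u = k" using P(5)[OF h] by blast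
    show "\<exists>!u. u \<in> Hom V x q \<and> (p1 \<cdot> e) \<cdot> u = h \<and> (p2 \<cdot> e) \<cdot> u = k"
    proof (rule ex1I[of _ "inv_arr V e \<cdot> u"])
      show "inv_arr V e \<cdot> u \<in> Hom V x q \<and> (p1 \<cdot> e) \<cdot> (inv_arr V e \<cdot> u) = h \<and> (p2 \<cdot> e) \<cdot> (inv_arr V e \<cdot> u) = k"
        using u i(1) e P(2,3) by (simp add: in_hom inv)
      fix v assume v: "v \<in> Hom V x q \<and> (p1 \<cdot> e) \<cdot> v = h \<and> (p2 \<cdot> e) \<cdot> v = k"
      have "e \<cdot> v = u"
        by (rule P(6)[OF fg]) (use v u e P(2,3) in \<open>auto simp: in_hom\<close>)
      then show "v = inv_arr V e \<cdot> u"
        using comp_eq_at[OF i(2), of v] v e i(1) by (auto simp: in_hom)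
    qed
  qed
qed

text \<open>This turns products of internal categories into pullbacks over the terminal one, so that only
  pullbacks have to be constructed.\<close>

lemma is_product_iff_is_pullback:
  assumes t: "is_terminal V t" and f: "f \<in> Hom V a t" and g: "g \<in> Hom V b t"
  shows "is_product V a b (p, p1, p2) \<longleftrightarrow> is_pullback V f g (p, p1, p2)"
proof -
  have eq: "f \<cdot> h = g \<cdot> k" if "h \<in> Hom V x a" "k \<in> Hom V x b" for x h k
    using is_terminal_unique[OF t] that f g comp_hom by blast
  have D: "Dom V f = a" "Dom V g = b" using f g by (auto simp: in_hom)
  show ?thesis
    unfolding is_product_def is_pullback_def prod.case D using eq by blast
qed

end

context lex
begin

subsection \<open>The category of internal categories\<close>

lemma Cat_simps [simp]:
  "A \<in> Ob (Cat V) \<longleftrightarrow> IC A" "F \<in> Ar (Cat V) \<longleftrightarrow> IF F" "Dom (Cat V) F = IDom F" "Cod (Cat V) F = ICod F"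
  "IDom (Id (Cat V) A) = A" "ICod (Id (Cat V) A) = A"
  "Fun0 (Id (Cat V) A) = Id V (Ob0 A)" "Fun1 (Id (Cat V) A) = Id V (Ob1 A)"
  "IDom (G \<cdot>\<^bsub>Cat V\<^esub> F) = IDom F" "ICod (G \<cdot>\<^bsub>Cat V\<^esub> F) = ICod G"
  "Fun0 (G \<cdot>\<^bsub>Cat V\<^esub> F) = Fun0 G \<cdot> Fun0 F" "Fun1 (G \<cdot>\<^bsub>Cat V\<^esub> F) = Fun1 G \<cdot> Fun1 F"
  by (simp_all add: Cat_def)

lemma in_Cat_hom: "F \<in> Hom (Cat V) A B \<longleftrightarrow> IF F \<and> IDom F = A \<and> ICod F = B"
  by (simp add: Hom_def)

lemma IF_at_simps [simp]:
  assumes "IF F"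
  shows "ICod F = B \<Longrightarrow> u \<in> Ar V \<Longrightarrow> Cod V u = Ob1 (IDom F) \<Longrightarrow> Src B \<cdot> (Fun1 F \<cdot> u) = Fun0 F \<cdot> (Src (IDom F) \<cdot> u)"
    "ICod F = B \<Longrightarrow> u \<in> Ar V \<Longrightarrow> Cod V u = Ob1 (IDom F) \<Longrightarrow> Tgt B \<cdot> (Fun1 F \<cdot> u) = Fun0 F \<cdot> (Tgt (IDom F) \<cdot> u)"
    "IDom F = A \<Longrightarrow> u \<in> Ar V \<Longrightarrow> Cod V u = Ob0 A \<Longrightarrow> Fun1 F \<cdot> (Idn A \<cdot> u) = Idn (ICod F) \<cdot> (Fun0 F \<cdot> u)"
    "IDom F = A \<Longrightarrow> f \<in> Ar V \<Longrightarrow> g \<in> Ar V \<Longrightarrow> Dom V f = Dom V g \<Longrightarrow> Cod V f = Ob1 A \<Longrightarrow> Cod V g = Ob1 A \<Longrightarrow>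
     Tgt A \<cdot> f = Src A \<cdot> g \<Longrightarrow> Fun1 F \<cdot> icomp A f g = icomp (ICod F) (Fun1 F \<cdot> f) (Fun1 F \<cdot> g)"
  using IF_at[OF assms] by auto

lemma IF_eqs [simp]:
  assumes "IF F"
  shows "ICod F = B \<Longrightarrow> Src B \<cdot> Fun1 F = Fun0 F \<cdot> Src (IDom F)"
    "ICod F = B \<Longrightarrow> Tgt B \<cdot> Fun1 F = Fun0 F \<cdot> Tgt (IDom F)"
    "IDom F = A \<Longrightarrow> Fun1 F \<cdot> Idn A = Idn (ICod F) \<cdot> Fun0 F"
  using assms unfolding is_internal_functor_def Let_def by blast+

lemma Cat_is_category: "is_category (Cat V)"
proof (rule is_categoryI)
  fix A assume "A \<in> Ob (Cat V)"
  then have A: "IC A" by simp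
  show "Id (Cat V) A \<in> Hom (Cat V) A A"
    unfolding in_Cat_hom
  proof (intro conjI is_internal_functorI[OF A A])
    show "Fun1 (Id (Cat V) A) \<cdot> icomp A f g = icomp A (Fun1 (Id (Cat V) A) \<cdot> f) (Fun1 (Id (Cat V) A) \<cdot> g)"
      if "f \<in> Hom V U (Ob1 A)" "g \<in> Hom V U (Ob1 A)" "Tgt A \<cdot> f = Src A \<cdot> g" for U f g
      using that A by (simp add: in_hom)
  qed (use A in \<open>simp_all add: in_hom\<close>)
next
  fix F G assume "F \<in> Ar (Cat V)" "G \<in> Ar (Cat V)" "Cod (Cat V) F = Dom (Cat V) G"
  then have F: "IF F" "IF G" "IDom G = ICod F" by simp_all
  show "G \<cdot>\<^bsub>Cat V\<^esub> F \<in> Hom (Cat V) (Dom (Cat V) F) (Cod (Cat V) G)"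
    unfolding in_Cat_hom
  proof (intro conjI is_internal_functorI[of "IDom F" "ICod G"])
    show "Fun1 (G \<cdot>\<^bsub>Cat V\<^esub> F) \<cdot> icomp (IDom F) f g =
        icomp (ICod G) (Fun1 (G \<cdot>\<^bsub>Cat V\<^esub> F) \<cdot> f) (Fun1 (G \<cdot>\<^bsub>Cat V\<^esub> F) \<cdot> g)"
      if "f \<in> Hom V U (Ob1 (IDom F))" "g \<in> Hom V U (Ob1 (IDom F))" "Tgt (IDom F) \<cdot> f = Src (IDom F) \<cdot> g" for U f g
      using that F by (simp add: in_hom)
  qed (use F IF_eqs[OF F(1)] IF_eqs[OF F(2)] IF_simps[OF F(2)] in \<open>simp_all add: in_hom\<close>)
qed (auto simp: Cat_def)

end

sublocale lex \<subseteq> Cat_cat: cat "Cat V" by unfold_locales (rule Cat_is_category)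

subsection \<open>Pullbacks\<close>

text \<open>Pullbacks of internal categories are computed on objects and on arrows.\<close>

locale cospan = lex V for V :: "('o, 'm) category" (structure) +
  fixes F G :: "('o, 'm) internal_functor"
  assumes cospan: "IF F" "IF G" "ICod F = ICod G"
begin

abbreviation "q1 \<equiv> pb1 V (Fun0 F) (Fun0 G)"
abbreviation "q2 \<equiv> pb2 V (Fun0 F) (Fun0 G)"
abbreviation "r1 \<equiv> pb1 V (Fun1 F) (Fun1 G)"
abbreviation "r2 \<equiv> pb2 V (Fun1 F) (Fun1 G)"
abbreviation "pair0 \<equiv> pb_pair V (Fun0 F) (Fun0 G)"
abbreviation "pair1 \<equiv> pb_pair V (Fun1 F) (Fun1 G)"

definition S :: 'm where "S = pair0 (Src (IDom F) \<cdot> r1) (Src (IDom G) \<cdot> r2)"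
definition T :: 'm where "T = pair0 (Tgt (IDom F) \<cdot> r1) (Tgt (IDom G) \<cdot> r2)"

definition m :: "'m \<Rightarrow> 'm \<Rightarrow> 'm" where
  "m f g = pair1 (icomp (IDom F) (r1 \<cdot> f) (r1 \<cdot> g)) (icomp (IDom G) (r2 \<cdot> f) (r2 \<cdot> g))"

definition P :: "('o, 'm) internal_category" where
  "P = \<lparr>Ob0 = pb V (Fun0 F) (Fun0 G), Ob1 = pb V (Fun1 F) (Fun1 G), Src = S, Tgt = T,
    Idn = pair1 (Idn (IDom F) \<cdot> q1) (Idn (IDom G) \<cdot> q2), Cmpn = m (pb1 V T S) (pb2 V T S)\<rparr>"

lemma cospan_simps [simp]: "IF F" "IF G" "ICod F = ICod G"
  using cospan by auto

lemma r_square [simp]: "u \<in> Ar V \<Longrightarrow> Cod V u = pb V (Fun1 F) (Fun1 G) \<Longrightarrow> Fun1 F \<cdot> (r1 \<cdot> u) = Fun1 G \<cdot> (r2 \<cdot> u)"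
  by (simp add: pb_square_at)

lemma q_square [simp]: "u \<in> Ar V \<Longrightarrow> Cod V u = pb V (Fun0 F) (Fun0 G) \<Longrightarrow> Fun0 F \<cdot> (q1 \<cdot> u) = Fun0 G \<cdot> (q2 \<cdot> u)"
  by (simp add: pb_square_at)

lemma st_square:
  assumes "u \<in> Ar V" "Cod V u = pb V (Fun1 F) (Fun1 G)"
  shows "Fun0 F \<cdot> (Src (IDom F) \<cdot> (r1 \<cdot> u)) = Fun0 G \<cdot> (Src (IDom G) \<cdot> (r2 \<cdot> u))"
    "Fun0 F \<cdot> (Tgt (IDom F) \<cdot> (r1 \<cdot> u)) = Fun0 G \<cdot> (Tgt (IDom G) \<cdot> (r2 \<cdot> u))"
proof -
  have "Src (ICod G) \<cdot> (Fun1 F \<cdot> (r1 \<cdot> u)) = Src (ICod G) \<cdot> (Fun1 G \<cdot> (r2 \<cdot> u))"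
    "Tgt (ICod G) \<cdot> (Fun1 F \<cdot> (r1 \<cdot> u)) = Tgt (ICod G) \<cdot> (Fun1 G \<cdot> (r2 \<cdot> u))"
    using assms by simp_all
  then show "Fun0 F \<cdot> (Src (IDom F) \<cdot> (r1 \<cdot> u)) = Fun0 G \<cdot> (Src (IDom G) \<cdot> (r2 \<cdot> u))"
    "Fun0 F \<cdot> (Tgt (IDom F) \<cdot> (r1 \<cdot> u)) = Fun0 G \<cdot> (Tgt (IDom G) \<cdot> (r2 \<cdot> u))"
    using assms by (simp_all del: r_square)
qed

lemma ST [simp]:
  "S \<in> Ar V" "Dom V S = pb V (Fun1 F) (Fun1 G)" "Cod V S = pb V (Fun0 F) (Fun0 G)"
  "T \<in> Ar V" "Dom V T = pb V (Fun1 F) (Fun1 G)" "Cod V T = pb V (Fun0 F) (Fun0 G)"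
  "q1 \<cdot> S = Src (IDom F) \<cdot> r1" "q2 \<cdot> S = Src (IDom G) \<cdot> r2"
  "q1 \<cdot> T = Tgt (IDom F) \<cdot> r1" "q2 \<cdot> T = Tgt (IDom G) \<cdot> r2"
  using st_square[of "Id V (pb V (Fun1 F) (Fun1 G))"] by (simp_all add: S_def T_def)

lemma ST_at [simp]:
  assumes "u \<in> Ar V" "Cod V u = pb V (Fun1 F) (Fun1 G)"
  shows "q1 \<cdot> (S \<cdot> u) = Src (IDom F) \<cdot> (r1 \<cdot> u)" "q2 \<cdot> (S \<cdot> u) = Src (IDom G) \<cdot> (r2 \<cdot> u)"
    "q1 \<cdot> (T \<cdot> u) = Tgt (IDom F) \<cdot> (r1 \<cdot> u)" "q2 \<cdot> (T \<cdot> u) = Tgt (IDom G) \<cdot> (r2 \<cdot> u)"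
  using assms comp_eq_at[OF ST(7), of u] comp_eq_at[OF ST(8), of u] comp_eq_at[OF ST(9), of u]
    comp_eq_at[OF ST(10), of u] by simp_all

lemma composable:
  assumes "f \<in> Hom V U (pb V (Fun1 F) (Fun1 G))" "g \<in> Hom V U (pb V (Fun1 F) (Fun1 G))" "T \<cdot> f = S \<cdot> g"
  shows "Tgt (IDom F) \<cdot> (r1 \<cdot> f) = Src (IDom F) \<cdot> (r1 \<cdot> g)" "Tgt (IDom G) \<cdot> (r2 \<cdot> f) = Src (IDom G) \<cdot> (r2 \<cdot> g)"
proof -
  have "q1 \<cdot> (T \<cdot> f) = q1 \<cdot> (S \<cdot> g)" "q2 \<cdot> (T \<cdot> f) = q2 \<cdot> (S \<cdot> g)" using assms(3) by simp_all
  then show "Tgt (IDom F) \<cdot> (r1 \<cdot> f) = Src (IDom F) \<cdot> (r1 \<cdot> g)" "Tgt (IDom G) \<cdot> (r2 \<cdot> f) = Src (IDom G) \<cdot> (r2 \<cdot> g)"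
    using assms(1,2) by (simp_all add: in_hom)
qed

lemma m:
  assumes "f \<in> Hom V U (pb V (Fun1 F) (Fun1 G))" "g \<in> Hom V U (pb V (Fun1 F) (Fun1 G))" "T \<cdot> f = S \<cdot> g"
  shows "m f g \<in> Hom V U (pb V (Fun1 F) (Fun1 G))"
    "r1 \<cdot> m f g = icomp (IDom F) (r1 \<cdot> f) (r1 \<cdot> g)" "r2 \<cdot> m f g = icomp (IDom G) (r2 \<cdot> f) (r2 \<cdot> g)"
    "u \<in> Hom V W U \<Longrightarrow> m f g \<cdot> u = m (f \<cdot> u) (g \<cdot> u)"
  using assms composable[OF assms] by (simp_all add: in_hom m_def pb_pair_comp)

lemma P_simps [simp]:
  "Ob0 P = pb V (Fun0 F) (Fun0 G)" "Ob1 P = pb V (Fun1 F) (Fun1 G)" "Src P = S" "Tgt P = T"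
  "Idn P = pair1 (Idn (IDom F) \<cdot> q1) (Idn (IDom G) \<cdot> q2)" "Cmpn P = m (pb1 V T S) (pb2 V T S)"
  by (simp_all add: P_def)

lemma icomp_P:
  assumes "f \<in> Hom V U (pb V (Fun1 F) (Fun1 G))" "g \<in> Hom V U (pb V (Fun1 F) (Fun1 G))" "T \<cdot> f = S \<cdot> g"
  shows "icomp P f g = m f g"
  by (rule icomp_natural(2)[where ?a1.0 = "pb V (Fun1 F) (Fun1 G)" and ?a0.0 = "pb V (Fun0 F) (Fun0 G)"])
    (use assms m in \<open>auto simp: in_hom\<close>)

lemma Cmpn_P: "m (pb1 V T S) (pb2 V T S) \<in> Hom V (pb V T S) (pb V (Fun1 F) (Fun1 G))"
  by (rule m(1)) (simp_all add: in_hom pb_square)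

lemma Idn_P [simp]:
  "pair1 (Idn (IDom F) \<cdot> q1) (Idn (IDom G) \<cdot> q2) \<in> Ar V"
  "Dom V (pair1 (Idn (IDom F) \<cdot> q1) (Idn (IDom G) \<cdot> q2)) = pb V (Fun0 F) (Fun0 G)"
  "Cod V (pair1 (Idn (IDom F) \<cdot> q1) (Idn (IDom G) \<cdot> q2)) = pb V (Fun1 F) (Fun1 G)"
  "r1 \<cdot> pair1 (Idn (IDom F) \<cdot> q1) (Idn (IDom G) \<cdot> q2) = Idn (IDom F) \<cdot> q1"
  "r2 \<cdot> pair1 (Idn (IDom F) \<cdot> q1) (Idn (IDom G) \<cdot> q2) = Idn (IDom G) \<cdot> q2"
  by (simp_all add: pb_square)

lemma Idn_P_at [simp]:
  assumes "u \<in> Ar V" "Cod V u = pb V (Fun0 F) (Fun0 G)"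
  shows "r1 \<cdot> (pair1 (Idn (IDom F) \<cdot> q1) (Idn (IDom G) \<cdot> q2) \<cdot> u) = Idn (IDom F) \<cdot> (q1 \<cdot> u)"
    "r2 \<cdot> (pair1 (Idn (IDom F) \<cdot> q1) (Idn (IDom G) \<cdot> q2) \<cdot> u) = Idn (IDom G) \<cdot> (q2 \<cdot> u)"
  using assms comp_eq_at[OF Idn_P(4), of u] comp_eq_at[OF Idn_P(5), of u] by simp_all

lemma eq0:
  "u \<in> Hom V U (pb V (Fun0 F) (Fun0 G)) \<Longrightarrow> v \<in> Hom V U (pb V (Fun0 F) (Fun0 G)) \<Longrightarrow>
   q1 \<cdot> u = q1 \<cdot> v \<Longrightarrow> q2 \<cdot> u = q2 \<cdot> v \<Longrightarrow> u = v"
  by (rule pb_unique[of "Fun0 F" "Fun0 G"]) simp_all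

lemma eq1:
  "u \<in> Hom V U (pb V (Fun1 F) (Fun1 G)) \<Longrightarrow> v \<in> Hom V U (pb V (Fun1 F) (Fun1 G)) \<Longrightarrow>
   r1 \<cdot> u = r1 \<cdot> v \<Longrightarrow> r2 \<cdot> u = r2 \<cdot> v \<Longrightarrow> u = v"
  by (rule pb_unique[of "Fun1 F" "Fun1 G"]) simp_all

lemma IC_P: "IC P"
proof (rule is_internal_categoryI)
  show "internal_graph P"
    using Cmpn_P by (simp add: internal_graph_def in_hom)
  show "Src P \<cdot> Idn P = Id V (Ob0 P)" "Tgt P \<cdot> Idn P = Id V (Ob0 P)"
    by (rule eq0[of _ "Ob0 P"]; simp add: in_hom)+
next
  fix U f g assume "f \<in> Hom V U (Ob1 P)" "g \<in> Hom V U (Ob1 P)" "Tgt P \<cdot> f = Src P \<cdot> g"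
  then have fg: "f \<in> Hom V U (pb V (Fun1 F) (Fun1 G))" "g \<in> Hom V U (pb V (Fun1 F) (Fun1 G))" "T \<cdot> f = S \<cdot> g"
    by simp_all
  note c = composable[OF fg] and m = m[OF fg]
  show "Src P \<cdot> icomp P f g = Src P \<cdot> f \<and> Tgt P \<cdot> icomp P f g = Tgt P \<cdot> g"
    unfolding icomp_P[OF fg] P_simps
    by (intro conjI; rule eq0[of _ U]) (use fg c m in \<open>simp_all add: in_hom\<close>)
next
  fix U f assume "f \<in> Hom V U (Ob1 P)"
  then have f: "f \<in> Hom V U (pb V (Fun1 F) (Fun1 G))" by simp
  have i1: "Idn P \<cdot> (Src P \<cdot> f) \<in> Hom V U (pb V (Fun1 F) (Fun1 G))"
    using f by (simp add: in_hom)
  have i2: "T \<cdot> (Idn P \<cdot> (Src P \<cdot> f)) = S \<cdot> f"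
    by (rule eq0[of _ U]; use f in \<open>simp add: in_hom\<close>)
  note i = i1 i2
  show "icomp P (Idn P \<cdot> (Src P \<cdot> f)) f = f"
    unfolding icomp_P[OF i(1) f i(2)]
    by (rule eq1[of _ U]) (use m[OF i(1) f i(2)] f in \<open>simp_all add: in_hom\<close>)
  have j1: "Idn P \<cdot> (Tgt P \<cdot> f) \<in> Hom V U (pb V (Fun1 F) (Fun1 G))"
    using f by (simp add: in_hom)
  have j2: "T \<cdot> f = S \<cdot> (Idn P \<cdot> (Tgt P \<cdot> f))"
    by (rule eq0[of _ U]; use f in \<open>simp add: in_hom\<close>)
  note i = j1 j2
  show "icomp P f (Idn P \<cdot> (Tgt P \<cdot> f)) = f"
    unfolding icomp_P[OF f i]
    by (rule eq1[of _ U]) (use m[OF f i] f in \<open>simp_all add: in_hom\<close>)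
next
  fix U f g h assume "f \<in> Hom V U (Ob1 P)" "g \<in> Hom V U (Ob1 P)" "h \<in> Hom V U (Ob1 P)"
    "Tgt P \<cdot> f = Src P \<cdot> g" "Tgt P \<cdot> g = Src P \<cdot> h"
  then have h: "f \<in> Hom V U (pb V (Fun1 F) (Fun1 G))" "g \<in> Hom V U (pb V (Fun1 F) (Fun1 G))"
    "h \<in> Hom V U (pb V (Fun1 F) (Fun1 G))" "T \<cdot> f = S \<cdot> g" "T \<cdot> g = S \<cdot> h"
    by simp_all
  note c1 = composable[OF h(1,2,4)] and c2 = composable[OF h(2,3,5)]
    and m1 = m[OF h(1,2,4)] and m2 = m[OF h(2,3,5)]
  have t: "T \<cdot> m f g = S \<cdot> h" "T \<cdot> f = S \<cdot> m g h"
    by (rule eq0[of _ U]; use h c1 c2 m1 m2 in \<open>simp add: in_hom\<close>)+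
  note m3 = m[OF m1(1) h(3) t(1)] and m4 = m[OF h(1) m2(1) t(2)]
  show "icomp P (icomp P f g) h = icomp P f (icomp P g h)"
    unfolding icomp_P[OF h(1,2,4)] icomp_P[OF h(2,3,5)] icomp_P[OF m1(1) h(3) t(1)] icomp_P[OF h(1) m2(1) t(2)]
    by (rule eq1[of _ U]) (use h c1 c2 m1 m2 m3 m4 in \<open>simp_all add: in_hom icomp_assoc\<close>)
qed

definition P1 :: "('o, 'm) internal_functor" where
  "P1 = \<lparr>IDom = P, ICod = IDom F, Fun0 = q1, Fun1 = r1\<rparr>"
definition P2 :: "('o, 'm) internal_functor" where
  "P2 = \<lparr>IDom = P, ICod = IDom G, Fun0 = q2, Fun1 = r2\<rparr>"

lemma P12_simps [simp]:
  "IDom P1 = P" "ICod P1 = IDom F" "Fun0 P1 = q1" "Fun1 P1 = r1"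
  "IDom P2 = P" "ICod P2 = IDom G" "Fun0 P2 = q2" "Fun1 P2 = r2"
  by (simp_all add: P1_def P2_def)

lemma IF_P1: "IF P1"
  by (rule is_internal_functorI[OF IC_P, of "IDom F"]) (use m in \<open>simp_all add: in_hom icomp_P\<close>)

lemma IF_P2: "IF P2"
  by (rule is_internal_functorI[OF IC_P, of "IDom G"]) (use m in \<open>simp_all add: in_hom icomp_P\<close>)

lemma mediating:
  assumes H: "IF H" "ICod H = IDom F" and K: "IF K" "ICod K = IDom G" "IDom K = IDom H"
    and eq: "Fun0 F \<cdot> Fun0 H = Fun0 G \<cdot> Fun0 K" "Fun1 F \<cdot> Fun1 H = Fun1 G \<cdot> Fun1 K"
  defines "M \<equiv> \<lparr>IDom = IDom H, ICod = P, Fun0 = pair0 (Fun0 H) (Fun0 K), Fun1 = pair1 (Fun1 H) (Fun1 K)\<rparr>"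
  shows "IF M"
proof -
  have ty0 [simp]: "Fun0 M \<in> Ar V" "Dom V (Fun0 M) = Ob0 (IDom H)" "Cod V (Fun0 M) = pb V (Fun0 F) (Fun0 G)"
    "q1 \<cdot> Fun0 M = Fun0 H" "q2 \<cdot> Fun0 M = Fun0 K"
    and ty1 [simp]: "Fun1 M \<in> Ar V" "Dom V (Fun1 M) = Ob1 (IDom H)" "Cod V (Fun1 M) = pb V (Fun1 F) (Fun1 G)"
    "r1 \<cdot> Fun1 M = Fun1 H" "r2 \<cdot> Fun1 M = Fun1 K"
    using assms by simp_all
  have at0 [simp]: "q1 \<cdot> (Fun0 M \<cdot> u) = Fun0 H \<cdot> u" "q2 \<cdot> (Fun0 M \<cdot> u) = Fun0 K \<cdot> u"
    if "u \<in> Ar V" "Cod V u = Ob0 (IDom H)" for u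
    using that comp_eq_at[OF ty0(4), of u] comp_eq_at[OF ty0(5), of u] by simp_all
  have at1 [simp]: "r1 \<cdot> (Fun1 M \<cdot> u) = Fun1 H \<cdot> u" "r2 \<cdot> (Fun1 M \<cdot> u) = Fun1 K \<cdot> u"
    if "u \<in> Ar V" "Cod V u = Ob1 (IDom H)" for u
    using that comp_eq_at[OF ty1(4), of u] comp_eq_at[OF ty1(5), of u] by simp_all
  have HK: "IF H" "IF K" "ICod H = IDom F" "ICod K = IDom G" "IDom K = IDom H" by fact+
  note K' = IF_simps[OF \<open>IF K\<close>, unfolded \<open>IDom K = IDom H\<close>]
  have st: "S \<cdot> (Fun1 M \<cdot> u) = Fun0 M \<cdot> (Src (IDom H) \<cdot> u)" "T \<cdot> (Fun1 M \<cdot> u) = Fun0 M \<cdot> (Tgt (IDom H) \<cdot> u)"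
    if "u \<in> Ar V" "Cod V u = Ob1 (IDom H)" for u
    by (rule eq0[of _ "Dom V u"]; use that HK K' in \<open>simp add: in_hom\<close>)+
  have d: "IDom M = IDom H" "ICod M = P" by (simp_all add: M_def)
  show ?thesis
  proof (rule is_internal_functorI[OF _ IC_P d])
    show "Src P \<cdot> Fun1 M = Fun0 M \<cdot> Src (IDom H)" "Tgt P \<cdot> Fun1 M = Fun0 M \<cdot> Tgt (IDom H)"
      using st[of "Id V (Ob1 (IDom H))"] HK by simp_all
    show "Fun1 M \<cdot> Idn (IDom H) = Idn P \<cdot> Fun0 M"
      by (rule eq1[of _ "Ob0 (IDom H)"]) (use HK K' in \<open>simp_all add: in_hom\<close>)
    fix U f g assume fg: "f \<in> Hom V U (Ob1 (IDom H))" "g \<in> Hom V U (Ob1 (IDom H))"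
      "Tgt (IDom H) \<cdot> f = Src (IDom H) \<cdot> g"
    have p: "Fun1 M \<cdot> f \<in> Hom V U (pb V (Fun1 F) (Fun1 G))" "Fun1 M \<cdot> g \<in> Hom V U (pb V (Fun1 F) (Fun1 G))"
      "T \<cdot> (Fun1 M \<cdot> f) = S \<cdot> (Fun1 M \<cdot> g)"
      using fg st by (simp_all add: in_hom)
    show "Fun1 M \<cdot> icomp (IDom H) f g = icomp P (Fun1 M \<cdot> f) (Fun1 M \<cdot> g)"
      unfolding icomp_P[OF p]
      by (rule eq1[of _ U]) (use fg m[OF p] HK K' in \<open>simp_all add: in_hom\<close>)
  qed (use HK in \<open>simp_all add: in_hom\<close>)
qed

theorem is_pullback_P: "is_pullback (Cat V) F G (P, P1, P2)"
  unfolding is_pullback_def prod.case Cat_simps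
proof (intro conjI ballI impI)
  show "IC P" by (rule IC_P)
  show "P1 \<in> Hom (Cat V) P (IDom F)" "P2 \<in> Hom (Cat V) P (IDom G)"
    using IF_P1 IF_P2 by (simp_all add: in_Cat_hom)
  show "F \<cdot>\<^bsub>Cat V\<^esub> P1 = G \<cdot>\<^bsub>Cat V\<^esub> P2"
    by (rule internal_functor_eqI) (simp_all add: pb_square)
  fix X H K assume H: "H \<in> Hom (Cat V) X (IDom F)" and K: "K \<in> Hom (Cat V) X (IDom G)"
    and eq: "F \<cdot>\<^bsub>Cat V\<^esub> H = G \<cdot>\<^bsub>Cat V\<^esub> K"
  have HK: "IF H" "IF K" "ICod H = IDom F" "ICod K = IDom G" "IDom H = X" "IDom K = X"
    using H K by (simp_all add: in_Cat_hom)
  have e: "Fun0 F \<cdot> Fun0 H = Fun0 G \<cdot> Fun0 K" "Fun1 F \<cdot> Fun1 H = Fun1 G \<cdot> Fun1 K"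
    using arg_cong[OF eq, of Fun0] arg_cong[OF eq, of Fun1] by simp_all
  let ?M = "\<lparr>IDom = IDom H, ICod = P, Fun0 = pair0 (Fun0 H) (Fun0 K), Fun1 = pair1 (Fun1 H) (Fun1 K)\<rparr>"
  note K' = IF_simps[OF HK(2), unfolded HK(6)]
  show "\<exists>!M. M \<in> Hom (Cat V) X P \<and> P1 \<cdot>\<^bsub>Cat V\<^esub> M = H \<and> P2 \<cdot>\<^bsub>Cat V\<^esub> M = K"
  proof (rule ex1I[of _ ?M])
    have "IF ?M" by (rule mediating) (use HK e in auto)
    then show "?M \<in> Hom (Cat V) X P \<and> P1 \<cdot>\<^bsub>Cat V\<^esub> ?M = H \<and> P2 \<cdot>\<^bsub>Cat V\<^esub> ?M = K"
      using HK e K' by (auto simp: in_Cat_hom intro!: internal_functor_eqI)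
    fix M assume M: "M \<in> Hom (Cat V) X P \<and> P1 \<cdot>\<^bsub>Cat V\<^esub> M = H \<and> P2 \<cdot>\<^bsub>Cat V\<^esub> M = K"
    then have M': "IF M" "IDom M = X" "ICod M = P" by (simp_all add: in_Cat_hom)
    have c: "Fun0 H = q1 \<cdot> Fun0 M" "Fun0 K = q2 \<cdot> Fun0 M" "Fun1 H = r1 \<cdot> Fun1 M" "Fun1 K = r2 \<cdot> Fun1 M"
      using M by auto
    show "M = ?M"
      by (rule internal_functor_eqI) (use M' HK(5) in \<open>simp_all add: c pb_pair_eta\<close>)
  qed
qed

end

subsection \<open>Terminal object and products\<close>

context lex
begin

lemma IC_int_one: "IC (int_one V)"
proof (rule is_internal_categoryI)
  let ?t = "terminal V"
  have eq: "f = g" if "f \<in> Hom V U ?t" "g \<in> Hom V U ?t" for f g U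
    using is_terminal_unique[OF terminal that] .
  show g: "internal_graph (int_one V)"
    by (simp add: internal_graph_def int_one_def Let_def in_hom)
  note ty = graph_simps[OF g]
  have [simp]: "Ob0 (int_one V) = ?t" "Ob1 (int_one V) = ?t" by (simp_all add: int_one_def Let_def)
  show "Src (int_one V) \<cdot> Idn (int_one V) = Id V (Ob0 (int_one V))"
    "Tgt (int_one V) \<cdot> Idn (int_one V) = Id V (Ob0 (int_one V))"
    by (rule eq[of _ ?t]; use ty in \<open>simp add: in_hom\<close>)+
  note ic = icomp_graph[OF g]
  fix U f g h assume f: "f \<in> Hom V U (Ob1 (int_one V))"
  show "icomp (int_one V) (Idn (int_one V) \<cdot> (Src (int_one V) \<cdot> f)) f = f"
    "icomp (int_one V) f (Idn (int_one V) \<cdot> (Tgt (int_one V) \<cdot> f)) = f"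
    by (rule eq[of _ U]; use f ty ic eq[of _ U] in \<open>simp add: in_hom\<close>)+
  assume g: "g \<in> Hom V U (Ob1 (int_one V))"
  show "Src (int_one V) \<cdot> icomp (int_one V) f g = Src (int_one V) \<cdot> f \<and>
      Tgt (int_one V) \<cdot> icomp (int_one V) f g = Tgt (int_one V) \<cdot> g"
    by (intro conjI; rule eq[of _ U]; use f g ty ic eq[of _ U] in \<open>simp add: in_hom\<close>)
  assume h: "h \<in> Hom V U (Ob1 (int_one V))"
  show "icomp (int_one V) (icomp (int_one V) f g) h = icomp (int_one V) f (icomp (int_one V) g h)"
    by (rule eq[of _ U]; use f g h ty ic eq[of _ U] in \<open>simp add: in_hom\<close>)
qed

lemma int_one_simps [simp]: "Ob0 (int_one V) = terminal V" "Ob1 (int_one V) = terminal V"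
  by (simp_all add: int_one_def Let_def)

lemma terminal_eq: "f \<in> Ar V \<Longrightarrow> g \<in> Ar V \<Longrightarrow> Dom V f = Dom V g \<Longrightarrow> Cod V f = terminal V \<Longrightarrow>
    Cod V g = terminal V \<Longrightarrow> f = g"
  using is_terminal_unique[OF terminal] by (simp add: in_hom)

lemma is_terminal_int_one: "is_terminal (Cat V) (int_one V)"
  unfolding is_terminal_def Cat_simps
proof (intro conjI ballI)
  show "IC (int_one V)" by (rule IC_int_one)
  fix A assume "A \<in> Ob (Cat V)"
  then have A: "IC A" by simp
  note [simp] = IC_simps[OF IC_int_one, simplified]
  let ?B = "\<lparr>IDom = A, ICod = int_one V, Fun0 = bang V (Ob0 A), Fun1 = bang V (Ob1 A)\<rparr>"
  have "IF ?B"
  proof (rule is_internal_functorI[OF A IC_int_one])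
    show "Fun1 ?B \<cdot> icomp A f g = icomp (int_one V) (Fun1 ?B \<cdot> f) (Fun1 ?B \<cdot> g)"
      if "f \<in> Hom V U (Ob1 A)" "g \<in> Hom V U (Ob1 A)" "Tgt A \<cdot> f = Src A \<cdot> g" for f g U
    proof -
      have "U \<in> Ob V" using that hom_Ob by blast
      moreover from this have "Tgt (int_one V) \<cdot> bang V U = Src (int_one V) \<cdot> bang V U"
        by (intro terminal_eq) (simp_all add: IC_int_one)
      ultimately show ?thesis
        by (intro terminal_eq) (use that A IC_int_one in \<open>simp_all add: in_hom\<close>)
    qed
  qed (use A in \<open>auto simp: in_hom intro!: terminal_eq\<close>)
  then show "\<exists>!F. F \<in> Hom (Cat V) A (int_one V)"
  proof (intro ex1I[of _ ?B])
    fix F assume "F \<in> Hom (Cat V) A (int_one V)"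
    then have F: "IF F" "IDom F = A" "ICod F = int_one V" by (simp_all add: in_Cat_hom)
    show "F = ?B"
      by (rule internal_functor_eqI) (use F A in \<open>auto intro!: terminal_eq\<close>)
  qed (simp add: in_Cat_hom)
qed

lemma Cat_lex: "lex (Cat V)"
proof
  show "\<exists>t. is_terminal (Cat V) t" using is_terminal_int_one by blast
  have pb: "\<exists>p. is_pullback (Cat V) F G p" if "IF F" "IF G" "ICod F = ICod G" for F G
  proof -
    interpret cospan V F G using that by unfold_locales
    show ?thesis using is_pullback_P by blast
  qed
  then show "has_pullbacks (Cat V)" by (simp add: has_pullbacks_def)
  fix A B assume AB: "A \<in> Ob (Cat V)" "B \<in> Ob (Cat V)"
  obtain F G where F: "F \<in> Hom (Cat V) A (int_one V)" and G: "G \<in> Hom (Cat V) B (int_one V)"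
    using is_terminal_int_one AB by (metis is_terminal_def)
  obtain p p1 p2 where "is_pullback (Cat V) F G (p, p1, p2)"
    using pb[of F G] F G by (auto simp: in_Cat_hom)
  then have "is_product (Cat V) A B (p, p1, p2)"
    using Cat_cat.is_product_iff_is_pullback[OF is_terminal_int_one F G] by blast
  then show "\<exists>p. is_product (Cat V) A B p" by blast
qed

lemma Fun_iso:
  assumes "is_iso (Cat V) E" "E \<in> Hom (Cat V) A B"
  shows "is_iso V (Fun0 E)" "is_iso V (Fun1 E)"
proof -
  note i = Cat_cat.inv_arr[OF assms]
  let ?I = "inv_arr (Cat V) E"
  have e: "IF E" "IDom E = A" "ICod E = B" "IF ?I" "IDom ?I = B" "ICod ?I = A"
    using assms(2) i(1) by (simp_all add: in_Cat_hom)
  have c: "Fun0 ?I \<cdot> Fun0 E = Id V (Ob0 A)" "Fun0 E \<cdot> Fun0 ?I = Id V (Ob0 B)"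
    "Fun1 ?I \<cdot> Fun1 E = Id V (Ob1 A)" "Fun1 E \<cdot> Fun1 ?I = Id V (Ob1 B)"
    using arg_cong[OF i(2), of Fun0] arg_cong[OF i(3), of Fun0] arg_cong[OF i(2), of Fun1] arg_cong[OF i(3), of Fun1]
    by simp_all
  show "is_iso V (Fun0 E)" "is_iso V (Fun1 E)"
    using is_isoI[OF _ _ c(1,2)] is_isoI[OF _ _ c(3,4)] e by (auto simp: in_hom)
qed

text \<open>Whatever product is chosen, its generalised objects and arrows are the pairs of generalised
  objects and arrows of the factors.\<close>

lemma product_Fun:
  assumes p: "is_product (Cat V) A B (P, P1, P2)" and AB: "IC A" "IC B"
  shows "is_product V (Ob0 A) (Ob0 B) (Ob0 P, Fun0 P1, Fun0 P2)"
    "is_product V (Ob1 A) (Ob1 B) (Ob1 P, Fun1 P1, Fun1 P2)"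
proof -
  obtain F G where F: "F \<in> Hom (Cat V) A (int_one V)" and G: "G \<in> Hom (Cat V) B (int_one V)"
    using is_terminal_int_one AB by (metis is_terminal_def Cat_simps(1))
  have FG: "IF F" "IF G" "IDom F = A" "IDom G = B" "ICod F = int_one V" "ICod G = int_one V"
    using F G by (simp_all add: in_Cat_hom)
  interpret Q: cospan V F G using FG by unfold_locales auto
  have "is_pullback (Cat V) F G (P, P1, P2)"
    using Cat_cat.is_product_iff_is_pullback[OF is_terminal_int_one F G] p by blast
  then obtain E where E: "E \<in> Hom (Cat V) P Q.P" "is_iso (Cat V) E" "Q.P1 \<cdot>\<^bsub>Cat V\<^esub> E = P1" "Q.P2 \<cdot>\<^bsub>Cat V\<^esub> E = P2"
    using Cat_cat.is_pullback_iso_unique[OF _ Q.is_pullback_P] FG by (metis Cat_simps(2))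
  have E': "IF E" "IDom E = P" "ICod E = Q.P" using E(1) by (simp_all add: in_Cat_hom)
  have P12: "Fun0 P1 = Q.q1 \<cdot> Fun0 E" "Fun0 P2 = Q.q2 \<cdot> Fun0 E"
    "Fun1 P1 = Q.r1 \<cdot> Fun1 E" "Fun1 P2 = Q.r2 \<cdot> Fun1 E"
    using E(3,4) by auto
  have t: "Fun0 F \<in> Hom V (Ob0 A) (terminal V)" "Fun0 G \<in> Hom V (Ob0 B) (terminal V)"
    "Fun1 F \<in> Hom V (Ob1 A) (terminal V)" "Fun1 G \<in> Hom V (Ob1 B) (terminal V)"
    using FG IF_simps[OF FG(1)] IF_simps[OF FG(2)] by (simp_all add: in_hom)
  have "is_pullback V (Fun0 F) (Fun0 G) (Ob0 P, Fun0 P1, Fun0 P2)"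
    unfolding P12
    by (rule is_pullback_transport[OF pullback_chosen]) (use t E' Fun_iso[OF E(2,1)] in \<open>simp_all add: in_hom\<close>)
  then show "is_product V (Ob0 A) (Ob0 B) (Ob0 P, Fun0 P1, Fun0 P2)"
    using is_product_iff_is_pullback[OF terminal t(1,2)] by blast
  have "is_pullback V (Fun1 F) (Fun1 G) (Ob1 P, Fun1 P1, Fun1 P2)"
    unfolding P12
    by (rule is_pullback_transport[OF pullback_chosen]) (use t E' Fun_iso[OF E(2,1)] in \<open>simp_all add: in_hom\<close>)
  then show "is_product V (Ob1 A) (Ob1 B) (Ob1 P, Fun1 P1, Fun1 P2)"
    using is_product_iff_is_pullback[OF terminal t(3,4)] by blast
qed

end

section \<open>Internal categories glued from a family\<close>

context cat
begin

lemma extensive_at_coproduct: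
  "extensive_at I \<Longrightarrow> (\<And>i. i \<in> I \<Longrightarrow> X i \<in> Ob V) \<Longrightarrow> is_coproduct V I X (coprd V I X, coprd_in V I X)"
  unfolding extensive_at_def by (metis is_coproduct_chosen)

end

text \<open>Both the internal category of an enriched category and the internal category of elements of a
  presheaf arise by summing a family of objects \<open>X0\<close> and a matrix of objects \<open>X1\<close> that carries the
  structure of a category with several objects: \<open>X2 (a, b, d)\<close> are the composable pairs.\<close>

locale family = lex V for V :: "('o, 'm) category" (structure) +
  fixes I :: "'k set" and X0 :: "'k \<Rightarrow> 'o" and X1 :: "'k \<times> 'k \<Rightarrow> 'o" and X2 :: "'k \<times> 'k \<times> 'k \<Rightarrow> 'o"
    and sf tf :: "'k \<Rightarrow> 'k \<Rightarrow> 'm" and idf :: "'k \<Rightarrow> 'm" and p1f p2f cf :: "'k \<Rightarrow> 'k \<Rightarrow> 'k \<Rightarrow> 'm"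
  assumes ext0: "extensive_at I" and ext1: "extensive_at (I \<times> I)" and ext2: "extensive_at (I \<times> I \<times> I)"
    and sf: "a \<in> I \<Longrightarrow> b \<in> I \<Longrightarrow> sf a b \<in> Hom V (X1 (a, b)) (X0 a)"
    and tf: "a \<in> I \<Longrightarrow> b \<in> I \<Longrightarrow> tf a b \<in> Hom V (X1 (a, b)) (X0 b)"
    and idf: "a \<in> I \<Longrightarrow> idf a \<in> Hom V (X0 a) (X1 (a, a))"
    and s_idf: "a \<in> I \<Longrightarrow> sf a a \<cdot> idf a = Id V (X0 a)" and t_idf: "a \<in> I \<Longrightarrow> tf a a \<cdot> idf a = Id V (X0 a)"
    and X2: "a \<in> I \<Longrightarrow> b \<in> I \<Longrightarrow> d \<in> I \<Longrightarrow> is_pullback V (tf a b) (sf b d) (X2 (a, b, d), p1f a b d, p2f a b d)"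
    and cf: "a \<in> I \<Longrightarrow> b \<in> I \<Longrightarrow> d \<in> I \<Longrightarrow> cf a b d \<in> Hom V (X2 (a, b, d)) (X1 (a, d))"
    and s_cf: "a \<in> I \<Longrightarrow> b \<in> I \<Longrightarrow> d \<in> I \<Longrightarrow> sf a d \<cdot> cf a b d = sf a b \<cdot> p1f a b d"
    and t_cf: "a \<in> I \<Longrightarrow> b \<in> I \<Longrightarrow> d \<in> I \<Longrightarrow> tf a d \<cdot> cf a b d = tf b d \<cdot> p2f a b d"
    and unit_l: "a \<in> I \<Longrightarrow> b \<in> I \<Longrightarrow> f \<in> Hom V U (X1 (a, b)) \<Longrightarrow> w \<in> Hom V U (X2 (a, a, b)) \<Longrightarrow>
      p1f a a b \<cdot> w = idf a \<cdot> (sf a b \<cdot> f) \<Longrightarrow> p2f a a b \<cdot> w = f \<Longrightarrow> cf a a b \<cdot> w = f"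
    and unit_r: "a \<in> I \<Longrightarrow> b \<in> I \<Longrightarrow> f \<in> Hom V U (X1 (a, b)) \<Longrightarrow> w \<in> Hom V U (X2 (a, b, b)) \<Longrightarrow>
      p1f a b b \<cdot> w = f \<Longrightarrow> p2f a b b \<cdot> w = idf b \<cdot> (tf a b \<cdot> f) \<Longrightarrow> cf a b b \<cdot> w = f"
    and assoc_f: "a \<in> I \<Longrightarrow> b \<in> I \<Longrightarrow> d \<in> I \<Longrightarrow> e \<in> I \<Longrightarrow>
      w1 \<in> Hom V U (X2 (a, b, d)) \<Longrightarrow> w2 \<in> Hom V U (X2 (a, d, e)) \<Longrightarrow>
      w3 \<in> Hom V U (X2 (b, d, e)) \<Longrightarrow> w4 \<in> Hom V U (X2 (a, b, e)) \<Longrightarrow>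
      p1f a d e \<cdot> w2 = cf a b d \<cdot> w1 \<Longrightarrow> p2f a d e \<cdot> w2 = p2f b d e \<cdot> w3 \<Longrightarrow> p1f b d e \<cdot> w3 = p2f a b d \<cdot> w1 \<Longrightarrow>
      p1f a b e \<cdot> w4 = p1f a b d \<cdot> w1 \<Longrightarrow> p2f a b e \<cdot> w4 = cf b d e \<cdot> w3 \<Longrightarrow>
      cf a d e \<cdot> w2 = cf a b e \<cdot> w4"
begin

definition A0 :: 'o where "A0 = coprd V I X0"
definition A1 :: 'o where "A1 = coprd V (I \<times> I) X1"
definition in0 :: "'k \<Rightarrow> 'm" where "in0 = coprd_in V I X0"
definition in1 :: "'k \<times> 'k \<Rightarrow> 'm" where "in1 = coprd_in V (I \<times> I) X1"
definition in2 :: "'k \<times> 'k \<times> 'k \<Rightarrow> 'm" where "in2 = coprd_in V (I \<times> I \<times> I) X2"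
definition s :: 'm where "s = cotuple V (I \<times> I) X1 A0 (\<lambda>(a, b). in0 a \<cdot> sf a b)"
definition t :: 'm where "t = cotuple V (I \<times> I) X1 A0 (\<lambda>(a, b). in0 b \<cdot> tf a b)"
definition comparison :: 'm where
  "comparison = cotuple V (I \<times> I \<times> I) X2 (pb V t s) (\<lambda>(a, b, d).
     pb_pair V t s (in1 (a, b) \<cdot> p1f a b d) (in1 (b, d) \<cdot> p2f a b d))"

definition glued :: "('o, 'm) internal_category" where
  "glued = \<lparr>Ob0 = A0, Ob1 = A1, Src = s, Tgt = t, Idn = cotuple V I X0 A1 (\<lambda>a. in1 (a, a) \<cdot> idf a),
     Cmpn = cotuple V (I \<times> I \<times> I) X2 A1 (\<lambda>(a, b, d). in1 (a, d) \<cdot> cf a b d) \<cdot> inv_arr V comparison\<rparr>"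

lemma ty [simp]:
  assumes "a \<in> I" "b \<in> I"
  shows "X0 a \<in> Ob V" "X1 (a, b) \<in> Ob V" "sf a b \<in> Ar V" "Dom V (sf a b) = X1 (a, b)" "Cod V (sf a b) = X0 a"
    "tf a b \<in> Ar V" "Dom V (tf a b) = X1 (a, b)" "Cod V (tf a b) = X0 b"
    "idf a \<in> Ar V" "Dom V (idf a) = X0 a" "Cod V (idf a) = X1 (a, a)"
  using assms sf[OF assms] tf[OF assms] idf[OF assms(1)] hom_Ob[OF sf[OF assms]] by (auto simp: in_hom)

lemma ty2 [simp]:
  assumes "a \<in> I" "b \<in> I" "d \<in> I"
  shows "X2 (a, b, d) \<in> Ob V" "p1f a b d \<in> Ar V" "Dom V (p1f a b d) = X2 (a, b, d)" "Cod V (p1f a b d) = X1 (a, b)"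
    "p2f a b d \<in> Ar V" "Dom V (p2f a b d) = X2 (a, b, d)" "Cod V (p2f a b d) = X1 (b, d)"
    "cf a b d \<in> Ar V" "Dom V (cf a b d) = X2 (a, b, d)" "Cod V (cf a b d) = X1 (a, d)"
  using assms is_pullbackD(1-3)[OF X2[OF assms]] cf[OF assms] by (auto simp: in_hom)

lemma c0: "is_coproduct V I X0 (A0, in0)"
  unfolding A0_def in0_def by (rule extensive_at_coproduct[OF ext0]) auto

lemma c1: "is_coproduct V (I \<times> I) X1 (A1, in1)"
  unfolding A1_def in1_def by (rule extensive_at_coproduct[OF ext1]) auto

lemma c2: "is_coproduct V (I \<times> I \<times> I) X2 (coprd V (I \<times> I \<times> I) X2, in2)"
  unfolding in2_def by (rule extensive_at_coproduct[OF ext2]) auto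

lemma in_simps [simp]:
  "A0 \<in> Ob V" "A1 \<in> Ob V"
  "a \<in> I \<Longrightarrow> in0 a \<in> Ar V" "a \<in> I \<Longrightarrow> Dom V (in0 a) = X0 a" "a \<in> I \<Longrightarrow> Cod V (in0 a) = A0"
  "a \<in> I \<Longrightarrow> b \<in> I \<Longrightarrow> in1 (a, b) \<in> Ar V" "a \<in> I \<Longrightarrow> b \<in> I \<Longrightarrow> Dom V (in1 (a, b)) = X1 (a, b)"
  "a \<in> I \<Longrightarrow> b \<in> I \<Longrightarrow> Cod V (in1 (a, b)) = A1"
  "a \<in> I \<Longrightarrow> b \<in> I \<Longrightarrow> d \<in> I \<Longrightarrow> in2 (a, b, d) \<in> Ar V"
  "a \<in> I \<Longrightarrow> b \<in> I \<Longrightarrow> d \<in> I \<Longrightarrow> Dom V (in2 (a, b, d)) = X2 (a, b, d)"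
  "a \<in> I \<Longrightarrow> b \<in> I \<Longrightarrow> d \<in> I \<Longrightarrow> Cod V (in2 (a, b, d)) = coprd V (I \<times> I \<times> I) X2"
  using is_coproductD(1,2)[OF c0] is_coproductD(1,2)[OF c1] is_coproductD(1,2)[OF c2] by (auto simp: in_hom)

lemma st [simp]:
  "s \<in> Ar V" "Dom V s = A1" "Cod V s = A0" "t \<in> Ar V" "Dom V t = A1" "Cod V t = A0"
  "a \<in> I \<Longrightarrow> b \<in> I \<Longrightarrow> s \<cdot> in1 (a, b) = in0 a \<cdot> sf a b" "a \<in> I \<Longrightarrow> b \<in> I \<Longrightarrow> t \<cdot> in1 (a, b) = in0 b \<cdot> tf a b"
proof -
  note c = cotuple[OF c1[unfolded A1_def in1_def], where y = A0]
  have f: "(case i of (a, b) \<Rightarrow> in0 a \<cdot> sf a b) \<in> Hom V (X1 i) A0"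
    "(case i of (a, b) \<Rightarrow> in0 b \<cdot> tf a b) \<in> Hom V (X1 i) A0" if "i \<in> I \<times> I" for i
    using that by (auto simp: in_hom)
  have "s \<in> Hom V A1 A0" "t \<in> Hom V A1 A0"
    unfolding s_def t_def A1_def using c(1)[OF _ f(1)] c(1)[OF _ f(2)] by auto
  then show "s \<in> Ar V" "Dom V s = A1" "Cod V s = A0" "t \<in> Ar V" "Dom V t = A1" "Cod V t = A0"
    by (auto simp: in_hom)
  show "a \<in> I \<Longrightarrow> b \<in> I \<Longrightarrow> s \<cdot> in1 (a, b) = in0 a \<cdot> sf a b"
    "a \<in> I \<Longrightarrow> b \<in> I \<Longrightarrow> t \<cdot> in1 (a, b) = in0 b \<cdot> tf a b"
    unfolding s_def t_def in1_def using c(2)[OF _ f(1), of "(a, b)"] c(2)[OF _ f(2), of "(a, b)"] by auto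
qed

lemma st_at [simp]:
  assumes "a \<in> I" "b \<in> I" "u \<in> Ar V" "Cod V u = X1 (a, b)"
  shows "s \<cdot> (in1 (a, b) \<cdot> u) = in0 a \<cdot> (sf a b \<cdot> u)" "t \<cdot> (in1 (a, b) \<cdot> u) = in0 b \<cdot> (tf a b \<cdot> u)"
  using assms comp_eq_at[OF st(7), of a b u] comp_eq_at[OF st(8), of a b u] by simp_all

lemma p_square [simp]:
  assumes "a \<in> I" "b \<in> I" "d \<in> I"
  shows "tf a b \<cdot> p1f a b d = sf b d \<cdot> p2f a b d"
    "u \<in> Ar V \<Longrightarrow> Cod V u = X2 (a, b, d) \<Longrightarrow> tf a b \<cdot> (p1f a b d \<cdot> u) = sf b d \<cdot> (p2f a b d \<cdot> u)"
proof -
  show e: "tf a b \<cdot> p1f a b d = sf b d \<cdot> p2f a b d" using is_pullbackD(4)[OF X2[OF assms]] .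
  show "tf a b \<cdot> (p1f a b d \<cdot> u) = sf b d \<cdot> (p2f a b d \<cdot> u)" if "u \<in> Ar V" "Cod V u = X2 (a, b, d)"
    using comp_eq_at[OF e, of u] that assms by simp
qed

lemma comparison:
  "comparison \<in> Hom V (coprd V (I \<times> I \<times> I) X2) (pb V t s)"
  "a \<in> I \<Longrightarrow> b \<in> I \<Longrightarrow> d \<in> I \<Longrightarrow> comparison \<cdot> in2 (a, b, d) =
     pb_pair V t s (in1 (a, b) \<cdot> p1f a b d) (in1 (b, d) \<cdot> p2f a b d)"
proof -
  let ?f = "\<lambda>(a, b, d). pb_pair V t s (in1 (a, b) \<cdot> p1f a b d) (in1 (b, d) \<cdot> p2f a b d)"
  have "?f i \<in> Hom V (X2 i) (pb V t s)" if "i \<in> I \<times> I \<times> I" for i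
    using that by (auto simp: in_hom)
  note c = cotuple[OF c2[unfolded in2_def], where y = "pb V t s" and f = ?f, OF _ this]
  show "comparison \<in> Hom V (coprd V (I \<times> I \<times> I) X2) (pb V t s)"
    unfolding comparison_def by (rule c(1)) simp
  show "a \<in> I \<Longrightarrow> b \<in> I \<Longrightarrow> d \<in> I \<Longrightarrow> comparison \<cdot> in2 (a, b, d) =
     pb_pair V t s (in1 (a, b) \<cdot> p1f a b d) (in1 (b, d) \<cdot> p2f a b d)"
    unfolding comparison_def in2_def using c(2)[where i = "(a, b, d)"] by simp
qed

lemma comparison_simps [simp]:
  "comparison \<in> Ar V" "Dom V comparison = coprd V (I \<times> I \<times> I) X2" "Cod V comparison = pb V t s"
  using comparison(1) by (auto simp: in_hom)

lemma comparison_at: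
  assumes "a \<in> I" "b \<in> I" "d \<in> I" "u \<in> Ar V" "Cod V u = X2 (a, b, d)"
  shows "comparison \<cdot> (in2 (a, b, d) \<cdot> u) = pb_pair V t s (in1 (a, b) \<cdot> (p1f a b d \<cdot> u)) (in1 (b, d) \<cdot> (p2f a b d \<cdot> u))"
  using assms comp_eq_at[OF comparison(2)[OF assms(1-3)], of u] by (simp add: pb_pair_comp)

text \<open>Locally, composable pairs in the glued category are composable pairs in the family: two arrows
  from non-matching rows and columns can only be composed at an initial stage.\<close>

lemma composable_pieces:
  assumes ab: "a \<in> I" "b \<in> I" "b' \<in> I" "d \<in> I"
    and f: "f \<in> Hom V W (X1 (a, b))" and g: "g \<in> Hom V W (X1 (b', d))"
    and eq: "t \<cdot> (in1 (a, b) \<cdot> f) = s \<cdot> (in1 (b', d) \<cdot> g)"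
  shows "is_initial V W \<or> b = b' \<and> (\<exists>x. x \<in> Hom V W (X2 (a, b, d)) \<and> p1f a b d \<cdot> x = f \<and> p2f a b d \<cdot> x = g)"
proof -
  have e: "in0 b \<cdot> (tf a b \<cdot> f) = in0 b' \<cdot> (sf b' d \<cdot> g)"
    using eq ab f g by (simp add: in_hom)
  have h: "tf a b \<cdot> f \<in> Hom V W (X0 b)" "sf b' d \<cdot> g \<in> Hom V W (X0 b')"
    using ab f g by (simp_all add: in_hom)
  show ?thesis
  proof (cases "b = b'")
    case True
    then have "tf a b \<cdot> f = sf b d \<cdot> g"
      using summand_eq[OF ext0 c0 ab(2) h(1) _ e[folded True]] h by simp
    then show ?thesis
      using is_pullbackD(5)[OF X2[OF ab(1,2,4)], of f W g] ab f g True by simp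
  next
    case False
    then show ?thesis using summand_disjoint[OF ext0 c0 ab(2,3) False h e] by blast
  qed
qed

lemma local_composable:
  assumes f: "f \<in> Hom V U A1" and g: "g \<in> Hom V U A1" and fg: "t \<cdot> f = s \<cdot> g"
    and hk: "h \<in> Hom V U Y" "k \<in> Hom V U Y"
    and step: "\<And>W w a b d x. a \<in> I \<Longrightarrow> b \<in> I \<Longrightarrow> d \<in> I \<Longrightarrow> w \<in> Hom V W U \<Longrightarrow> x \<in> Hom V W (X2 (a, b, d)) \<Longrightarrow>
      f \<cdot> w = in1 (a, b) \<cdot> (p1f a b d \<cdot> x) \<Longrightarrow> g \<cdot> w = in1 (b, d) \<cdot> (p2f a b d \<cdot> x) \<Longrightarrow> h \<cdot> w = k \<cdot> w"
  shows "h = k"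
proof (rule local_eq[OF ext1 c1 f hk])
  fix W w i v assume i: "i \<in> I \<times> I" and w: "w \<in> Hom V W U" and v: "v \<in> Hom V W (X1 i)" and fw: "f \<cdot> w = in1 i \<cdot> v"
  show "h \<cdot> w = k \<cdot> w"
  proof (rule local_eq[OF ext1 c1 comp_hom[OF w g] comp_hom[OF w hk(1)] comp_hom[OF w hk(2)]])
    fix W' w' i' v' assume i': "i' \<in> I \<times> I" and w': "w' \<in> Hom V W' W" and v': "v' \<in> Hom V W' (X1 i')"
      and gw: "(g \<cdot> w) \<cdot> w' = in1 i' \<cdot> v'"
    obtain a b b' d where ii: "i = (a, b)" "i' = (b', d)" "a \<in> I" "b \<in> I" "b' \<in> I" "d \<in> I" using i i' by auto
    have ww: "w \<cdot> w' \<in> Hom V W' U" using w w' comp_hom by blast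
    have fw': "f \<cdot> (w \<cdot> w') = in1 (a, b) \<cdot> (v \<cdot> w')"
      using comp_eq_at[OF fw, of w'] ii f w w' v by (simp add: in_hom)
    have gw': "g \<cdot> (w \<cdot> w') = in1 (b', d) \<cdot> v'" using gw ii g w w' by (simp add: in_hom)
    have "t \<cdot> (f \<cdot> (w \<cdot> w')) = s \<cdot> (g \<cdot> (w \<cdot> w'))"
      using comp_eq_at[OF fg, of "w \<cdot> w'"] f g ww by (simp add: in_hom)
    then have "t \<cdot> (in1 (a, b) \<cdot> (v \<cdot> w')) = s \<cdot> (in1 (b', d) \<cdot> v')" by (simp only: fw' gw')
    from composable_pieces[OF ii(3-6) _ _ this, of W'] v v' w' ii
    have "is_initial V W' \<or> b = b' \<and> (\<exists>x. x \<in> Hom V W' (X2 (a, b, d)) \<and> p1f a b d \<cdot> x = v \<cdot> w' \<and> p2f a b d \<cdot> x = v')"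
      by (auto simp: in_hom)
    then have "h \<cdot> (w \<cdot> w') = k \<cdot> (w \<cdot> w')"
      using is_initial_unique[OF _ comp_hom[OF ww hk(1)] comp_hom[OF ww hk(2)]]
        step[OF ii(3,4,6) ww] fw' gw' by metis
    then show "(h \<cdot> w) \<cdot> w' = (k \<cdot> w) \<cdot> w'" using hk w w' by (simp add: in_hom)
  qed
qed

text \<open>Bijectivity on elements. An element of the pullback is a composable pair, which locally lies in
  two entries of the matrix and is lifted there; the local lifts glue. For uniqueness, the two
  entries determine the index triple, and the pair determines the element of \<open>X2\<close>.\<close>

lemma comparison_iso: "is_iso V comparison"
  unfolding is_iso_iff_bij_elements[OF comparison(1)]
proof (intro ballI ex_ex1I)
  fix U v assume v: "v \<in> Hom V U (pb V t s)"
  let ?f = "pb1 V t s \<cdot> v" and ?g = "pb2 V t s \<cdot> v"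
  have f: "?f \<in> Hom V U A1" and g: "?g \<in> Hom V U A1" and fg: "t \<cdot> ?f = s \<cdot> ?g"
    using v pb_square_at[of t s v] by (simp_all add: in_hom)
  have "\<exists>u. u \<in> Hom V U (coprd V (I \<times> I \<times> I) X2) \<and> comparison \<cdot> u = v \<and> comparison \<cdot> u = v"
  proof (rule local_lift[OF ext1 c1 f comparison(1) v comparison(1) v])
    fix W w i x assume i: "i \<in> I \<times> I" and w: "w \<in> Hom V W U" and x: "x \<in> Hom V W (X1 i)" and fw: "?f \<cdot> w = in1 i \<cdot> x"
    show "\<exists>a. a \<in> Hom V W (coprd V (I \<times> I \<times> I) X2) \<and> comparison \<cdot> a = v \<cdot> w \<and> comparison \<cdot> a = v \<cdot> w"
    proof (rule local_lift[OF ext1 c1 comp_hom[OF w g] comparison(1) comp_hom[OF w v] comparison(1) comp_hom[OF w v]])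
      fix W' w' i' x' assume i': "i' \<in> I \<times> I" and w': "w' \<in> Hom V W' W" and x': "x' \<in> Hom V W' (X1 i')"
        and gw: "(?g \<cdot> w) \<cdot> w' = in1 i' \<cdot> x'"
      obtain a b b' d where ii: "i = (a, b)" "i' = (b', d)" "a \<in> I" "b \<in> I" "b' \<in> I" "d \<in> I" using i i' by auto
      let ?z = "(v \<cdot> w) \<cdot> w'"
      have z: "?z \<in> Hom V W' (pb V t s)" using v w w' comp_hom by blast
      have fz: "pb1 V t s \<cdot> ?z = in1 (a, b) \<cdot> (x \<cdot> w')"
        using comp_eq_at[OF fw, of w'] ii v w w' x by (simp add: in_hom)
      have gz: "pb2 V t s \<cdot> ?z = in1 (b', d) \<cdot> x'" using gw ii v w w' by (simp add: in_hom)
      have "t \<cdot> (pb1 V t s \<cdot> ?z) = s \<cdot> (pb2 V t s \<cdot> ?z)"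
        using z by (intro pb_square_at) (auto simp: in_hom)
      then have "t \<cdot> (in1 (a, b) \<cdot> (x \<cdot> w')) = s \<cdot> (in1 (b', d) \<cdot> x')" by (simp only: fz gz)
      from composable_pieces[OF ii(3-6) _ _ this, of W'] x x' w' ii
      consider "is_initial V W'" | y where "b = b'" "y \<in> Hom V W' (X2 (a, b, d))" "p1f a b d \<cdot> y = x \<cdot> w'" "p2f a b d \<cdot> y = x'"
        by (auto simp: in_hom)
      then have "\<exists>a. a \<in> Hom V W' (coprd V (I \<times> I \<times> I) X2) \<and> comparison \<cdot> a = ?z"
      proof cases
        case 1
        obtain a where a: "a \<in> Hom V W' (coprd V (I \<times> I \<times> I) X2)"
          using is_initial_ex[OF 1] is_coproductD(1)[OF c2] by blast
        then show ?thesis using is_initial_unique[OF 1 _ z] comp_hom comparison(1) by blast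
      next
        case 2
        have "comparison \<cdot> (in2 (a, b, d) \<cdot> y) = pb_pair V t s (pb1 V t s \<cdot> ?z) (pb2 V t s \<cdot> ?z)"
          using comparison_at[OF ii(3,4,6), of y] 2 by (simp only: fz gz) (simp add: in_hom)
        also have "\<dots> = ?z" by (rule pb_pair_eta) (use z in \<open>simp_all add: in_hom\<close>)
        finally show ?thesis using 2 ii by (intro exI[of _ "in2 (a, b, d) \<cdot> y"]) (simp add: in_hom)
      qed
      then show "\<exists>a. a \<in> Hom V W' (coprd V (I \<times> I \<times> I) X2) \<and> comparison \<cdot> a = (v \<cdot> w) \<cdot> w' \<and> comparison \<cdot> a = (v \<cdot> w) \<cdot> w'"
        by blast
    qed
  qed
  then show "\<exists>u. u \<in> Hom V U (coprd V (I \<times> I \<times> I) X2) \<and> comparison \<cdot> u = v" by blast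
next
  fix U v u u'
  assume "u \<in> Hom V U (coprd V (I \<times> I \<times> I) X2) \<and> comparison \<cdot> u = v"
    and "u' \<in> Hom V U (coprd V (I \<times> I \<times> I) X2) \<and> comparison \<cdot> u' = v"
  then have u: "u \<in> Hom V U (coprd V (I \<times> I \<times> I) X2)" and u': "u' \<in> Hom V U (coprd V (I \<times> I \<times> I) X2)"
    and uu: "comparison \<cdot> u = comparison \<cdot> u'" by auto
  show "u = u'"
  proof (rule local_eq[OF ext2 c2 u u u'])
    fix W w i y assume i: "i \<in> I \<times> I \<times> I" and w: "w \<in> Hom V W U" and y: "y \<in> Hom V W (X2 i)" and uw: "u \<cdot> w = in2 i \<cdot> y"
    show "u \<cdot> w = u' \<cdot> w"
    proof (rule local_eq[OF ext2 c2 comp_hom[OF w u'] comp_hom[OF w u] comp_hom[OF w u']])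
      fix W' w' i' y' assume i': "i' \<in> I \<times> I \<times> I" and w': "w' \<in> Hom V W' W" and y': "y' \<in> Hom V W' (X2 i')"
        and uw': "(u' \<cdot> w) \<cdot> w' = in2 i' \<cdot> y'"
      obtain a b d a' b' d' where ii: "i = (a, b, d)" "i' = (a', b', d')" "a \<in> I" "b \<in> I" "d \<in> I" "a' \<in> I" "b' \<in> I" "d' \<in> I"
        using i i' by auto
      let ?y = "y \<cdot> w'"
      have yy: "?y \<in> Hom V W' (X2 (a, b, d))" "y' \<in> Hom V W' (X2 (a', b', d'))" using y y' w' ii by (auto simp: in_hom)
      have e1: "(u \<cdot> w) \<cdot> w' = in2 (a, b, d) \<cdot> ?y" using uw ii w' y by (simp add: in_hom)
      have h: "(u \<cdot> w) \<cdot> w' \<in> Hom V W' (coprd V (I \<times> I \<times> I) X2)" "(u' \<cdot> w) \<cdot> w' \<in> Hom V W' (coprd V (I \<times> I \<times> I) X2)"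
        using u u' w w' comp_hom by blast+
      have "comparison \<cdot> ((u \<cdot> w) \<cdot> w') = comparison \<cdot> ((u' \<cdot> w) \<cdot> w')"
        using comp_eq_at[OF uu, of "w \<cdot> w'"] u u' w w' by (simp add: in_hom)
      then have "pb_pair V t s (in1 (a, b) \<cdot> (p1f a b d \<cdot> ?y)) (in1 (b, d) \<cdot> (p2f a b d \<cdot> ?y)) =
          pb_pair V t s (in1 (a', b') \<cdot> (p1f a' b' d' \<cdot> y')) (in1 (b', d') \<cdot> (p2f a' b' d' \<cdot> y'))" (is "?l = ?r")
        unfolding e1 uw'[unfolded ii(2)] using comparison_at[of a b d ?y] comparison_at[of a' b' d' y'] yy ii
        by (simp add: in_hom)
      moreover have "pb1 V t s \<cdot> ?l = in1 (a, b) \<cdot> (p1f a b d \<cdot> ?y)" "pb2 V t s \<cdot> ?l = in1 (b, d) \<cdot> (p2f a b d \<cdot> ?y)"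
        "pb1 V t s \<cdot> ?r = in1 (a', b') \<cdot> (p1f a' b' d' \<cdot> y')" "pb2 V t s \<cdot> ?r = in1 (b', d') \<cdot> (p2f a' b' d' \<cdot> y')"
        using yy ii by (simp_all add: in_hom)
      ultimately have c: "in1 (a, b) \<cdot> (p1f a b d \<cdot> ?y) = in1 (a', b') \<cdot> (p1f a' b' d' \<cdot> y')"
        "in1 (b, d) \<cdot> (p2f a b d \<cdot> ?y) = in1 (b', d') \<cdot> (p2f a' b' d' \<cdot> y')"
        by metis+
      have ty': "p1f a b d \<cdot> ?y \<in> Hom V W' (X1 (a, b))" "p1f a' b' d' \<cdot> y' \<in> Hom V W' (X1 (a', b'))"
        "p2f a b d \<cdot> ?y \<in> Hom V W' (X1 (b, d))" "p2f a' b' d' \<cdot> y' \<in> Hom V W' (X1 (b', d'))"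
        using yy ii by (auto simp: in_hom)
      show "(u \<cdot> w) \<cdot> w' = (u' \<cdot> w) \<cdot> w'"
      proof (cases "(a, b) = (a', b') \<and> (b, d) = (b', d')")
        case True
        then have eq: "a' = a" "b' = b" "d' = d" by auto
        have "p1f a b d \<cdot> ?y = p1f a b d \<cdot> y'" "p2f a b d \<cdot> ?y = p2f a b d \<cdot> y'"
          using summand_eq[OF ext1 c1 _ ty'(1) ty'(2)[unfolded eq] c(1)[unfolded eq]]
            summand_eq[OF ext1 c1 _ ty'(3) ty'(4)[unfolded eq] c(2)[unfolded eq]] ii by auto
        then have "?y = y'"
          using is_pullbackD(6)[OF X2[OF ii(3,4,5)], of ?y W' y'] yy ii eq by simp
        then show ?thesis using e1 uw' ii eq by simp
      next
        case False
        then have "is_initial V W'"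
          using summand_disjoint[OF ext1 c1 _ _ _ ty'(1,2) c(1)] summand_disjoint[OF ext1 c1 _ _ _ ty'(3,4) c(2)] ii
          by blast
        then show ?thesis using is_initial_unique h by blast
      qed
    qed
  qed
qed

lemma glued_simps [simp]:
  "Ob0 glued = A0" "Ob1 glued = A1" "Src glued = s" "Tgt glued = t"
  by (simp_all add: glued_def)

lemma Idn_glued:
  "Idn glued \<in> Hom V A0 A1" "a \<in> I \<Longrightarrow> Idn glued \<cdot> in0 a = in1 (a, a) \<cdot> idf a"
proof -
  have f: "in1 (a, a) \<cdot> idf a \<in> Hom V (X0 a) A1" if "a \<in> I" for a using that by (simp add: in_hom)
  note c = cotuple[OF c0[unfolded A0_def in0_def], where y = A1 and f = "\<lambda>a. in1 (a, a) \<cdot> idf a", OF in_simps(2) f]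
  show "Idn glued \<in> Hom V A0 A1" "a \<in> I \<Longrightarrow> Idn glued \<cdot> in0 a = in1 (a, a) \<cdot> idf a"
    unfolding glued_def A0_def in0_def using c by auto
qed

lemma Idn_glued_simps [simp]:
  "Idn glued \<in> Ar V" "Dom V (Idn glued) = A0" "Cod V (Idn glued) = A1"
  using Idn_glued(1) by (auto simp: in_hom)

lemma Idn_glued_at:
  "a \<in> I \<Longrightarrow> u \<in> Ar V \<Longrightarrow> Cod V u = X0 a \<Longrightarrow> Idn glued \<cdot> (in0 a \<cdot> u) = in1 (a, a) \<cdot> (idf a \<cdot> u)"
  using comp_eq_at[OF Idn_glued(2), of a u] by simp

definition C2 :: 'm where "C2 = cotuple V (I \<times> I \<times> I) X2 A1 (\<lambda>(a, b, d). in1 (a, d) \<cdot> cf a b d)"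

lemma C2: "C2 \<in> Hom V (coprd V (I \<times> I \<times> I) X2) A1"
  "a \<in> I \<Longrightarrow> b \<in> I \<Longrightarrow> d \<in> I \<Longrightarrow> C2 \<cdot> in2 (a, b, d) = in1 (a, d) \<cdot> cf a b d"
proof -
  let ?f = "\<lambda>(a, b, d). in1 (a, d) \<cdot> cf a b d"
  have f: "?f i \<in> Hom V (X2 i) A1" if "i \<in> I \<times> I \<times> I" for i using that by (auto simp: in_hom)
  note c = cotuple[OF c2[unfolded in2_def], where y = A1 and f = ?f, OF in_simps(2) f]
  show "C2 \<in> Hom V (coprd V (I \<times> I \<times> I) X2) A1" unfolding C2_def by (rule c(1)) simp
  show "a \<in> I \<Longrightarrow> b \<in> I \<Longrightarrow> d \<in> I \<Longrightarrow> C2 \<cdot> in2 (a, b, d) = in1 (a, d) \<cdot> cf a b d"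
    unfolding C2_def in2_def using c(2)[where i = "(a, b, d)"] by simp
qed

lemma Cmpn_glued: "Cmpn glued = C2 \<cdot> inv_arr V comparison"
  by (simp add: glued_def C2_def)

lemma graph_glued: "internal_graph glued"
  using Idn_glued(1) comp_hom[OF inv_arr(1)[OF comparison_iso comparison(1)] C2(1)]
  by (simp add: internal_graph_def in_hom Cmpn_glued)

text \<open>The inverse of the comparison map disappears: on a pair that comes from \<open>X2\<close>, composition in the
  glued category is composition in the family.\<close>

lemma icomp_glued:
  assumes "a \<in> I" "b \<in> I" "d \<in> I" "x \<in> Ar V" "Cod V x = X2 (a, b, d)"
    "p1f a b d \<cdot> x = f" "p2f a b d \<cdot> x = g"
  shows "icomp glued (in1 (a, b) \<cdot> f) (in1 (b, d) \<cdot> g) = in1 (a, d) \<cdot> (cf a b d \<cdot> x)"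
proof -
  note i = inv_arr[OF comparison_iso comparison(1)]
  have "icomp glued (in1 (a, b) \<cdot> f) (in1 (b, d) \<cdot> g) =
      (C2 \<cdot> inv_arr V comparison) \<cdot> (comparison \<cdot> (in2 (a, b, d) \<cdot> x))"
    using assms by (simp add: icomp_def Cmpn_glued comparison_at)
  also have "\<dots> = C2 \<cdot> (in2 (a, b, d) \<cdot> x)"
    using assms C2(1) i(1) comp_eq_at[OF i(2), of "in2 (a, b, d) \<cdot> x"] by (simp add: in_hom)
  also have "\<dots> = in1 (a, d) \<cdot> (cf a b d \<cdot> x)"
    using assms C2(1) comp_eq_at[OF C2(2)[OF assms(1-3)], of x] by (simp add: in_hom)
  finally show ?thesis .
qed

lemma sf_cf_at:
  assumes "a \<in> I" "b \<in> I" "d \<in> I" "x \<in> Ar V" "Cod V x = X2 (a, b, d)"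
  shows "sf a d \<cdot> (cf a b d \<cdot> x) = sf a b \<cdot> (p1f a b d \<cdot> x)" "tf a d \<cdot> (cf a b d \<cdot> x) = tf b d \<cdot> (p2f a b d \<cdot> x)"
  using assms comp_eq_at[OF s_cf, of a b d x] comp_eq_at[OF t_cf, of a b d x] by simp_all

lemma sf_idf_at:
  assumes "a \<in> I" "x \<in> Ar V" "Cod V x = X0 a"
  shows "sf a a \<cdot> (idf a \<cdot> x) = x" "tf a a \<cdot> (idf a \<cdot> x) = x"
  using assms comp_eq_at[OF s_idf, of a x] comp_eq_at[OF t_idf, of a x] by simp_all

lemma pair_of:
  assumes "a \<in> I" "b \<in> I" "d \<in> I" "f \<in> Hom V U (X1 (a, b))" "g \<in> Hom V U (X1 (b, d))" "tf a b \<cdot> f = sf b d \<cdot> g"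
  obtains x where "x \<in> Hom V U (X2 (a, b, d))" "p1f a b d \<cdot> x = f" "p2f a b d \<cdot> x = g"
  using is_pullbackD(5)[OF X2[OF assms(1-3)], of f U g] assms by auto

lemma st_icomp:
  assumes fg: "f \<in> Hom V U A1" "g \<in> Hom V U A1" "t \<cdot> f = s \<cdot> g"
  shows "s \<cdot> icomp glued f g = s \<cdot> f" "t \<cdot> icomp glued f g = t \<cdot> g"
proof -
  note ic = icomp_graph[OF graph_glued, simplified]
  show "s \<cdot> icomp glued f g = s \<cdot> f"
  proof (rule local_composable[OF fg, of _ A0])
    fix W w a b d x assume h: "a \<in> I" "b \<in> I" "d \<in> I" "w \<in> Hom V W U" "x \<in> Hom V W (X2 (a, b, d))"
      and e: "f \<cdot> w = in1 (a, b) \<cdot> (p1f a b d \<cdot> x)" "g \<cdot> w = in1 (b, d) \<cdot> (p2f a b d \<cdot> x)"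
    show "(s \<cdot> icomp glued f g) \<cdot> w = (s \<cdot> f) \<cdot> w"
      using fg h e ic[of f g] icomp_glued[of a b d x] by (simp add: in_hom sf_cf_at)
  qed (use fg ic[of f g] in \<open>auto simp: in_hom\<close>)
  show "t \<cdot> icomp glued f g = t \<cdot> g"
  proof (rule local_composable[OF fg, of _ A0])
    fix W w a b d x assume h: "a \<in> I" "b \<in> I" "d \<in> I" "w \<in> Hom V W U" "x \<in> Hom V W (X2 (a, b, d))"
      and e: "f \<cdot> w = in1 (a, b) \<cdot> (p1f a b d \<cdot> x)" "g \<cdot> w = in1 (b, d) \<cdot> (p2f a b d \<cdot> x)"
    show "(t \<cdot> icomp glued f g) \<cdot> w = (t \<cdot> g) \<cdot> w"
      using fg h e ic[of f g] icomp_glued[of a b d x] by (simp add: in_hom sf_cf_at)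
  qed (use fg ic[of f g] in \<open>auto simp: in_hom\<close>)
qed

text \<open>Each law is checked locally, where it is the corresponding law of the family.\<close>

theorem IC_glued: "IC glued"
proof (rule is_internal_categoryI[OF graph_glued])
  have "s \<cdot> Idn glued = Id V A0"
    by (rule is_coproductD(4)[OF c0, of _ A0]) (simp_all add: in_hom Idn_glued(2) s_idf)
  moreover have "t \<cdot> Idn glued = Id V A0"
    by (rule is_coproductD(4)[OF c0, of _ A0]) (simp_all add: in_hom Idn_glued(2) t_idf)
  ultimately show "Src glued \<cdot> Idn glued = Id V (Ob0 glued)" "Tgt glued \<cdot> Idn glued = Id V (Ob0 glued)"
    by simp_all
next
  show "Src glued \<cdot> icomp glued f g = Src glued \<cdot> f \<and> Tgt glued \<cdot> icomp glued f g = Tgt glued \<cdot> g"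
    if "f \<in> Hom V U (Ob1 glued)" "g \<in> Hom V U (Ob1 glued)" "Tgt glued \<cdot> f = Src glued \<cdot> g" for U f g
    using st_icomp that by simp
next
  note ic = icomp_graph[OF graph_glued, simplified]
  have ti: "t \<cdot> (Idn glued \<cdot> (s \<cdot> f)) = s \<cdot> f \<and> s \<cdot> (Idn glued \<cdot> (t \<cdot> f)) = t \<cdot> f" if "f \<in> Hom V U A1" for f U
  proof (intro conjI; rule local_eq[OF ext1 c1 that, of _ A0])
    fix W w i v assume i: "i \<in> I \<times> I" and h: "w \<in> Hom V W U" "v \<in> Hom V W (X1 i)" "f \<cdot> w = in1 i \<cdot> v"
    obtain a b where ab: "i = (a, b)" "a \<in> I" "b \<in> I" using i by auto
    show "(t \<cdot> (Idn glued \<cdot> (s \<cdot> f))) \<cdot> w = (s \<cdot> f) \<cdot> w" "(s \<cdot> (Idn glued \<cdot> (t \<cdot> f))) \<cdot> w = (t \<cdot> f) \<cdot> w"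
      using that h ab by (simp_all add: in_hom Idn_glued_at sf_idf_at)
  qed (use that in \<open>auto simp: in_hom\<close>)
  fix U f assume "f \<in> Hom V U (Ob1 glued)"
  then have f: "f \<in> Hom V U A1" by simp
  show "icomp glued (Idn glued \<cdot> (Src glued \<cdot> f)) f = f"
  proof (rule local_eq[OF ext1 c1 f, of _ A1])
    fix W w i v assume i: "i \<in> I \<times> I" and h: "w \<in> Hom V W U" "v \<in> Hom V W (X1 i)" "f \<cdot> w = in1 i \<cdot> v"
    obtain a b where ab: "i = (a, b)" "a \<in> I" "b \<in> I" using i by auto
    obtain x where x: "x \<in> Hom V W (X2 (a, a, b))" "p1f a a b \<cdot> x = idf a \<cdot> (sf a b \<cdot> v)" "p2f a a b \<cdot> x = v"
      by (rule pair_of[of a a b "idf a \<cdot> (sf a b \<cdot> v)" W v]) (use ab h in \<open>auto simp: in_hom sf_idf_at\<close>)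
    have "icomp glued (Idn glued \<cdot> (Src glued \<cdot> f)) f \<cdot> w = icomp glued (in1 (a, a) \<cdot> (idf a \<cdot> (sf a b \<cdot> v))) (in1 (a, b) \<cdot> v)"
      using ic[of "Idn glued \<cdot> (s \<cdot> f)" f] f h ab ti[OF f] by (simp add: in_hom Idn_glued_at)
    also have "\<dots> = in1 (a, b) \<cdot> (cf a a b \<cdot> x)"
      by (rule icomp_glued) (use x ab in \<open>auto simp: in_hom\<close>)
    also have "cf a a b \<cdot> x = v" using unit_l[OF ab(2,3) _ x] h ab by simp
    finally show "icomp glued (Idn glued \<cdot> (Src glued \<cdot> f)) f \<cdot> w = f \<cdot> w" using h ab by simp
  qed (use f ic[of "Idn glued \<cdot> (s \<cdot> f)" f] ti[OF f] in \<open>auto simp: in_hom\<close>)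
  show "icomp glued f (Idn glued \<cdot> (Tgt glued \<cdot> f)) = f"
  proof (rule local_eq[OF ext1 c1 f, of _ A1])
    fix W w i v assume i: "i \<in> I \<times> I" and h: "w \<in> Hom V W U" "v \<in> Hom V W (X1 i)" "f \<cdot> w = in1 i \<cdot> v"
    obtain a b where ab: "i = (a, b)" "a \<in> I" "b \<in> I" using i by auto
    obtain x where x: "x \<in> Hom V W (X2 (a, b, b))" "p1f a b b \<cdot> x = v" "p2f a b b \<cdot> x = idf b \<cdot> (tf a b \<cdot> v)"
      by (rule pair_of[of a b b v W "idf b \<cdot> (tf a b \<cdot> v)"]) (use ab h in \<open>auto simp: in_hom sf_idf_at\<close>)
    have "icomp glued f (Idn glued \<cdot> (Tgt glued \<cdot> f)) \<cdot> w = icomp glued (in1 (a, b) \<cdot> v) (in1 (b, b) \<cdot> (idf b \<cdot> (tf a b \<cdot> v)))"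
      using ic[of f "Idn glued \<cdot> (t \<cdot> f)"] f h ab ti[OF f] by (simp add: in_hom Idn_glued_at)
    also have "\<dots> = in1 (a, b) \<cdot> (cf a b b \<cdot> x)"
      by (rule icomp_glued) (use x ab in \<open>auto simp: in_hom\<close>)
    also have "cf a b b \<cdot> x = v" using unit_r[OF ab(2,3) _ x] h ab by simp
    finally show "icomp glued f (Idn glued \<cdot> (Tgt glued \<cdot> f)) \<cdot> w = f \<cdot> w" using h ab by simp
  qed (use f ic[of f "Idn glued \<cdot> (t \<cdot> f)"] ti[OF f] in \<open>auto simp: in_hom\<close>)
next
  note ic = icomp_graph[OF graph_glued, simplified]
  fix U f g h assume "f \<in> Hom V U (Ob1 glued)" "g \<in> Hom V U (Ob1 glued)" "h \<in> Hom V U (Ob1 glued)"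
    "Tgt glued \<cdot> f = Src glued \<cdot> g" "Tgt glued \<cdot> g = Src glued \<cdot> h"
  then have f: "f \<in> Hom V U A1" and g: "g \<in> Hom V U A1" and h: "h \<in> Hom V U A1"
    and fg: "t \<cdot> f = s \<cdot> g" and gh: "t \<cdot> g = s \<cdot> h" by simp_all
  have fgh: "t \<cdot> icomp glued f g = s \<cdot> h" "t \<cdot> f = s \<cdot> icomp glued g h"
    using st_icomp[OF f g fg] st_icomp[OF g h gh] fg gh by simp_all
  have ty1: "icomp glued f g \<in> Hom V U A1" "icomp glued g h \<in> Hom V U A1"
    using f g h fg gh ic[of f g] ic[of g h] by (simp_all add: in_hom)
  have ty2: "icomp glued (icomp glued f g) h \<in> Hom V U A1" "icomp glued f (icomp glued g h) \<in> Hom V U A1"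
    using f g h ty1 fgh ic[of "icomp glued f g" h] ic[of f "icomp glued g h"] by (simp_all add: in_hom)
  show "icomp glued (icomp glued f g) h = icomp glued f (icomp glued g h)" (is "?l = ?r")
  proof (rule local_composable[OF f g fg ty2])
    fix W w a b d x assume I: "a \<in> I" "b \<in> I" "d \<in> I" and w: "w \<in> Hom V W U" and x: "x \<in> Hom V W (X2 (a, b, d))"
      and fw: "f \<cdot> w = in1 (a, b) \<cdot> (p1f a b d \<cdot> x)" and gw: "g \<cdot> w = in1 (b, d) \<cdot> (p2f a b d \<cdot> x)"
    show "?l \<cdot> w = ?r \<cdot> w"
    proof (rule local_eq[OF ext1 c1 comp_hom[OF w h] comp_hom[OF w ty2(1)] comp_hom[OF w ty2(2)]])
      fix W' w' i v assume i: "i \<in> I \<times> I" and w': "w' \<in> Hom V W' W" and v: "v \<in> Hom V W' (X1 i)"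
        and hw: "(h \<cdot> w) \<cdot> w' = in1 i \<cdot> v"
      obtain d' e where ii: "i = (d', e)" "d' \<in> I" "e \<in> I" using i by auto
      let ?w = "w \<cdot> w'" and ?x = "x \<cdot> w'"
      have ww: "?w \<in> Hom V W' U" and xx: "?x \<in> Hom V W' (X2 (a, b, d))" using w w' x comp_hom by blast+
      have fw': "f \<cdot> ?w = in1 (a, b) \<cdot> (p1f a b d \<cdot> ?x)"
        using comp_eq_at[OF fw, of w'] f w w' x I by (simp add: in_hom)
      have gw': "g \<cdot> ?w = in1 (b, d) \<cdot> (p2f a b d \<cdot> ?x)"
        using comp_eq_at[OF gw, of w'] g w w' x I by (simp add: in_hom)
      have hw': "h \<cdot> ?w = in1 (d', e) \<cdot> v" using hw ii h w w' by (simp add: in_hom)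
      have "t \<cdot> (g \<cdot> ?w) = s \<cdot> (h \<cdot> ?w)"
        using comp_eq_at[OF gh, of ?w] g h ww by (simp add: in_hom)
      then have e1: "t \<cdot> (in1 (b, d) \<cdot> (p2f a b d \<cdot> ?x)) = s \<cdot> (in1 (d', e) \<cdot> v)" by (simp only: gw' hw')
      have "p2f a b d \<cdot> ?x \<in> Hom V W' (X1 (b, d))" "v \<in> Hom V W' (X1 (d', e))"
        using xx I v ii by (simp_all add: in_hom)
      from composable_pieces[OF I(2,3) ii(2,3) this e1]
      consider "is_initial V W'" | y where "d' = d" "y \<in> Hom V W' (X2 (b, d, e))" "p1f b d e \<cdot> y = p2f a b d \<cdot> ?x" "p2f b d e \<cdot> y = v"
        by auto
      then have "?l \<cdot> ?w = ?r \<cdot> ?w"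
      proof cases
        case 1
        then show ?thesis using is_initial_unique comp_hom[OF ww ty2(1)] comp_hom[OF ww ty2(2)] by blast
      next
        case 2
        have y: "y \<in> Ar V" "Dom V y = W'" "Cod V y = X2 (b, d, e)" using 2 by (simp_all add: in_hom)
        have x': "?x \<in> Ar V" "Dom V ?x = W'" "Cod V ?x = X2 (a, b, d)" using xx by (simp_all add: in_hom)
        obtain w2 where w2: "w2 \<in> Hom V W' (X2 (a, d, e))" "p1f a d e \<cdot> w2 = cf a b d \<cdot> ?x" "p2f a d e \<cdot> w2 = v"
        proof (rule pair_of[of a d e "cf a b d \<cdot> ?x" W' v])
          show "tf a d \<cdot> (cf a b d \<cdot> ?x) = sf d e \<cdot> v"
            unfolding sf_cf_at(2)[OF I x'(1,3)] 2(3)[symmetric] 2(4)[symmetric]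
            using I ii y by simp
        qed (use I ii y x' v 2 in \<open>auto simp: in_hom\<close>)
        obtain w4 where w4: "w4 \<in> Hom V W' (X2 (a, b, e))" "p1f a b e \<cdot> w4 = p1f a b d \<cdot> ?x" "p2f a b e \<cdot> w4 = cf b d e \<cdot> y"
        proof (rule pair_of[of a b e "p1f a b d \<cdot> ?x" W' "cf b d e \<cdot> y"])
          show "tf a b \<cdot> (p1f a b d \<cdot> ?x) = sf b e \<cdot> (cf b d e \<cdot> y)"
            unfolding sf_cf_at(1)[OF I(2,3) ii(3) y(1,3)] 2(3) using I x' by simp
        qed (use I ii y x' in \<open>auto simp: in_hom\<close>)
        have "?l \<cdot> ?w = icomp glued (icomp glued (f \<cdot> ?w) (g \<cdot> ?w)) (h \<cdot> ?w)"
          using ic[of f g] ic[of "icomp glued f g" h] f g h fg fgh ww by (simp add: in_hom)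
        also have "icomp glued (f \<cdot> ?w) (g \<cdot> ?w) = in1 (a, d) \<cdot> (cf a b d \<cdot> ?x)"
          unfolding fw' gw' by (rule icomp_glued[OF I x'(1,3) refl refl])
        also have "icomp glued (in1 (a, d) \<cdot> (cf a b d \<cdot> ?x)) (h \<cdot> ?w) = in1 (a, e) \<cdot> (cf a d e \<cdot> w2)"
          unfolding hw' 2(1) by (rule icomp_glued[OF I(1,3) ii(3) _ _ w2(2,3)]) (use w2 in \<open>simp_all add: in_hom\<close>)
        also have "cf a d e \<cdot> w2 = cf a b e \<cdot> w4"
          by (rule assoc_f[OF I ii(3) xx w2(1) 2(2) w4(1) w2(2) _ 2(3) w4(2,3)]) (simp add: w2(3) 2(4))
        also have "in1 (a, e) \<cdot> (cf a b e \<cdot> w4) = icomp glued (f \<cdot> ?w) (in1 (b, e) \<cdot> (cf b d e \<cdot> y))"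
          unfolding fw' by (rule icomp_glued[OF I(1,2) ii(3) _ _ w4(2,3), symmetric]) (use w4 in \<open>simp_all add: in_hom\<close>)
        also have "in1 (b, e) \<cdot> (cf b d e \<cdot> y) = icomp glued (g \<cdot> ?w) (h \<cdot> ?w)"
          unfolding gw' hw' 2(1) by (rule icomp_glued[OF I(2,3) ii(3) y(1,3) 2(3,4), symmetric])
        also have "icomp glued (f \<cdot> ?w) (icomp glued (g \<cdot> ?w) (h \<cdot> ?w)) = ?r \<cdot> ?w"
          using ic[of g h] ic[of f "icomp glued g h"] f g h gh fgh ww by (simp add: in_hom)
        finally show ?thesis .
      qed
      then show "(?l \<cdot> w) \<cdot> w' = (?r \<cdot> w) \<cdot> w'" using ty2 w w' by (simp add: in_hom)
    qed
  qed
qed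

end

section \<open>The interval\<close>

context extensive_cat
begin

lemma extensive_at_finite: "extensive_at (I :: ('a :: finite) set)"
proof -
  obtain e :: "'a \<Rightarrow> 'i" where "inj e" using inj_of_finite[OF infinite_universe, where ?'a = 'a] by auto
  then show ?thesis using extensive_at_small[of e I] inj_on_subset by blast
qed

text \<open>The hom-objects of the interval. Any two parallel arrows into one of them agree, over the initial
  one because its stages are themselves initial; so every law of the interval holds as soon as it
  makes sense.\<close>

definition H2 :: "bool \<Rightarrow> bool \<Rightarrow> 'o" where
  "H2 a b = (if a \<and> \<not> b then initial V else terminal V)"

lemma H2_Ob [simp]: "H2 a b \<in> Ob V"
  by (simp add: H2_def)

lemma H2_eq: "f \<in> Hom V U (H2 a b) \<Longrightarrow> g \<in> Hom V U (H2 a b) \<Longrightarrow> f = g"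
  using is_terminal_unique[OF terminal] is_initial_unique[OF strict_initial[OF initial]]
  by (auto simp: H2_def split: if_splits)

lemma H2_the:
  assumes "f \<in> Hom V U (H2 a b)"
  shows "(THE f. f \<in> Hom V U (H2 a b)) \<in> Hom V U (H2 a b)"
  by (rule theI[of "\<lambda>f. f \<in> Hom V U (H2 a b)", OF assms]) (use assms H2_eq in blast)

lemma two_simps [simp]:
  "EOb (enriched_two V) = UNIV" "EHom (enriched_two V) = H2"
  "EId (enriched_two V) = (\<lambda>a. THE f. f \<in> Hom V (terminal V) (H2 a a))"
  "ECmp (enriched_two V) = (\<lambda>a b c. THE f. f \<in> Hom V (prd V (H2 a b) (H2 b c)) (H2 a c))"
  by (simp_all add: enriched_two_def Let_def H2_def fun_eq_iff)

definition id2 :: "bool \<Rightarrow> 'm" where "id2 a = (THE f. f \<in> Hom V (terminal V) (H2 a a))"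
definition cmp2 :: "bool \<Rightarrow> bool \<Rightarrow> bool \<Rightarrow> 'm" where
  "cmp2 a b c = (THE f. f \<in> Hom V (prd V (H2 a b) (H2 b c)) (H2 a c))"

lemma id2: "id2 a \<in> Hom V (terminal V) (H2 a a)"
  unfolding id2_def by (rule H2_the[of "Id V (terminal V)"]) (simp add: H2_def in_hom)

text \<open>If \<open>a = 1\<close> and \<open>c = 0\<close>, one of the two factors already is the initial object, and the composition
  is the projection to it.\<close>

lemma cmp2: "cmp2 a b c \<in> Hom V (prd V (H2 a b) (H2 b c)) (H2 a c)"
proof (cases "a \<and> \<not> c")
  case True
  then have "pr1 V (H2 a b) (H2 b c) \<in> Hom V (prd V (H2 a b) (H2 b c)) (H2 a c) \<or>
    pr2 V (H2 a b) (H2 b c) \<in> Hom V (prd V (H2 a b) (H2 b c)) (H2 a c)"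
    by (cases b) (auto simp: in_hom H2_def)
  then show ?thesis unfolding cmp2_def using H2_the by blast
next
  case False
  then have "bang V (prd V (H2 a b) (H2 b c)) \<in> Hom V (prd V (H2 a b) (H2 b c)) (H2 a c)"
    by (auto simp: in_hom H2_def)
  then show ?thesis unfolding cmp2_def using H2_the by blast
qed

sublocale two: family V UNIV "\<lambda>_. terminal V" "\<lambda>(a, b). H2 a b" "\<lambda>(a, b, d). prd V (H2 a b) (H2 b d)"
  "\<lambda>a b. bang V (H2 a b)" "\<lambda>a b. bang V (H2 a b)" id2
  "\<lambda>a b d. pr1 V (H2 a b) (H2 b d)" "\<lambda>a b d. pr2 V (H2 a b) (H2 b d)" cmp2
proof
  show "extensive_at (UNIV :: bool set)" "extensive_at (UNIV \<times> UNIV :: (bool \<times> bool) set)"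
    "extensive_at (UNIV \<times> UNIV \<times> UNIV :: (bool \<times> bool \<times> bool) set)"
    by (rule extensive_at_finite)+
next
  fix a b d :: bool
  show "is_pullback V (bang V (H2 a b)) (bang V (H2 b d))
      (case (a, b, d) of (a, b, d) \<Rightarrow> prd V (H2 a b) (H2 b d), pr1 V (H2 a b) (H2 b d), pr2 V (H2 a b) (H2 b d))"
    using is_product_iff_is_pullback[OF terminal bang bang] product_chosen[of "H2 a b" "H2 b d"] by simp
next
  fix a b U f w assume "f \<in> Hom V U (case (a, b) of (a, b) \<Rightarrow> H2 a b)"
    and "w \<in> Hom V U (case (a, a, b) of (a, b, d) \<Rightarrow> prd V (H2 a b) (H2 b d))"
  then show "cmp2 a a b \<cdot> w = f" using cmp2[of a a b] comp_hom H2_eq by simp blast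
next
  fix a b U f w assume "f \<in> Hom V U (case (a, b) of (a, b) \<Rightarrow> H2 a b)"
    and "w \<in> Hom V U (case (a, b, b) of (a, b, d) \<Rightarrow> prd V (H2 a b) (H2 b d))"
  then show "cmp2 a b b \<cdot> w = f" using cmp2[of a b b] comp_hom H2_eq by simp blast
next
  fix a b d e U w1 w2 w3 w4
  assume "w2 \<in> Hom V U (case (a, d, e) of (a, b, d) \<Rightarrow> prd V (H2 a b) (H2 b d))"
    "w4 \<in> Hom V U (case (a, b, e) of (a, b, d) \<Rightarrow> prd V (H2 a b) (H2 b d))"
  then show "cmp2 a d e \<cdot> w2 = cmp2 a b e \<cdot> w4"
    using cmp2[of a d e] cmp2[of a b e] comp_hom H2_eq by simp blast
qed (use id2 cmp2 in \<open>auto simp: in_hom intro!: terminal_eq\<close>)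

lemma int_two_glued: "int_two V = two.glued"
  unfolding int_two_def Int_cat_def two.glued_def two.comparison_def two.s_def two.t_def two.in0_def
    two.in1_def two.A0_def two.A1_def Let_def
  by (simp add: id2_def cmp2_def)

end

section \<open>The internal category of elements\<close>

locale closed_extensive_cat = extensive_cat V universe for V :: "('o, 'm) category" (structure) and universe :: "'i itself" +
  assumes ex_exponential: "\<And>a b. a \<in> Ob V \<Longrightarrow> b \<in> Ob V \<Longrightarrow> \<exists>e. is_exponential V a b e"
begin

lemma exponential_chosen:
  "a \<in> Ob V \<Longrightarrow> b \<in> Ob V \<Longrightarrow> is_exponential V a b (exp_ob V a b, exp_ev V a b)"
  using ex_exponential unfolding exp_ob_def exp_ev_def exponential_def by (auto intro: someI2)

lemma exp_simps [simp]:
  assumes "a \<in> Ob V" "b \<in> Ob V"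
  shows "exp_ob V a b \<in> Ob V" "exp_ev V a b \<in> Ar V" "Dom V (exp_ev V a b) = prd V (exp_ob V a b) a" "Cod V (exp_ev V a b) = b"
  using exponential_chosen[OF assms] by (auto simp: is_exponential_def in_hom)

lemma prd_map_at:
  assumes "f \<in> Ar V" "g \<in> Ar V" "u \<in> Ar V" "v \<in> Ar V" "Dom V u = Dom V v" "Cod V u = Dom V f" "Cod V v = Dom V g"
  shows "prd_map V f g \<cdot> pair V u v = pair V (f \<cdot> u) (g \<cdot> v)"
  using assms by (simp add: prd_map_def)

lemma prd_map_simps [simp]:
  assumes "f \<in> Ar V" "g \<in> Ar V"
  shows "prd_map V f g \<in> Ar V" "Dom V (prd_map V f g) = prd V (Dom V f) (Dom V g)"
    "Cod V (prd_map V f g) = prd V (Cod V f) (Cod V g)"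
  using assms by (simp_all add: prd_map_def)

lemma curry_arr:
  assumes "f \<in> Hom V (prd V x a) b" "x \<in> Ob V" "a \<in> Ob V"
  shows "curry_arr V x a b f \<in> Hom V x (exp_ob V a b)"
    "exp_ev V a b \<cdot> prd_map V (curry_arr V x a b f) (Id V a) = f"
proof -
  have "b \<in> Ob V" using assms hom_Ob by blast
  then have "\<exists>!g. g \<in> Hom V x (exp_ob V a b) \<and> exp_ev V a b \<cdot> prd_map V g (Id V a) = f"
    using exponential_chosen[OF assms(3)] assms by (simp add: is_exponential_def)
  then have "curry_arr V x a b f \<in> Hom V x (exp_ob V a b) \<and> exp_ev V a b \<cdot> prd_map V (curry_arr V x a b f) (Id V a) = f"
    unfolding curry_arr_def by (rule theI')
  then show "curry_arr V x a b f \<in> Hom V x (exp_ob V a b)"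
    "exp_ev V a b \<cdot> prd_map V (curry_arr V x a b f) (Id V a) = f" by auto
qed

lemma exp_ev_curry:
  assumes f: "f \<in> Hom V (prd V x a) b" and x: "x \<in> Ob V" "a \<in> Ob V"
    and uv: "u \<in> Ar V" "v \<in> Ar V" "Dom V u = Dom V v" "Cod V u = x" "Cod V v = a"
  shows "exp_ev V a b \<cdot> pair V (curry_arr V x a b f \<cdot> u) v = f \<cdot> pair V u v"
proof -
  note c = curry_arr[OF f x]
  have b: "b \<in> Ob V" using f hom_Ob by blast
  show ?thesis
    using comp_eq_at[OF c(2), of "pair V u v"] c(1) uv x b by (simp add: in_hom prd_map_at)
qed

text \<open>Evaluation at the two projections already determines an arrow into an exponential; all elements
  are allowed in the premise because this is how equations come out of computations.\<close>

lemma exp_eqI: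
  assumes gh: "g \<in> Hom V x (exp_ob V a b)" "h \<in> Hom V x (exp_ob V a b)" and ab: "a \<in> Ob V" "b \<in> Ob V"
    and eq: "\<And>U u v. u \<in> Hom V U x \<Longrightarrow> v \<in> Hom V U a \<Longrightarrow>
      exp_ev V a b \<cdot> pair V (g \<cdot> u) v = exp_ev V a b \<cdot> pair V (h \<cdot> u) v"
  shows "g = h"
proof -
  have x: "x \<in> Ob V" using gh hom_Ob by blast
  have e: "exp_ev V a b \<cdot> prd_map V g (Id V a) = exp_ev V a b \<cdot> prd_map V h (Id V a)"
    using eq[of "pr1 V x a" "prd V x a" "pr2 V x a"] gh x ab by (simp add: in_hom prd_map_def)
  have "exp_ev V a b \<cdot> prd_map V g (Id V a) \<in> Hom V (prd V x a) b"
    using gh x ab by (simp add: in_hom)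
  then have "\<exists>!k. k \<in> Hom V x (exp_ob V a b) \<and>
      exp_ev V a b \<cdot> prd_map V k (Id V a) = exp_ev V a b \<cdot> prd_map V g (Id V a)"
    using exponential_chosen[OF ab] x by (simp add: is_exponential_def)
  then show ?thesis using gh e by auto
qed

end

locale presheaf = closed_extensive_cat V universe for V :: "('o, 'm) category" (structure) and universe :: "'i itself" +
  fixes C :: "('i, 'o, 'm) enriched_category" and F :: "('i, 'o, 'm) enriched_functor"
  assumes C: "is_enriched_category V C"
    and F: "is_enriched_functor V (enriched_op V C) (self_enriched V) F"
begin

abbreviation "obs \<equiv> EOb C"
abbreviation "hm \<equiv> EHom C"
abbreviation "FO \<equiv> FOb F"

lemma C_simps [simp]:
  "a \<in> obs \<Longrightarrow> b \<in> obs \<Longrightarrow> hm a b \<in> Ob V"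
  "a \<in> obs \<Longrightarrow> EId C a \<in> Ar V" "a \<in> obs \<Longrightarrow> Dom V (EId C a) = terminal V" "a \<in> obs \<Longrightarrow> Cod V (EId C a) = hm a a"
  "a \<in> obs \<Longrightarrow> b \<in> obs \<Longrightarrow> d \<in> obs \<Longrightarrow> ECmp C a b d \<in> Ar V"
  "a \<in> obs \<Longrightarrow> b \<in> obs \<Longrightarrow> d \<in> obs \<Longrightarrow> Dom V (ECmp C a b d) = prd V (hm a b) (hm b d)"
  "a \<in> obs \<Longrightarrow> b \<in> obs \<Longrightarrow> d \<in> obs \<Longrightarrow> Cod V (ECmp C a b d) = hm a d"
  using C unfolding is_enriched_category_def in_hom by blast+

lemma F_simps [simp]:
  "a \<in> obs \<Longrightarrow> FO a \<in> Ob V"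
  "a \<in> obs \<Longrightarrow> b \<in> obs \<Longrightarrow> FHom F b a \<in> Ar V" "a \<in> obs \<Longrightarrow> b \<in> obs \<Longrightarrow> Dom V (FHom F b a) = hm a b"
  "a \<in> obs \<Longrightarrow> b \<in> obs \<Longrightarrow> Cod V (FHom F b a) = exp_ob V (FO b) (FO a)"
  using F by (auto simp: is_enriched_functor_def enriched_op_def self_enriched_def in_hom)

text \<open>On elements, \<open>C\<close> is a category and \<open>F\<close> a contravariant action of it; the equations below hold
  at every stage and replace the diagrams for \<open>C\<close> and \<open>F\<close>.\<close>

definition cmp :: "'i \<Rightarrow> 'i \<Rightarrow> 'i \<Rightarrow> 'm \<Rightarrow> 'm \<Rightarrow> 'm" where
  "cmp a b d f g = ECmp C a b d \<cdot> pair V f g"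

definition act :: "'i \<Rightarrow> 'i \<Rightarrow> 'm \<Rightarrow> 'm \<Rightarrow> 'm" where
  "act a b f y = ev_fun V F a b \<cdot> pair V f y"

lemma ev_fun_eq: "a \<in> obs \<Longrightarrow> b \<in> obs \<Longrightarrow> ev_fun V F a b = exp_ev V (FO b) (FO a) \<cdot> prd_map V (FHom F b a) (Id V (FO b))"
  by (simp add: ev_fun_def uncurry_arr_def)

lemma ev_fun_simps [simp]:
  "a \<in> obs \<Longrightarrow> b \<in> obs \<Longrightarrow> ev_fun V F a b \<in> Ar V" "a \<in> obs \<Longrightarrow> b \<in> obs \<Longrightarrow> Dom V (ev_fun V F a b) = prd V (hm a b) (FO b)"
  "a \<in> obs \<Longrightarrow> b \<in> obs \<Longrightarrow> Cod V (ev_fun V F a b) = FO a"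
  by (simp_all add: ev_fun_eq)

lemma cmp_simps [simp]:
  assumes "a \<in> obs" "b \<in> obs" "d \<in> obs" "f \<in> Ar V" "g \<in> Ar V" "Dom V f = Dom V g" "Cod V f = hm a b" "Cod V g = hm b d"
  shows "cmp a b d f g \<in> Ar V" "Dom V (cmp a b d f g) = Dom V g" "Cod V (cmp a b d f g) = hm a d"
    "u \<in> Ar V \<Longrightarrow> Cod V u = Dom V g \<Longrightarrow> cmp a b d f g \<cdot> u = cmp a b d (f \<cdot> u) (g \<cdot> u)"
  using assms by (simp_all add: cmp_def)

lemma act_simps [simp]:
  assumes "a \<in> obs" "b \<in> obs" "f \<in> Ar V" "y \<in> Ar V" "Dom V f = Dom V y" "Cod V f = hm a b" "Cod V y = FO b"
  shows "act a b f y \<in> Ar V" "Dom V (act a b f y) = Dom V y" "Cod V (act a b f y) = FO a"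
    "u \<in> Ar V \<Longrightarrow> Cod V u = Dom V y \<Longrightarrow> act a b f y \<cdot> u = act a b (f \<cdot> u) (y \<cdot> u)"
  using assms by (simp_all add: act_def)

lemma cmp_id [simp]:
  assumes "a \<in> obs" "b \<in> obs" "f \<in> Ar V" "Cod V f = hm a b" "Dom V f = U"
  shows "cmp a a b (EId C a \<cdot> bang V U) f = f" "cmp a b b f (EId C b \<cdot> bang V U) = f"
proof -
  have U: "U \<in> Ob V" using assms by auto
  have e: "ECmp C a a b \<cdot> prd_map V (EId C a) (Id V (hm a b)) = pr2 V (terminal V) (hm a b)"
    "ECmp C a b b \<cdot> prd_map V (Id V (hm a b)) (EId C b) = pr1 V (hm a b) (terminal V)"
    using C assms(1,2) unfolding is_enriched_category_def by blast+
  show "cmp a a b (EId C a \<cdot> bang V U) f = f"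
    using comp_eq_at[OF e(1), of "pair V (bang V U) f"] assms U by (simp add: cmp_def prd_map_at)
  show "cmp a b b f (EId C b \<cdot> bang V U) = f"
    using comp_eq_at[OF e(2), of "pair V f (bang V U)"] assms U by (simp add: cmp_def prd_map_at)
qed

lemma cmp_assoc:
  assumes "a \<in> obs" "b \<in> obs" "d \<in> obs" "e \<in> obs" "f \<in> Ar V" "g \<in> Ar V" "h \<in> Ar V" "Dom V f = Dom V h" "Dom V g = Dom V h"
    "Cod V f = hm a b" "Cod V g = hm b d" "Cod V h = hm d e"
  shows "cmp a d e (cmp a b d f g) h = cmp a b e f (cmp b d e g h)"
proof -
  have e: "ECmp C a d e \<cdot> prd_map V (ECmp C a b d) (Id V (hm d e)) =
        ECmp C a b e \<cdot> prd_map V (Id V (hm a b)) (ECmp C b d e) \<cdot> prd_assoc V (hm a b) (hm b d) (hm d e)"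
    using C assms(1-4) unfolding is_enriched_category_def by blast
  have pa: "prd_assoc V (hm a b) (hm b d) (hm d e) \<in> Ar V"
    "Dom V (prd_assoc V (hm a b) (hm b d) (hm d e)) = prd V (prd V (hm a b) (hm b d)) (hm d e)"
    "Cod V (prd_assoc V (hm a b) (hm b d) (hm d e)) = prd V (hm a b) (prd V (hm b d) (hm d e))"
    "prd_assoc V (hm a b) (hm b d) (hm d e) \<cdot> pair V (pair V f g) h = pair V f (pair V g h)"
    using assms by (simp_all add: prd_assoc_def pr_first_def pr_rest_def)
  show ?thesis
    using comp_eq_at[OF e, of "pair V (pair V f g) h"] assms pa by (simp add: cmp_def prd_map_at)
qed

lemma act_eq:
  assumes "a \<in> obs" "b \<in> obs" "f \<in> Ar V" "y \<in> Ar V" "Dom V f = Dom V y" "Cod V f = hm a b" "Cod V y = FO b"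
  shows "act a b f y = exp_ev V (FO b) (FO a) \<cdot> pair V (FHom F b a \<cdot> f) y"
  using assms by (simp add: act_def ev_fun_eq prd_map_at)

lemma act_id [simp]:
  assumes "a \<in> obs" "y \<in> Ar V" "Cod V y = FO a" "Dom V y = U"
  shows "act a a (EId C a \<cdot> bang V U) y = y"
proof -
  have U: "U \<in> Ob V" using assms by auto
  have e: "FHom F a a \<cdot> EId C a = curry_arr V (terminal V) (FO a) (FO a) (pr2 V (terminal V) (FO a))"
    using F assms(1) by (simp add: is_enriched_functor_def enriched_op_def self_enriched_def)
  have "act a a (EId C a \<cdot> bang V U) y = exp_ev V (FO a) (FO a) \<cdot> pair V ((FHom F a a \<cdot> EId C a) \<cdot> bang V U) y"
    using assms U by (simp add: act_eq)
  also have "\<dots> = pr2 V (terminal V) (FO a) \<cdot> pair V (bang V U) y"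
    unfolding e by (rule exp_ev_curry) (use assms U in \<open>simp_all add: in_hom\<close>)
  finally show ?thesis using assms U by simp
qed

text \<open>Functoriality of \<open>F\<close> is an equation between arrows into \<open>[F d, F a]\<close>; here it is evaluated at \<open>y\<close>.
  The symmetry enters because \<open>F\<close> is a functor on the opposite category.\<close>

lemma act_cmp:
  assumes "a \<in> obs" "b \<in> obs" "d \<in> obs" "f \<in> Ar V" "g \<in> Ar V" "y \<in> Ar V" "Dom V f = Dom V y" "Dom V g = Dom V y"
    "Cod V f = hm a b" "Cod V g = hm b d" "Cod V y = FO d"
  shows "act a d (cmp a b d f g) y = act a b f (act b d g y)"
proof -
  let ?E = "exp_ob V (FO d) (FO b)" and ?E' = "exp_ob V (FO b) (FO a)"
  let ?K = "exp_ev V (FO b) (FO a) \<cdot> pair V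
            (pr2 V ?E ?E' \<cdot> pr1 V (prd V ?E ?E') (FO d))
            (exp_ev V (FO d) (FO b) \<cdot> pair V (pr_first V ?E ?E' (FO d)) (pr2 V (prd V ?E ?E') (FO d)))"
  have e: "FHom F d a \<cdot> (ECmp C a b d \<cdot> prd_swap V (hm b d) (hm a b)) =
      curry_arr V (prd V ?E ?E') (FO d) (FO a) ?K \<cdot> prd_map V (FHom F d b) (FHom F b a)"
    using F assms(1-3) unfolding is_enriched_functor_def by (auto simp: enriched_op_def self_enriched_def Let_def)
  have K: "?K \<in> Hom V (prd V (prd V ?E ?E') (FO d)) (FO a)"
    using assms by (simp add: in_hom pr_first_def)
  note cK = curry_arr[OF K]
  have sw: "prd_swap V (hm b d) (hm a b) \<in> Ar V" "Dom V (prd_swap V (hm b d) (hm a b)) = prd V (hm b d) (hm a b)"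
    "Cod V (prd_swap V (hm b d) (hm a b)) = prd V (hm a b) (hm b d)" "prd_swap V (hm b d) (hm a b) \<cdot> pair V g f = pair V f g"
    using assms by (simp_all add: prd_swap_def)
  let ?z = "pair V (FHom F d b \<cdot> g) (FHom F b a \<cdot> f)"
  have "FHom F d a \<cdot> cmp a b d f g = (FHom F d a \<cdot> (ECmp C a b d \<cdot> prd_swap V (hm b d) (hm a b))) \<cdot> pair V g f"
    using assms sw by (simp add: cmp_def)
  also have "\<dots> = curry_arr V (prd V ?E ?E') (FO d) (FO a) ?K \<cdot> ?z"
    unfolding e using assms cK(1) by (simp add: in_hom prd_map_at)
  finally have "act a d (cmp a b d f g) y = exp_ev V (FO d) (FO a) \<cdot> pair V (curry_arr V (prd V ?E ?E') (FO d) (FO a) ?K \<cdot> ?z) y"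
    using assms by (simp add: act_eq)
  also have "\<dots> = ?K \<cdot> pair V ?z y"
    by (rule exp_ev_curry[OF K]) (use assms in simp_all)
  also have "\<dots> = act a b f (act b d g y)"
    using assms by (simp add: act_eq pr_first_def)
  finally show ?thesis .
qed

lemma prd_elementE:
  assumes "u \<in> Hom V U (prd V a b)" "a \<in> Ob V" "b \<in> Ob V"
  obtains f g where "u = pair V f g" "f \<in> Hom V U a" "g \<in> Hom V U b"
  using that[of "pr1 V a b \<cdot> u" "pr2 V a b \<cdot> u"] assms by (simp add: in_hom)

abbreviation "idn a \<equiv> prd_map V (EId C a) (Id V (FO a)) \<cdot> pair V (bang V (FO a)) (Id V (FO a))"
abbreviation "rest a b d \<equiv> pr_rest V (hm a b) (hm b d) (FO d)"
abbreviation "initl a b d \<equiv> pair V (pr_first V (hm a b) (hm b d) (FO d)) (ev_fun V F b d \<cdot> rest a b d)"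

lemma el_simps [simp]:
  assumes "a \<in> obs" "b \<in> obs" "d \<in> obs"
  shows "rest a b d \<in> Ar V" "Dom V (rest a b d) = prd V (prd V (hm a b) (hm b d)) (FO d)"
    "Cod V (rest a b d) = prd V (hm b d) (FO d)"
    "pr_first V (hm a b) (hm b d) (FO d) \<in> Ar V"
    "Dom V (pr_first V (hm a b) (hm b d) (FO d)) = prd V (prd V (hm a b) (hm b d)) (FO d)"
    "Cod V (pr_first V (hm a b) (hm b d) (FO d)) = hm a b"
  using assms by (simp_all add: pr_rest_def pr_first_def)

lemma el_at:
  assumes "a \<in> obs" "b \<in> obs" "d \<in> obs" "f \<in> Hom V U (hm a b)" "g \<in> Hom V U (hm b d)"
    "y \<in> Hom V U (FO d)"
  shows "initl a b d \<cdot> pair V (pair V f g) y = pair V f (act b d g y)"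
    "rest a b d \<cdot> pair V (pair V f g) y = pair V g y"
    "prd_map V (ECmp C a b d) (Id V (FO d)) \<cdot> pair V (pair V f g) y = pair V (cmp a b d f g) y"
    "ev_fun V F b d \<cdot> pair V g y = act b d g y" "pr2 V (hm b d) (FO d) \<cdot> pair V g y = y"
  using assms by (simp_all add: in_hom prd_map_at act_def cmp_def pr_rest_def pr_first_def)

lemma idn_at:
  assumes "a \<in> obs" "y \<in> Hom V U (FO a)"
  shows "idn a \<cdot> y = pair V (EId C a \<cdot> bang V U) y"
  using assms hom_Ob[OF assms(2)] by (simp add: in_hom prd_map_at)

lemma pair_injects:
  assumes "pair V f g = pair V f' g'" "f \<in> Hom V U a" "g \<in> Hom V U b" "f' \<in> Hom V U a" "g' \<in> Hom V U b"
  shows "f = f'" "g = g'"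
  using assms pair_eq_iff[of f g f' g'] by (auto simp: in_hom)

text \<open>A composable pair in the category of elements is \<open>(f, z)\<close> followed by \<open>(g, y)\<close> with \<open>z = g \<cdot> y\<close>, so
  that it amounts to a triple \<open>((f, g), y)\<close>.\<close>

sublocale el: family V obs FO "\<lambda>(a, b). prd V (hm a b) (FO b)" "\<lambda>(a, b, d). prd V (prd V (hm a b) (hm b d)) (FO d)"
  "ev_fun V F" "\<lambda>a b. pr2 V (hm a b) (FO b)" idn initl rest "\<lambda>a b d. prd_map V (ECmp C a b d) (Id V (FO d))"
proof
  obtain e :: "'i \<times> 'i \<Rightarrow> 'i" where e: "inj e" using inj_pairs[OF infinite_universe] by blast
  obtain e' :: "'i \<times> 'i \<times> 'i \<Rightarrow> 'i" where e': "inj e'" using inj_triples[OF infinite_universe] by blast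
  show "extensive_at obs" by (rule extensive_at_universe)
  show "extensive_at (obs \<times> obs)" by (rule extensive_at_small[of e]) (use e in \<open>auto intro: inj_on_subset\<close>)
  show "extensive_at (obs \<times> obs \<times> obs)" by (rule extensive_at_small[of e']) (use e' in \<open>auto intro: inj_on_subset\<close>)
next
  fix a assume a: "a \<in> obs"
  have I: "Id V (FO a) \<in> Hom V (FO a) (FO a)" using a by (simp add: in_hom)
  show "ev_fun V F a a \<cdot> idn a = Id V (FO a)"
    using idn_at[OF a I] act_id[of a "Id V (FO a)" "FO a"] a by (simp add: act_def)
next
  fix a b d assume abd: "a \<in> obs" "b \<in> obs" "d \<in> obs"
  note at = el_at[OF abd]
  have sq: "pr2 V (hm a b) (FO b) \<cdot> initl a b d = ev_fun V F b d \<cdot> rest a b d" using abd by simp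
  show "is_pullback V (pr2 V (hm a b) (FO b)) (ev_fun V F b d)
      (case (a, b, d) of (a, b, d) \<Rightarrow> prd V (prd V (hm a b) (hm b d)) (FO d), initl a b d, rest a b d)"
    unfolding is_pullback_def prod.case
  proof (intro conjI ballI impI)
    fix x h k assume "h \<in> Hom V x (Dom V (pr2 V (hm a b) (FO b)))" "k \<in> Hom V x (Dom V (ev_fun V F b d))"
      and eq: "pr2 V (hm a b) (FO b) \<cdot> h = ev_fun V F b d \<cdot> k"
    then have hk: "h \<in> Hom V x (prd V (hm a b) (FO b))" "k \<in> Hom V x (prd V (hm b d) (FO d))" using abd by simp_all
    obtain f z where h: "h = pair V f z" "f \<in> Hom V x (hm a b)" "z \<in> Hom V x (FO b)"
      using prd_elementE[OF hk(1)] abd by auto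
    obtain g y where k: "k = pair V g y" "g \<in> Hom V x (hm b d)" "y \<in> Hom V x (FO d)"
      using prd_elementE[OF hk(2)] abd by auto
    have z: "z = act b d g y"
      using eq at(4)[OF h(2) k(2,3)] h k abd by (simp add: in_hom)
    show "\<exists>!u. u \<in> Hom V x (prd V (prd V (hm a b) (hm b d)) (FO d)) \<and> initl a b d \<cdot> u = h \<and> rest a b d \<cdot> u = k"
    proof (rule ex1I[of _ "pair V (pair V f g) y"])
      show "pair V (pair V f g) y \<in> Hom V x (prd V (prd V (hm a b) (hm b d)) (FO d)) \<and>
          initl a b d \<cdot> pair V (pair V f g) y = h \<and> rest a b d \<cdot> pair V (pair V f g) y = k"
        unfolding at(1)[OF h(2) k(2,3)] at(2)[OF h(2) k(2,3)] using h k z by (simp add: in_hom)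
      fix u assume u: "u \<in> Hom V x (prd V (prd V (hm a b) (hm b d)) (FO d)) \<and> initl a b d \<cdot> u = h \<and> rest a b d \<cdot> u = k"
      obtain w y' where w: "u = pair V w y'" "w \<in> Hom V x (prd V (hm a b) (hm b d))" "y' \<in> Hom V x (FO d)"
        using prd_elementE[of u x "prd V (hm a b) (hm b d)" "FO d"] u abd by auto
      obtain f' g' where f': "w = pair V f' g'" "f' \<in> Hom V x (hm a b)" "g' \<in> Hom V x (hm b d)"
        using prd_elementE[OF w(2)] abd by auto
      have "pair V f' (act b d g' y') = pair V f z" "pair V g' y' = pair V g y"
        using u at(1,2)[OF f'(2,3) w(3)] w f' h k by auto
      moreover have "act b d g' y' \<in> Hom V x (FO b)" using abd f' w by (simp add: in_hom)
      ultimately show "u = pair V (pair V f g) y"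
        using pair_injects[of f' "act b d g' y'" f z x "hm a b" "FO b"] pair_injects[of g' y' g y x "hm b d" "FO d"]
          f' w h k by simp
    qed
  qed (use abd sq in \<open>simp_all add: in_hom\<close>)
  have abd': "prd V (hm a b) (hm b d) \<in> Ob V" "FO d \<in> Ob V" using abd by simp_all
  let ?X = "prd V (prd V (hm a b) (hm b d)) (FO d)"
  let ?f = "pr1 V (hm a b) (hm b d) \<cdot> pr1 V (prd V (hm a b) (hm b d)) (FO d)"
  let ?g = "pr2 V (hm a b) (hm b d) \<cdot> pr1 V (prd V (hm a b) (hm b d)) (FO d)"
  let ?y = "pr2 V (prd V (hm a b) (hm b d)) (FO d)"
  have fgy: "?f \<in> Hom V ?X (hm a b)" "?g \<in> Hom V ?X (hm b d)" "?y \<in> Hom V ?X (FO d)"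
    using abd by (simp_all add: in_hom)
  have Id: "pair V (pair V ?f ?g) ?y = Id V ?X" using abd by simp
  have e: "initl a b d = pair V ?f (act b d ?g ?y)" "rest a b d = pair V ?g ?y"
    "prd_map V (ECmp C a b d) (Id V (FO d)) = pair V (cmp a b d ?f ?g) ?y"
    using at(1-3)[OF fgy] unfolding Id using abd by simp_all
  show "ev_fun V F a d \<cdot> prd_map V (ECmp C a b d) (Id V (FO d)) = ev_fun V F a b \<cdot> initl a b d"
    unfolding e(1,3) act_def[symmetric]
    by (rule act_cmp) (use abd in simp_all)
  show "pr2 V (hm a d) (FO d) \<cdot> prd_map V (ECmp C a b d) (Id V (FO d)) = pr2 V (hm b d) (FO d) \<cdot> rest a b d"
    unfolding e using abd by simp
next
  fix a b U f w
  assume a: "a \<in> obs" and b: "b \<in> obs" and f: "f \<in> Hom V U (case (a, b) of (a, b) \<Rightarrow> prd V (hm a b) (FO b))"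
    and w: "w \<in> Hom V U (case (a, a, b) of (a, b, d) \<Rightarrow> prd V (prd V (hm a b) (hm b d)) (FO d))"
    and e: "initl a a b \<cdot> w = idn a \<cdot> (ev_fun V F a b \<cdot> f)" "rest a a b \<cdot> w = f"
  obtain w' y where w1: "w = pair V w' y" "w' \<in> Hom V U (prd V (hm a a) (hm a b))" "y \<in> Hom V U (FO b)"
    using prd_elementE[of w U "prd V (hm a a) (hm a b)" "FO b"] w a b by auto
  obtain k g where w2: "w' = pair V k g" "k \<in> Hom V U (hm a a)" "g \<in> Hom V U (hm a b)"
    using prd_elementE[OF w1(2)] a b by auto
  note at = el_at[OF a a b w2(2,3) w1(3)]
  have fy: "f = pair V g y" using e(2) at(2) w1 w2 by simp
  have ac: "act a b g y \<in> Hom V U (FO a)" using a b w1 w2 by (simp add: in_hom)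
  have U: "U \<in> Ob V" using w1(3) hom_Ob by blast
  have "pair V k (act a b g y) = pair V (EId C a \<cdot> bang V U) (act a b g y)"
    using e(1) at(1,4) w1 w2 fy idn_at[OF a ac] by simp
  then have "k = EId C a \<cdot> bang V U"
    by (rule pair_injects(1)[where U = U and a = "hm a a" and b = "FO a"]) (use w2 ac a U in \<open>auto simp: in_hom\<close>)
  then show "prd_map V (ECmp C a a b) (Id V (FO b)) \<cdot> w = f"
    using at(3) w1 w2 fy a b by (simp add: in_hom)
next
  fix a b U f w
  assume a: "a \<in> obs" and b: "b \<in> obs" and f: "f \<in> Hom V U (case (a, b) of (a, b) \<Rightarrow> prd V (hm a b) (FO b))"
    and w: "w \<in> Hom V U (case (a, b, b) of (a, b, d) \<Rightarrow> prd V (prd V (hm a b) (hm b d)) (FO d))"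
    and e: "initl a b b \<cdot> w = f" "rest a b b \<cdot> w = idn b \<cdot> (pr2 V (hm a b) (FO b) \<cdot> f)"
  obtain w' y where w1: "w = pair V w' y" "w' \<in> Hom V U (prd V (hm a b) (hm b b))" "y \<in> Hom V U (FO b)"
    using prd_elementE[of w U "prd V (hm a b) (hm b b)" "FO b"] w a b by auto
  obtain k g where w2: "w' = pair V k g" "k \<in> Hom V U (hm a b)" "g \<in> Hom V U (hm b b)"
    using prd_elementE[OF w1(2)] a b by auto
  note at = el_at[OF a b b w2(2,3) w1(3)]
  have U: "U \<in> Ob V" using w1(3) hom_Ob by blast
  have ac: "act b b g y \<in> Hom V U (FO b)" using a b w1 w2 by (simp add: in_hom)
  have fy: "f = pair V k (act b b g y)" using e(1) at(1) w1 w2 by simp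
  have "pair V g y = pair V (EId C b \<cdot> bang V U) (act b b g y)"
    using e(2) at(2) w1 w2 fy idn_at[OF b ac] a b ac by (simp add: in_hom)
  note inj = pair_injects[OF this, where U = U and a = "hm b b" and b = "FO b"]
  have "g = EId C b \<cdot> bang V U" "y = act b b g y"
    using inj w2 w1 ac b U by (auto simp: in_hom)
  then show "prd_map V (ECmp C a b b) (Id V (FO b)) \<cdot> w = f"
    using at(3) w1 w2 fy a b by (simp add: in_hom)
next
  fix a b d e U w1 w2 w3 w4
  assume o: "a \<in> obs" "b \<in> obs" "d \<in> obs" "e \<in> obs"
    and "w1 \<in> Hom V U (case (a, b, d) of (a, b, d) \<Rightarrow> prd V (prd V (hm a b) (hm b d)) (FO d))"
    and "w2 \<in> Hom V U (case (a, d, e) of (a, b, d) \<Rightarrow> prd V (prd V (hm a b) (hm b d)) (FO d))"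
    and "w3 \<in> Hom V U (case (b, d, e) of (a, b, d) \<Rightarrow> prd V (prd V (hm a b) (hm b d)) (FO d))"
    and "w4 \<in> Hom V U (case (a, b, e) of (a, b, d) \<Rightarrow> prd V (prd V (hm a b) (hm b d)) (FO d))"
    and e: "initl a d e \<cdot> w2 = prd_map V (ECmp C a b d) (Id V (FO d)) \<cdot> w1" "rest a d e \<cdot> w2 = rest b d e \<cdot> w3"
      "initl b d e \<cdot> w3 = rest a b d \<cdot> w1" "initl a b e \<cdot> w4 = initl a b d \<cdot> w1"
      "rest a b e \<cdot> w4 = prd_map V (ECmp C b d e) (Id V (FO e)) \<cdot> w3"
  then have w: "w1 \<in> Hom V U (prd V (prd V (hm a b) (hm b d)) (FO d))"
    "w2 \<in> Hom V U (prd V (prd V (hm a d) (hm d e)) (FO e))"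
    "w3 \<in> Hom V U (prd V (prd V (hm b d) (hm d e)) (FO e))"
    "w4 \<in> Hom V U (prd V (prd V (hm a b) (hm b e)) (FO e))" by simp_all
  have triple: "\<exists>f g y. u = pair V (pair V f g) y \<and> f \<in> Hom V U (hm i j) \<and> g \<in> Hom V U (hm j k) \<and> y \<in> Hom V U (FO k)"
    if "u \<in> Hom V U (prd V (prd V (hm i j) (hm j k)) (FO k))" "i \<in> obs" "j \<in> obs" "k \<in> obs" for u i j k
    using that by (metis prd_elementE product_simps(1) C_simps(1) F_simps(1))
  obtain f1 g1 y1 where 1: "w1 = pair V (pair V f1 g1) y1" "f1 \<in> Hom V U (hm a b)" "g1 \<in> Hom V U (hm b d)" "y1 \<in> Hom V U (FO d)"
    using triple[OF w(1)] o by blast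
  obtain f2 g2 y2 where 2: "w2 = pair V (pair V f2 g2) y2" "f2 \<in> Hom V U (hm a d)" "g2 \<in> Hom V U (hm d e)" "y2 \<in> Hom V U (FO e)"
    using triple[OF w(2)] o by blast
  obtain f3 g3 y3 where 3: "w3 = pair V (pair V f3 g3) y3" "f3 \<in> Hom V U (hm b d)" "g3 \<in> Hom V U (hm d e)" "y3 \<in> Hom V U (FO e)"
    using triple[OF w(3)] o by blast
  obtain f4 g4 y4 where 4: "w4 = pair V (pair V f4 g4) y4" "f4 \<in> Hom V U (hm a b)" "g4 \<in> Hom V U (hm b e)" "y4 \<in> Hom V U (FO e)"
    using triple[OF w(4)] o by blast
  note at1 = el_at[OF o(1,2,3) 1(2-4)] and at2 = el_at[OF o(1,3,4) 2(2-4)] and at3 = el_at[OF o(2,3,4) 3(2-4)]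
    and at4 = el_at[OF o(1,2,4) 4(2-4)]
  have ac: "act d e g2 y2 \<in> Hom V U (FO d)" "cmp a b d f1 g1 \<in> Hom V U (hm a d)" "cmp b d e f3 g3 \<in> Hom V U (hm b e)"
    "act d e g3 y3 \<in> Hom V U (FO d)" "act b e g4 y4 \<in> Hom V U (FO b)" "act b d g1 y1 \<in> Hom V U (FO b)"
    using o 1 2 3 4 by (simp_all add: in_hom)
  have "f2 = cmp a b d f1 g1"
    using e(1)[unfolded 1(1) 2(1) at1 at2] pair_injects(1) 2 ac 1 by blast
  moreover have "g2 = g3" "y2 = y3"
    using pair_injects[OF e(2)[unfolded 2(1) 3(1) at2 at3] 2(3,4) 3(3,4)] by auto
  moreover have "f3 = g1"
    using e(3)[unfolded 1(1) 3(1) at1 at3] pair_injects(1) 3 ac 1 by blast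
  moreover have "f4 = f1"
    using e(4)[unfolded 1(1) 4(1) at1 at4] pair_injects(1) 4 ac 1 by blast
  moreover have "g4 = cmp b d e f3 g3" "y4 = y3"
    using pair_injects[OF e(5)[unfolded 3(1) 4(1) at3 at4] 4(3,4) ac(3) 3(4)] by auto
  ultimately show "prd_map V (ECmp C a d e) (Id V (FO e)) \<cdot> w2 = prd_map V (ECmp C a b e) (Id V (FO e)) \<cdot> w4"
    unfolding 2(1) 4(1) at2(3) at4(3) using cmp_assoc[of a b d e f1 g1 g3] o 1 3 by (simp add: in_hom)
qed (auto simp: in_hom prd_map_at)

lemma cotuple_cong: "(\<And>i. i \<in> I \<Longrightarrow> f i = g i) \<Longrightarrow> cotuple V I X y f = cotuple V I X y g"
  by (simp add: cotuple_def)

lemma elements_glued: "elements V C F = el.glued"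
proof -
  have "cotuple V obs FO el.A1 (\<lambda>a. el.in1 (a, a) \<cdot> prd_map V (EId C a) (Id V (FO a)) \<cdot> pair V (bang V (FO a)) (Id V (FO a)))
      = cotuple V obs FO el.A1 (\<lambda>a. el.in1 (a, a) \<cdot> idn a)"
    by (rule cotuple_cong) simp
  then show ?thesis
    unfolding elements_def el.glued_def el.comparison_def el.s_def el.t_def el.in0_def
      el.in1_def el.A0_def el.A1_def Let_def
    by simp
qed

end

section \<open>Transformations as functors out of a cylinder\<close>

context lex
begin

text \<open>Naturality is required at every generalised arrow; the case of the identity of \<open>Ob1 X\<close> is the
  usual diagram and implies all others.\<close>

definition is_transf :: "('o, 'm) internal_category \<Rightarrow> ('o, 'm) internal_category \<Rightarrow>
    ('o, 'm) internal_functor \<Rightarrow> ('o, 'm) internal_functor \<Rightarrow> 'm \<Rightarrow> bool" where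
  "is_transf X A G H \<tau> \<longleftrightarrow> G \<in> Hom (Cat V) X A \<and> H \<in> Hom (Cat V) X A \<and> \<tau> \<in> Hom V (Ob0 X) (Ob1 A) \<and>
     Src A \<cdot> \<tau> = Fun0 G \<and> Tgt A \<cdot> \<tau> = Fun0 H \<and>
     (\<forall>U. \<forall>f\<in>Hom V U (Ob1 X).
        icomp A (Fun1 G \<cdot> f) (\<tau> \<cdot> (Tgt X \<cdot> f)) = icomp A (\<tau> \<cdot> (Src X \<cdot> f)) (Fun1 H \<cdot> f))"

end

context extensive_cat
begin

abbreviation "Two \<equiv> two.glued"

lemma IC_Two [simp]: "IC Two"
  by (rule two.IC_glued)

text \<open>The constant elements of the interval at a stage \<open>U\<close>: its two objects and, for \<open>a \<longrightarrow> b\<close>, the arrow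
  from \<open>a\<close> to \<open>b\<close>.\<close>

definition e0 :: "bool \<Rightarrow> 'o \<Rightarrow> 'm" where "e0 k U = two.in0 k \<cdot> bang V U"
definition e1 :: "bool \<Rightarrow> bool \<Rightarrow> 'o \<Rightarrow> 'm" where "e1 a b U = two.in1 (a, b) \<cdot> bang V U"

lemma H2_terminal [simp]: "a \<longrightarrow> b \<Longrightarrow> H2 a b = terminal V"
  by (auto simp: H2_def)

lemma two_in_simps [simp]:
  "two.in0 k \<in> Ar V" "Dom V (two.in0 k) = terminal V" "Cod V (two.in0 k) = two.A0"
  "two.in1 (a, b) \<in> Ar V" "Dom V (two.in1 (a, b)) = H2 a b" "Cod V (two.in1 (a, b)) = two.A1"
  by simp_all

lemma e_simps [simp]:
  assumes "U \<in> Ob V"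
  shows "e0 k U \<in> Ar V" "Dom V (e0 k U) = U" "Cod V (e0 k U) = two.A0"
    "a \<longrightarrow> b \<Longrightarrow> e1 a b U \<in> Ar V" "a \<longrightarrow> b \<Longrightarrow> Dom V (e1 a b U) = U" "a \<longrightarrow> b \<Longrightarrow> Cod V (e1 a b U) = two.A1"
  using assms by (simp_all add: e0_def e1_def)

lemma e_at [simp]:
  assumes "u \<in> Ar V" "Cod V u = U"
  shows "e0 k U \<cdot> u = e0 k (Dom V u)" "a \<longrightarrow> b \<Longrightarrow> e1 a b U \<cdot> u = e1 a b (Dom V u)"
  using assms Cod_Ob[of u] by (simp_all add: e0_def e1_def)

lemma e_Two:
  assumes "U \<in> Ob V"
  shows "a \<longrightarrow> b \<Longrightarrow> two.s \<cdot> e1 a b U = e0 a U" "a \<longrightarrow> b \<Longrightarrow> two.t \<cdot> e1 a b U = e0 b U"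
    "Idn Two \<cdot> e0 a U = e1 a a U"
    "a \<longrightarrow> b \<Longrightarrow> b \<longrightarrow> d \<Longrightarrow> icomp Two (e1 a b U) (e1 b d U) = e1 a d U"
proof -
  show "a \<longrightarrow> b \<Longrightarrow> two.s \<cdot> e1 a b U = e0 a U" "a \<longrightarrow> b \<Longrightarrow> two.t \<cdot> e1 a b U = e0 b U"
    using assms by (simp_all add: e0_def e1_def)
  have id: "id2 a \<cdot> bang V U = bang V U"
    by (rule terminal_eq) (use id2[of a] assms in \<open>simp_all add: in_hom\<close>)
  show "Idn Two \<cdot> e0 a U = e1 a a U"
    using assms two.Idn_glued_at[of a "bang V U"] by (simp add: e0_def e1_def id)
  assume ab: "a \<longrightarrow> b" "b \<longrightarrow> d"
  let ?x = "pair V (bang V U) (bang V U)"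
  have "icomp Two (e1 a b U) (e1 b d U) = two.in1 (a, d) \<cdot> (cmp2 a b d \<cdot> ?x)"
    unfolding e1_def by (rule two.icomp_glued) (use assms ab in simp_all)
  also have "cmp2 a b d \<cdot> ?x = bang V U"
    by (rule terminal_eq) (use cmp2[of a b d] assms ab in \<open>simp_all add: in_hom\<close>)
  finally show "icomp Two (e1 a b U) (e1 b d U) = e1 a d U" by (simp add: e1_def)
qed

end

text \<open>\<open>Y\<close> is any product of \<open>X\<close> with the interval. Its generalised objects are locally pairs
  \<open>(x, k)\<close> with \<open>k\<close> one of the two objects of the interval, and likewise for arrows.\<close>

locale cylinder = extensive_cat V universe for V :: "('o, 'm) category" (structure) and universe :: "'i itself" +
  fixes X Y :: "('o, 'm) internal_category" and \<pi>1 \<pi>2 :: "('o, 'm) internal_functor"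
  assumes X [simp]: "IC X" and Y: "is_product (Cat V) X Two (Y, \<pi>1, \<pi>2)"
begin

lemma IC_Y [simp]: "IC Y"
  using Y by (auto simp: is_product_def)

lemma \<pi>_simps [simp]: "IF \<pi>1" "IDom \<pi>1 = Y" "ICod \<pi>1 = X" "IF \<pi>2" "IDom \<pi>2 = Y" "ICod \<pi>2 = Two"
  using Y by (auto simp: is_product_def in_Cat_hom)

lemma \<pi>_types [simp]:
  "Fun0 \<pi>1 \<in> Ar V" "Dom V (Fun0 \<pi>1) = Ob0 Y" "Cod V (Fun0 \<pi>1) = Ob0 X"
  "Fun1 \<pi>1 \<in> Ar V" "Dom V (Fun1 \<pi>1) = Ob1 Y" "Cod V (Fun1 \<pi>1) = Ob1 X"
  "Fun0 \<pi>2 \<in> Ar V" "Dom V (Fun0 \<pi>2) = Ob0 Y" "Cod V (Fun0 \<pi>2) = two.A0"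
  "Fun1 \<pi>2 \<in> Ar V" "Dom V (Fun1 \<pi>2) = Ob1 Y" "Cod V (Fun1 \<pi>2) = two.A1"
  by simp_all

lemmas Y0 = is_productD[OF product_Fun(1)[OF Y X IC_Two], unfolded two.glued_simps]
lemmas Y1 = is_productD[OF product_Fun(2)[OF Y X IC_Two], unfolded two.glued_simps]

definition ob :: "bool \<Rightarrow> 'm \<Rightarrow> 'm" where
  "ob k x = (SOME z. z \<in> Hom V (Dom V x) (Ob0 Y) \<and> Fun0 \<pi>1 \<cdot> z = x \<and> Fun0 \<pi>2 \<cdot> z = e0 k (Dom V x))"

definition ar :: "bool \<Rightarrow> bool \<Rightarrow> 'm \<Rightarrow> 'm" where
  "ar a b f = (SOME z. z \<in> Hom V (Dom V f) (Ob1 Y) \<and> Fun1 \<pi>1 \<cdot> z = f \<and> Fun1 \<pi>2 \<cdot> z = e1 a b (Dom V f))"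

lemma ob [simp]:
  assumes "x \<in> Ar V" "Cod V x = Ob0 X"
  shows "ob k x \<in> Ar V" "Dom V (ob k x) = Dom V x" "Cod V (ob k x) = Ob0 Y"
    "Fun0 \<pi>1 \<cdot> ob k x = x" "Fun0 \<pi>2 \<cdot> ob k x = e0 k (Dom V x)"
proof -
  have "\<exists>z. z \<in> Hom V (Dom V x) (Ob0 Y) \<and> Fun0 \<pi>1 \<cdot> z = x \<and> Fun0 \<pi>2 \<cdot> z = e0 k (Dom V x)"
    by (rule Y0(4)) (use assms in \<open>simp_all add: in_hom\<close>)
  from someI_ex[OF this] show "ob k x \<in> Ar V" "Dom V (ob k x) = Dom V x" "Cod V (ob k x) = Ob0 Y"
    "Fun0 \<pi>1 \<cdot> ob k x = x" "Fun0 \<pi>2 \<cdot> ob k x = e0 k (Dom V x)"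
    unfolding ob_def by (auto simp: in_hom)
qed

lemma ar [simp]:
  assumes "f \<in> Ar V" "Cod V f = Ob1 X" "a \<longrightarrow> b"
  shows "ar a b f \<in> Ar V" "Dom V (ar a b f) = Dom V f" "Cod V (ar a b f) = Ob1 Y"
    "Fun1 \<pi>1 \<cdot> ar a b f = f" "Fun1 \<pi>2 \<cdot> ar a b f = e1 a b (Dom V f)"
proof -
  have "\<exists>z. z \<in> Hom V (Dom V f) (Ob1 Y) \<and> Fun1 \<pi>1 \<cdot> z = f \<and> Fun1 \<pi>2 \<cdot> z = e1 a b (Dom V f)"
    by (rule Y1(4)) (use assms in \<open>simp_all add: in_hom\<close>)
  from someI_ex[OF this] show "ar a b f \<in> Ar V" "Dom V (ar a b f) = Dom V f" "Cod V (ar a b f) = Ob1 Y"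
    "Fun1 \<pi>1 \<cdot> ar a b f = f" "Fun1 \<pi>2 \<cdot> ar a b f = e1 a b (Dom V f)"
    unfolding ar_def by (auto simp: in_hom)
qed

lemma ob_eqI:
  assumes "z \<in> Ar V" "Cod V z = Ob0 Y" "Fun0 \<pi>1 \<cdot> z = x" "Fun0 \<pi>2 \<cdot> z = e0 k (Dom V z)"
  shows "z = ob k x"
proof -
  have x: "x \<in> Ar V" "Cod V x = Ob0 X" "Dom V x = Dom V z" using assms(1,2) unfolding assms(3)[symmetric] by simp_all
  show ?thesis by (rule Y0(5)[of _ "Dom V z"]) (use assms x in \<open>simp_all add: in_hom\<close>)
qed

lemma ar_eqI:
  assumes "z \<in> Ar V" "Cod V z = Ob1 Y" "Fun1 \<pi>1 \<cdot> z = f" "Fun1 \<pi>2 \<cdot> z = e1 a b (Dom V z)" "a \<longrightarrow> b"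
  shows "z = ar a b f"
proof -
  have f: "f \<in> Ar V" "Cod V f = Ob1 X" "Dom V f = Dom V z" using assms(1,2) unfolding assms(3)[symmetric] by simp_all
  show ?thesis by (rule Y1(5)[of _ "Dom V z"]) (use assms f in \<open>simp_all add: in_hom\<close>)
qed

lemma ob_at [simp]:
  assumes "x \<in> Ar V" "Cod V x = Ob0 X" "u \<in> Ar V" "Cod V u = Dom V x"
  shows "ob k x \<cdot> u = ob k (x \<cdot> u)"
  by (rule ob_eqI) (use assms in \<open>simp_all add: comp_eq_at[OF ob(4)] comp_eq_at[OF ob(5)]\<close>)

lemma ar_at [simp]:
  assumes "f \<in> Ar V" "Cod V f = Ob1 X" "a \<longrightarrow> b" "u \<in> Ar V" "Cod V u = Dom V f"
  shows "ar a b f \<cdot> u = ar a b (f \<cdot> u)"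
  by (rule ar_eqI) (use assms in \<open>simp_all add: comp_eq_at[OF ar(4)] comp_eq_at[OF ar(5)]\<close>)

lemma ar_ob [simp]:
  assumes "f \<in> Ar V" "Cod V f = Ob1 X" "a \<longrightarrow> b"
  shows "Src Y \<cdot> ar a b f = ob a (Src X \<cdot> f)" "Tgt Y \<cdot> ar a b f = ob b (Tgt X \<cdot> f)"
proof -
  note st = IF_at(1,2)[of _ Y _ "ar a b f", symmetric]
  have e: "Fun0 \<pi>2 \<cdot> (Src Y \<cdot> ar a b f) = e0 a (Dom V f)" "Fun0 \<pi>2 \<cdot> (Tgt Y \<cdot> ar a b f) = e0 b (Dom V f)"
    "Fun0 \<pi>1 \<cdot> (Src Y \<cdot> ar a b f) = Src X \<cdot> f" "Fun0 \<pi>1 \<cdot> (Tgt Y \<cdot> ar a b f) = Tgt X \<cdot> f"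
    using st[of \<pi>2 Two] st[of \<pi>1 X] assms by (simp_all add: e_Two)
  show "Src Y \<cdot> ar a b f = ob a (Src X \<cdot> f)" "Tgt Y \<cdot> ar a b f = ob b (Tgt X \<cdot> f)"
    by (rule ob_eqI; use assms e in \<open>simp add: e_Two\<close>)+
qed

lemma Idn_ob [simp]:
  assumes "x \<in> Ar V" "Cod V x = Ob0 X"
  shows "Idn Y \<cdot> ob a x = ar a a (Idn X \<cdot> x)"
  by (rule ar_eqI) (use assms in \<open>simp_all add: e_Two\<close>)

lemma icomp_ar [simp]:
  assumes "f \<in> Ar V" "g \<in> Ar V" "Dom V f = Dom V g" "Cod V f = Ob1 X" "Cod V g = Ob1 X" "Tgt X \<cdot> f = Src X \<cdot> g"
    "a \<longrightarrow> b" "b \<longrightarrow> d"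
  shows "icomp Y (ar a b f) (ar b d g) = ar a d (icomp X f g)"
  by (rule ar_eqI) (use assms in \<open>simp_all add: e_Two\<close>)

lemma local_ob:
  assumes z: "z \<in> Hom V U (Ob0 Y)" and hk: "h \<in> Hom V U Z" "k \<in> Hom V U Z"
    and step: "\<And>W w n x. w \<in> Hom V W U \<Longrightarrow> x \<in> Hom V W (Ob0 X) \<Longrightarrow> z \<cdot> w = ob n x \<Longrightarrow> h \<cdot> w = k \<cdot> w"
  shows "h = k"
proof (rule local_eq[OF two.ext0 two.c0 comp_hom[OF z Y0(3)] hk])
  fix W w n v assume w: "w \<in> Hom V W U" and v: "v \<in> Hom V W (terminal V)" and e: "(Fun0 \<pi>2 \<cdot> z) \<cdot> w = two.in0 n \<cdot> v"
  have "v = bang V W" using v to_terminal[of v] by (simp add: in_hom)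
  then have "z \<cdot> w = ob n (Fun0 \<pi>1 \<cdot> (z \<cdot> w))"
    by (intro ob_eqI) (use z w e in \<open>simp_all add: in_hom e0_def\<close>)
  then show "h \<cdot> w = k \<cdot> w"
    by (rule step[OF w, rotated]) (use z w in \<open>simp add: in_hom\<close>)
qed

lemma local_ar:
  assumes z: "z \<in> Hom V U (Ob1 Y)" and hk: "h \<in> Hom V U Z" "k \<in> Hom V U Z"
    and step: "\<And>W w a b f. w \<in> Hom V W U \<Longrightarrow> f \<in> Hom V W (Ob1 X) \<Longrightarrow> a \<longrightarrow> b \<Longrightarrow> z \<cdot> w = ar a b f \<Longrightarrow> h \<cdot> w = k \<cdot> w"
  shows "h = k"
proof (rule local_eq[OF two.ext1 two.c1 comp_hom[OF z Y1(3)] hk])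
  fix W w i v assume w: "w \<in> Hom V W U" and v: "v \<in> Hom V W (case i of (a, b) \<Rightarrow> H2 a b)"
    and e: "(Fun1 \<pi>2 \<cdot> z) \<cdot> w = two.in1 i \<cdot> v"
  obtain a b where i: "i = (a, b)" by (cases i)
  show "h \<cdot> w = k \<cdot> w"
  proof (cases "a \<longrightarrow> b")
    case True
    then have "v = bang V W" using v i to_terminal[of v] by (simp add: in_hom)
    then have "z \<cdot> w = ar a b (Fun1 \<pi>1 \<cdot> (z \<cdot> w))"
      by (intro ar_eqI) (use z w e i True in \<open>simp_all add: in_hom e1_def\<close>)
    then show ?thesis
      by (rule step[OF w _ True, rotated]) (use z w in \<open>simp add: in_hom\<close>)
  next
    case False
    then have "v \<in> Hom V W (initial V)" using v i by (simp add: H2_def)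
    from is_initial_unique[OF strict_initial[OF initial this]] show ?thesis using comp_hom[OF w] hk by blast
  qed
qed

lemma e0_disjoint:
  assumes "e0 a U = e0 b U" "U \<in> Ob V" "a \<noteq> b"
  shows "is_initial V U"
  by (rule summand_disjoint[OF two.ext0 two.c0 _ _ assms(3), of "bang V U" U "bang V U"])
    (use assms bang in \<open>auto simp: e0_def\<close>)

lemma local_ar_composable:
  assumes f: "f \<in> Hom V U (Ob1 Y)" and g: "g \<in> Hom V U (Ob1 Y)" and fg: "Tgt Y \<cdot> f = Src Y \<cdot> g"
    and hk: "h \<in> Hom V U Z" "k \<in> Hom V U Z"
    and step: "\<And>W w a b d f' g'. w \<in> Hom V W U \<Longrightarrow> f' \<in> Hom V W (Ob1 X) \<Longrightarrow> g' \<in> Hom V W (Ob1 X) \<Longrightarrow>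
      Tgt X \<cdot> f' = Src X \<cdot> g' \<Longrightarrow> a \<longrightarrow> b \<Longrightarrow> b \<longrightarrow> d \<Longrightarrow> f \<cdot> w = ar a b f' \<Longrightarrow> g \<cdot> w = ar b d g' \<Longrightarrow> h \<cdot> w = k \<cdot> w"
  shows "h = k"
proof (rule local_ar[OF f hk])
  fix W w a b f' assume w: "w \<in> Hom V W U" and f': "f' \<in> Hom V W (Ob1 X)" and ab: "a \<longrightarrow> b" and fw: "f \<cdot> w = ar a b f'"
  show "h \<cdot> w = k \<cdot> w"
  proof (rule local_ar[OF comp_hom[OF w g] comp_hom[OF w hk(1)] comp_hom[OF w hk(2)]])
    fix W' w' b' d g' assume w': "w' \<in> Hom V W' W" and g': "g' \<in> Hom V W' (Ob1 X)" and bd: "b' \<longrightarrow> d"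
      and gw: "(g \<cdot> w) \<cdot> w' = ar b' d g'"
    have ww: "w \<cdot> w' \<in> Hom V W' U" using w w' comp_hom by blast
    have f1: "f' \<cdot> w' \<in> Hom V W' (Ob1 X)" using f' w' comp_hom by blast
    have fw': "f \<cdot> (w \<cdot> w') = ar a b (f' \<cdot> w')"
      using comp_eq_at[OF fw, of w'] f w w' f' ab by (simp add: in_hom)
    have gw': "g \<cdot> (w \<cdot> w') = ar b' d g'" using gw g w w' by (simp add: in_hom)
    have "Tgt Y \<cdot> (f \<cdot> (w \<cdot> w')) = Src Y \<cdot> (g \<cdot> (w \<cdot> w'))"
      using comp_eq_at[OF fg, of "w \<cdot> w'"] f g ww by (simp add: in_hom)
    then have e: "ob b (Tgt X \<cdot> (f' \<cdot> w')) = ob b' (Src X \<cdot> g')"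
      unfolding fw' gw' using f1 g' ab bd by (simp add: in_hom)
    have "Fun0 \<pi>1 \<cdot> ob b (Tgt X \<cdot> (f' \<cdot> w')) = Fun0 \<pi>1 \<cdot> ob b' (Src X \<cdot> g')" by (simp only: e)
    then have e1: "Tgt X \<cdot> (f' \<cdot> w') = Src X \<cdot> g'" using f1 g' by (simp add: in_hom)
    have "Fun0 \<pi>2 \<cdot> ob b (Tgt X \<cdot> (f' \<cdot> w')) = Fun0 \<pi>2 \<cdot> ob b' (Src X \<cdot> g')" by (simp only: e)
    then have e2: "e0 b W' = e0 b' W'" using f1 g' by (simp add: in_hom)
    have "h \<cdot> (w \<cdot> w') = k \<cdot> (w \<cdot> w')"
    proof (cases "b = b'")
      case True
      show ?thesis
        by (rule step[OF ww f1 g' e1 ab _ fw']) (use bd True gw' in auto)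
    next
      case False
      have "is_initial V W'" using e0_disjoint[OF e2 _ False] w' hom_Ob by blast
      then show ?thesis using is_initial_unique comp_hom[OF ww] hk by blast
    qed
    then show "(h \<cdot> w) \<cdot> w' = (k \<cdot> w) \<cdot> w'" using hk w w' by (simp add: in_hom)
  qed
qed

definition incl :: "bool \<Rightarrow> ('o, 'm) internal_functor" where
  "incl k = \<lparr>IDom = X, ICod = Y, Fun0 = ob k (Id V (Ob0 X)), Fun1 = ar k k (Id V (Ob1 X))\<rparr>"

lemma incl_simps [simp]:
  "IDom (incl k) = X" "ICod (incl k) = Y" "Fun0 (incl k) = ob k (Id V (Ob0 X))" "Fun1 (incl k) = ar k k (Id V (Ob1 X))"
  by (simp_all add: incl_def)

lemma IF_incl [simp]: "IF (incl k)"
  by (rule is_internal_functorI[of X Y]) (simp_all add: in_hom)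

lemma incl_unique:
  assumes "I \<in> Hom (Cat V) X Y" "\<pi>1 \<cdot>\<^bsub>Cat V\<^esub> I = Id (Cat V) X"
    and "Fun0 \<pi>2 \<cdot> Fun0 I = e0 k (Ob0 X)" "Fun1 \<pi>2 \<cdot> Fun1 I = e1 k k (Ob1 X)"
  shows "I = incl k"
proof -
  have I: "IF I" "IDom I = X" "ICod I = Y" using assms(1) by (simp_all add: in_Cat_hom)
  have p: "Fun0 \<pi>1 \<cdot> Fun0 I = Id V (Ob0 X)" "Fun1 \<pi>1 \<cdot> Fun1 I = Id V (Ob1 X)"
    using arg_cong[OF assms(2), of Fun0] arg_cong[OF assms(2), of Fun1] by simp_all
  have "Fun0 I = ob k (Id V (Ob0 X))" by (rule ob_eqI) (use I assms(3) p in simp_all)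
  moreover have "Fun1 I = ar k k (Id V (Ob1 X))" by (rule ar_eqI) (use I assms(4) p in simp_all)
  ultimately show ?thesis using I by (intro internal_functor_eqI) simp_all
qed

text \<open>The component at \<open>x\<close> of the transformation given by a functor \<open>K\<close> is the value of \<open>K\<close> at the
  identity of \<open>x\<close> paired with the arrow of the interval.\<close>

definition tau :: "('o, 'm) internal_functor \<Rightarrow> 'm" where
  "tau K = Fun1 K \<cdot> ar False True (Idn X)"

text \<open>The arrow \<open>(f, 0 \<rightarrow> 1)\<close> of the cylinder factors in two ways, as \<open>(f, id\<^sub>0)\<close> followed by \<open>(id, 0 \<rightarrow> 1)\<close> and
  as \<open>(id, 0 \<rightarrow> 1)\<close> followed by \<open>(f, id\<^sub>1)\<close>. The first factorisation shows that \<open>K\<close> is determined by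
  its ends and \<open>tau K\<close>; both together are naturality.\<close>

lemma functor_at:
  assumes K: "K \<in> Hom (Cat V) Y A"
  shows "x \<in> Ar V \<Longrightarrow> Cod V x = Ob0 X \<Longrightarrow> Fun0 K \<cdot> ob k x = Fun0 (K \<cdot>\<^bsub>Cat V\<^esub> incl k) \<cdot> x"
    "f \<in> Ar V \<Longrightarrow> Cod V f = Ob1 X \<Longrightarrow> Fun1 K \<cdot> ar k k f = Fun1 (K \<cdot>\<^bsub>Cat V\<^esub> incl k) \<cdot> f"
    "f \<in> Ar V \<Longrightarrow> Cod V f = Ob1 X \<Longrightarrow> Fun1 K \<cdot> ar False True f =
       icomp A (Fun1 (K \<cdot>\<^bsub>Cat V\<^esub> incl False) \<cdot> f) (tau K \<cdot> (Tgt X \<cdot> f))"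
    "f \<in> Ar V \<Longrightarrow> Cod V f = Ob1 X \<Longrightarrow> Fun1 K \<cdot> ar False True f =
       icomp A (tau K \<cdot> (Src X \<cdot> f)) (Fun1 (K \<cdot>\<^bsub>Cat V\<^esub> incl True) \<cdot> f)"
proof -
  have K': "IF K" "IDom K = Y" "ICod K = A" using K by (simp_all add: in_Cat_hom)
  note [simp] = IF_simps(3-)[OF K'(1), unfolded K'(2)]
  show "x \<in> Ar V \<Longrightarrow> Cod V x = Ob0 X \<Longrightarrow> Fun0 K \<cdot> ob k x = Fun0 (K \<cdot>\<^bsub>Cat V\<^esub> incl k) \<cdot> x"
    "f \<in> Ar V \<Longrightarrow> Cod V f = Ob1 X \<Longrightarrow> Fun1 K \<cdot> ar k k f = Fun1 (K \<cdot>\<^bsub>Cat V\<^esub> incl k) \<cdot> f"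
    using K' by simp_all
  assume f: "f \<in> Ar V" "Cod V f = Ob1 X"
  have i: "icomp Y (ar False False f) (ar False True (Idn X \<cdot> (Tgt X \<cdot> f))) = ar False True f"
    "icomp Y (ar False True (Idn X \<cdot> (Src X \<cdot> f))) (ar True True f) = ar False True f"
    using f by simp_all
  have "Fun1 K \<cdot> icomp Y (ar False False f) (ar False True (Idn X \<cdot> (Tgt X \<cdot> f))) =
      icomp A (Fun1 K \<cdot> ar False False f) (Fun1 K \<cdot> ar False True (Idn X \<cdot> (Tgt X \<cdot> f)))"
    by (rule IF_at(4)[OF K']) (use f in simp_all)
  then show "Fun1 K \<cdot> ar False True f = icomp A (Fun1 (K \<cdot>\<^bsub>Cat V\<^esub> incl False) \<cdot> f) (tau K \<cdot> (Tgt X \<cdot> f))"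
    unfolding i using f K' by (simp add: tau_def)
  have "Fun1 K \<cdot> icomp Y (ar False True (Idn X \<cdot> (Src X \<cdot> f))) (ar True True f) =
      icomp A (Fun1 K \<cdot> ar False True (Idn X \<cdot> (Src X \<cdot> f))) (Fun1 K \<cdot> ar True True f)"
    by (rule IF_at(4)[OF K']) (use f in simp_all)
  then show "Fun1 K \<cdot> ar False True f = icomp A (tau K \<cdot> (Src X \<cdot> f)) (Fun1 (K \<cdot>\<^bsub>Cat V\<^esub> incl True) \<cdot> f)"
    unfolding i using f K' by (simp add: tau_def)
qed

lemma transf_of_functor:
  assumes K: "K \<in> Hom (Cat V) Y A"
  shows "is_transf X A (K \<cdot>\<^bsub>Cat V\<^esub> incl False) (K \<cdot>\<^bsub>Cat V\<^esub> incl True) (tau K)"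
proof -
  have K': "IF K" "IDom K = Y" "ICod K = A" using K by (simp_all add: in_Cat_hom)
  note [simp] = IF_simps(3-)[OF K'(1), unfolded K'(2)]
  have "K \<cdot>\<^bsub>Cat V\<^esub> incl k \<in> Hom (Cat V) X A" for k
    by (rule Cat_cat.comp_hom[OF _ K]) (simp add: in_Cat_hom)
  moreover have "tau K \<in> Hom V (Ob0 X) (Ob1 A)" "Src A \<cdot> tau K = Fun0 (K \<cdot>\<^bsub>Cat V\<^esub> incl False)"
    "Tgt A \<cdot> tau K = Fun0 (K \<cdot>\<^bsub>Cat V\<^esub> incl True)"
    using K' by (simp_all add: in_hom tau_def)
  moreover have "icomp A (Fun1 (K \<cdot>\<^bsub>Cat V\<^esub> incl False) \<cdot> f) (tau K \<cdot> (Tgt X \<cdot> f)) =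
      icomp A (tau K \<cdot> (Src X \<cdot> f)) (Fun1 (K \<cdot>\<^bsub>Cat V\<^esub> incl True) \<cdot> f)" if "f \<in> Hom V U (Ob1 X)" for U f
    using functor_at(3,4)[OF K, of f] that unfolding in_hom by metis
  ultimately show ?thesis unfolding is_transf_def by blast
qed

lemma functor_eqI:
  assumes K: "K \<in> Hom (Cat V) Y A" and L: "L \<in> Hom (Cat V) Y A"
    and eq: "\<And>k. K \<cdot>\<^bsub>Cat V\<^esub> incl k = L \<cdot>\<^bsub>Cat V\<^esub> incl k" "tau K = tau L"
  shows "K = L"
proof (rule internal_functor_eqI)
  have K': "IF K" "IDom K = Y" "ICod K = A" "IF L" "IDom L = Y" "ICod L = A"
    using K L by (simp_all add: in_Cat_hom)
  note [simp] = IF_simps(3-)[OF K'(1), unfolded K'(2,3)] IF_simps(3-)[OF K'(4), unfolded K'(5,6)]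
  show "IDom K = IDom L" "ICod K = ICod L" using K' by simp_all
  have "Fun0 K \<in> Hom V (Ob0 Y) (Ob0 A)" "Fun0 L \<in> Hom V (Ob0 Y) (Ob0 A)" by (simp_all add: in_hom)
  then show "Fun0 K = Fun0 L"
  proof (rule local_ob[of "Id V (Ob0 Y)" "Ob0 Y", rotated])
    show "Fun0 K \<cdot> w = Fun0 L \<cdot> w"
      if "w \<in> Hom V W (Ob0 Y)" "x \<in> Hom V W (Ob0 X)" "Id V (Ob0 Y) \<cdot> w = ob n x" for W w n x
      using that functor_at(1)[OF K, of x n] functor_at(1)[OF L, of x n] eq by (simp add: in_hom del: Cat_simps)
  qed (simp add: in_hom)
  have "Fun1 K \<in> Hom V (Ob1 Y) (Ob1 A)" "Fun1 L \<in> Hom V (Ob1 Y) (Ob1 A)" by (simp_all add: in_hom)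
  then show "Fun1 K = Fun1 L"
  proof (rule local_ar[of "Id V (Ob1 Y)" "Ob1 Y", rotated])
    show "Fun1 K \<cdot> w = Fun1 L \<cdot> w"
      if "w \<in> Hom V W (Ob1 Y)" "f \<in> Hom V W (Ob1 X)" "a \<longrightarrow> b" "Id V (Ob1 Y) \<cdot> w = ar a b f" for W w a b f
      using that functor_at(2)[OF K, of f a] functor_at(2)[OF L, of f a] eq
        functor_at(3)[OF K, of f] functor_at(3)[OF L, of f] by (cases a; cases b) (simp_all add: in_hom del: Cat_simps)
  qed (simp add: in_hom)
qed

text \<open>The functor is defined by cases on the component in the interval, as dictated by \<open>functor_at\<close>.
  That it preserves composition has to be checked for the four composable pairs of the interval;
  naturality is used for \<open>(f, 0 \<rightarrow> 1)\<close> followed by \<open>(g, id\<^sub>1)\<close>.\<close>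

theorem functor_of_transf:
  assumes "is_transf X A G H \<tau>"
  obtains K where "K \<in> Hom (Cat V) Y A" "K \<cdot>\<^bsub>Cat V\<^esub> incl False = G" "K \<cdot>\<^bsub>Cat V\<^esub> incl True = H" "tau K = \<tau>"
proof -
  have GH: "IF G" "IDom G = X" "ICod G = A" "IF H" "IDom H = X" "ICod H = A"
    and \<tau>: "\<tau> \<in> Hom V (Ob0 X) (Ob1 A)" and st: "Src A \<cdot> \<tau> = Fun0 G" "Tgt A \<cdot> \<tau> = Fun0 H"
    and nat: "\<And>U f. f \<in> Hom V U (Ob1 X) \<Longrightarrow>
        icomp A (Fun1 G \<cdot> f) (\<tau> \<cdot> (Tgt X \<cdot> f)) = icomp A (\<tau> \<cdot> (Src X \<cdot> f)) (Fun1 H \<cdot> f)"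
    using assms unfolding is_transf_def in_Cat_hom by blast+
  note [simp] = IF_simps(2-)[OF GH(1), unfolded GH(2,3)] IF_simps(3-)[OF GH(4), unfolded GH(5,6)] GH
  have [simp]: "\<tau> \<in> Ar V" "Dom V \<tau> = Ob0 X" "Cod V \<tau> = Ob1 A" using \<tau> by (simp_all add: in_hom)
  have [simp]: "Src A \<cdot> (\<tau> \<cdot> u) = Fun0 G \<cdot> u" "Tgt A \<cdot> (\<tau> \<cdot> u) = Fun0 H \<cdot> u" if "u \<in> Ar V" "Cod V u = Ob0 X" for u
    using that comp_eq_at[OF st(1), of u] comp_eq_at[OF st(2), of u] by simp_all
  obtain K0 where K0: "K0 \<in> Hom V (Ob0 Y) (Ob0 A)"
    and K0_at: "\<And>i U u v. i \<in> UNIV \<Longrightarrow> u \<in> Hom V U (Ob0 Y) \<Longrightarrow> v \<in> Hom V U (terminal V) \<Longrightarrow> Fun0 \<pi>2 \<cdot> u = two.in0 i \<cdot> v \<Longrightarrow>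
      K0 \<cdot> u = Fun0 (if i then H else G) \<cdot> (Fun0 \<pi>1 \<cdot> u)"
    by (rule define_by_cases[OF two.ext0 two.c0 Y0(3), of "Ob0 A" "\<lambda>i u v. Fun0 (if i then H else G) \<cdot> (Fun0 \<pi>1 \<cdot> u)"])
      (auto simp: in_hom)
  \<comment> \<open>The index \<open>(True, False)\<close> only occurs at initial stages, where any arrow of the right type will do.\<close>
  define \<phi> where "\<phi> = (\<lambda>i u (v :: 'm). let f = Fun1 \<pi>1 \<cdot> u in
    if fst i then Fun1 H \<cdot> f else if snd i then icomp A (Fun1 G \<cdot> f) (\<tau> \<cdot> (Tgt X \<cdot> f)) else Fun1 G \<cdot> f)"
  obtain K1 where K1: "K1 \<in> Hom V (Ob1 Y) (Ob1 A)"
    and K1_at: "\<And>i U u v. i \<in> UNIV \<times> UNIV \<Longrightarrow> u \<in> Hom V U (Ob1 Y) \<Longrightarrow> v \<in> Hom V U (case i of (a, b) \<Rightarrow> H2 a b) \<Longrightarrow>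
      Fun1 \<pi>2 \<cdot> u = two.in1 i \<cdot> v \<Longrightarrow> K1 \<cdot> u = \<phi> i u v"
    by (rule define_by_cases[OF two.ext1 two.c1 Y1(3), of "Ob1 A" \<phi>]) (auto simp: in_hom \<phi>_def Let_def)
  have K0_ob [simp]: "K0 \<cdot> ob k x = Fun0 (if k then H else G) \<cdot> x" if "x \<in> Ar V" "Cod V x = Ob0 X" for k x
    using that K0_at[of k "ob k x" "Dom V x" "bang V (Dom V x)"] by (simp add: in_hom e0_def)
  have K1_ar: "K1 \<cdot> ar a b f = \<phi> (a, b) (ar a b f) (bang V (Dom V f))" if "f \<in> Ar V" "Cod V f = Ob1 X" "a \<longrightarrow> b" for a b f
    using that K1_at[of "(a, b)" "ar a b f" "Dom V f" "bang V (Dom V f)"] by (simp add: in_hom e1_def)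
  have K1_ar' [simp]: "K1 \<cdot> ar False False f = Fun1 G \<cdot> f" "K1 \<cdot> ar True True f = Fun1 H \<cdot> f"
    "K1 \<cdot> ar False True f = icomp A (Fun1 G \<cdot> f) (\<tau> \<cdot> (Tgt X \<cdot> f))"
    if "f \<in> Ar V" "Cod V f = Ob1 X" for f
    using that K1_ar[of f] by (simp_all add: \<phi>_def)
  have [simp]: "K0 \<in> Ar V" "Dom V K0 = Ob0 Y" "Cod V K0 = Ob0 A" "K1 \<in> Ar V" "Dom V K1 = Ob1 Y" "Cod V K1 = Ob1 A"
    using K0 K1 by (simp_all add: in_hom)
  define K where "K = \<lparr>IDom = Y, ICod = A, Fun0 = K0, Fun1 = K1\<rparr>"
  have [simp]: "IDom K = Y" "ICod K = A" "Fun0 K = K0" "Fun1 K = K1" by (simp_all add: K_def)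
  have "IF K"
  proof (rule is_internal_functorI[of Y A])
    have "Src A \<cdot> K1 \<in> Hom V (Ob1 Y) (Ob0 A)" "K0 \<cdot> Src Y \<in> Hom V (Ob1 Y) (Ob0 A)" by (simp_all add: in_hom)
    then show "Src A \<cdot> Fun1 K = Fun0 K \<cdot> Src Y"
      unfolding \<open>Fun1 K = K1\<close> \<open>Fun0 K = K0\<close>
    proof (rule local_ar[of "Id V (Ob1 Y)" "Ob1 Y", rotated])
      show "(Src A \<cdot> K1) \<cdot> w = (K0 \<cdot> Src Y) \<cdot> w"
        if "w \<in> Hom V W (Ob1 Y)" "f \<in> Hom V W (Ob1 X)" "a \<longrightarrow> b" "Id V (Ob1 Y) \<cdot> w = ar a b f" for W w a b f
        using that by (cases a; cases b) (simp_all add: in_hom)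
    qed (simp add: in_hom)
    have "Tgt A \<cdot> K1 \<in> Hom V (Ob1 Y) (Ob0 A)" "K0 \<cdot> Tgt Y \<in> Hom V (Ob1 Y) (Ob0 A)" by (simp_all add: in_hom)
    then show "Tgt A \<cdot> Fun1 K = Fun0 K \<cdot> Tgt Y"
      unfolding \<open>Fun1 K = K1\<close> \<open>Fun0 K = K0\<close>
    proof (rule local_ar[of "Id V (Ob1 Y)" "Ob1 Y", rotated])
      show "(Tgt A \<cdot> K1) \<cdot> w = (K0 \<cdot> Tgt Y) \<cdot> w"
        if "w \<in> Hom V W (Ob1 Y)" "f \<in> Hom V W (Ob1 X)" "a \<longrightarrow> b" "Id V (Ob1 Y) \<cdot> w = ar a b f" for W w a b f
        using that by (cases a; cases b) (simp_all add: in_hom)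
    qed (simp add: in_hom)
    have "K1 \<cdot> Idn Y \<in> Hom V (Ob0 Y) (Ob1 A)" "Idn A \<cdot> K0 \<in> Hom V (Ob0 Y) (Ob1 A)" by (simp_all add: in_hom)
    then show "Fun1 K \<cdot> Idn Y = Idn A \<cdot> Fun0 K"
      unfolding \<open>Fun1 K = K1\<close> \<open>Fun0 K = K0\<close>
    proof (rule local_ob[of "Id V (Ob0 Y)" "Ob0 Y", rotated])
      show "(K1 \<cdot> Idn Y) \<cdot> w = (Idn A \<cdot> K0) \<cdot> w"
        if "w \<in> Hom V W (Ob0 Y)" "x \<in> Hom V W (Ob0 X)" "Id V (Ob0 Y) \<cdot> w = ob n x" for W w n x
        using that by (cases n) (simp_all add: in_hom)
    qed (simp add: in_hom)
    have s1: "Src A \<cdot> (K1 \<cdot> u) = K0 \<cdot> (Src Y \<cdot> u)" "Tgt A \<cdot> (K1 \<cdot> u) = K0 \<cdot> (Tgt Y \<cdot> u)" if "u \<in> Ar V" "Cod V u = Ob1 Y" for u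
      using that comp_eq_at[OF \<open>Src A \<cdot> Fun1 K = Fun0 K \<cdot> Src Y\<close>, of u]
        comp_eq_at[OF \<open>Tgt A \<cdot> Fun1 K = Fun0 K \<cdot> Tgt Y\<close>, of u] by simp_all
    fix U f g assume f: "f \<in> Hom V U (Ob1 Y)" and g: "g \<in> Hom V U (Ob1 Y)" and fg: "Tgt Y \<cdot> f = Src Y \<cdot> g"
    have "K1 \<cdot> icomp Y f g \<in> Hom V U (Ob1 A)" "icomp A (K1 \<cdot> f) (K1 \<cdot> g) \<in> Hom V U (Ob1 A)"
      using f g fg s1 by (simp_all add: in_hom)
    then show "Fun1 K \<cdot> icomp Y f g = icomp A (Fun1 K \<cdot> f) (Fun1 K \<cdot> g)"
      unfolding \<open>Fun1 K = K1\<close>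
    proof (rule local_ar_composable[OF f g fg])
      fix W w a b d f' g' assume w: "w \<in> Hom V W U" and f': "f' \<in> Hom V W (Ob1 X)" and g': "g' \<in> Hom V W (Ob1 X)"
        and fg': "Tgt X \<cdot> f' = Src X \<cdot> g'" and abd: "a \<longrightarrow> b" "b \<longrightarrow> d" and fw: "f \<cdot> w = ar a b f'" "g \<cdot> w = ar b d g'"
      have "(K1 \<cdot> icomp Y f g) \<cdot> w = K1 \<cdot> ar a d (icomp X f' g')"
        using f g fg w fw f' g' fg' abd by (simp add: in_hom)
      also have "\<dots> = icomp A (K1 \<cdot> ar a b f') (K1 \<cdot> ar b d g')"
        using f' g' fg' abd nat[OF g'] by (cases a; cases b; cases d) (simp_all add: in_hom icomp_assoc)
      also have "\<dots> = icomp A (K1 \<cdot> f) (K1 \<cdot> g) \<cdot> w"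
        using f g fg w fw s1 by (simp add: in_hom)
      finally show "(K1 \<cdot> icomp Y f g) \<cdot> w = icomp A (K1 \<cdot> f) (K1 \<cdot> g) \<cdot> w" .
    qed
  qed (simp_all add: in_hom)
  then have K: "K \<in> Hom (Cat V) Y A" by (simp add: in_Cat_hom)
  have "K \<cdot>\<^bsub>Cat V\<^esub> incl False = G" "K \<cdot>\<^bsub>Cat V\<^esub> incl True = H"
    by (rule internal_functor_eqI; simp)+
  moreover have "tau K = \<tau>" by (simp add: tau_def st)
  ultimately show ?thesis using that K by blast
qed

end

section \<open>The internal category of arrows\<close>

text \<open>The exponential of \<open>A\<close> by the interval: its objects are the arrows of \<open>A\<close>, its arrows the
  commutative squares. A square with sides \<open>\<alpha>\<close>, \<open>\<beta>\<close>, \<open>\<gamma>\<close>, \<open>\<delta>\<close> such that \<open>\<alpha>\<close> followed by \<open>\<beta>\<close> is \<open>\<gamma>\<close>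
  followed by \<open>\<delta>\<close> is an arrow from \<open>\<alpha>\<close> to \<open>\<delta>\<close>.\<close>

locale arrows = lex V for V :: "('o, 'm) category" (structure) +
  fixes A :: "('o, 'm) internal_category"
  assumes A [simp]: "IC A"
begin

abbreviation "A2 \<equiv> pb V (Tgt A) (Src A)"
abbreviation "p1 \<equiv> pb1 V (Tgt A) (Src A)"
abbreviation "p2 \<equiv> pb2 V (Tgt A) (Src A)"
definition Sq :: 'o where "Sq = pb V (Cmpn A) (Cmpn A)"
definition \<alpha> :: 'm where "\<alpha> = p1 \<cdot> pb1 V (Cmpn A) (Cmpn A)"
definition \<beta> :: 'm where "\<beta> = p2 \<cdot> pb1 V (Cmpn A) (Cmpn A)"
definition \<gamma> :: 'm where "\<gamma> = p1 \<cdot> pb2 V (Cmpn A) (Cmpn A)"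
definition \<delta> :: 'm where "\<delta> = p2 \<cdot> pb2 V (Cmpn A) (Cmpn A)"

definition square :: "'o \<Rightarrow> 'm \<Rightarrow> 'm \<Rightarrow> 'm \<Rightarrow> 'm \<Rightarrow> bool" where
  "square U a b g d \<longleftrightarrow> a \<in> Hom V U (Ob1 A) \<and> b \<in> Hom V U (Ob1 A) \<and> g \<in> Hom V U (Ob1 A) \<and> d \<in> Hom V U (Ob1 A) \<and>
     Tgt A \<cdot> a = Src A \<cdot> b \<and> Tgt A \<cdot> g = Src A \<cdot> d \<and> icomp A a b = icomp A g d"

definition mk :: "'m \<Rightarrow> 'm \<Rightarrow> 'm \<Rightarrow> 'm \<Rightarrow> 'm" where
  "mk a b g d = pb_pair V (Cmpn A) (Cmpn A) (pb_pair V (Tgt A) (Src A) a b) (pb_pair V (Tgt A) (Src A) g d)"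

lemma side_simps [simp]:
  "Sq \<in> Ob V" "\<alpha> \<in> Ar V" "\<beta> \<in> Ar V" "\<gamma> \<in> Ar V" "\<delta> \<in> Ar V"
  "Dom V \<alpha> = Sq" "Dom V \<beta> = Sq" "Dom V \<gamma> = Sq" "Dom V \<delta> = Sq"
  "Cod V \<alpha> = Ob1 A" "Cod V \<beta> = Ob1 A" "Cod V \<gamma> = Ob1 A" "Cod V \<delta> = Ob1 A"
  by (simp_all add: Sq_def \<alpha>_def \<beta>_def \<gamma>_def \<delta>_def)

lemma square_sides:
  assumes "z \<in> Hom V U Sq"
  shows "square U (\<alpha> \<cdot> z) (\<beta> \<cdot> z) (\<gamma> \<cdot> z) (\<delta> \<cdot> z)"
proof -
  have z: "z \<in> Ar V" "Dom V z = U" "Cod V z = pb V (Cmpn A) (Cmpn A)" using assms by (simp_all add: in_hom Sq_def)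
  let ?r1 = "pb1 V (Cmpn A) (Cmpn A)" and ?r2 = "pb2 V (Cmpn A) (Cmpn A)"
  have "icomp A (p1 \<cdot> u) (p2 \<cdot> u) = Cmpn A \<cdot> u" if "u \<in> Ar V" "Cod V u = A2" for u
    using that by (simp add: icomp_def pb_pair_eta)
  from this[of "?r1 \<cdot> z"] this[of "?r2 \<cdot> z"] show ?thesis
    using z pb_square_at[of "Cmpn A" "Cmpn A" z] pb_square_at[of "Tgt A" "Src A" "?r1 \<cdot> z"]
      pb_square_at[of "Tgt A" "Src A" "?r2 \<cdot> z"]
    by (simp add: square_def \<alpha>_def \<beta>_def \<gamma>_def \<delta>_def in_hom)
qed

lemma mk:
  assumes "square U a b g d"
  shows "mk a b g d \<in> Hom V U Sq" "\<alpha> \<cdot> mk a b g d = a" "\<beta> \<cdot> mk a b g d = b" "\<gamma> \<cdot> mk a b g d = g" "\<delta> \<cdot> mk a b g d = d"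
proof -
  have h: "a \<in> Ar V" "b \<in> Ar V" "g \<in> Ar V" "d \<in> Ar V" "Dom V a = U" "Dom V b = U" "Dom V g = U" "Dom V d = U"
    "Cod V a = Ob1 A" "Cod V b = Ob1 A" "Cod V g = Ob1 A" "Cod V d = Ob1 A"
    "Tgt A \<cdot> a = Src A \<cdot> b" "Tgt A \<cdot> g = Src A \<cdot> d"
    "Cmpn A \<cdot> pb_pair V (Tgt A) (Src A) a b = Cmpn A \<cdot> pb_pair V (Tgt A) (Src A) g d"
    using assms by (auto simp: square_def in_hom icomp_def)
  then show "mk a b g d \<in> Hom V U Sq" "\<alpha> \<cdot> mk a b g d = a" "\<beta> \<cdot> mk a b g d = b" "\<gamma> \<cdot> mk a b g d = g" "\<delta> \<cdot> mk a b g d = d"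
    by (simp_all add: mk_def in_hom Sq_def \<alpha>_def \<beta>_def \<gamma>_def \<delta>_def)
qed

lemma Sq_eqI:
  assumes z: "z \<in> Hom V U Sq" "z' \<in> Hom V U Sq"
    and "\<alpha> \<cdot> z = \<alpha> \<cdot> z'" "\<beta> \<cdot> z = \<beta> \<cdot> z'" "\<gamma> \<cdot> z = \<gamma> \<cdot> z'" "\<delta> \<cdot> z = \<delta> \<cdot> z'"
  shows "z = z'"
proof (rule pb_unique[of "Cmpn A" "Cmpn A" _ U])
  show "pb1 V (Cmpn A) (Cmpn A) \<cdot> z = pb1 V (Cmpn A) (Cmpn A) \<cdot> z'"
    by (rule pb_unique[of "Tgt A" "Src A" _ U]) (use assms in \<open>simp_all add: in_hom Sq_def \<alpha>_def \<beta>_def \<gamma>_def \<delta>_def\<close>)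
  show "pb2 V (Cmpn A) (Cmpn A) \<cdot> z = pb2 V (Cmpn A) (Cmpn A) \<cdot> z'"
    by (rule pb_unique[of "Tgt A" "Src A" _ U]) (use assms in \<open>simp_all add: in_hom Sq_def \<alpha>_def \<beta>_def \<gamma>_def \<delta>_def\<close>)
qed (use z in \<open>simp_all add: Sq_def\<close>)

lemma square_at:
  assumes "square U a b g d" "u \<in> Hom V W U"
  shows "square W (a \<cdot> u) (b \<cdot> u) (g \<cdot> u) (d \<cdot> u)" "mk a b g d \<cdot> u = mk (a \<cdot> u) (b \<cdot> u) (g \<cdot> u) (d \<cdot> u)"
proof -
  note m = mk[OF assms(1)]
  have mu: "mk a b g d \<cdot> u \<in> Hom V W Sq" using m assms(2) comp_hom by blast
  have e: "\<alpha> \<cdot> (mk a b g d \<cdot> u) = a \<cdot> u" "\<beta> \<cdot> (mk a b g d \<cdot> u) = b \<cdot> u" "\<gamma> \<cdot> (mk a b g d \<cdot> u) = g \<cdot> u"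
    "\<delta> \<cdot> (mk a b g d \<cdot> u) = d \<cdot> u"
    using comp_eq_at[OF m(2), of u] comp_eq_at[OF m(3), of u] comp_eq_at[OF m(4), of u] comp_eq_at[OF m(5), of u]
      m(1) assms(2) by (simp_all add: in_hom)
  show s: "square W (a \<cdot> u) (b \<cdot> u) (g \<cdot> u) (d \<cdot> u)" using square_sides[OF mu] unfolding e .
  show "mk a b g d \<cdot> u = mk (a \<cdot> u) (b \<cdot> u) (g \<cdot> u) (d \<cdot> u)"
    by (rule Sq_eqI[OF mu mk(1)[OF s]]) (simp_all add: e mk[OF s])
qed

lemma square_corners:
  assumes "square U a b g d"
  shows "Src A \<cdot> a = Src A \<cdot> g" "Tgt A \<cdot> b = Tgt A \<cdot> d"
proof -
  have h: "a \<in> Ar V" "b \<in> Ar V" "g \<in> Ar V" "d \<in> Ar V" "Dom V a = Dom V b" "Dom V g = Dom V d"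
    "Cod V a = Ob1 A" "Cod V b = Ob1 A" "Cod V g = Ob1 A" "Cod V d = Ob1 A"
    "Tgt A \<cdot> a = Src A \<cdot> b" "Tgt A \<cdot> g = Src A \<cdot> d" and e: "icomp A a b = icomp A g d"
    using assms by (auto simp: square_def in_hom)
  have "Src A \<cdot> icomp A a b = Src A \<cdot> icomp A g d" "Tgt A \<cdot> icomp A a b = Tgt A \<cdot> icomp A g d" by (simp_all only: e)
  then show "Src A \<cdot> a = Src A \<cdot> g" "Tgt A \<cdot> b = Tgt A \<cdot> d" using h by simp_all
qed

definition m :: "'m \<Rightarrow> 'm \<Rightarrow> 'm" where
  "m z w = mk (\<alpha> \<cdot> z) (icomp A (\<beta> \<cdot> z) (\<beta> \<cdot> w)) (icomp A (\<gamma> \<cdot> z) (\<gamma> \<cdot> w)) (\<delta> \<cdot> w)"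

definition AA :: "('o, 'm) internal_category" where
  "AA = \<lparr>Ob0 = Ob1 A, Ob1 = Sq, Src = \<alpha>, Tgt = \<delta>,
     Idn = mk (Id V (Ob1 A)) (Idn A \<cdot> Tgt A) (Idn A \<cdot> Src A) (Id V (Ob1 A)),
     Cmpn = m (pb1 V \<delta> \<alpha>) (pb2 V \<delta> \<alpha>)\<rparr>"

lemma AA_simps [simp]:
  "Ob0 AA = Ob1 A" "Ob1 AA = Sq" "Src AA = \<alpha>" "Tgt AA = \<delta>"
  by (simp_all add: AA_def)

lemma square_Idn:
  assumes "f \<in> Hom V U (Ob1 A)"
  shows "square U f (Idn A \<cdot> (Tgt A \<cdot> f)) (Idn A \<cdot> (Src A \<cdot> f)) f"
  using assms by (simp add: square_def in_hom)

lemma Idn_AA: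
  assumes "f \<in> Hom V U (Ob1 A)"
  shows "Idn AA \<cdot> f = mk f (Idn A \<cdot> (Tgt A \<cdot> f)) (Idn A \<cdot> (Src A \<cdot> f)) f" "Idn AA \<in> Hom V (Ob1 A) Sq"
proof -
  have I: "Id V (Ob1 A) \<in> Hom V (Ob1 A) (Ob1 A)" by (simp add: in_hom)
  have s: "square (Ob1 A) (Id V (Ob1 A)) (Idn A \<cdot> Tgt A) (Idn A \<cdot> Src A) (Id V (Ob1 A))"
    using square_Idn[OF I] by simp
  show "Idn AA \<cdot> f = mk f (Idn A \<cdot> (Tgt A \<cdot> f)) (Idn A \<cdot> (Src A \<cdot> f)) f"
    using square_at(2)[OF s assms] assms by (simp add: AA_def in_hom)
  show "Idn AA \<in> Hom V (Ob1 A) Sq" using mk(1)[OF s] by (simp add: AA_def)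
qed

text \<open>Two squares that share the side \<open>\<delta> \<cdot> z = \<alpha> \<cdot> w\<close> can be pasted.\<close>

lemma square_m:
  assumes z: "z \<in> Hom V U Sq" and w: "w \<in> Hom V U Sq" and zw: "\<delta> \<cdot> z = \<alpha> \<cdot> w"
  shows "square U (\<alpha> \<cdot> z) (icomp A (\<beta> \<cdot> z) (\<beta> \<cdot> w)) (icomp A (\<gamma> \<cdot> z) (\<gamma> \<cdot> w)) (\<delta> \<cdot> w)"
    "Tgt A \<cdot> (\<beta> \<cdot> z) = Src A \<cdot> (\<beta> \<cdot> w)" "Tgt A \<cdot> (\<gamma> \<cdot> z) = Src A \<cdot> (\<gamma> \<cdot> w)"
proof -
  note sz = square_sides[OF z] and sw = square_sides[OF w]
  have ty: "\<alpha> \<cdot> z \<in> Ar V" "\<beta> \<cdot> z \<in> Ar V" "\<gamma> \<cdot> z \<in> Ar V" "\<delta> \<cdot> z \<in> Ar V"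
    "\<alpha> \<cdot> w \<in> Ar V" "\<beta> \<cdot> w \<in> Ar V" "\<gamma> \<cdot> w \<in> Ar V" "\<delta> \<cdot> w \<in> Ar V"
    using z w by (simp_all add: in_hom)
  have tz: "Tgt A \<cdot> (\<alpha> \<cdot> z) = Src A \<cdot> (\<beta> \<cdot> z)" "Tgt A \<cdot> (\<gamma> \<cdot> z) = Src A \<cdot> (\<delta> \<cdot> z)"
    "icomp A (\<alpha> \<cdot> z) (\<beta> \<cdot> z) = icomp A (\<gamma> \<cdot> z) (\<delta> \<cdot> z)"
    "Tgt A \<cdot> (\<alpha> \<cdot> w) = Src A \<cdot> (\<beta> \<cdot> w)" "Tgt A \<cdot> (\<gamma> \<cdot> w) = Src A \<cdot> (\<delta> \<cdot> w)"
    "icomp A (\<alpha> \<cdot> w) (\<beta> \<cdot> w) = icomp A (\<gamma> \<cdot> w) (\<delta> \<cdot> w)"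
    using sz sw by (simp_all add: square_def)
  show t: "Tgt A \<cdot> (\<beta> \<cdot> z) = Src A \<cdot> (\<beta> \<cdot> w)" using square_corners(2)[OF sz] zw tz(4) by simp
  show t': "Tgt A \<cdot> (\<gamma> \<cdot> z) = Src A \<cdot> (\<gamma> \<cdot> w)" using square_corners(1)[OF sw] zw tz(2) by simp
  have zt: "Tgt A \<cdot> (\<alpha> \<cdot> w) = Src A \<cdot> (\<beta> \<cdot> w)" "Tgt A \<cdot> (\<gamma> \<cdot> z) = Src A \<cdot> (\<alpha> \<cdot> w)" using tz zw by simp_all
  have "icomp A (\<alpha> \<cdot> z) (icomp A (\<beta> \<cdot> z) (\<beta> \<cdot> w)) = icomp A (icomp A (\<alpha> \<cdot> z) (\<beta> \<cdot> z)) (\<beta> \<cdot> w)"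
    by (rule icomp_assoc[symmetric]) (use z w tz t in \<open>simp_all add: in_hom\<close>)
  also have "\<dots> = icomp A (\<gamma> \<cdot> z) (icomp A (\<alpha> \<cdot> w) (\<beta> \<cdot> w))"
    unfolding tz(3) zw by (rule icomp_assoc) (use z w zt in \<open>simp_all add: in_hom\<close>)
  also have "\<dots> = icomp A (icomp A (\<gamma> \<cdot> z) (\<gamma> \<cdot> w)) (\<delta> \<cdot> w)"
    unfolding tz(6) by (rule icomp_assoc[symmetric]) (use z w tz t' in \<open>simp_all add: in_hom\<close>)
  finally show "square U (\<alpha> \<cdot> z) (icomp A (\<beta> \<cdot> z) (\<beta> \<cdot> w)) (icomp A (\<gamma> \<cdot> z) (\<gamma> \<cdot> w)) (\<delta> \<cdot> w)"
    using z w tz t t' by (simp add: square_def in_hom)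
qed

lemma m:
  assumes "z \<in> Hom V U Sq" "w \<in> Hom V U Sq" "\<delta> \<cdot> z = \<alpha> \<cdot> w"
  shows "m z w \<in> Hom V U Sq" "\<alpha> \<cdot> m z w = \<alpha> \<cdot> z" "\<beta> \<cdot> m z w = icomp A (\<beta> \<cdot> z) (\<beta> \<cdot> w)"
    "\<gamma> \<cdot> m z w = icomp A (\<gamma> \<cdot> z) (\<gamma> \<cdot> w)" "\<delta> \<cdot> m z w = \<delta> \<cdot> w"
    "u \<in> Hom V W U \<Longrightarrow> m z w \<cdot> u = m (z \<cdot> u) (w \<cdot> u)"
proof -
  note s = square_m[OF assms]
  show "m z w \<in> Hom V U Sq" "\<alpha> \<cdot> m z w = \<alpha> \<cdot> z" "\<beta> \<cdot> m z w = icomp A (\<beta> \<cdot> z) (\<beta> \<cdot> w)"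
    "\<gamma> \<cdot> m z w = icomp A (\<gamma> \<cdot> z) (\<gamma> \<cdot> w)" "\<delta> \<cdot> m z w = \<delta> \<cdot> w"
    unfolding m_def by (rule mk[OF s(1)])+
  show "m z w \<cdot> u = m (z \<cdot> u) (w \<cdot> u)" if "u \<in> Hom V W U"
    unfolding m_def square_at(2)[OF s(1) that] using assms s that by (simp add: in_hom)
qed

lemma icomp_AA:
  assumes "z \<in> Hom V U Sq" "w \<in> Hom V U Sq" "\<delta> \<cdot> z = \<alpha> \<cdot> w"
  shows "icomp AA z w = m z w"
  by (rule icomp_natural(2)[where ?a1.0 = Sq and ?a0.0 = "Ob1 A"])
    (use assms m in \<open>auto simp: in_hom AA_def\<close>)

lemma IC_AA [simp]: "IC AA"
proof (rule is_internal_categoryI)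
  have "m (pb1 V \<delta> \<alpha>) (pb2 V \<delta> \<alpha>) \<in> Hom V (pb V \<delta> \<alpha>) Sq"
    by (rule m(1)) (simp_all add: in_hom pb_square)
  moreover have I: "Id V (Ob1 A) \<in> Hom V (Ob1 A) (Ob1 A)" by (simp add: in_hom)
  ultimately show "internal_graph AA"
    using Idn_AA(2)[OF I] by (simp add: internal_graph_def in_hom) (simp add: AA_def)
  show "Src AA \<cdot> Idn AA = Id V (Ob0 AA)" "Tgt AA \<cdot> Idn AA = Id V (Ob0 AA)"
    using Idn_AA[OF I] mk[OF square_Idn[OF I]] by (simp_all add: in_hom)
next
  fix U f g assume "f \<in> Hom V U (Ob1 AA)" "g \<in> Hom V U (Ob1 AA)" "Tgt AA \<cdot> f = Src AA \<cdot> g"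
  then have fg: "f \<in> Hom V U Sq" "g \<in> Hom V U Sq" "\<delta> \<cdot> f = \<alpha> \<cdot> g" by simp_all
  show "Src AA \<cdot> icomp AA f g = Src AA \<cdot> f \<and> Tgt AA \<cdot> icomp AA f g = Tgt AA \<cdot> g"
    unfolding icomp_AA[OF fg] using m[OF fg] by simp
next
  fix U f assume "f \<in> Hom V U (Ob1 AA)"
  then have f: "f \<in> Hom V U Sq" by simp
  have a: "\<alpha> \<cdot> f \<in> Hom V U (Ob1 A)" "\<delta> \<cdot> f \<in> Hom V U (Ob1 A)" using f by (simp_all add: in_hom)
  note ia = mk[OF square_Idn[OF a(1)]] and id = mk[OF square_Idn[OF a(2)]]
  note i = Idn_AA(1)[OF a(1)] Idn_AA(1)[OF a(2)]
  have sf: "Src A \<cdot> (\<beta> \<cdot> f) = Tgt A \<cdot> (\<alpha> \<cdot> f)" "Tgt A \<cdot> (\<gamma> \<cdot> f) = Src A \<cdot> (\<delta> \<cdot> f)"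
    using square_sides[OF f] by (simp_all add: square_def)
  note sc = square_corners[OF square_sides[OF f]]
  show "icomp AA (Idn AA \<cdot> (Src AA \<cdot> f)) f = f"
    unfolding AA_simps i icomp_AA[OF ia(1) f ia(5)]
    by (rule Sq_eqI[OF m(1)[OF ia(1) f ia(5)] f]) (use m[OF ia(1) f ia(5)] ia f sf sc in \<open>simp_all add: in_hom\<close>)
  show "icomp AA f (Idn AA \<cdot> (Tgt AA \<cdot> f)) = f"
    unfolding AA_simps i icomp_AA[OF f id(1) id(2)[symmetric]]
    by (rule Sq_eqI[OF m(1)[OF f id(1) id(2)[symmetric]] f])
      (use m[OF f id(1) id(2)[symmetric]] id f sf sc in \<open>simp_all add: in_hom\<close>)
next
  fix U f g h assume "f \<in> Hom V U (Ob1 AA)" "g \<in> Hom V U (Ob1 AA)" "h \<in> Hom V U (Ob1 AA)"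
    "Tgt AA \<cdot> f = Src AA \<cdot> g" "Tgt AA \<cdot> g = Src AA \<cdot> h"
  then have h: "f \<in> Hom V U Sq" "g \<in> Hom V U Sq" "h \<in> Hom V U Sq" "\<delta> \<cdot> f = \<alpha> \<cdot> g" "\<delta> \<cdot> g = \<alpha> \<cdot> h" by simp_all
  note m1 = m[OF h(1,2,4)] and m2 = m[OF h(2,3,5)]
  note s1 = square_m(2,3)[OF h(1,2,4)] and s2 = square_m(2,3)[OF h(2,3,5)]
  have t: "\<delta> \<cdot> m f g = \<alpha> \<cdot> h" "\<delta> \<cdot> f = \<alpha> \<cdot> m g h" using m1 m2 h by simp_all
  note m3 = m[OF m1(1) h(3) t(1)] and m4 = m[OF h(1) m2(1) t(2)]
  have b: "icomp A (icomp A (\<beta> \<cdot> f) (\<beta> \<cdot> g)) (\<beta> \<cdot> h) = icomp A (\<beta> \<cdot> f) (icomp A (\<beta> \<cdot> g) (\<beta> \<cdot> h))"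
    "icomp A (icomp A (\<gamma> \<cdot> f) (\<gamma> \<cdot> g)) (\<gamma> \<cdot> h) = icomp A (\<gamma> \<cdot> f) (icomp A (\<gamma> \<cdot> g) (\<gamma> \<cdot> h))"
    by (rule icomp_assoc; use h s1 s2 in \<open>simp add: in_hom\<close>)+
  show "icomp AA (icomp AA f g) h = icomp AA f (icomp AA g h)"
    unfolding icomp_AA[OF h(1,2,4)] icomp_AA[OF h(2,3,5)] icomp_AA[OF m1(1) h(3) t(1)] icomp_AA[OF h(1) m2(1) t(2)]
    by (rule Sq_eqI[OF m3(1) m4(1)]) (simp_all only: m1 m2 m3 m4 b)
qed

definition dom :: "('o, 'm) internal_functor" where
  "dom = \<lparr>IDom = AA, ICod = A, Fun0 = Src A, Fun1 = \<gamma>\<rparr>"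
definition cod :: "('o, 'm) internal_functor" where
  "cod = \<lparr>IDom = AA, ICod = A, Fun0 = Tgt A, Fun1 = \<beta>\<rparr>"

lemma dom_cod_simps [simp]:
  "IDom dom = AA" "ICod dom = A" "Fun0 dom = Src A" "Fun1 dom = \<gamma>"
  "IDom cod = AA" "ICod cod = A" "Fun0 cod = Tgt A" "Fun1 cod = \<beta>"
  by (simp_all add: dom_def cod_def)

lemma side_corners:
  assumes "z \<in> Ar V" "Cod V z = Sq"
  shows "Src A \<cdot> (\<gamma> \<cdot> z) = Src A \<cdot> (\<alpha> \<cdot> z)" "Tgt A \<cdot> (\<gamma> \<cdot> z) = Src A \<cdot> (\<delta> \<cdot> z)"
    "Src A \<cdot> (\<beta> \<cdot> z) = Tgt A \<cdot> (\<alpha> \<cdot> z)" "Tgt A \<cdot> (\<beta> \<cdot> z) = Tgt A \<cdot> (\<delta> \<cdot> z)"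
    "icomp A (\<gamma> \<cdot> z) (\<delta> \<cdot> z) = icomp A (\<alpha> \<cdot> z) (\<beta> \<cdot> z)"
proof -
  have s: "square (Dom V z) (\<alpha> \<cdot> z) (\<beta> \<cdot> z) (\<gamma> \<cdot> z) (\<delta> \<cdot> z)" using square_sides assms by (simp add: in_hom)
  from square_corners[OF s] s
  show "Src A \<cdot> (\<gamma> \<cdot> z) = Src A \<cdot> (\<alpha> \<cdot> z)" "Tgt A \<cdot> (\<gamma> \<cdot> z) = Src A \<cdot> (\<delta> \<cdot> z)"
    "Src A \<cdot> (\<beta> \<cdot> z) = Tgt A \<cdot> (\<alpha> \<cdot> z)" "Tgt A \<cdot> (\<beta> \<cdot> z) = Tgt A \<cdot> (\<delta> \<cdot> z)"
    "icomp A (\<gamma> \<cdot> z) (\<delta> \<cdot> z) = icomp A (\<alpha> \<cdot> z) (\<beta> \<cdot> z)"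
    by (simp_all add: square_def)
qed

lemma IF_dom_cod: "IF dom" "IF cod"
proof -
  have I: "Id V (Ob1 A) \<in> Hom V (Ob1 A) (Ob1 A)" by (simp add: in_hom)
  note i = Idn_AA[OF I] and k = mk[OF square_Idn[OF I]]
  have i': "Idn AA = mk (Id V (Ob1 A)) (Idn A \<cdot> Tgt A) (Idn A \<cdot> Src A) (Id V (Ob1 A))" by (simp add: AA_def)
  have st: "Src A \<cdot> \<gamma> = Src A \<cdot> \<alpha>" "Tgt A \<cdot> \<gamma> = Src A \<cdot> \<delta>" "Src A \<cdot> \<beta> = Tgt A \<cdot> \<alpha>" "Tgt A \<cdot> \<beta> = Tgt A \<cdot> \<delta>"
    using side_corners[of "Id V Sq"] by simp_all
  show "IF dom"
    by (rule is_internal_functorI[of AA A]) (use m icomp_AA k st in \<open>simp_all add: in_hom i'\<close>)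
  show "IF cod"
    by (rule is_internal_functorI[of AA A]) (use m icomp_AA k st in \<open>simp_all add: in_hom i'\<close>)
qed

text \<open>An arrow of \<open>A\<close> is the component at itself of a transformation from its source to its target.\<close>

lemma universal_transf: "is_transf AA A dom cod (Id V (Ob1 A))"
  unfolding is_transf_def using IF_dom_cod side_corners by (auto simp: in_Cat_hom in_hom)

text \<open>The functor corresponding to \<open>\<tau>\<close> sends an object to its component and an arrow to its naturality
  square.\<close>

lemma functor_into_AA:
  assumes \<tau>: "is_transf X A G H \<tau>" and X: "IC X"
  shows "\<exists>!M. M \<in> Hom (Cat V) X AA \<and> dom \<cdot>\<^bsub>Cat V\<^esub> M = G \<and> cod \<cdot>\<^bsub>Cat V\<^esub> M = H \<and> Fun0 M = \<tau>"
proof -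
  have GH: "IF G" "IDom G = X" "ICod G = A" "IF H" "IDom H = X" "ICod H = A"
    and \<tau>h: "\<tau> \<in> Hom V (Ob0 X) (Ob1 A)" and st: "Src A \<cdot> \<tau> = Fun0 G" "Tgt A \<cdot> \<tau> = Fun0 H"
    and nat: "\<And>U f. f \<in> Hom V U (Ob1 X) \<Longrightarrow>
        icomp A (Fun1 G \<cdot> f) (\<tau> \<cdot> (Tgt X \<cdot> f)) = icomp A (\<tau> \<cdot> (Src X \<cdot> f)) (Fun1 H \<cdot> f)"
    using \<tau> unfolding is_transf_def in_Cat_hom by blast+
  note [simp] = IF_simps(3-)[OF GH(1), unfolded GH(2,3)] IF_simps(3-)[OF GH(4), unfolded GH(5,6)] GH X
  have [simp]: "\<tau> \<in> Ar V" "Dom V \<tau> = Ob0 X" "Cod V \<tau> = Ob1 A" using \<tau>h by (simp_all add: in_hom)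
  have [simp]: "Src A \<cdot> (\<tau> \<cdot> u) = Fun0 G \<cdot> u" "Tgt A \<cdot> (\<tau> \<cdot> u) = Fun0 H \<cdot> u" if "u \<in> Ar V" "Cod V u = Ob0 X" for u
    using that comp_eq_at[OF st(1), of u] comp_eq_at[OF st(2), of u] by simp_all
  let ?M1 = "mk (\<tau> \<cdot> Src X) (Fun1 H) (Fun1 G) (\<tau> \<cdot> Tgt X)"
  have sq: "square (Ob1 X) (\<tau> \<cdot> Src X) (Fun1 H) (Fun1 G) (\<tau> \<cdot> Tgt X)"
    using nat[of "Id V (Ob1 X)" "Ob1 X"] by (simp add: square_def in_hom)
  note k = mk[OF sq]
  have k' [simp]: "?M1 \<in> Ar V" "Dom V ?M1 = Ob1 X" "Cod V ?M1 = Sq" using k(1) by (simp_all add: in_hom)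
  have kat [simp]: "\<alpha> \<cdot> (?M1 \<cdot> u) = \<tau> \<cdot> (Src X \<cdot> u)" "\<beta> \<cdot> (?M1 \<cdot> u) = Fun1 H \<cdot> u" "\<gamma> \<cdot> (?M1 \<cdot> u) = Fun1 G \<cdot> u"
    "\<delta> \<cdot> (?M1 \<cdot> u) = \<tau> \<cdot> (Tgt X \<cdot> u)" if "u \<in> Ar V" "Cod V u = Ob1 X" for u
    using that comp_eq_at[OF k(2), of u] comp_eq_at[OF k(3), of u] comp_eq_at[OF k(4), of u] comp_eq_at[OF k(5), of u]
    by simp_all
  let ?M = "\<lparr>IDom = X, ICod = AA, Fun0 = \<tau>, Fun1 = ?M1\<rparr>"
  note j = mk[OF square_Idn[OF \<tau>h]] and j' = Idn_AA(1)[OF \<tau>h]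
  have "IF ?M"
  proof (rule is_internal_functorI[of X AA])
    show "Fun1 ?M \<cdot> Idn X = Idn AA \<cdot> Fun0 ?M"
      unfolding internal_functor.simps j'
      by (rule Sq_eqI[of _ "Ob0 X"]) (use j st in \<open>simp_all add: in_hom\<close>)
    fix U f g assume fg: "f \<in> Hom V U (Ob1 X)" "g \<in> Hom V U (Ob1 X)" "Tgt X \<cdot> f = Src X \<cdot> g"
    have z: "?M1 \<cdot> f \<in> Hom V U Sq" "?M1 \<cdot> g \<in> Hom V U Sq" "\<delta> \<cdot> (?M1 \<cdot> f) = \<alpha> \<cdot> (?M1 \<cdot> g)"
      using fg by (simp_all add: in_hom)
    show "Fun1 ?M \<cdot> icomp X f g = icomp AA (Fun1 ?M \<cdot> f) (Fun1 ?M \<cdot> g)"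
      unfolding internal_functor.simps icomp_AA[OF z]
      by (rule Sq_eqI[of _ U]) (use m[OF z] fg in \<open>simp_all add: in_hom\<close>)
  qed (use k in \<open>simp_all add: in_hom\<close>)
  then have M: "?M \<in> Hom (Cat V) X AA \<and> dom \<cdot>\<^bsub>Cat V\<^esub> ?M = G \<and> cod \<cdot>\<^bsub>Cat V\<^esub> ?M = H \<and> Fun0 ?M = \<tau>"
    using k st by (auto simp: in_Cat_hom intro!: internal_functor_eqI)
  show ?thesis
  proof (rule ex1I[of _ ?M])
    show "?M \<in> Hom (Cat V) X AA \<and> dom \<cdot>\<^bsub>Cat V\<^esub> ?M = G \<and> cod \<cdot>\<^bsub>Cat V\<^esub> ?M = H \<and> Fun0 ?M = \<tau>"
      by (rule M)
    fix M assume "M \<in> Hom (Cat V) X AA \<and> dom \<cdot>\<^bsub>Cat V\<^esub> M = G \<and> cod \<cdot>\<^bsub>Cat V\<^esub> M = H \<and> Fun0 M = \<tau>"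
    then have M: "IF M" "IDom M = X" "ICod M = AA" "Fun0 M = \<tau>" and e: "dom \<cdot>\<^bsub>Cat V\<^esub> M = G" "cod \<cdot>\<^bsub>Cat V\<^esub> M = H"
      by (simp_all add: in_Cat_hom)
    have e': "\<gamma> \<cdot> Fun1 M = Fun1 G" "\<beta> \<cdot> Fun1 M = Fun1 H"
      using arg_cong[OF e(1), of Fun1] arg_cong[OF e(2), of Fun1] by simp_all
    have e'': "\<alpha> \<cdot> Fun1 M = \<tau> \<cdot> Src X" "\<delta> \<cdot> Fun1 M = \<tau> \<cdot> Tgt X"
      using IF_eqs(1,2)[OF M(1), of AA] M by simp_all
    have "Fun1 M = ?M1"
      by (rule Sq_eqI[of _ "Ob1 X"]) (use M e' e'' k in \<open>simp_all add: in_hom\<close>)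
    then show "M = ?M" using M by (intro internal_functor_eqI) simp_all
  qed
qed

end

section \<open>Internal terminal objects\<close>

text \<open>A unique solution may be looked for on the other side of a bijection.\<close>

lemma ex1_bij:
  assumes ty: "\<And>a. A a \<Longrightarrow> B (h a)" and bij: "\<And>b. B b \<Longrightarrow> \<exists>!a. A a \<and> h a = b"
    and PQ: "\<And>a. A a \<Longrightarrow> P a \<longleftrightarrow> Q (h a)"
  shows "(\<exists>!a. A a \<and> P a) \<longleftrightarrow> (\<exists>!b. B b \<and> Q b)"
proof
  assume "\<exists>!a. A a \<and> P a"
  then obtain a where a: "A a" "P a" and u: "\<And>a'. A a' \<Longrightarrow> P a' \<Longrightarrow> a' = a" by blast
  show "\<exists>!b. B b \<and> Q b"
  proof (rule ex1I[of _ "h a"])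
    show "B (h a) \<and> Q (h a)" using ty PQ a by blast
    fix b assume b: "B b \<and> Q b"
    then obtain a' where "A a'" "h a' = b" using bij by blast
    then show "b = h a" using u PQ b by blast
  qed
next
  assume "\<exists>!b. B b \<and> Q b"
  then obtain b where b: "B b" "Q b" and u: "\<And>b'. B b' \<Longrightarrow> Q b' \<Longrightarrow> b' = b" by blast
  obtain a where a: "A a" "h a = b" and v: "\<And>a'. A a' \<Longrightarrow> h a' = b \<Longrightarrow> a' = a" using bij[OF b(1)] by blast
  show "\<exists>!a. A a \<and> P a"
    by (rule ex1I[of _ a]) (use a b PQ u v ty in blast)+
qed

lemma (in cat) assoc_hom:
  "f \<in> Hom V a b \<Longrightarrow> g \<in> Hom V b c \<Longrightarrow> h \<in> Hom V c d \<Longrightarrow> (h \<cdot> g) \<cdot> f = h \<cdot> (g \<cdot> f)"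
  by (simp add: in_hom)

context lex
begin

lemma pair_comp_hom:
  "f \<in> Hom V x a \<Longrightarrow> g \<in> Hom V x b \<Longrightarrow> u \<in> Hom V w x \<Longrightarrow> pair V f g \<cdot> u = pair V (f \<cdot> u) (g \<cdot> u)"
  by (simp add: in_hom)

text \<open>The projection from a pullback is invertible iff every element of its codomain has exactly one
  element over it, and such an element is the same as an arrow into the other corner.\<close>

lemma is_iso_pb2_iff:
  assumes f: "f \<in> Ar V" and g: "g \<in> Ar V" and fg: "Cod V f = Cod V g"
  shows "is_iso V (pb2 V f g) \<longleftrightarrow>
    (\<forall>U\<in>Ob V. \<forall>v\<in>Hom V U (Dom V g). \<exists>!u. u \<in> Hom V U (Dom V f) \<and> f \<cdot> u = g \<cdot> v)"
proof -
  have p2: "pb2 V f g \<in> Hom V (pb V f g) (Dom V g)" using assms by (simp add: in_hom)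
  have "(\<exists>!w. w \<in> Hom V U (pb V f g) \<and> pb2 V f g \<cdot> w = v) \<longleftrightarrow> (\<exists>!u. u \<in> Hom V U (Dom V f) \<and> f \<cdot> u = g \<cdot> v)"
    if v: "v \<in> Hom V U (Dom V g)" for U v
  proof
    assume "\<exists>!w. w \<in> Hom V U (pb V f g) \<and> pb2 V f g \<cdot> w = v"
    then obtain w where w: "w \<in> Hom V U (pb V f g)" "pb2 V f g \<cdot> w = v"
      and uniq: "\<And>w'. w' \<in> Hom V U (pb V f g) \<Longrightarrow> pb2 V f g \<cdot> w' = v \<Longrightarrow> w' = w" by blast
    show "\<exists>!u. u \<in> Hom V U (Dom V f) \<and> f \<cdot> u = g \<cdot> v"
    proof (rule ex1I[of _ "pb1 V f g \<cdot> w"])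
      show "pb1 V f g \<cdot> w \<in> Hom V U (Dom V f) \<and> f \<cdot> (pb1 V f g \<cdot> w) = g \<cdot> v"
        using w assms pb_square_at[OF assms, of w] by (simp add: in_hom)
      fix u assume u: "u \<in> Hom V U (Dom V f) \<and> f \<cdot> u = g \<cdot> v"
      have "pb_pair V f g u v = w"
        by (rule uniq) (use u v assms in \<open>simp_all add: in_hom\<close>)
      then show "u = pb1 V f g \<cdot> w" using u v assms by (auto simp: in_hom)
    qed
  next
    assume "\<exists>!u. u \<in> Hom V U (Dom V f) \<and> f \<cdot> u = g \<cdot> v"
    then obtain u where u: "u \<in> Hom V U (Dom V f)" "f \<cdot> u = g \<cdot> v"
      and uniq: "\<And>u'. u' \<in> Hom V U (Dom V f) \<Longrightarrow> f \<cdot> u' = g \<cdot> v \<Longrightarrow> u' = u" by blast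
    show "\<exists>!w. w \<in> Hom V U (pb V f g) \<and> pb2 V f g \<cdot> w = v"
    proof (rule ex1I[of _ "pb_pair V f g u v"])
      show "pb_pair V f g u v \<in> Hom V U (pb V f g) \<and> pb2 V f g \<cdot> pb_pair V f g u v = v"
        using u v assms by (simp add: in_hom)
      fix w assume w: "w \<in> Hom V U (pb V f g) \<and> pb2 V f g \<cdot> w = v"
      have "pb1 V f g \<cdot> w = u"
        by (rule uniq) (use w assms pb_square_at[OF assms, of w] in \<open>auto simp: in_hom\<close>)
      then show "w = pb_pair V f g u v"
        using w pb_pair_eta[OF assms, of w] by (auto simp: in_hom)
    qed
  qed
  then show ?thesis using is_iso_iff_bij_elements[OF p2] by blast
qed

lemma int_element:
  assumes A: "IC A" and x: "x \<in> Hom V (terminal V) (Ob0 A)"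
  shows "int_element V A x \<in> Hom (Cat V) (int_one V) A"
proof -
  note [simp] = IC_simps[OF IC_int_one, simplified] IC_int_one
  have x': "x \<in> Ar V" "Dom V x = terminal V" "Cod V x = Ob0 A" using x by (simp_all add: in_hom)
  have st: "Src (int_one V) = Id V (terminal V)" "Tgt (int_one V) = Id V (terminal V)" "Idn (int_one V) = Id V (terminal V)"
    by (simp_all add: int_one_def Let_def)
  have "IF (int_element V A x)"
  proof (rule is_internal_functorI[OF IC_int_one A])
    fix U f g assume fg: "f \<in> Hom V U (Ob1 (int_one V))" "g \<in> Hom V U (Ob1 (int_one V))"
      "Tgt (int_one V) \<cdot> f = Src (int_one V) \<cdot> g"
    have gf: "g = f" using fg by (intro terminal_eq) (simp_all add: in_hom)
    have "icomp (int_one V) f g = f"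
      using fg by (intro terminal_eq) (simp_all add: in_hom)
    then show "Fun1 (int_element V A x) \<cdot> icomp (int_one V) f g =
        icomp A (Fun1 (int_element V A x) \<cdot> f) (Fun1 (int_element V A x) \<cdot> g)"
      using fg x' A by (simp add: gf int_element_def in_hom)
  qed (use x' A st in \<open>simp_all add: int_element_def in_hom\<close>)
  then show ?thesis by (simp add: in_Cat_hom int_element_def)
qed

interpretation CV: lex "Cat V" by (rule Cat_lex)

lemma int_const:
  assumes A: "IC A" and T: "T \<in> Hom (Cat V) (int_one V) B"
  shows "int_const V A T \<in> Hom (Cat V) A B"
    "Fun0 (int_const V A T) = Fun0 T \<cdot> bang V (Ob0 A)" "Fun1 (int_const V A T) = Fun1 T \<cdot> bang V (Ob1 A)"
    "K \<in> Hom (Cat V) X A \<Longrightarrow> int_const V A T \<cdot>\<^bsub>Cat V\<^esub> K = int_const V X T"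
proof -
  define u where "u A = (THE u. u \<in> Hom (Cat V) A (int_one V))" for A
  have u: "u A \<in> Hom (Cat V) A (int_one V)" if "IC A" for A
    unfolding u_def
    by (rule theI'[of "\<lambda>u. u \<in> Hom (Cat V) A (int_one V)"])
      (use that is_terminal_int_one in \<open>simp add: is_terminal_def\<close>)
  have c: "int_const V A T = T \<cdot>\<^bsub>Cat V\<^esub> u A" for A by (simp add: int_const_def u_def)
  show "int_const V A T \<in> Hom (Cat V) A B" unfolding c using u[OF A] T by (rule Cat_cat.comp_hom)
  have uA: "IF (u A)" "IDom (u A) = A" "ICod (u A) = int_one V" using u[OF A] by (simp_all add: in_Cat_hom)
  have "Fun0 (u A) = bang V (Ob0 A)" "Fun1 (u A) = bang V (Ob1 A)"
    by (rule terminal_eq; use IF_simps[OF uA(1)] uA A in simp)+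
  then show "Fun0 (int_const V A T) = Fun0 T \<cdot> bang V (Ob0 A)" "Fun1 (int_const V A T) = Fun1 T \<cdot> bang V (Ob1 A)"
    by (simp_all add: c)
  assume K: "K \<in> Hom (Cat V) X A"
  then have X: "IC X" using Cat_cat.hom_Ob by (metis Cat_simps(1))
  have "u A \<cdot>\<^bsub>Cat V\<^esub> K = u X"
    using is_terminal_int_one Cat_cat.is_terminal_unique Cat_cat.comp_hom[OF K u[OF A]] u[OF X] by blast
  then show "int_const V A T \<cdot>\<^bsub>Cat V\<^esub> K = int_const V X T"
    unfolding c using Cat_cat.assoc_hom[OF K u[OF A] T] by simp
qed

end

context extensive_cat
begin

interpretation CV: lex "Cat V" by (rule Cat_lex)

abbreviation "Cyl X \<equiv> prd (Cat V) X Two"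
abbreviation "cyl1 X \<equiv> pr1 (Cat V) X Two"
abbreviation "cyl2 X \<equiv> pr2 (Cat V) X Two"

definition inc :: "('o, 'm) internal_category \<Rightarrow> bool \<Rightarrow> ('o, 'm) internal_functor" where
  "inc X = cylinder.incl V X (Cyl X) (cyl1 X) (cyl2 X)"

definition tr :: "('o, 'm) internal_category \<Rightarrow> ('o, 'm) internal_functor \<Rightarrow> 'm" where
  "tr X = cylinder.tau V X (Cyl X) (cyl1 X) (cyl2 X)"

lemma cylinder_Cyl: "IC X \<Longrightarrow> cylinder TYPE('i) V X (Cyl X) (cyl1 X) (cyl2 X)"
  using CV.product_chosen[of X Two] by unfold_locales auto

text \<open>As \<open>g \<times> 2\<close> sends \<open>(x, k)\<close> to \<open>(g x, k)\<close>, restricting a functor along it restricts both ends and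
  the components of the corresponding transformation along \<open>g\<close>.\<close>

lemma cylinder_map:
  assumes XZ: "IC X" "IC Z" and g: "g \<in> Hom (Cat V) X Z"
  defines "N \<equiv> prd_map (Cat V) g (Id (Cat V) Two)"
  shows "N \<in> Hom (Cat V) (Cyl X) (Cyl Z)"
    "N \<cdot>\<^bsub>Cat V\<^esub> inc X k = inc Z k \<cdot>\<^bsub>Cat V\<^esub> g"
    "K \<in> Hom (Cat V) (Cyl Z) A \<Longrightarrow> tr X (K \<cdot>\<^bsub>Cat V\<^esub> N) = tr Z K \<cdot> Fun0 g"
proof -
  interpret CX: cylinder V "TYPE('i)" X "Cyl X" "cyl1 X" "cyl2 X" by (rule cylinder_Cyl[OF XZ(1)])
  interpret CZ: cylinder V "TYPE('i)" Z "Cyl Z" "cyl1 Z" "cyl2 Z" by (rule cylinder_Cyl[OF XZ(2)])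
  have g': "IF g" "IDom g = X" "ICod g = Z" using g by (simp_all add: in_Cat_hom)
  note [simp] = IF_simps(3-)[OF g'(1), unfolded g'(2,3)]
  have a: "g \<cdot>\<^bsub>Cat V\<^esub> cyl1 X \<in> Hom (Cat V) (Cyl X) Z"
    by (rule Cat_cat.comp_hom[OF _ g]) (simp add: in_Cat_hom)
  have b: "Id (Cat V) Two \<cdot>\<^bsub>Cat V\<^esub> cyl2 X = cyl2 X" "cyl2 X \<in> Hom (Cat V) (Cyl X) Two"
    using Cat_cat.Id_comp[of "cyl2 X" Two] by (simp_all add: in_Cat_hom)
  have N: "N = pair (Cat V) (g \<cdot>\<^bsub>Cat V\<^esub> cyl1 X) (cyl2 X)"
    using g' b by (simp add: N_def prd_map_def)
  note n = CV.pair[OF a b(2), folded N]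
  show "N \<in> Hom (Cat V) (Cyl X) (Cyl Z)" by (rule n(1))
  then have N': "IF N" "IDom N = Cyl X" "ICod N = Cyl Z" by (simp_all add: in_Cat_hom)
  note [simp] = IF_simps(3-)[OF N'(1), unfolded N'(2,3)]
  have e: "Fun0 (cyl1 Z) \<cdot> Fun0 N = Fun0 g \<cdot> Fun0 (cyl1 X)" "Fun1 (cyl1 Z) \<cdot> Fun1 N = Fun1 g \<cdot> Fun1 (cyl1 X)"
    "Fun0 (cyl2 Z) \<cdot> Fun0 N = Fun0 (cyl2 X)" "Fun1 (cyl2 Z) \<cdot> Fun1 N = Fun1 (cyl2 X)"
    using arg_cong[OF n(2), of Fun0] arg_cong[OF n(2), of Fun1] arg_cong[OF n(3), of Fun0] arg_cong[OF n(3), of Fun1]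
    by simp_all
  have N0: "Fun0 N \<cdot> CX.ob k x = CZ.ob k (Fun0 g \<cdot> x)" if "x \<in> Ar V" "Cod V x = Ob0 X" for k x
    by (rule CZ.ob_eqI) (use that comp_eq_at[OF e(1), of "CX.ob k x"] comp_eq_at[OF e(3), of "CX.ob k x"] in simp_all)
  have N1: "Fun1 N \<cdot> CX.ar a b f = CZ.ar a b (Fun1 g \<cdot> f)" if "f \<in> Ar V" "Cod V f = Ob1 X" "a \<longrightarrow> b" for a b f
    by (rule CZ.ar_eqI) (use that comp_eq_at[OF e(2), of "CX.ar a b f"] comp_eq_at[OF e(4), of "CX.ar a b f"] in simp_all)
  show "N \<cdot>\<^bsub>Cat V\<^esub> inc X k = inc Z k \<cdot>\<^bsub>Cat V\<^esub> g"
    by (rule internal_functor_eqI) (use N' g' N0 N1 in \<open>simp_all add: inc_def\<close>)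
  assume "K \<in> Hom (Cat V) (Cyl Z) A"
  then have K: "IF K" "IDom K = Cyl Z" by (simp_all add: in_Cat_hom)
  note [simp] = IF_simps(3-)[OF K(1), unfolded K(2)]
  show "tr X (K \<cdot>\<^bsub>Cat V\<^esub> N) = tr Z K \<cdot> Fun0 g"
    using N1[of "Idn X" False True] g' IF_eqs(3)[OF g'(1,2)] by (simp add: tr_def CX.tau_def CZ.tau_def)
qed

text \<open>A functor out of \<open>X \<times> 2\<close> and a functor into the category of arrows are both determined by, and can
  be constructed from, a transformation; evaluation is the functor corresponding to the universal
  one.\<close>

lemma Two_exponential:
  assumes A: "IC A"
  shows "\<exists>e. is_exponential (Cat V) Two A e"
proof -
  interpret A: arrows V A using A by unfold_locales
  interpret CA: cylinder V "TYPE('i)" A.AA "Cyl A.AA" "cyl1 A.AA" "cyl2 A.AA" by (rule cylinder_Cyl[OF A.IC_AA])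
  obtain ev where ev: "ev \<in> Hom (Cat V) (Cyl A.AA) A" "ev \<cdot>\<^bsub>Cat V\<^esub> inc A.AA False = A.dom"
    "ev \<cdot>\<^bsub>Cat V\<^esub> inc A.AA True = A.cod" "tr A.AA ev = Id V (Ob1 A)"
    using CA.functor_of_transf[OF A.universal_transf] unfolding inc_def tr_def by blast
  have "\<exists>!M. M \<in> Hom (Cat V) X A.AA \<and> ev \<cdot>\<^bsub>Cat V\<^esub> prd_map (Cat V) M (Id (Cat V) Two) = f"
    if X: "IC X" and f: "f \<in> Hom (Cat V) (Cyl X) A" for X f
  proof -
    interpret CX: cylinder V "TYPE('i)" X "Cyl X" "cyl1 X" "cyl2 X" by (rule cylinder_Cyl[OF X])
    have I: "inc X k \<in> Hom (Cat V) X (Cyl X)" "inc A.AA k \<in> Hom (Cat V) A.AA (Cyl A.AA)" for k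
      by (simp_all add: in_Cat_hom inc_def)
    have iff: "ev \<cdot>\<^bsub>Cat V\<^esub> prd_map (Cat V) M (Id (Cat V) Two) = f \<longleftrightarrow>
      A.dom \<cdot>\<^bsub>Cat V\<^esub> M = f \<cdot>\<^bsub>Cat V\<^esub> inc X False \<and> A.cod \<cdot>\<^bsub>Cat V\<^esub> M = f \<cdot>\<^bsub>Cat V\<^esub> inc X True \<and> Fun0 M = tr X f"
      if M: "M \<in> Hom (Cat V) X A.AA" for M
    proof -
      let ?N = "prd_map (Cat V) M (Id (Cat V) Two)"
      note n = cylinder_map[OF X A.IC_AA M]
      have eN: "ev \<cdot>\<^bsub>Cat V\<^esub> ?N \<in> Hom (Cat V) (Cyl X) A" using Cat_cat.comp_hom[OF n(1) ev(1)] .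
      have r: "(ev \<cdot>\<^bsub>Cat V\<^esub> ?N) \<cdot>\<^bsub>Cat V\<^esub> inc X k = (ev \<cdot>\<^bsub>Cat V\<^esub> inc A.AA k) \<cdot>\<^bsub>Cat V\<^esub> M" for k
        unfolding Cat_cat.assoc_hom[OF I(1) n(1) ev(1)] n(2) Cat_cat.assoc_hom[OF M I(2) ev(1)] ..
      have t: "tr X (ev \<cdot>\<^bsub>Cat V\<^esub> ?N) = Fun0 M"
        using n(3)[OF ev(1)] ev(4) M IF_simps(3,5)[of M] by (simp add: in_Cat_hom)
      have "ev \<cdot>\<^bsub>Cat V\<^esub> ?N = f \<longleftrightarrow> (\<forall>k. (ev \<cdot>\<^bsub>Cat V\<^esub> ?N) \<cdot>\<^bsub>Cat V\<^esub> inc X k = f \<cdot>\<^bsub>Cat V\<^esub> inc X k) \<and> tr X (ev \<cdot>\<^bsub>Cat V\<^esub> ?N) = tr X f"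
        using CX.functor_eqI[OF eN f, folded inc_def tr_def] by blast
      then show ?thesis unfolding r t by (auto simp: ev(2,3) all_bool_eq)
    qed
    have "\<exists>!M. M \<in> Hom (Cat V) X A.AA \<and> A.dom \<cdot>\<^bsub>Cat V\<^esub> M = f \<cdot>\<^bsub>Cat V\<^esub> inc X False \<and>
      A.cod \<cdot>\<^bsub>Cat V\<^esub> M = f \<cdot>\<^bsub>Cat V\<^esub> inc X True \<and> Fun0 M = tr X f"
      unfolding inc_def tr_def by (rule A.functor_into_AA[OF CX.transf_of_functor[OF f] X])
    then show ?thesis using iff by (simp cong: conj_cong)
  qed
  then have "is_exponential (Cat V) Two A (A.AA, ev)"
    unfolding is_exponential_def using ev(1) by simp
  then show ?thesis by blast
qed

lemma Two_exponential_chosen: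
  "IC A \<Longrightarrow> is_exponential (Cat V) Two A (exp_ob (Cat V) Two A, exp_ev (Cat V) Two A)"
  using Two_exponential unfolding exp_ob_def exp_ev_def exponential_def by (auto intro: someI2)

lemma int_two_element: "int_two_element V k \<in> Hom (Cat V) (int_one V) Two"
proof -
  have "coprd_in V UNIV (\<lambda>_. terminal V) k \<in> Hom V (terminal V) (Ob0 Two)"
    using is_coproductD(2)[OF two.c0, of k] by (simp add: two.in0_def)
  then show ?thesis unfolding int_two_element_def int_two_glued by (rule int_element[OF IC_Two])
qed

text \<open>In this form the ends of the cylinder enter the definition of evaluation at an element of the
  interval.\<close>

lemma inc_eq:
  assumes X: "IC X"
  shows "pair (Cat V) (Id (Cat V) X) (int_const V X (int_two_element V k)) = inc X k"
proof -
  interpret CX: cylinder V "TYPE('i)" X "Cyl X" "cyl1 X" "cyl2 X" by (rule cylinder_Cyl[OF X])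
  note c = int_const(1-3)[OF X int_two_element[of k]]
  have I: "Id (Cat V) X \<in> Hom (Cat V) X X" using Cat_cat.Id_Ar[of X] X by (simp add: in_Cat_hom)
  note p = CV.pair[OF I c(1)]
  let ?p = "pair (Cat V) (Id (Cat V) X) (int_const V X (int_two_element V k))"
  have "Fun0 (cyl2 X) \<cdot> Fun0 ?p = Fun0 (int_const V X (int_two_element V k))"
    "Fun1 (cyl2 X) \<cdot> Fun1 ?p = Fun1 (int_const V X (int_two_element V k))"
    using arg_cong[OF p(3), of Fun0] arg_cong[OF p(3), of Fun1] by simp_all
  moreover have "Fun0 (int_const V X (int_two_element V k)) = e0 k (Ob0 X)"
    unfolding c by (simp add: int_two_element_def int_element_def e0_def two.in0_def)
  moreover have "Fun1 (int_const V X (int_two_element V k)) = e1 k k (Ob1 X)"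
    unfolding c using X e_Two(3)[of "Ob1 X" k]
    by (simp add: int_two_element_def int_element_def int_two_glued e0_def flip: two.in0_def)
  ultimately show ?thesis
    unfolding inc_def using p(1,2) by (intro CX.incl_unique) simp_all
qed

text \<open>Unwinding the pullback that defines the slice: an object of \<open>A\<^bsub>/T\<^esub>\<close> over \<open>G\<close>, at any stage \<open>X\<close>, is
  a transformation from \<open>G\<close> to the constant functor at \<open>T\<close>.\<close>

theorem is_internal_terminal_iff_transf:
  assumes A: "IC A" and T: "T \<in> Hom (Cat V) (int_one V) A"
  shows "is_internal_terminal V A T \<longleftrightarrow>
    (\<forall>X. IC X \<longrightarrow> (\<forall>G\<in>Hom (Cat V) X A. \<exists>!\<tau>. is_transf X A G (int_const V X T) \<tau>))"
proof -
  let ?E = "exp_ob (Cat V) Two A" and ?ev = "exp_ev (Cat V) Two A"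
  have E: "IC ?E" and ev: "?ev \<in> Hom (Cat V) (Cyl ?E) A"
    and uni: "\<And>X f. IC X \<Longrightarrow> f \<in> Hom (Cat V) (Cyl X) A \<Longrightarrow>
      \<exists>!g. g \<in> Hom (Cat V) X ?E \<and> ?ev \<cdot>\<^bsub>Cat V\<^esub> prd_map (Cat V) g (Id (Cat V) Two) = f"
    using Two_exponential_chosen[OF A] by (auto simp: is_exponential_def)
  have I: "inc X k \<in> Hom (Cat V) X (Cyl X)" if "IC X" for X k
  proof -
    interpret CX: cylinder V "TYPE('i)" X "Cyl X" "cyl1 X" "cyl2 X" by (rule cylinder_Cyl[OF that])
    show ?thesis by (simp add: in_Cat_hom inc_def)
  qed
  have D: "ICod (int_two_element V k) = Two" for k using int_two_element by (simp add: in_Cat_hom)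
  have eval: "int_eval_at V A (int_two_element V k) = ?ev \<cdot>\<^bsub>Cat V\<^esub> inc ?E k" for k
    unfolding int_eval_at_def Let_def D inc_eq[OF E] ..
  have evalh: "int_eval_at V A (int_two_element V k) \<in> Hom (Cat V) ?E A" for k
    unfolding eval using Cat_cat.comp_hom[OF I[OF E] ev] .
  have ends: "int_endpoints V A \<in> Hom (Cat V) ?E (prd (Cat V) A A)"
    unfolding int_endpoints_def by (rule CV.pair(1)[OF evalh evalh])
  have IdA: "Id (Cat V) A \<in> Hom (Cat V) A A" using Cat_cat.Id_Ar[of A] A by (simp add: in_Cat_hom)
  have cT: "int_const V X T \<in> Hom (Cat V) X A" if "IC X" for X using int_const(1)[OF that T] .
  have idT: "int_id_times V A T \<in> Hom (Cat V) A (prd (Cat V) A A)"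
    unfolding int_id_times_def by (rule CV.pair(1)[OF IdA cT[OF A]])
  have step: "(\<exists>!K. K \<in> Hom (Cat V) X ?E \<and> int_endpoints V A \<cdot>\<^bsub>Cat V\<^esub> K = int_id_times V A T \<cdot>\<^bsub>Cat V\<^esub> G) \<longleftrightarrow>
      (\<exists>!\<tau>. is_transf X A G (int_const V X T) \<tau>)"
    if X: "IC X" and G: "G \<in> Hom (Cat V) X A" for X G
  proof -
    interpret CX: cylinder V "TYPE('i)" X "Cyl X" "cyl1 X" "cyl2 X" by (rule cylinder_Cyl[OF X])
    let ?N = "\<lambda>K. prd_map (Cat V) K (Id (Cat V) Two)"
    let ?P = "\<lambda>f. f \<in> Hom (Cat V) (Cyl X) A \<and> f \<cdot>\<^bsub>Cat V\<^esub> inc X False = G \<and> f \<cdot>\<^bsub>Cat V\<^esub> inc X True = int_const V X T"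
    have Q: "int_endpoints V A \<cdot>\<^bsub>Cat V\<^esub> K = int_id_times V A T \<cdot>\<^bsub>Cat V\<^esub> G \<longleftrightarrow>
        (?ev \<cdot>\<^bsub>Cat V\<^esub> ?N K) \<cdot>\<^bsub>Cat V\<^esub> inc X False = G \<and> (?ev \<cdot>\<^bsub>Cat V\<^esub> ?N K) \<cdot>\<^bsub>Cat V\<^esub> inc X True = int_const V X T"
      if K: "K \<in> Hom (Cat V) X ?E" for K
    proof -
      have l: "int_endpoints V A \<cdot>\<^bsub>Cat V\<^esub> K = pair (Cat V) (int_eval_at V A (int_two_element V False) \<cdot>\<^bsub>Cat V\<^esub> K)
          (int_eval_at V A (int_two_element V True) \<cdot>\<^bsub>Cat V\<^esub> K)"
        unfolding int_endpoints_def by (rule CV.pair_comp_hom[OF evalh evalh K])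
      have "int_id_times V A T \<cdot>\<^bsub>Cat V\<^esub> G = pair (Cat V) (Id (Cat V) A \<cdot>\<^bsub>Cat V\<^esub> G) (int_const V A T \<cdot>\<^bsub>Cat V\<^esub> G)"
        unfolding int_id_times_def by (rule CV.pair_comp_hom[OF IdA cT[OF A] G])
      also have "\<dots> = pair (Cat V) G (int_const V X T)"
        using Cat_cat.Id_comp[of G A] G int_const(4)[OF A T G] unfolding Cat_cat.in_hom by simp
      finally have r: "int_id_times V A T \<cdot>\<^bsub>Cat V\<^esub> G = pair (Cat V) G (int_const V X T)" .
      have e: "int_eval_at V A (int_two_element V k) \<cdot>\<^bsub>Cat V\<^esub> K = (?ev \<cdot>\<^bsub>Cat V\<^esub> ?N K) \<cdot>\<^bsub>Cat V\<^esub> inc X k" for k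
        unfolding eval Cat_cat.assoc_hom[OF K I[OF E] ev] Cat_cat.assoc_hom[OF I[OF X] cylinder_map(1)[OF X E K] ev]
          cylinder_map(2)[OF X E K] ..
      have eK: "int_eval_at V A (int_two_element V k) \<cdot>\<^bsub>Cat V\<^esub> K \<in> Hom (Cat V) X A" for k
        using Cat_cat.comp_hom[OF K evalh] .
      have "int_endpoints V A \<cdot>\<^bsub>Cat V\<^esub> K = int_id_times V A T \<cdot>\<^bsub>Cat V\<^esub> G \<longleftrightarrow>
          int_eval_at V A (int_two_element V False) \<cdot>\<^bsub>Cat V\<^esub> K = G \<and>
          int_eval_at V A (int_two_element V True) \<cdot>\<^bsub>Cat V\<^esub> K = int_const V X T"
        unfolding l r by (rule CV.pair_eq_iff) (use eK G cT[OF X] in \<open>simp_all only: Cat_cat.in_hom\<close>)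
      then show ?thesis unfolding e .
    qed
    have "(\<exists>!K. K \<in> Hom (Cat V) X ?E \<and> int_endpoints V A \<cdot>\<^bsub>Cat V\<^esub> K = int_id_times V A T \<cdot>\<^bsub>Cat V\<^esub> G) \<longleftrightarrow> (\<exists>!f. ?P f)"
      by (rule ex1_bij[where h = "\<lambda>K. ?ev \<cdot>\<^bsub>Cat V\<^esub> ?N K"])
        (fact Cat_cat.comp_hom[OF cylinder_map(1)[OF X E] ev] uni[OF X] Q)+
    also have "\<dots> \<longleftrightarrow> (\<exists>!\<tau>. is_transf X A G (int_const V X T) \<tau>)"
    proof
      assume "\<exists>!f. ?P f"
      then obtain f where f: "?P f" and uniq: "\<And>f'. ?P f' \<Longrightarrow> f' = f" by blast
      show "\<exists>!\<tau>. is_transf X A G (int_const V X T) \<tau>"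
      proof (rule ex1I[of _ "tr X f"])
        show "is_transf X A G (int_const V X T) (tr X f)"
          using CX.transf_of_functor[of f A] f by (simp add: inc_def tr_def)
        fix \<tau> assume "is_transf X A G (int_const V X T) \<tau>"
        then obtain f' where "?P f'" "tr X f' = \<tau>"
          using CX.functor_of_transf[of A G "int_const V X T" \<tau>] unfolding inc_def tr_def by blast
        then show "\<tau> = tr X f" using uniq by blast
      qed
    next
      assume "\<exists>!\<tau>. is_transf X A G (int_const V X T) \<tau>"
      then obtain \<tau> where \<tau>: "is_transf X A G (int_const V X T) \<tau>"
        and uniq: "\<And>\<tau>'. is_transf X A G (int_const V X T) \<tau>' \<Longrightarrow> \<tau>' = \<tau>" by blast
      obtain f where f: "?P f" "tr X f = \<tau>"
        using CX.functor_of_transf[OF \<tau>] unfolding inc_def tr_def by blast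
      show "\<exists>!f. ?P f"
      proof (rule ex1I[of _ f])
        show "?P f" by (rule f(1))
        fix f' assume f': "?P f'"
        have "tr X f' = \<tau>"
          by (rule uniq) (use CX.transf_of_functor[of f' A] f' in \<open>simp add: inc_def tr_def\<close>)
        then show "f' = f"
          by (intro CX.functor_eqI[of f' A f, folded inc_def tr_def]) (use f f' in \<open>auto simp: all_bool_eq intro: bool.induct\<close>)
      qed
    qed
    finally show ?thesis .
  qed
  have "is_internal_terminal V A T \<longleftrightarrow> is_iso (Cat V) (int_slice_proj V A T)"
    using T by (simp add: is_internal_terminal_def)
  also have "\<dots> \<longleftrightarrow> (\<forall>X\<in>Ob (Cat V). \<forall>G\<in>Hom (Cat V) X (Dom (Cat V) (int_id_times V A T)).
      \<exists>!K. K \<in> Hom (Cat V) X (Dom (Cat V) (int_endpoints V A)) \<and> int_endpoints V A \<cdot>\<^bsub>Cat V\<^esub> K = int_id_times V A T \<cdot>\<^bsub>Cat V\<^esub> G)"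
    unfolding int_slice_proj_def by (rule CV.is_iso_pb2_iff) (use ends idT in \<open>simp_all only: Cat_cat.in_hom\<close>)
  also have "\<dots> \<longleftrightarrow> (\<forall>X. IC X \<longrightarrow> (\<forall>G\<in>Hom (Cat V) X A. \<exists>!\<tau>. is_transf X A G (int_const V X T) \<tau>))"
  proof -
    have "Dom (Cat V) (int_endpoints V A) = ?E" "Dom (Cat V) (int_id_times V A T) = A"
      using ends idT unfolding Cat_cat.in_hom by blast+
    then show ?thesis
      by (simp only: Ball_def[of "Ob (Cat V)"] Cat_simps(1)) (intro all_cong1 imp_cong refl ball_cong step)
  qed
  finally show ?thesis .
qed

text \<open>Functors from this category to \<open>A\<close> are the generalised objects of \<open>A\<close> at stage \<open>U\<close>, and their
  transformations are the generalised arrows.\<close>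

definition discrete :: "'o \<Rightarrow> ('o, 'm) internal_category" where
  "discrete U = \<lparr>Ob0 = U, Ob1 = U, Src = Id V U, Tgt = Id V U, Idn = Id V U, Cmpn = pb1 V (Id V U) (Id V U)\<rparr>"

lemma discrete_simps [simp]:
  "Ob0 (discrete U) = U" "Ob1 (discrete U) = U" "Src (discrete U) = Id V U" "Tgt (discrete U) = Id V U" "Idn (discrete U) = Id V U"
  "Cmpn (discrete U) = pb1 V (Id V U) (Id V U)"
  by (simp_all add: discrete_def)

lemma icomp_discrete:
  assumes "U \<in> Ob V" "f \<in> Ar V" "Cod V f = U"
  shows "icomp (discrete U) f f = f"
  using assms by (simp add: icomp_def)

lemma IC_discrete:
  assumes U: "U \<in> Ob V"
  shows "IC (discrete U)"
  by (rule is_internal_categoryI) (use U icomp_discrete in \<open>auto simp: internal_graph_def in_hom\<close>)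

text \<open>Discrete categories \<open>X\<close> give the condition on elements. In the other direction the components of the
  transformation are the unique arrow at the stage \<open>Ob0 X\<close>, and naturality is the uniqueness of arrows
  to the constant element at the stages of \<open>Ob1 X\<close>.\<close>

theorem is_internal_terminal_iff:
  assumes A: "IC A" and x: "x \<in> Hom V (terminal V) (Ob0 A)"
  shows "is_internal_terminal V A (int_element V A x) \<longleftrightarrow>
    (\<forall>U\<in>Ob V. \<forall>a\<in>Hom V U (Ob0 A). \<exists>!f. f \<in> Hom V U (Ob1 A) \<and> Src A \<cdot> f = a \<and> Tgt A \<cdot> f = x \<cdot> bang V U)"
    (is "_ \<longleftrightarrow> ?R")
proof -
  let ?T = "int_element V A x"
  have T: "?T \<in> Hom (Cat V) (int_one V) A" using int_element[OF A x] .
  have x': "x \<in> Ar V" "Dom V x = terminal V" "Cod V x = Ob0 A" using x by (simp_all add: in_hom)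
  have cT: "int_const V X ?T \<in> Hom (Cat V) X A" "Fun0 (int_const V X ?T) = x \<cdot> bang V (Ob0 X)"
    "Fun1 (int_const V X ?T) = (Idn A \<cdot> x) \<cdot> bang V (Ob1 X)" if "IC X" for X
    using int_const(1-3)[OF that T] by (simp_all add: int_element_def)
  have "(\<forall>X. IC X \<longrightarrow> (\<forall>G\<in>Hom (Cat V) X A. \<exists>!\<tau>. is_transf X A G (int_const V X ?T) \<tau>)) \<longleftrightarrow> ?R"
  proof
    assume L: "\<forall>X. IC X \<longrightarrow> (\<forall>G\<in>Hom (Cat V) X A. \<exists>!\<tau>. is_transf X A G (int_const V X ?T) \<tau>)"
    show ?R
    proof (intro ballI)
      fix U a assume U: "U \<in> Ob V" and a: "a \<in> Hom V U (Ob0 A)"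
      let ?G = "\<lparr>IDom = discrete U, ICod = A, Fun0 = a, Fun1 = Idn A \<cdot> a\<rparr>"
      have a': "a \<in> Ar V" "Dom V a = U" "Cod V a = Ob0 A" using a by (simp_all add: in_hom)
      have "IF ?G"
      proof (rule is_internal_functorI[OF IC_discrete[OF U] A])
        fix W f g assume fg: "f \<in> Hom V W (Ob1 (discrete U))" "g \<in> Hom V W (Ob1 (discrete U))" "Tgt (discrete U) \<cdot> f = Src (discrete U) \<cdot> g"
        then have "g = f" by (auto simp: in_hom)
        then show "Fun1 ?G \<cdot> icomp (discrete U) f g = icomp A (Fun1 ?G \<cdot> f) (Fun1 ?G \<cdot> g)"
          using fg a' A U by (simp add: in_hom icomp_discrete)
      qed (use a' A U in \<open>simp_all add: in_hom\<close>)
      then have G: "?G \<in> Hom (Cat V) (discrete U) A" by (simp add: in_Cat_hom)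
      have eq: "is_transf (discrete U) A ?G (int_const V (discrete U) ?T) \<tau> \<longleftrightarrow>
          \<tau> \<in> Hom V U (Ob1 A) \<and> Src A \<cdot> \<tau> = a \<and> Tgt A \<cdot> \<tau> = x \<cdot> bang V U" for \<tau>
      proof
        assume "is_transf (discrete U) A ?G (int_const V (discrete U) ?T) \<tau>"
        then show "\<tau> \<in> Hom V U (Ob1 A) \<and> Src A \<cdot> \<tau> = a \<and> Tgt A \<cdot> \<tau> = x \<cdot> bang V U"
          using cT(2)[OF IC_discrete[OF U]] by (simp add: is_transf_def)
      next
        assume \<tau>: "\<tau> \<in> Hom V U (Ob1 A) \<and> Src A \<cdot> \<tau> = a \<and> Tgt A \<cdot> \<tau> = x \<cdot> bang V U"
        then have \<tau>': "\<tau> \<in> Ar V" "Dom V \<tau> = U" "Cod V \<tau> = Ob1 A" "Src A \<cdot> \<tau> = a" "Tgt A \<cdot> \<tau> = x \<cdot> bang V U"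
          by (simp_all add: in_hom)
        have "icomp A (Fun1 ?G \<cdot> f) (\<tau> \<cdot> (Tgt (discrete U) \<cdot> f)) =
            icomp A (\<tau> \<cdot> (Src (discrete U) \<cdot> f)) (Fun1 (int_const V (discrete U) ?T) \<cdot> f)" if f: "f \<in> Hom V W U" for W f
        proof -
          have "Src A \<cdot> (\<tau> \<cdot> f) = a \<cdot> f" "Tgt A \<cdot> (\<tau> \<cdot> f) = x \<cdot> bang V W"
            using comp_eq_at[OF \<tau>'(4), of f] comp_eq_at[OF \<tau>'(5), of f] f \<tau>' x' A U by (simp_all add: in_hom)
          then show ?thesis
            using f \<tau>' a' x' A U cT(3)[OF IC_discrete[OF U]] by (simp add: in_hom)
        qed
        then show "is_transf (discrete U) A ?G (int_const V (discrete U) ?T) \<tau>"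
          using \<tau> G cT(1,2)[OF IC_discrete[OF U]] by (simp add: is_transf_def)
      qed
      have "\<exists>!\<tau>. is_transf (discrete U) A ?G (int_const V (discrete U) ?T) \<tau>"
        using L IC_discrete[OF U] G by blast
      then show "\<exists>!f. f \<in> Hom V U (Ob1 A) \<and> Src A \<cdot> f = a \<and> Tgt A \<cdot> f = x \<cdot> bang V U"
        by (simp only: eq)
    qed
  next
    assume R: ?R
    then have R_eq: "f = g" if "f \<in> Hom V U (Ob1 A)" "g \<in> Hom V U (Ob1 A)" "Src A \<cdot> f = Src A \<cdot> g"
      "Tgt A \<cdot> f = x \<cdot> bang V U" "Tgt A \<cdot> g = x \<cdot> bang V U" for U f g
    proof -
      have "U \<in> Ob V" "Src A \<cdot> f \<in> Hom V U (Ob0 A)" using that A hom_Ob(1)[OF that(1)] by (simp_all add: in_hom)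
      then show ?thesis using R that by metis
    qed
    show "\<forall>X. IC X \<longrightarrow> (\<forall>G\<in>Hom (Cat V) X A. \<exists>!\<tau>. is_transf X A G (int_const V X ?T) \<tau>)"
    proof (intro allI impI ballI)
      fix X G assume X: "IC X" and G: "G \<in> Hom (Cat V) X A"
      have G': "IF G" "IDom G = X" "ICod G = A" using G by (simp_all add: in_Cat_hom)
      note [simp] = IF_simps(3-)[OF G'(1), unfolded G'(2,3)]
      have g0: "Fun0 G \<in> Hom V (Ob0 X) (Ob0 A)" by (simp add: in_hom)
      then obtain \<tau> where \<tau>: "\<tau> \<in> Hom V (Ob0 X) (Ob1 A)" "Src A \<cdot> \<tau> = Fun0 G" "Tgt A \<cdot> \<tau> = x \<cdot> bang V (Ob0 X)"
        using R X by (meson IC_simps(1))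
      have \<tau>': "\<tau> \<in> Ar V" "Dom V \<tau> = Ob0 X" "Cod V \<tau> = Ob1 A" using \<tau>(1) by (simp_all add: in_hom)
      have at: "Src A \<cdot> (\<tau> \<cdot> u) = Fun0 G \<cdot> u" "Tgt A \<cdot> (\<tau> \<cdot> u) = x \<cdot> bang V (Dom V u)" if "u \<in> Ar V" "Cod V u = Ob0 X" for u
        using comp_eq_at[OF \<tau>(2), of u] comp_eq_at[OF \<tau>(3), of u] that \<tau>' x' A X by simp_all
      have "icomp A (Fun1 G \<cdot> f) (\<tau> \<cdot> (Tgt X \<cdot> f)) = icomp A (\<tau> \<cdot> (Src X \<cdot> f)) (Fun1 (int_const V X ?T) \<cdot> f)"
        if f: "f \<in> Hom V U (Ob1 X)" for U f
      proof (rule R_eq[of _ U])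
        have c: "Fun1 (int_const V X ?T) \<cdot> f = Idn A \<cdot> (x \<cdot> bang V U)"
          using f X A x' cT(3)[OF X] by (simp add: in_hom)
        have f': "f \<in> Ar V" "Dom V f = U" "Cod V f = Ob1 X" "U \<in> Ob V" using f hom_Ob(1)[OF f] by (simp_all add: in_hom)
        show "icomp A (Fun1 G \<cdot> f) (\<tau> \<cdot> (Tgt X \<cdot> f)) \<in> Hom V U (Ob1 A)"
          "icomp A (\<tau> \<cdot> (Src X \<cdot> f)) (Fun1 (int_const V X ?T) \<cdot> f) \<in> Hom V U (Ob1 A)"
          "Src A \<cdot> icomp A (Fun1 G \<cdot> f) (\<tau> \<cdot> (Tgt X \<cdot> f)) = Src A \<cdot> icomp A (\<tau> \<cdot> (Src X \<cdot> f)) (Fun1 (int_const V X ?T) \<cdot> f)"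
          "Tgt A \<cdot> icomp A (Fun1 G \<cdot> f) (\<tau> \<cdot> (Tgt X \<cdot> f)) = x \<cdot> bang V U"
          "Tgt A \<cdot> icomp A (\<tau> \<cdot> (Src X \<cdot> f)) (Fun1 (int_const V X ?T) \<cdot> f) = x \<cdot> bang V U"
          unfolding c using f' G' X A \<tau>' x' at by (simp_all add: in_hom)
      qed
      then have t: "is_transf X A G (int_const V X ?T) \<tau>"
        using G cT(1,2)[OF X] \<tau> by (simp add: is_transf_def)
      show "\<exists>!\<tau>. is_transf X A G (int_const V X ?T) \<tau>"
      proof (rule ex1I[of _ \<tau>])
        show "is_transf X A G (int_const V X ?T) \<tau>" by (rule t)
        show "\<sigma> = \<tau>" if "is_transf X A G (int_const V X ?T) \<sigma>" for \<sigma>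
          by (rule R_eq[of _ "Ob0 X"]) (use that \<tau> cT(2)[OF X] in \<open>simp_all add: is_transf_def\<close>)
      qed
    qed
  qed
  then show ?thesis using is_internal_terminal_iff_transf[OF A T] by simp
qed

end

section \<open>The enriched Yoneda lemma\<close>

context closed_extensive_cat
begin

lemma exp_post:
  assumes "h \<in> Hom V b d" "a \<in> Ob V"
  shows "exp_post V a h \<in> Hom V (exp_ob V a b) (exp_ob V a d)"
    "u \<in> Hom V U (exp_ob V a b) \<Longrightarrow> v \<in> Hom V U a \<Longrightarrow>
     exp_ev V a d \<cdot> pair V (exp_post V a h \<cdot> u) v = h \<cdot> (exp_ev V a b \<cdot> pair V u v)"
proof -
  have h: "h \<in> Ar V" "Dom V h = b" "Cod V h = d" "b \<in> Ob V" "d \<in> Ob V"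
    using assms(1) hom_Ob[OF assms(1)] by (simp_all add: in_hom)
  have k: "h \<cdot> exp_ev V a b \<in> Hom V (prd V (exp_ob V a b) a) d" using h assms(2) by (simp add: in_hom)
  show "exp_post V a h \<in> Hom V (exp_ob V a b) (exp_ob V a d)"
    unfolding exp_post_def h using curry_arr(1)[OF k] h assms(2) by simp
  show "exp_ev V a d \<cdot> pair V (exp_post V a h \<cdot> u) v = h \<cdot> (exp_ev V a b \<cdot> pair V u v)"
    if "u \<in> Hom V U (exp_ob V a b)" "v \<in> Hom V U a"
    unfolding exp_post_def h using exp_ev_curry[OF k, of u v] h assms(2) that by (simp add: in_hom)
qed

lemma exp_pre:
  assumes "h \<in> Hom V a' a" "b \<in> Ob V"
  shows "exp_pre V h b \<in> Hom V (exp_ob V a b) (exp_ob V a' b)"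
    "u \<in> Hom V U (exp_ob V a b) \<Longrightarrow> v \<in> Hom V U a' \<Longrightarrow>
     exp_ev V a' b \<cdot> pair V (exp_pre V h b \<cdot> u) v = exp_ev V a b \<cdot> pair V u (h \<cdot> v)"
proof -
  have h: "h \<in> Ar V" "Dom V h = a'" "Cod V h = a" "a' \<in> Ob V" "a \<in> Ob V"
    using assms(1) hom_Ob[OF assms(1)] by (simp_all add: in_hom)
  have k: "exp_ev V a b \<cdot> prd_map V (Id V (exp_ob V a b)) h \<in> Hom V (prd V (exp_ob V a b) a') b"
    using h assms(2) by (simp add: in_hom)
  show "exp_pre V h b \<in> Hom V (exp_ob V a b) (exp_ob V a' b)"
    unfolding exp_pre_def h using curry_arr(1)[OF k] h assms(2) by simp
  show "exp_ev V a' b \<cdot> pair V (exp_pre V h b \<cdot> u) v = exp_ev V a b \<cdot> pair V u (h \<cdot> v)"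
    if "u \<in> Hom V U (exp_ob V a b)" "v \<in> Hom V U a'"
    unfolding exp_pre_def h using exp_ev_curry[OF k, of u v] h assms(2) that by (simp add: in_hom prd_map_at)
qed

text \<open>Both composites end in the exponential of \<open>gb\<close> by \<open>fa\<close>, so they are compared by evaluating them.\<close>

lemma naturality_iff:
  assumes \<phi>: "\<phi> \<in> Hom V h (exp_ob V fa fb)" and \<psi>: "\<psi> \<in> Hom V h (exp_ob V ga gb)"
    and \<alpha>: "\<alpha>a \<in> Hom V fa ga" "\<alpha>b \<in> Hom V fb gb"
  shows "exp_post V fa \<alpha>b \<cdot> \<phi> = exp_pre V \<alpha>a gb \<cdot> \<psi> \<longleftrightarrow>
    (\<forall>U. \<forall>f\<in>Hom V U h. \<forall>y\<in>Hom V U fa.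
      \<alpha>b \<cdot> (exp_ev V fa fb \<cdot> pair V (\<phi> \<cdot> f) y) = exp_ev V ga gb \<cdot> pair V (\<psi> \<cdot> f) (\<alpha>a \<cdot> y))"
proof -
  have O: "fa \<in> Ob V" "gb \<in> Ob V" using \<alpha> hom_Ob by blast+
  note p = exp_post[OF \<alpha>(2) O(1)] and q = exp_pre[OF \<alpha>(1) O(2)]
  have l: "exp_ev V fa gb \<cdot> pair V ((exp_post V fa \<alpha>b \<cdot> \<phi>) \<cdot> f) y = \<alpha>b \<cdot> (exp_ev V fa fb \<cdot> pair V (\<phi> \<cdot> f) y)"
    and r: "exp_ev V fa gb \<cdot> pair V ((exp_pre V \<alpha>a gb \<cdot> \<psi>) \<cdot> f) y = exp_ev V ga gb \<cdot> pair V (\<psi> \<cdot> f) (\<alpha>a \<cdot> y)"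
    if f: "f \<in> Hom V U h" and y: "y \<in> Hom V U fa" for U f y
    using p(2)[OF comp_hom[OF f \<phi>] y] q(2)[OF comp_hom[OF f \<psi>] y] assoc_hom[OF f \<phi> p(1)] assoc_hom[OF f \<psi> q(1)]
    by simp_all
  show ?thesis
  proof
    assume e: "exp_post V fa \<alpha>b \<cdot> \<phi> = exp_pre V \<alpha>a gb \<cdot> \<psi>"
    show "\<forall>U. \<forall>f\<in>Hom V U h. \<forall>y\<in>Hom V U fa.
      \<alpha>b \<cdot> (exp_ev V fa fb \<cdot> pair V (\<phi> \<cdot> f) y) = exp_ev V ga gb \<cdot> pair V (\<psi> \<cdot> f) (\<alpha>a \<cdot> y)"
      using l[unfolded e] r by metis
  next
    assume R: "\<forall>U. \<forall>f\<in>Hom V U h. \<forall>y\<in>Hom V U fa.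
      \<alpha>b \<cdot> (exp_ev V fa fb \<cdot> pair V (\<phi> \<cdot> f) y) = exp_ev V ga gb \<cdot> pair V (\<psi> \<cdot> f) (\<alpha>a \<cdot> y)"
    show "exp_post V fa \<alpha>b \<cdot> \<phi> = exp_pre V \<alpha>a gb \<cdot> \<psi>"
      by (rule exp_eqI[OF comp_hom[OF \<phi> p(1)] comp_hom[OF \<psi> q(1)] O]) (use l r R in simp)
  qed
qed

end

locale pointed_presheaf = presheaf V universe C F
  for V :: "('o, 'm) category" (structure) and universe :: "'i itself"
    and C :: "('i, 'o, 'm) enriched_category" and F :: "('i, 'o, 'm) enriched_functor" +
  fixes z :: 'i and x :: 'm
  assumes z [simp]: "z \<in> obs" and x: "x \<in> Hom V (terminal V) (FO z)"
begin

lemma x_simps [simp]: "x \<in> Ar V" "Dom V x = terminal V" "Cod V x = FO z"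
  using x by (simp_all add: in_hom)

definition \<alpha> :: "'i \<Rightarrow> 'm" where
  "\<alpha> = (\<lambda>a\<in>obs. act a z (Id V (hm a z)) (x \<cdot> bang V (hm a z)))"

lemma \<alpha>: "a \<in> obs \<Longrightarrow> \<alpha> a \<in> Hom V (hm a z) (FO a)"
  by (simp add: \<alpha>_def in_hom)

lemma \<alpha>_at: "a \<in> obs \<Longrightarrow> f \<in> Hom V U (hm a z) \<Longrightarrow> \<alpha> a \<cdot> f = act a z f (x \<cdot> bang V U)"
  by (simp add: \<alpha>_def in_hom)

abbreviation "rep \<equiv> representable V C z"

lemma rep_simps [simp]: "FOb rep a = hm a z"
  by (simp add: representable_def)

lemma rep_FHom:
  assumes "a \<in> obs" "b \<in> obs"
  shows "FHom rep b a \<in> Hom V (hm a b) (exp_ob V (hm b z) (hm a z))"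
    "f \<in> Hom V U (hm a b) \<Longrightarrow> g \<in> Hom V U (hm b z) \<Longrightarrow>
     exp_ev V (hm b z) (hm a z) \<cdot> pair V (FHom rep b a \<cdot> f) g = cmp a b z f g"
proof -
  have E: "ECmp C a b z \<in> Hom V (prd V (hm a b) (hm b z)) (hm a z)" using assms by (simp add: in_hom)
  show "FHom rep b a \<in> Hom V (hm a b) (exp_ob V (hm b z) (hm a z))"
    unfolding representable_def using curry_arr(1)[OF E] assms by simp
  show "exp_ev V (hm b z) (hm a z) \<cdot> pair V (FHom rep b a \<cdot> f) g = cmp a b z f g"
    if "f \<in> Hom V U (hm a b)" "g \<in> Hom V U (hm b z)"
    unfolding representable_def using exp_ev_curry[OF E, of f g] assms that by (simp add: in_hom cmp_def)
qed

lemma F_FHom: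
  "a \<in> obs \<Longrightarrow> b \<in> obs \<Longrightarrow> FHom F b a \<in> Hom V (hm a b) (exp_ob V (FO b) (FO a))"
  by (simp add: in_hom)

lemma nat_rep_iff:
  "is_enriched_nat V (enriched_op V C) rep F \<eta> \<longleftrightarrow> \<eta> \<in> (\<Pi>\<^sub>E a\<in>obs. Hom V (hm a z) (FO a)) \<and>
    (\<forall>a\<in>obs. \<forall>b\<in>obs. \<forall>U. \<forall>f\<in>Hom V U (hm a b). \<forall>g\<in>Hom V U (hm b z). \<eta> a \<cdot> cmp a b z f g = act a b f (\<eta> b \<cdot> g))"
proof -
  have "exp_post V (hm b z) (\<eta> a) \<cdot> FHom rep b a = exp_pre V (\<eta> b) (FO a) \<cdot> FHom F b a \<longleftrightarrow>
    (\<forall>U. \<forall>f\<in>Hom V U (hm a b). \<forall>g\<in>Hom V U (hm b z). \<eta> a \<cdot> cmp a b z f g = act a b f (\<eta> b \<cdot> g))"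
    if ab: "a \<in> obs" "b \<in> obs" and \<eta>: "\<eta> \<in> (\<Pi>\<^sub>E a\<in>obs. Hom V (hm a z) (FO a))" for a b
  proof -
    have \<eta>': "\<eta> b \<in> Hom V (hm b z) (FO b)" "\<eta> a \<in> Hom V (hm a z) (FO a)" using ab \<eta> by auto
    have r: "exp_ev V (FO b) (FO a) \<cdot> pair V (FHom F b a \<cdot> f) (\<eta> b \<cdot> g) = act a b f (\<eta> b \<cdot> g)"
      if "f \<in> Hom V U (hm a b)" "g \<in> Hom V U (hm b z)" for U f g
      using act_eq[of a b f "\<eta> b \<cdot> g"] that \<eta>' ab by (simp add: in_hom)
    show ?thesis
      unfolding naturality_iff[OF rep_FHom(1)[OF ab] F_FHom[OF ab] \<eta>'] using rep_FHom(2)[OF ab] r by simp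
  qed
  then show ?thesis
    unfolding is_enriched_nat_def by (auto simp: enriched_op_def)
qed

lemma nat_F_iff:
  "is_enriched_nat V (enriched_op V C) F rep \<eta> \<longleftrightarrow> \<eta> \<in> (\<Pi>\<^sub>E a\<in>obs. Hom V (FO a) (hm a z)) \<and>
    (\<forall>a\<in>obs. \<forall>b\<in>obs. \<forall>U. \<forall>f\<in>Hom V U (hm a b). \<forall>y\<in>Hom V U (FO b). \<eta> a \<cdot> act a b f y = cmp a b z f (\<eta> b \<cdot> y))"
proof -
  have "exp_post V (FO b) (\<eta> a) \<cdot> FHom F b a = exp_pre V (\<eta> b) (hm a z) \<cdot> FHom rep b a \<longleftrightarrow>
    (\<forall>U. \<forall>f\<in>Hom V U (hm a b). \<forall>y\<in>Hom V U (FO b). \<eta> a \<cdot> act a b f y = cmp a b z f (\<eta> b \<cdot> y))"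
    if ab: "a \<in> obs" "b \<in> obs" and \<eta>: "\<eta> \<in> (\<Pi>\<^sub>E a\<in>obs. Hom V (FO a) (hm a z))" for a b
  proof -
    have \<eta>': "\<eta> b \<in> Hom V (FO b) (hm b z)" "\<eta> a \<in> Hom V (FO a) (hm a z)" using ab \<eta> by auto
    have r: "exp_ev V (FO b) (FO a) \<cdot> pair V (FHom F b a \<cdot> f) y = act a b f y"
      if "f \<in> Hom V U (hm a b)" "y \<in> Hom V U (FO b)" for U f y
      using act_eq[of a b f y] that ab by (simp add: in_hom)
    show ?thesis
      unfolding naturality_iff[OF F_FHom[OF ab] rep_FHom(1)[OF ab] \<eta>'] 
      using rep_FHom(2)[OF ab] r comp_hom[OF _ \<eta>'(1)] by simp
  qed
  then show ?thesis
    unfolding is_enriched_nat_def by (auto simp: enriched_op_def)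
qed

lemma EId_bang: "a \<in> obs \<Longrightarrow> EId C a \<cdot> bang V (terminal V) = EId C a"
  using terminal_eq[of "bang V (terminal V)" "Id V (terminal V)"] by simp

lemma \<alpha>_nat: "is_enriched_nat V (enriched_op V C) rep F \<alpha>"
proof -
  have "\<alpha> a \<cdot> cmp a b z f g = act a b f (\<alpha> b \<cdot> g)"
    if "a \<in> obs" "b \<in> obs" "f \<in> Hom V U (hm a b)" "g \<in> Hom V U (hm b z)" for a b U f g
    using that \<alpha>_at[of a "cmp a b z f g" U] \<alpha>_at[of b g U] act_cmp[of a b z f g "x \<cdot> bang V U"] hom_Ob(1)[OF that(3)]
    by (simp add: in_hom)
  moreover have "\<alpha> \<in> (\<Pi>\<^sub>E a\<in>obs. Hom V (hm a z) (FO a))" using \<alpha> by (auto simp: \<alpha>_def)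
  ultimately show ?thesis unfolding nat_rep_iff by blast
qed

text \<open>Naturality at the identity of \<open>z\<close> forces a transformation with value \<open>x\<close> there to be \<open>\<alpha>\<close>.\<close>

lemma yoneda_nat_eq: "yoneda_nat V C F z x = \<alpha>"
  unfolding yoneda_nat_def
proof (rule the_equality)
  have "\<alpha> z \<cdot> EId C z = x"
    using \<alpha>_at[of z "EId C z" "terminal V"] act_id[of z "x \<cdot> bang V (terminal V)" "terminal V"]
      terminal_eq[of "bang V (terminal V)" "Id V (terminal V)"]
    by (simp add: in_hom EId_bang)
  then show "is_enriched_nat V (enriched_op V C) rep F \<alpha> \<and> \<alpha> z \<cdot> EId C z = x"
    using \<alpha>_nat by blast
next
  fix \<eta> assume "is_enriched_nat V (enriched_op V C) rep F \<eta> \<and> \<eta> z \<cdot> EId C z = x"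
  then have \<eta>: "\<eta> \<in> (\<Pi>\<^sub>E a\<in>obs. Hom V (hm a z) (FO a))" "\<eta> z \<cdot> EId C z = x"
    and nat: "\<And>a b U f g. a \<in> obs \<Longrightarrow> b \<in> obs \<Longrightarrow> f \<in> Hom V U (hm a b) \<Longrightarrow> g \<in> Hom V U (hm b z) \<Longrightarrow>
      \<eta> a \<cdot> cmp a b z f g = act a b f (\<eta> b \<cdot> g)"
    unfolding nat_rep_iff by blast+
  show "\<eta> = \<alpha>"
  proof (rule extensionalityI[of _ obs])
    show "\<eta> \<in> extensional obs" "\<alpha> \<in> extensional obs" using \<eta> by (auto simp: PiE_iff \<alpha>_def)
    fix a assume a: "a \<in> obs"
    have I: "Id V (hm a z) \<in> Hom V (hm a z) (hm a z)" using a by (simp add: in_hom)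
    have E: "EId C z \<cdot> bang V (hm a z) \<in> Hom V (hm a z) (hm z z)" using a by (simp add: in_hom)
    have h: "\<eta> z \<in> Ar V" "Dom V (\<eta> z) = hm z z" "\<eta> a \<in> Ar V" "Dom V (\<eta> a) = hm a z"
      using \<eta>(1) a z by (auto simp: PiE_iff in_hom)
    have "\<eta> a = \<eta> a \<cdot> cmp a z z (Id V (hm a z)) (EId C z \<cdot> bang V (hm a z))"
      using a h by simp
    also have "\<dots> = act a z (Id V (hm a z)) (\<eta> z \<cdot> (EId C z \<cdot> bang V (hm a z)))"
      by (rule nat[OF a z I E])
    also have "\<eta> z \<cdot> (EId C z \<cdot> bang V (hm a z)) = x \<cdot> bang V (hm a z)"
      using comp_eq_at[OF \<eta>(2), of "bang V (hm a z)"] h a by simp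
    finally show "\<eta> a = \<alpha> a" using a by (simp add: \<alpha>_def)
  qed
qed

text \<open>The inverses of the components are natural because the components can be cancelled.\<close>

lemma representable_by_iff_iso: "representable_by V C F z x \<longleftrightarrow> (\<forall>a\<in>obs. is_iso V (\<alpha> a))"
proof
  assume "representable_by V C F z x"
  then obtain \<beta> where b: "is_enriched_nat V (enriched_op V C) F rep \<beta>"
    and i: "\<forall>a\<in>obs. \<beta> a \<cdot> \<alpha> a = Id V (hm a z) \<and> \<alpha> a \<cdot> \<beta> a = Id V (FO a)"
    unfolding representable_by_def is_enriched_nat_iso_def yoneda_nat_eq by (auto simp: enriched_op_def)
  have "\<beta> a \<in> Hom V (FO a) (hm a z)" if "a \<in> obs" for a
    using b that unfolding nat_F_iff by auto
  then show "\<forall>a\<in>obs. is_iso V (\<alpha> a)" using is_isoI[OF \<alpha>] i by blast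
next
  assume iso: "\<forall>a\<in>obs. is_iso V (\<alpha> a)"
  define \<beta> where "\<beta> = (\<lambda>a\<in>obs. inv_arr V (\<alpha> a))"
  have \<beta>: "\<beta> a \<in> Hom V (FO a) (hm a z)" "\<beta> a \<cdot> \<alpha> a = Id V (hm a z)" "\<alpha> a \<cdot> \<beta> a = Id V (FO a)" if "a \<in> obs" for a
    using inv_arr[OF _ \<alpha>[OF that]] iso that by (auto simp: \<beta>_def)
  note nat = \<alpha>_nat
  have "\<beta> a \<cdot> act a b f y = cmp a b z f (\<beta> b \<cdot> y)"
    if ab: "a \<in> obs" "b \<in> obs" and f: "f \<in> Hom V U (hm a b)" and y: "y \<in> Hom V U (FO b)" for a b U f y
  proof (rule is_iso_cancel[OF _ \<alpha>[OF ab(1)]])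
    show "is_iso V (\<alpha> a)" using iso ab by blast
    have by': "\<beta> b \<cdot> y \<in> Hom V U (hm b z)" using \<beta>(1)[OF ab(2)] y comp_hom by blast
    have ac: "act a b f y \<in> Hom V U (FO a)" using ab f y by (simp add: in_hom)
    show "\<beta> a \<cdot> act a b f y \<in> Hom V U (hm a z)" using \<beta>(1)[OF ab(1)] ac comp_hom by blast
    show "cmp a b z f (\<beta> b \<cdot> y) \<in> Hom V U (hm a z)" using ab f by' by (simp add: in_hom)
    have "\<alpha> a \<cdot> (\<beta> a \<cdot> act a b f y) = act a b f y"
      using comp_eq_at[OF \<beta>(3)[OF ab(1)], of "act a b f y"] ac \<beta>(1)[OF ab(1)] \<alpha>[OF ab(1)] by (simp add: in_hom)
    also have "\<dots> = act a b f (\<alpha> b \<cdot> (\<beta> b \<cdot> y))"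
      using comp_eq_at[OF \<beta>(3)[OF ab(2)], of y] y \<beta>(1)[OF ab(2)] \<alpha>[OF ab(2)] by (simp add: in_hom)
    also have "\<dots> = \<alpha> a \<cdot> cmp a b z f (\<beta> b \<cdot> y)"
      using nat ab f by' unfolding nat_rep_iff by auto
    finally show "\<alpha> a \<cdot> (\<beta> a \<cdot> act a b f y) = \<alpha> a \<cdot> cmp a b z f (\<beta> b \<cdot> y)" .
  qed
  moreover have "\<beta> \<in> (\<Pi>\<^sub>E a\<in>obs. Hom V (FO a) (hm a z))" using \<beta>(1) by (auto simp: \<beta>_def)
  ultimately have "is_enriched_nat V (enriched_op V C) F rep \<beta>" unfolding nat_F_iff by blast
  then show "representable_by V C F z x"
    unfolding representable_by_def is_enriched_nat_iso_def yoneda_nat_eq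
    using nat \<beta>(2,3) by (auto simp: enriched_op_def)
qed

corollary representable_by_iff:
  "representable_by V C F z x \<longleftrightarrow>
    (\<forall>a\<in>obs. \<forall>U\<in>Ob V. \<forall>y\<in>Hom V U (FO a). \<exists>!f. f \<in> Hom V U (hm a z) \<and> act a z f (x \<cdot> bang V U) = y)"
  unfolding representable_by_iff_iso
  by (intro ball_cong refl) (simp add: is_iso_iff_bij_elements[OF \<alpha>] \<alpha>_at cong: conj_cong)

section \<open>Representability and terminal objects\<close>

lemma el_summands:
  assumes "el.in0 a \<cdot> u = el.in0 b \<cdot> v" "u \<in> Hom V W (FO a)" "v \<in> Hom V W (FO b)" "a \<in> obs" "b \<in> obs"
  shows "is_initial V W \<or> a = b \<and> u = v"
  using summand_eq[OF el.ext0 el.c0 assms(4), of u W v] summand_disjoint[OF el.ext0 el.c0 assms(4,5) _ assms(2,3,1)] assms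
  by blast

text \<open>Unique solvability of \<open>f \<cdot> x = y\<close> for all elements \<open>y\<close> of the summands \<open>F a\<close> is compared with unique
  existence of arrows from elements of \<open>\<Squnion>\<^sub>a F a\<close> to \<open>(z, x)\<close>. An element of the coproduct is decomposed
  into elements of the summands, and an arrow into entries of \<open>\<Squnion>\<^sub>a\<^sub>b C(a, b) \<times> F b\<close>; where its ends lie
  in the wrong summands, the stage is initial.\<close>

theorem representable_iff_terminal:
  "representable_by V C F z x \<longleftrightarrow> is_internal_terminal V (elements V C F) (elements_pair V C F z x)"
proof -
  let ?x = "el.in0 z \<cdot> x"
  have x0: "?x \<in> Hom V (terminal V) (Ob0 el.glued)" by (simp add: in_hom)
  have T: "elements_pair V C F z x = int_element V el.glued ?x"
    by (simp add: elements_pair_def elements_glued el.in0_def)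
  have R: "is_internal_terminal V (elements V C F) (elements_pair V C F z x) \<longleftrightarrow>
    (\<forall>U\<in>Ob V. \<forall>y\<in>Hom V U el.A0. \<exists>!h. h \<in> Hom V U el.A1 \<and> el.s \<cdot> h = y \<and> el.t \<cdot> h = ?x \<cdot> bang V U)"
    unfolding T unfolding elements_glued is_internal_terminal_iff[OF el.IC_glued x0] by simp
  have glued_at: "el.s \<cdot> (el.in1 (a, b) \<cdot> pair V f y) = el.in0 a \<cdot> act a b f y"
    "el.t \<cdot> (el.in1 (a, b) \<cdot> pair V f y) = el.in0 b \<cdot> y" "el.in1 (a, b) \<cdot> pair V f y \<in> Hom V W el.A1"
    if "a \<in> obs" "b \<in> obs" "f \<in> Hom V W (hm a b)" "y \<in> Hom V W (FO b)" for a b f y W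
    using that by (simp_all add: in_hom act_def)
  show ?thesis
    unfolding R representable_by_iff
  proof (intro iffI ballI)
    fix U y assume U: "U \<in> Ob V" and y: "y \<in> Hom V U el.A0"
      and L: "\<forall>a\<in>obs. \<forall>U\<in>Ob V. \<forall>y\<in>Hom V U (FO a). \<exists>!f. f \<in> Hom V U (hm a z) \<and> act a z f (x \<cdot> bang V U) = y"
    have xU: "?x \<cdot> bang V U \<in> Hom V U el.A0" using U by (simp add: in_hom)
    have xW: "x \<cdot> bang V W \<in> Hom V W (FO z)" if "W \<in> Ob V" for W using that by (simp add: in_hom)
    have sh: "el.s \<in> Hom V el.A1 el.A0" "el.t \<in> Hom V el.A1 el.A0" by (simp_all add: in_hom)
    have "\<exists>h. h \<in> Hom V U el.A1 \<and> el.s \<cdot> h = y \<and> el.t \<cdot> h = ?x \<cdot> bang V U"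
    proof (rule local_lift[OF el.ext0 el.c0 y sh(1) y sh(2) xU])
      fix W w a v assume a: "a \<in> obs" and w: "w \<in> Hom V W U" and v: "v \<in> Hom V W (FO a)" and yw: "y \<cdot> w = el.in0 a \<cdot> v"
      have W: "W \<in> Ob V" using w hom_Ob by blast
      obtain f where f: "f \<in> Hom V W (hm a z)" "act a z f (x \<cdot> bang V W) = v" using L a W v by blast
      show "\<exists>h. h \<in> Hom V W el.A1 \<and> el.s \<cdot> h = y \<cdot> w \<and> el.t \<cdot> h = (?x \<cdot> bang V U) \<cdot> w"
        by (rule exI[of _ "el.in1 (a, z) \<cdot> pair V f (x \<cdot> bang V W)"])
          (use glued_at[OF a z f(1) xW[OF W]] f(2) yw w U in \<open>simp add: in_hom\<close>)
    qed
    moreover have "h = h'"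
      if h: "h \<in> Hom V U el.A1 \<and> el.s \<cdot> h = y \<and> el.t \<cdot> h = ?x \<cdot> bang V U"
        and h': "h' \<in> Hom V U el.A1 \<and> el.s \<cdot> h' = y \<and> el.t \<cdot> h' = ?x \<cdot> bang V U" for h h'
    proof -
      have hh: "h \<in> Hom V U el.A1" "h' \<in> Hom V U el.A1" and st: "el.s \<cdot> h = el.s \<cdot> h'" "el.t \<cdot> h = ?x \<cdot> bang V U"
        "el.t \<cdot> h' = ?x \<cdot> bang V U" using h h' by auto
      show ?thesis
      proof (rule local_eq[OF el.ext1 el.c1 hh(1) hh])
        fix W w i v assume i: "i \<in> obs \<times> obs" and w: "w \<in> Hom V W U"
          and v: "v \<in> Hom V W (case i of (a, b) \<Rightarrow> prd V (hm a b) (FO b))" and hw: "h \<cdot> w = el.in1 i \<cdot> v"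
        show "h \<cdot> w = h' \<cdot> w"
        proof (rule local_eq[OF el.ext1 el.c1 comp_hom[OF w hh(2)] comp_hom[OF w hh(1)] comp_hom[OF w hh(2)]])
          fix W' w' i' v' assume i': "i' \<in> obs \<times> obs" and w': "w' \<in> Hom V W' W"
            and v': "v' \<in> Hom V W' (case i' of (a, b) \<Rightarrow> prd V (hm a b) (FO b))" and hw': "(h' \<cdot> w) \<cdot> w' = el.in1 i' \<cdot> v'"
          obtain a b a' b' where ii: "i = (a, b)" "i' = (a', b')" and o: "a \<in> obs" "b \<in> obs" "a' \<in> obs" "b' \<in> obs"
            using i i' by auto
          have W': "W' \<in> Ob V" using w' hom_Ob by blast
          have ww: "w \<cdot> w' \<in> Hom V W' U" using w w' comp_hom by blast
          have "v \<cdot> w' \<in> Hom V W' (prd V (hm a b) (FO b))" "v' \<in> Hom V W' (prd V (hm a' b') (FO b'))"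
            using v v' w' comp_hom ii by auto
          then obtain f u f' u' where fu: "v \<cdot> w' = pair V f u" "f \<in> Hom V W' (hm a b)" "u \<in> Hom V W' (FO b)"
            and fu': "v' = pair V f' u'" "f' \<in> Hom V W' (hm a' b')" "u' \<in> Hom V W' (FO b')"
            using prd_elementE C_simps(1) F_simps(1) o by metis
          have e: "h \<cdot> (w \<cdot> w') = el.in1 (a, b) \<cdot> pair V f u"
            unfolding fu(1)[symmetric] using comp_eq_at[OF hw, of w'] hh w w' v ii o by (simp add: in_hom)
          have e': "h' \<cdot> (w \<cdot> w') = el.in1 (a', b') \<cdot> pair V f' u'"
            using hw' hh w w' by (simp add: in_hom ii fu'(1))
          note g = glued_at[OF o(1,2) fu(2,3)] and g' = glued_at[OF o(3,4) fu'(2,3)]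
          have t: "el.in0 b \<cdot> u = el.in0 z \<cdot> (x \<cdot> bang V W')" "el.in0 b' \<cdot> u' = el.in0 z \<cdot> (x \<cdot> bang V W')"
            using comp_eq_at[OF st(2), of "w \<cdot> w'"] comp_eq_at[OF st(3), of "w \<cdot> w'"] hh ww U e e' g g'
            by (simp_all add: in_hom)
          have s: "el.in0 a \<cdot> act a b f u = el.in0 a' \<cdot> act a' b' f' u'"
            using comp_eq_at[OF st(1), of "w \<cdot> w'"] hh ww e e' g g' by (simp add: in_hom)
          have ac: "act a b f u \<in> Hom V W' (FO a)" "act a' b' f' u' \<in> Hom V W' (FO a')"
            using o fu fu' by (simp_all add: in_hom)
          consider "is_initial V W'" | "b = z" "u = x \<cdot> bang V W'" "b' = z" "u' = x \<cdot> bang V W'" "a = a'"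
              "act a b f u = act a' b' f' u'"
            using el_summands[OF t(1) fu(3) xW[OF W'] o(2) z] el_summands[OF t(2) fu'(3) xW[OF W'] o(4) z]
              el_summands[OF s ac o(1,3)] by blast
          then have "h \<cdot> (w \<cdot> w') = h' \<cdot> (w \<cdot> w')"
          proof cases
            case 1
            then show ?thesis using is_initial_unique comp_hom[OF ww hh(1)] comp_hom[OF ww hh(2)] by blast
          next
            case 2
            then have "f = f'" using L[rule_format, OF o(1) W' ac(1)] fu(2) fu'(2) by auto
            then show ?thesis using e e' 2 by simp
          qed
          then show "(h \<cdot> w) \<cdot> w' = (h' \<cdot> w) \<cdot> w'" using hh w w' by (simp add: in_hom)
        qed
      qed
    qed
    ultimately show "\<exists>!h. h \<in> Hom V U el.A1 \<and> el.s \<cdot> h = y \<and> el.t \<cdot> h = ?x \<cdot> bang V U" by blast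
  next
    fix a U y assume a: "a \<in> obs" and U: "U \<in> Ob V" and y: "y \<in> Hom V U (FO a)"
      and R: "\<forall>U\<in>Ob V. \<forall>y\<in>Hom V U el.A0. \<exists>!h. h \<in> Hom V U el.A1 \<and> el.s \<cdot> h = y \<and> el.t \<cdot> h = ?x \<cdot> bang V U"
    have xU: "x \<cdot> bang V U \<in> Hom V U (FO z)" using U by (simp add: in_hom)
    have yA: "el.in0 a \<cdot> y \<in> Hom V U el.A0" using a y by (simp add: in_hom)
    obtain h where h: "h \<in> Hom V U el.A1" "el.s \<cdot> h = el.in0 a \<cdot> y" "el.t \<cdot> h = ?x \<cdot> bang V U"
      and uniq: "\<And>h'. h' \<in> Hom V U el.A1 \<Longrightarrow> el.s \<cdot> h' = el.in0 a \<cdot> y \<Longrightarrow> el.t \<cdot> h' = ?x \<cdot> bang V U \<Longrightarrow> h' = h"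
      using R U yA by blast
    have "\<exists>f. f \<in> Hom V U (hm a z) \<and> \<alpha> a \<cdot> f = y \<and> \<alpha> a \<cdot> f = y"
    proof (rule local_lift[OF el.ext1 el.c1 h(1) \<alpha>[OF a] y \<alpha>[OF a] y])
      fix W w i v assume i: "i \<in> obs \<times> obs" and w: "w \<in> Hom V W U"
        and v: "v \<in> Hom V W (case i of (a, b) \<Rightarrow> prd V (hm a b) (FO b))" and hw: "h \<cdot> w = el.in1 i \<cdot> v"
      obtain a' b where ii: "i = (a', b)" and o: "a' \<in> obs" "b \<in> obs" using i by auto
      have W: "W \<in> Ob V" using w hom_Ob by blast
      obtain f u where fu: "v = pair V f u" "f \<in> Hom V W (hm a' b)" "u \<in> Hom V W (FO b)"
        using prd_elementE[of v W "hm a' b" "FO b"] v ii o by auto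
      note g = glued_at[OF o fu(2,3)]
      have xW: "x \<cdot> bang V W \<in> Hom V W (FO z)" and yw: "y \<cdot> w \<in> Hom V W (FO a)" using W y w by (auto simp: in_hom)
      have t: "el.in0 b \<cdot> u = el.in0 z \<cdot> (x \<cdot> bang V W)"
        using comp_eq_at[OF h(3), of w] h(1) w U hw g by (simp add: in_hom ii fu(1))
      have s: "el.in0 a' \<cdot> act a' b f u = el.in0 a \<cdot> (y \<cdot> w)"
        using comp_eq_at[OF h(2), of w] h(1) w y a hw g by (simp add: in_hom ii fu(1))
      have ac: "act a' b f u \<in> Hom V W (FO a')" using o fu by (simp add: in_hom)
      consider "is_initial V W" | "b = z" "u = x \<cdot> bang V W" "a' = a" "act a' b f u = y \<cdot> w"
        using el_summands[OF t fu(3) xW o(2) z] el_summands[OF s ac yw o(1) a] by blast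
      then have "\<exists>k. k \<in> Hom V W (hm a z) \<and> \<alpha> a \<cdot> k = y \<cdot> w"
      proof cases
        case 1
        obtain k where k: "k \<in> Hom V W (hm a z)" using is_initial_ex[OF 1] a z by (meson C_simps(1))
        then show ?thesis using is_initial_unique[OF 1 comp_hom[OF k \<alpha>[OF a]] yw] by blast
      next
        case 2
        then show ?thesis using fu(2) \<alpha>_at[OF a, of f W] by auto
      qed
      then show "\<exists>k. k \<in> Hom V W (hm a z) \<and> \<alpha> a \<cdot> k = y \<cdot> w \<and> \<alpha> a \<cdot> k = y \<cdot> w" by blast
    qed
    then obtain f where f: "f \<in> Hom V U (hm a z)" "act a z f (x \<cdot> bang V U) = y" using \<alpha>_at[OF a] by auto
    show "\<exists>!f. f \<in> Hom V U (hm a z) \<and> act a z f (x \<cdot> bang V U) = y"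
    proof (rule ex1I[of _ f])
      show "f \<in> Hom V U (hm a z) \<and> act a z f (x \<cdot> bang V U) = y" using f by blast
      have eq: "el.in1 (a, z) \<cdot> pair V f' (x \<cdot> bang V U) = h"
        if "f' \<in> Hom V U (hm a z)" "act a z f' (x \<cdot> bang V U) = y" for f'
        by (rule uniq) (use glued_at[OF a z that(1) xU] that(2) U in simp_all)
      fix f' assume f': "f' \<in> Hom V U (hm a z) \<and> act a z f' (x \<cdot> bang V U) = y"
      have "el.in1 (a, z) \<cdot> pair V f' (x \<cdot> bang V U) = el.in1 (a, z) \<cdot> pair V f (x \<cdot> bang V U)"
        using eq[of f'] eq[of f] f f' by simp
      note e = this
      have p: "pair V k (x \<cdot> bang V U) \<in> Hom V U (case (a, z) of (a, b) \<Rightarrow> prd V (hm a b) (FO b))"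
        if "k \<in> Hom V U (hm a z)" for k
        using pair(1)[OF that xU] by simp
      have "pair V f' (x \<cdot> bang V U) = pair V f (x \<cdot> bang V U)"
        by (rule summand_eq[OF el.ext1 el.c1 _ p p e]) (use a f f' in simp_all)
      then show "f' = f"
        by (rule pair_injects(1)[where U = U and a = "hm a z" and b = "FO z"]) (use f f' xU in auto)
    qed
  qed
qed

end

theorem theorem2:
  fixes V :: "('o, 'm) category"
    and C :: "('i, 'o, 'm) enriched_category"
    and F :: "('i, 'o, 'm) enriched_functor"
    and c :: 'i and x :: 'm
  assumes "is_category V"
    and "infinite (UNIV :: 'i set)"
    and "extensive TYPE('i) V"
    and "cartesian_closed V"
    and "has_pullbacks V"
    and "is_enriched_category V C"
    and "is_enriched_functor V (enriched_op V C) (self_enriched V) F"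
    and "c \<in> EOb C"
    and "x \<in> Hom V (terminal V) (FOb F c)"
  shows "representable_by V C F c x \<longleftrightarrow>
         is_internal_terminal V (elements V C F) (elements_pair V C F c x)"
proof -
  interpret pointed_presheaf V "TYPE('i)" C F c x
    by unfold_locales (use assms in \<open>auto simp: cartesian_closed_def\<close>)
  show ?thesis by (rule representable_iff_terminal)
qed

end
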